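(* Let $d,p\ge 1$ be integers with $p(d-2)<d$, and let $B\subset\mathbb{R}^d$ be an open set that is bounded, or $B=\mathbb{R}^d$ with $d\ge 3$. Let $\phi=(\phi_1,\dots,\phi_n)$ be a family of nonnegative bounded measurable functions with compact support in $B$. Then the infimum $$\Theta(\phi)=\inf\Big\{\frac p2\|\nabla\psi\|_2^2\,:\,\psi\in\mathcal{D}(B),\ \sum_{i=1}^n\|\phi_i\psi\|_{2p}^2=1\Big\}$$ is attained. Every minimiser $\psi\in\mathcal{D}(B)$ satisfies the equation $$-\frac p2\Delta\psi=\Theta(\phi)\,\psi^{2p-1}\sum_{i=1}^n\|\phi_i\psi\|_{2p}^{2-2p}\,\phi_i^{2p}.$$
   Context: $\mathcal{D}(B)=H_0^1(B)$ is the classical Sobolev space with zero boundary condition if $B$ is bounded; if $B=\mathbb{R}^d$ ($d\ge3$), $\mathcal{D}(B)=D^1(\mathbb{R}^d)$ is the space of $f\in L^1_{\rm loc}(\mathbb{R}^d)$ vanishing at infinity (i.e. $\{|f|>a\}$ has finite Lebesgue measure for all $a>0$) with distributional gradient in $L^2(\mathbb{R}^d)$. $\|\cdot\|_q$ is the $L^q$-norm and $\Delta$ is the distributional Laplacian.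
   Formalization: It is additionally assumed that some φ_i is not almost everywhere zero; if all φ_i vanish a.e. (or n = 0), no ψ satisfies the constraint, so the infimum is over the empty set and is not attained. *)

theory Defs
  imports "HOL-Analysis.Analysis"
begin

text \<open>
  Functions on an open set \<open>B\<close> are represented by total functions whose values outside \<open>B\<close> are
  ignored; they are identified almost everywhere only implicitly, since all notions below depend
  on Lebesgue integrals over \<open>B\<close>.
\<close>

definition supp :: "('a::euclidean_space \<Rightarrow> real) \<Rightarrow> 'a set" where
  "supp f = closure {x. f x \<noteq> 0}"

definition pd :: "'a::euclidean_space \<Rightarrow> ('a \<Rightarrow> real) \<Rightarrow> 'a \<Rightarrow> real" where
  "pd b f x = frechet_derivative f (at x) b"

primrec Ck :: "nat \<Rightarrow> ('a::euclidean_space \<Rightarrow> real) \<Rightarrow> bool" where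
  "Ck 0 f \<longleftrightarrow> continuous_on UNIV f"
| "Ck (Suc k) f \<longleftrightarrow> f differentiable_on UNIV \<and> (\<forall>b\<in>Basis. Ck k (pd b f))"

definition test_fun :: "'a::euclidean_space set \<Rightarrow> ('a \<Rightarrow> real) set" where
  "test_fun B = {\<eta>. (\<forall>k. Ck k \<eta>) \<and> compact (supp \<eta>) \<and> supp \<eta> \<subseteq> B}"

definition laplace :: "('a::euclidean_space \<Rightarrow> real) \<Rightarrow> 'a \<Rightarrow> real" where
  "laplace \<eta> x = (\<Sum>b\<in>Basis. pd b (pd b \<eta>) x)"

definition Lq :: "'a::euclidean_space set \<Rightarrow> nat \<Rightarrow> ('a \<Rightarrow> 'b::euclidean_space) set" where
  "Lq B q = {f. f \<in> borel_measurable (lebesgue_on B) \<and>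
                integrable (lebesgue_on B) (\<lambda>x. norm (f x) ^ q)}"

text \<open>Only meaningful for \<open>f \<in> Lq B q\<close> and \<open>q \<ge> 1\<close>.\<close>

definition Lq_norm :: "'a::euclidean_space set \<Rightarrow> nat \<Rightarrow> ('a \<Rightarrow> 'b::euclidean_space) \<Rightarrow> real" where
  "Lq_norm B q f = root q (\<integral>x. norm (f x) ^ q \<partial>lebesgue_on B)"

definition L1_loc :: "'a::euclidean_space set \<Rightarrow> ('a \<Rightarrow> 'b::euclidean_space) set" where
  "L1_loc B = {f. f \<in> borel_measurable (lebesgue_on B) \<and>
                  (\<forall>K. compact K \<and> K \<subseteq> B \<longrightarrow> integrable (lebesgue_on K) f)}"

definition is_weak_gradient ::
    "'a::euclidean_space set \<Rightarrow> ('a \<Rightarrow> real) \<Rightarrow> ('a \<Rightarrow> 'a) \<Rightarrow> bool" where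
  "is_weak_gradient B f G \<longleftrightarrow> f \<in> L1_loc B \<and> G \<in> L1_loc B \<and>
     (\<forall>\<eta>\<in>test_fun B. \<forall>b\<in>Basis.
        (\<integral>x. f x * pd b \<eta> x \<partial>lebesgue_on B) = - (\<integral>x. (G x \<bullet> b) * \<eta> x \<partial>lebesgue_on B))"

text \<open>On open \<open>B\<close> a weak gradient is unique up to null sets, so the choice is immaterial.\<close>

definition weak_grad :: "'a::euclidean_space set \<Rightarrow> ('a \<Rightarrow> real) \<Rightarrow> 'a \<Rightarrow> 'a" where
  "weak_grad B f = (SOME G. is_weak_gradient B f G)"

definition H1 :: "'a::euclidean_space set \<Rightarrow> ('a \<Rightarrow> real) set" where
  "H1 B = {f. f \<in> Lq B 2 \<and> (\<exists>G. is_weak_gradient B f G \<and> G \<in> Lq B 2)}"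

definition H1_norm :: "'a::euclidean_space set \<Rightarrow> ('a \<Rightarrow> real) \<Rightarrow> real" where
  "H1_norm B f = sqrt ((Lq_norm B 2 f)\<^sup>2 + (Lq_norm B 2 (weak_grad B f))\<^sup>2)"

text \<open>The closure of the test functions in \<open>H1 B\<close>.\<close>

definition H10 :: "'a::euclidean_space set \<Rightarrow> ('a \<Rightarrow> real) set" where
  "H10 B = {f \<in> H1 B. \<exists>\<eta>::nat \<Rightarrow> 'a \<Rightarrow> real. (\<forall>k. \<eta> k \<in> test_fun B) \<and>
              (\<lambda>k. H1_norm B (\<lambda>x. \<eta> k x - f x)) \<longlonglongrightarrow> 0}"

definition vanishes_at_infinity :: "('a::euclidean_space \<Rightarrow> real) \<Rightarrow> bool" where
  "vanishes_at_infinity f \<longleftrightarrow> (\<forall>a>0. emeasure lebesgue {x. \<bar>f x\<bar> > a} < \<infinity>)"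

definition D1 :: "('a::euclidean_space \<Rightarrow> real) set" where
  "D1 = {f. f \<in> L1_loc UNIV \<and> vanishes_at_infinity f \<and>
            (\<exists>G. is_weak_gradient UNIV f G \<and> G \<in> Lq UNIV 2)}"

text \<open>Only used for \<open>B\<close> bounded or \<open>B = UNIV\<close>.\<close>

definition D_space :: "'a::euclidean_space set \<Rightarrow> ('a \<Rightarrow> real) set" where
  "D_space B = (if bounded B then H10 B else D1)"

definition energy :: "'a::euclidean_space set \<Rightarrow> nat \<Rightarrow> ('a \<Rightarrow> real) \<Rightarrow> real" where
  "energy B p \<psi> = real p / 2 * (Lq_norm B 2 (weak_grad B \<psi>))\<^sup>2"

text \<open>
  Since \<open>Lq_norm\<close> is real-valued, finiteness of the norms, which is implicit in their squares
  summing to 1, is stated explicitly.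
\<close>

definition admissible ::
    "'a::euclidean_space set \<Rightarrow> nat \<Rightarrow> nat \<Rightarrow> (nat \<Rightarrow> 'a \<Rightarrow> real) \<Rightarrow> ('a \<Rightarrow> real) set" where
  "admissible B p n \<phi> = {\<psi> \<in> D_space B.
     (\<forall>i\<in>{1..n}. (\<lambda>x. \<phi> i x * \<psi> x) \<in> Lq B (2 * p)) \<and>
     (\<Sum>i=1..n. (Lq_norm B (2 * p) (\<lambda>x. \<phi> i x * \<psi> x))\<^sup>2) = 1}"

definition Theta ::
    "'a::euclidean_space set \<Rightarrow> nat \<Rightarrow> nat \<Rightarrow> (nat \<Rightarrow> 'a \<Rightarrow> real) \<Rightarrow> real" where
  "Theta B p n \<phi> = (INF \<psi>\<in>admissible B p n \<phi>. energy B p \<psi>)"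

definition is_minimiser ::
    "'a::euclidean_space set \<Rightarrow> nat \<Rightarrow> nat \<Rightarrow> (nat \<Rightarrow> 'a \<Rightarrow> real) \<Rightarrow> ('a \<Rightarrow> real) \<Rightarrow> bool" where
  "is_minimiser B p n \<phi> \<psi> \<longleftrightarrow>
     \<psi> \<in> admissible B p n \<phi> \<and> energy B p \<psi> = Theta B p n \<phi>"

text \<open>Distributions on \<open>B\<close>, as functionals on \<open>test_fun B\<close>.\<close>

definition distr_of :: "'a::euclidean_space set \<Rightarrow> ('a \<Rightarrow> real) \<Rightarrow> ('a \<Rightarrow> real) \<Rightarrow> real" where
  "distr_of B g \<eta> = (\<integral>x. g x * \<eta> x \<partial>lebesgue_on B)"

definition distr_laplacian ::
    "'a::euclidean_space set \<Rightarrow> ('a \<Rightarrow> real) \<Rightarrow> ('a \<Rightarrow> real) \<Rightarrow> real" where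
  "distr_laplacian B f \<eta> = distr_of B f (laplace \<eta>)"

text \<open>
  If \<open>\<phi> i * \<psi>\<close> vanishes almost everywhere on \<open>B\<close>, then so does \<open>\<psi> ^ (2p-1) * \<phi> i ^ (2p)\<close>, hence
  the \<open>i\<close>-th summand vanishes almost everywhere whatever value the negative power of the zero
  norm has.
\<close>

definition el_rhs ::
    "'a::euclidean_space set \<Rightarrow> nat \<Rightarrow> nat \<Rightarrow> (nat \<Rightarrow> 'a \<Rightarrow> real) \<Rightarrow> ('a \<Rightarrow> real) \<Rightarrow> 'a \<Rightarrow> real" where
  "el_rhs B p n \<phi> \<psi> x = Theta B p n \<phi> * \<psi> x ^ (2 * p - 1) *
     (\<Sum>i=1..n. Lq_norm B (2 * p) (\<lambda>y. \<phi> i y * \<psi> y) powi (2 - 2 * int p) * \<phi> i x ^ (2 * p))"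

definition el_equation ::
    "'a::euclidean_space set \<Rightarrow> nat \<Rightarrow> nat \<Rightarrow> (nat \<Rightarrow> 'a \<Rightarrow> real) \<Rightarrow> ('a \<Rightarrow> real) \<Rightarrow> bool" where
  "el_equation B p n \<phi> \<psi> \<longleftrightarrow> \<psi> \<in> L1_loc B \<and> el_rhs B p n \<phi> \<psi> \<in> L1_loc B \<and>
     (\<forall>\<eta>\<in>test_fun B. - (real p / 2) * distr_laplacian B \<psi> \<eta> = distr_of B (el_rhs B p n \<phi> \<psi>) \<eta>)"

end

theory Submission
  imports Defs "HOL-Complex_Analysis.Great_Picard"
begin

text \<open>
  After extension by zero everything happens on the whole space. The central estimate compares a
  function with its averages over a cubic grid. Halving the cells changes an average by at most a
  constant times \<open>h\<close> to the power \<open>1 - d/2\<close> times the local energy: this follows by testing the weak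
  gradient against products of one-dimensional bumps. Since \<open>p * (d - 2) < d\<close>, summing over the scales
  \<open>h / 2 ^ j\<close> bounds the averaging error in the norm of exponent \<open>2 * p\<close> by a positive power of \<open>h\<close>
  times the Dirichlet norm. This single inequality replaces the Sobolev, Poincare and Rellich
  theorems: it gives local bounds, and compactness because the averages at dyadic scales take only
  countably many values.

  For a minimising sequence that is Cauchy in the constraint seminorm, the midpoints nearly satisfy
  the constraint, so the parallelogram law makes the gradients Cauchy as well, and completeness of
  the space yields a minimiser. The equation follows by differentiating
  \<open>energy (\<psi> + t \<eta>) - \<Theta> * constraint (\<psi> + t \<eta>) \<ge> 0\<close> at its minimum \<open>t = 0\<close>.
\<close>

section \<open>Smooth functions and test functions\<close>

text \<open>The averaging estimate sees a function only up to constants, so it cannot bound the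
  function by itself; a bound on the averages at one scale must be added. For bounded
  \<open>B\<close>, a cell with more volume than \<open>B\<close> reaches into the complement, where
  the extended function is 0 and its averaging error is the average itself. On the whole space, the
  averages over doubling cubes have increments of order 2^(j (1 - d/2)), summable since d \<ge> 3,
  and vanishing at infinity forces their limit to be 0. This bound and a completeness property are
  what distinguishes the two kinds of domain; the argument itself runs in an abstract linear space
  of pairs of a function and its gradient.

  The exponent condition enters through one number: replacing h by h/2 multiplies the error estimate
  of a single halving by 2^(p (d - 2) - d), which is below 1 exactly under that condition.

  Energy and squared constraint are homogeneous of the same degree. Hence the infimum bounds the
  energy by \<Theta> times the squared constraint on the whole class, which covers midpoints and
  perturbations that are not admissible.\<close>

primrec Cn :: "nat \<Rightarrow> (real \<Rightarrow> real) \<Rightarrow> bool" where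
  "Cn 0 f \<longleftrightarrow> continuous_on UNIV f"
| "Cn (Suc n) f \<longleftrightarrow> (\<exists>f'. (\<forall>t. (f has_real_derivative f' t) (at t)) \<and> Cn n f')"

lemma Cn_SucI: "(\<And>t. (f has_real_derivative f' t) (at t)) \<Longrightarrow> Cn n f' \<Longrightarrow> Cn (Suc n) f"
  by auto

lemma Cn_continuous: "Cn n f \<Longrightarrow> continuous_on UNIV f"
  by (cases n) (auto intro: DERIV_continuous_on)

lemma Cn_le: "Cn (Suc n) f \<Longrightarrow> Cn n f"
  by (induction n arbitrary: f) (auto intro: DERIV_continuous_on)

lemma Cn_const: "Cn n (\<lambda>t. c)"
  by (induction n arbitrary: c) (auto intro!: derivative_eq_intros exI[of _ "\<lambda>t. 0"])

lemma Cn_add: "Cn n f \<Longrightarrow> Cn n g \<Longrightarrow> Cn n (\<lambda>t. f t + g t)"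
proof (induction n arbitrary: f g)
  case (Suc n)
  then obtain f' g' where "\<forall>t. (f has_real_derivative f' t) (at t)" "Cn n f'"
    "\<forall>t. (g has_real_derivative g' t) (at t)" "Cn n g'" by auto
  moreover from this have "((\<lambda>t. f t + g t) has_real_derivative f' t + g' t) (at t)" for t
    by (intro DERIV_add) auto
  moreover have "Cn n (\<lambda>t. f' t + g' t)" using Suc.IH[of f' g'] calculation by auto
  ultimately show ?case by (intro Cn_SucI)
qed (auto intro: continuous_intros)

lemma Cn_mult: "Cn n f \<Longrightarrow> Cn n g \<Longrightarrow> Cn n (\<lambda>t. f t * g t)"
proof (induction n arbitrary: f g)
  case (Suc n)
  then obtain f' g' where d: "\<forall>t. (f has_real_derivative f' t) (at t)" "Cn n f'"
    "\<forall>t. (g has_real_derivative g' t) (at t)" "Cn n g'" by auto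
  have "Cn n (\<lambda>t. f' t * g t + f t * g' t)"
    using Suc.IH[OF d(2) Suc.prems(2)[THEN Cn_le]] Suc.IH[OF Suc.prems(1)[THEN Cn_le] d(4)]
    by (rule Cn_add)
  moreover have "((\<lambda>t. f t * g t) has_real_derivative f' t * g t + f t * g' t) (at t)" for t
    using DERIV_mult[of f "f' t" t UNIV g "g' t"] d by (simp add: algebra_simps)
  ultimately show ?case by (intro Cn_SucI)
qed (auto intro: continuous_intros)

lemma Cn_affine: "Cn n f \<Longrightarrow> Cn n (\<lambda>t. f (c * t + e))"
proof (induction n arbitrary: f)
  case (Suc n)
  then obtain f' where d: "\<forall>t. (f has_real_derivative f' t) (at t)" "Cn n f'" by auto
  have "Cn n (\<lambda>t. f' (c * t + e) * c)"
    using Suc.IH[OF d(2)] by (intro Cn_mult Cn_const)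
  moreover have "((\<lambda>t. f (c * t + e)) has_real_derivative f' (c * t + e) * c) (at t)" for t
    by (rule DERIV_chain2[where f = f]) (auto simp: d intro!: derivative_eq_intros)
  ultimately show ?case by (intro Cn_SucI)
next
  case 0
  then show ?case by (auto intro!: continuous_intros continuous_on_compose2[of UNIV f])
qed

text \<open>The standard flat function exp(-1/t) together with its quotients by powers of t:
  differentiating a member gives a combination of the next two, so one induction over all
  \<open>j\<close> yields smoothness of the whole family.\<close>

definition flat :: "nat \<Rightarrow> real \<Rightarrow> real" where
  "flat j t = (if t > 0 then exp (- 1 / t) / t ^ j else 0)"

text \<open>Substituting u = 1/t turns this into the decay of \<open>u ^ j / exp u\<close> at
  infinity. The limit is over the punctured neighbourhood, the form in which the difference quotient
  at 0 uses it.\<close>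

lemma flat_at_0: "((\<lambda>t. flat j t) \<longlongrightarrow> 0) (at 0)"
proof -
  have "((\<lambda>t. exp (- 1 / t) / t ^ j) \<longlongrightarrow> 0) (at_right (0::real))"
  proof -
    have "((\<lambda>u::real. u ^ j / exp u) \<longlongrightarrow> 0) at_top"
      by (rule tendsto_power_div_exp_0)
    then have "((\<lambda>u::real. (inverse u) ^ j / exp (inverse u)) \<longlongrightarrow> 0) (at_right 0)"
      by (rule filterlim_compose[OF _ filterlim_inverse_at_top_right])
    then show ?thesis
      by (rule Lim_transform_eventually)
         (auto simp: eventually_at_filter exp_minus field_simps)
  qed
  then have "((\<lambda>t. flat j t) \<longlongrightarrow> 0) (at_right 0)"
    by (rule Lim_transform_eventually) (auto simp: eventually_at_filter flat_def)
  moreover have "((\<lambda>t. flat j t) \<longlongrightarrow> 0) (at_left 0)"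
    by (rule Lim_transform_eventually[of "\<lambda>_. 0"]) (auto simp: eventually_at_filter flat_def)
  ultimately show ?thesis
    by (simp add: filterlim_at_split)
qed

lemma flat_deriv: "(flat j has_real_derivative flat (j + 2) t - real j * flat (j + 1) t) (at t)"
proof -
  consider "t > 0" | "t < 0" | "t = 0" by linarith
  then show ?thesis
  proof cases
    case 1
    have pw: "real j * t ^ (j - Suc 0) = real j * t ^ j / t"
      using 1 by (cases j) auto
    have "((\<lambda>t. exp (- 1 / t) / t ^ j) has_real_derivative
        (exp (- 1 / t) * (1 / t\<^sup>2) * t ^ j - exp (- 1 / t) * (real j * t ^ (j - Suc 0))) / (t ^ j * t ^ j)) (at t)"
      using 1 by (auto intro!: derivative_eq_intros simp: power2_eq_square)
    also have "(exp (- 1 / t) * (1 / t\<^sup>2) * t ^ j - exp (- 1 / t) * (real j * t ^ (j - Suc 0))) / (t ^ j * t ^ j)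
        = flat (j + 2) t - real j * flat (j + 1) t"
      unfolding pw using 1 by (simp add: flat_def field_simps power2_eq_square)
    finally have "((\<lambda>t. exp (- 1 / t) / t ^ j) has_real_derivative flat (j + 2) t - real j * flat (j + 1) t) (at t)" .
    then show ?thesis
      by (rule has_field_derivative_transform_within_open[where S = "{0<..}"])
         (use 1 in \<open>auto simp: flat_def\<close>)
  next
    case 2
    have "((\<lambda>t. 0) has_real_derivative flat (j + 2) t - real j * flat (j + 1) t) (at t)"
      using 2 by (auto simp: flat_def)
    then show ?thesis
      by (rule has_field_derivative_transform_within_open[where S = "{..<0}"])
         (use 2 in \<open>auto simp: flat_def\<close>)
  next
    case 3
    \<comment> \<open>The difference quotient of \<open>flat j\<close> at 0 is
      \<open>flat (Suc j)\<close>, so the case \<open>Suc j\<close> of \<open>flat_at_0\<close>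
      gives the derivative 0.\<close>
    have "((\<lambda>h. (flat j (0 + h) - flat j 0) / h) \<longlongrightarrow> 0) (at 0)"
      by (rule Lim_transform_eventually[OF flat_at_0[of "Suc j"]])
         (auto simp: eventually_at_filter flat_def field_simps)
    then show ?thesis using 3 by (simp add: DERIV_def flat_def)
  qed
qed

lemma Cn_flat: "Cn n (flat j)"
proof (induction n arbitrary: j)
  case 0
  show ?case by (auto intro: DERIV_continuous_on flat_deriv)
next
  case (Suc n)
  have "Cn n (\<lambda>t. flat (j + 2) t + (- real j) * flat (j + 1) t)"
    using Suc by (intro Cn_add Cn_mult Cn_const)
  then show ?case
    using flat_deriv[of j] by (auto intro!: exI[of _ "\<lambda>t. flat (j + 2) t - real j * flat (j + 1) t"])
qed

section \<open>Smoothness in several variables and test functions\<close>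

lemma has_derivative_pd:
  assumes "(f has_derivative f') (at x)" shows "pd b f x = f' b"
  using frechet_derivative_at[OF assms] by (simp add: pd_def)

text \<open>\<open>pd\<close> is built on \<open>frechet_derivative\<close>; by uniqueness of
  derivatives, any derivative found by the usual rules may stand in for it.\<close>

lemma Ck_SucI:
  assumes "\<And>x. (f has_derivative f' x) (at x)" "\<And>b. b \<in> Basis \<Longrightarrow> Ck k (\<lambda>x. f' x b)"
  shows "Ck (Suc k) f"
proof -
  have "pd b f = (\<lambda>x. f' x b)" for b
    using assms(1) has_derivative_pd by blast
  with assms show ?thesis
    by (auto simp: differentiable_on_def differentiable_def intro: has_derivative_at_withinI)
qed

lemma Ck_Suc_deriv:
  assumes "Ck (Suc k) f"
  shows "(f has_derivative (\<lambda>h. frechet_derivative f (at x) h)) (at x)"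
  using assms by (auto simp: differentiable_on_def frechet_derivative_works)

lemma Ck_le: "Ck (Suc k) f \<Longrightarrow> Ck k f"
  by (induction k arbitrary: f) (auto intro: differentiable_imp_continuous_on)

lemma Ck_add: "Ck k f \<Longrightarrow> Ck k g \<Longrightarrow> Ck k (\<lambda>x. f x + g x)"
proof (induction k arbitrary: f g)
  case (Suc k)
  show ?case
  proof (rule Ck_SucI)
    show "((\<lambda>x. f x + g x) has_derivative
        (\<lambda>h. frechet_derivative f (at x) h + frechet_derivative g (at x) h)) (at x)" for x
      using Suc.prems[THEN Ck_Suc_deriv] by (intro derivative_intros)
    show "Ck k (\<lambda>x. frechet_derivative f (at x) b + frechet_derivative g (at x) b)" if "b \<in> Basis" for b
      using Suc.prems that by (intro Suc.IH) (auto simp: pd_def[abs_def])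
  qed
qed (auto intro: continuous_intros)

lemma Ck_mult: "Ck k f \<Longrightarrow> Ck k g \<Longrightarrow> Ck k (\<lambda>x. f x * g x)"
proof (induction k arbitrary: f g)
  case (Suc k)
  show ?case
  proof (rule Ck_SucI)
    show "((\<lambda>x. f x * g x) has_derivative
        (\<lambda>h. f x * frechet_derivative g (at x) h + frechet_derivative f (at x) h * g x)) (at x)" for x
      using Suc.prems[THEN Ck_Suc_deriv] by (intro derivative_intros)
    show "Ck k (\<lambda>x. f x * frechet_derivative g (at x) b + frechet_derivative f (at x) b * g x)"
      if "b \<in> Basis" for b
      using Suc.IH[of f "pd b g"] Suc.IH[of "pd b f" g] Suc.prems[THEN Ck_le] Suc.prems that
      by (intro Ck_add) (auto simp: pd_def[abs_def])
  qed
qed (auto intro: continuous_intros)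

lemma Ck_const: "Ck k (\<lambda>x. c)"
proof (induction k arbitrary: c)
  case (Suc k)
  show ?case by (rule Ck_SucI[where f' = "\<lambda>x h. 0"]) (use Suc in auto)
qed auto

text \<open>Together with \<open>Ck_prod\<close> this assembles smooth functions of several
  variables from one smooth function per coordinate.\<close>

lemma Ck_comp_inner: "Cn k g \<Longrightarrow> Ck k (\<lambda>x. g (x \<bullet> b))"
proof (induction k arbitrary: g)
  case 0
  then show ?case by (auto intro!: continuous_intros continuous_on_compose2[of UNIV g])
next
  case (Suc k)
  then obtain g' where g': "\<And>t. (g has_real_derivative g' t) (at t)" "Cn k g'" by auto
  show ?case
  proof (rule Ck_SucI)
    show "((\<lambda>x. g (x \<bullet> b)) has_derivative (\<lambda>h. g' (x \<bullet> b) * (h \<bullet> b))) (at x)" for x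
    proof -
      have "((\<lambda>x. x \<bullet> b) has_derivative (\<lambda>h. h \<bullet> b)) (at x)" by (intro derivative_intros)
      from has_derivative_compose[OF this g'(1)[unfolded has_field_derivative_def]]
      show ?thesis by simp
    qed
    show "Ck k (\<lambda>x. g' (x \<bullet> b) * (h \<bullet> b))" for h
      using Suc.IH[OF g'(2)] by (intro Ck_mult Ck_const)
  qed
qed

lemma Ck_prod: "finite S \<Longrightarrow> (\<And>i. i \<in> S \<Longrightarrow> Ck k (g i)) \<Longrightarrow> Ck k (\<lambda>x. \<Prod>i\<in>S. g i x)"
  by (induction S rule: finite_induct) (auto intro: Ck_const Ck_mult)

lemma supp_subset: "closed C \<Longrightarrow> (\<And>x. x \<notin> C \<Longrightarrow> f x = 0) \<Longrightarrow> supp f \<subseteq> C"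
  unfolding supp_def by (rule closure_minimal) auto

lemma not_in_supp: "x \<notin> supp f \<Longrightarrow> f x = 0"
  unfolding supp_def using closure_subset[of "{x. f x \<noteq> 0}"] by auto

lemma closed_supp: "closed (supp f)"
  by (simp add: supp_def)

text \<open>Any compact set outside which \<open>f\<close> vanishes serves in place of the exact
  support, which would be awkward to determine for products of bumps.\<close>

lemma test_funI:
  assumes "\<And>k. Ck k f" "compact C" "C \<subseteq> B" "\<And>x. x \<notin> C \<Longrightarrow> f x = 0"
  shows "f \<in> test_fun B"
proof -
  have "supp f \<subseteq> C" using assms by (intro supp_subset compact_imp_closed)
  moreover then have "compact (supp f)"
    using assms(2) by (metis closed_supp compact_Int_closed inf.absorb_iff2)
  ultimately show ?thesis using assms by (auto simp: test_fun_def)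
qed

lemma test_fun_mono: "B \<subseteq> C \<Longrightarrow> test_fun B \<subseteq> test_fun C"
  by (auto simp: test_fun_def)

lemma test_fun_add: "f \<in> test_fun B \<Longrightarrow> g \<in> test_fun B \<Longrightarrow> (\<lambda>x. f x + g x) \<in> test_fun B"
  by (rule test_funI[where C = "supp f \<union> supp g"])
     (auto simp: test_fun_def not_in_supp intro!: Ck_add)

lemma test_fun_cmult: "f \<in> test_fun B \<Longrightarrow> (\<lambda>x. c * f x) \<in> test_fun B"
  by (rule test_funI[where C = "supp f"])
     (auto simp: test_fun_def intro!: Ck_mult Ck_const simp: not_in_supp)

lemma test_fun_mult: "f \<in> test_fun B \<Longrightarrow> g \<in> test_fun B \<Longrightarrow> (\<lambda>x. f x * g x) \<in> test_fun B"
  by (rule test_funI[where C = "supp f"])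
     (auto simp: test_fun_def intro!: Ck_mult simp: not_in_supp)

lemma test_fun_deriv:
  assumes "f \<in> test_fun B"
  shows "(f has_derivative (\<lambda>h. frechet_derivative f (at x) h)) (at x)"
proof (rule Ck_Suc_deriv)
  show "Ck (Suc 0) f" using assms unfolding test_fun_def by blast
qed

lemma test_fun_zero: "f \<in> test_fun B \<Longrightarrow> x \<notin> B \<Longrightarrow> f x = 0"
  using not_in_supp[of x f] by (auto simp: test_fun_def)

lemma pd_zero_off_supp:
  assumes "x \<notin> supp f" shows "pd b f x = 0"
proof -
  have "(f has_derivative (\<lambda>h. 0)) (at x)"
    by (rule has_derivative_transform_within_open[where s = "- supp f" and f = "\<lambda>x. 0"])
       (use assms in \<open>auto simp: closed_supp open_Compl not_in_supp\<close>)
  then show ?thesis by (simp add: has_derivative_pd)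
qed

lemma test_fun_pd:
  assumes "f \<in> test_fun B" "b \<in> Basis" shows "pd b f \<in> test_fun B"
proof (rule test_funI[where C = "supp f"])
  show "Ck k (pd b f)" for k
  proof -
    have "Ck (Suc k) f" using assms unfolding test_fun_def by blast
    then show ?thesis using assms by simp
  qed
qed (use assms in \<open>auto simp: test_fun_def pd_zero_off_supp\<close>)

lemma test_fun_continuous: "f \<in> test_fun B \<Longrightarrow> continuous_on A f"
  unfolding test_fun_def using Ck.simps(1)[of f] continuous_on_subset by blast

lemma test_fun_measurable [measurable_dest]:
  "f \<in> test_fun B \<Longrightarrow> f \<in> borel_measurable borel"
  by (intro borel_measurable_continuous_onI test_fun_continuous)

lemma borel_imp_lebesgue: "f \<in> borel_measurable borel \<Longrightarrow> f \<in> borel_measurable lebesgue"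
  by (simp add: measurable_completion)

lemma test_fun_bounded:
  assumes "f \<in> test_fun B"
  obtains M where "M > 0" "\<And>x. \<bar>f x\<bar> \<le> M"
proof -
  have "compact (f ` supp f)"
    using assms test_fun_continuous[OF assms] by (intro compact_continuous_image) (auto simp: test_fun_def)
  then obtain M where M: "M > 0" "\<And>x. x \<in> supp f \<Longrightarrow> \<bar>f x\<bar> \<le> M"
    by (metis bounded_pos compact_imp_bounded image_eqI real_norm_def)
  have "\<bar>f x\<bar> \<le> M" for x
    using M not_in_supp[of x f] by (cases "x \<in> supp f") auto
  with M(1) show thesis using that by blast
qed

lemma test_fun_integrable:
  assumes "f \<in> test_fun B" shows "integrable lebesgue f"
proof -
  obtain M where M: "M > 0" "\<And>x. \<bar>f x\<bar> \<le> M" using test_fun_bounded[OF assms] by blast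
  have c: "compact (supp f)" using assms by (simp add: test_fun_def)
  show ?thesis
  proof (rule Bochner_Integration.integrable_bound)
    show "integrable lebesgue (\<lambda>x. M * indicat_real (supp f) x)"
      using fmeasurableD[OF lmeasurable_compact[OF c]] fmeasurableD2[OF lmeasurable_compact[OF c]]
      by (intro integrable_mult_right integrable_real_indicator) (auto simp: less_top)
    show "f \<in> borel_measurable lebesgue"
      using test_fun_measurable[OF assms] by (rule borel_imp_lebesgue)
    show "AE x in lebesgue. norm (f x) \<le> norm (M * indicat_real (supp f) x)"
      using M by (auto simp: indicator_def not_in_supp)
  qed
qed

text \<open>In the product rule along \<open>e\<close> every term but one contains a factor
  \<open>e \<bullet> i = 0\<close>, because the basis is orthonormal.\<close>

lemma pd_prod_inner:
  fixes g g' :: "'a::euclidean_space \<Rightarrow> real \<Rightarrow> real"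
  assumes "e \<in> Basis" "\<And>b t. b \<in> Basis \<Longrightarrow> (g b has_real_derivative g' b t) (at t)"
  shows "pd e (\<lambda>x. \<Prod>b\<in>Basis. g b (x \<bullet> b)) x = g' e (x \<bullet> e) * (\<Prod>b\<in>Basis - {e}. g b (x \<bullet> b))"
proof -
  have "((\<lambda>x. g b (x \<bullet> b)) has_derivative (\<lambda>h. (h \<bullet> b) * g' b (x \<bullet> b))) (at x)" if "b \<in> Basis" for b
  proof -
    have "((\<lambda>x. x \<bullet> b) has_derivative (\<lambda>h. h \<bullet> b)) (at x)" by (intro derivative_intros)
    from has_derivative_compose[OF this assms(2)[OF that, unfolded has_field_derivative_def]]
    show ?thesis by (simp add: mult.commute)
  qed
  then have "((\<lambda>x. \<Prod>b\<in>Basis. g b (x \<bullet> b)) has_derivative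
     (\<lambda>h. \<Sum>i\<in>Basis. ((h \<bullet> i) * g' i (x \<bullet> i)) * (\<Prod>j\<in>Basis - {i}. g j (x \<bullet> j)))) (at x)"
    by (intro has_derivative_prod)
  then have "pd e (\<lambda>x. \<Prod>b\<in>Basis. g b (x \<bullet> b)) x =
     (\<Sum>i\<in>Basis. ((e \<bullet> i) * g' i (x \<bullet> i)) * (\<Prod>j\<in>Basis - {i}. g j (x \<bullet> j)))"
    by (rule has_derivative_pd)
  also have "\<dots> = (\<Sum>i\<in>Basis. if i = e then g' i (x \<bullet> i) * (\<Prod>j\<in>Basis - {i}. g j (x \<bullet> j)) else 0)"
    by (intro sum.cong) (auto simp: inner_Basis assms(1))
  finally show ?thesis using assms(1) by simp
qed

section \<open>Integration by parts and the fundamental lemma\<close>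

lemma integral_on_eq:
  fixes g :: "'a::euclidean_space \<Rightarrow> 'b::euclidean_space"
  assumes "B \<in> sets lebesgue"
  shows "(\<integral>x. g x \<partial>lebesgue_on B) = (\<integral>x. indicator B x *\<^sub>R g x \<partial>lebesgue)"
  using assms by (intro integral_restrict_space) auto

lemma integrable_on_eq:
  fixes g :: "'a::euclidean_space \<Rightarrow> 'b::euclidean_space"
  assumes "B \<in> sets lebesgue"
  shows "integrable (lebesgue_on B) g \<longleftrightarrow> integrable lebesgue (\<lambda>x. indicator B x *\<^sub>R g x)"
  using assms by (intro integrable_restrict_space) auto

lemma measurable_on_eq:
  fixes g :: "'a::euclidean_space \<Rightarrow> 'b::euclidean_space"
  assumes "B \<in> sets lebesgue"
  shows "g \<in> borel_measurable (lebesgue_on B) \<longleftrightarrow> (\<lambda>x. indicator B x *\<^sub>R g x) \<in> borel_measurable lebesgue"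
  using assms borel_measurable_restrict_space_iff[of B lebesgue g] by (simp add: mult.commute)

lemma box_sets_lebesgue [measurable, simp]:
  "box a c \<in> sets lebesgue" "cbox a c \<in> sets lebesgue"
  by auto

lemma compact_sets_lebesgue: "compact K \<Longrightarrow> K \<in> sets lebesgue"
  by (simp add: fmeasurableD lmeasurable_compact)

lemma integral_on_zero_off:
  fixes g :: "'a::euclidean_space \<Rightarrow> 'b::euclidean_space"
  assumes "B \<in> sets lebesgue" "\<And>x. x \<notin> B \<Longrightarrow> g x = 0"
  shows "(\<integral>x. g x \<partial>lebesgue_on B) = (\<integral>x. g x \<partial>lebesgue)"
proof -
  have "(\<lambda>x. indicator B x *\<^sub>R g x) = g" using assms(2) by (auto simp: indicator_def)
  then show ?thesis by (simp add: integral_on_eq[OF assms(1)])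
qed

lemma L1_loc_integrable:
  fixes f :: "'a::euclidean_space \<Rightarrow> 'b::euclidean_space"
  assumes "f \<in> L1_loc B" "compact K" "K \<subseteq> B"
  shows "integrable lebesgue (\<lambda>x. indicator K x *\<^sub>R f x)"
  using assms by (auto simp: L1_loc_def compact_sets_lebesgue simp flip: integrable_on_eq)

lemma bounded_measurable_integrable:
  fixes g :: "'a::euclidean_space \<Rightarrow> 'b::euclidean_space" and \<eta> :: "'a \<Rightarrow> real"
  assumes "integrable lebesgue g" "\<eta> \<in> borel_measurable lebesgue" "\<And>x. \<bar>\<eta> x\<bar> \<le> M"
  shows "integrable lebesgue (\<lambda>x. \<eta> x *\<^sub>R g x)"
proof (rule Bochner_Integration.integrable_bound)
  show "integrable lebesgue (\<lambda>x. M * norm (g x))" using assms(1) by auto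
  show "(\<lambda>x. \<eta> x *\<^sub>R g x) \<in> borel_measurable lebesgue" using assms by measurable
  show "AE x in lebesgue. norm (\<eta> x *\<^sub>R g x) \<le> norm (M * norm (g x))"
  proof (intro AE_I2)
    fix x
    have "\<bar>\<eta> x\<bar> * norm (g x) \<le> M * norm (g x)" using assms(3)[of x] by (rule mult_right_mono) simp
    then show "norm (\<eta> x *\<^sub>R g x) \<le> norm (M * norm (g x))" by simp
  qed
qed

lemma L1_loc_test_integrable:
  fixes f :: "'a::euclidean_space \<Rightarrow> 'b::euclidean_space"
  assumes "f \<in> L1_loc B" "\<eta> \<in> test_fun B"
  shows "integrable lebesgue (\<lambda>x. \<eta> x *\<^sub>R f x)"
proof -
  obtain M where M: "\<And>x. \<bar>\<eta> x\<bar> \<le> M" using test_fun_bounded[OF assms(2)] by blast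
  have K: "compact (supp \<eta>)" "supp \<eta> \<subseteq> B" using assms(2) by (auto simp: test_fun_def)
  have "integrable lebesgue (\<lambda>x. \<eta> x *\<^sub>R (indicator (supp \<eta>) x *\<^sub>R f x))"
    by (rule bounded_measurable_integrable[OF L1_loc_integrable[OF assms(1) K]
        borel_imp_lebesgue[OF test_fun_measurable[OF assms(2)]] M])
  moreover have "(\<lambda>x. \<eta> x *\<^sub>R (indicator (supp \<eta>) x *\<^sub>R f x)) = (\<lambda>x. \<eta> x *\<^sub>R f x)"
    by (auto simp: not_in_supp split: split_indicator)
  ultimately show ?thesis by simp
qed

lemma integral_test_on:
  assumes "open B" "\<eta> \<in> test_fun B"
  shows "(\<integral>x. f x * \<eta> x \<partial>lebesgue_on B) = (\<integral>x. f x * \<eta> x \<partial>lebesgue)"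
  by (rule integral_on_zero_off) (use assms test_fun_zero in auto)

text \<open>Test functions vanish off \<open>B\<close>, so the defining identity may be integrated
  over the whole space.\<close>

lemma is_weak_gradient_iff:
  assumes "open B"
  shows "is_weak_gradient B f G \<longleftrightarrow> f \<in> L1_loc B \<and> G \<in> L1_loc B \<and>
     (\<forall>\<eta>\<in>test_fun B. \<forall>b\<in>Basis.
        (\<integral>x. f x * pd b \<eta> x \<partial>lebesgue) = - (\<integral>x. (G x \<bullet> b) * \<eta> x \<partial>lebesgue))"
  unfolding is_weak_gradient_def
  by (intro conj_cong refl ball_cong) (simp add: integral_test_on[OF assms] test_fun_pd)

lemma integral_translate:
  fixes f :: "'a::euclidean_space \<Rightarrow> real"
  assumes [measurable]: "f \<in> borel_measurable borel"
  shows "(\<integral>x. f (v + x) \<partial>lebesgue) = (\<integral>x. f x \<partial>lebesgue)"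
proof -
  have "(\<integral>x. f x \<partial>lborel) = (\<integral>x. f x \<partial>distr lborel borel ((+) v))" by (simp add: lborel_distr_plus)
  also have "\<dots> = (\<integral>x. f (v + x) \<partial>lborel)" by (intro integral_distr) auto
  finally show ?thesis by (simp add: integral_completion)
qed

lemma directional_pd:
  assumes "f \<in> test_fun B"
  shows "((\<lambda>t. f (x + t *\<^sub>R b)) has_real_derivative pd b f (x + t *\<^sub>R b)) (at t)"
proof -
  have "((\<lambda>t. x + t *\<^sub>R b) has_derivative (\<lambda>h. h *\<^sub>R b)) (at t)" by (auto intro!: derivative_eq_intros)
  from has_derivative_compose[OF this test_fun_deriv[OF assms]]
  have d: "((\<lambda>t. f (x + t *\<^sub>R b)) has_derivative (\<lambda>h. frechet_derivative f (at (x + t *\<^sub>R b)) (h *\<^sub>R b))) (at t)" .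
  interpret bounded_linear "frechet_derivative f (at (x + t *\<^sub>R b))"
    using test_fun_deriv[OF assms] by (rule has_derivative_bounded_linear)
  have "(\<lambda>h. frechet_derivative f (at (x + t *\<^sub>R b)) (h *\<^sub>R b)) = (*) (pd b f (x + t *\<^sub>R b))"
    by (auto simp: scaleR pd_def)
  with d show ?thesis by (simp add: has_field_derivative_def)
qed

text \<open>The difference quotients in direction \<open>b\<close> have integral 0 by translation
  invariance, and they converge to \<open>pd b f\<close> under a common integrable bound.\<close>

lemma integral_pd_zero:
  fixes f :: "'a::euclidean_space \<Rightarrow> real"
  assumes f: "f \<in> test_fun B" and b: "b \<in> Basis"
  shows "(\<integral>x. pd b f x \<partial>lebesgue) = 0"
proof -
  define s where "s n x = (f (inverse (Suc n) *\<^sub>R b + x) - f x) * Suc n" for n :: nat and x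
  note [measurable] = test_fun_measurable[OF f] test_fun_measurable[OF test_fun_pd[OF f b]]
  have int: "integrable lebesgue f" using test_fun_integrable[OF f] .
  obtain M where M: "\<And>x. \<bar>pd b f x\<bar> \<le> M" using test_fun_bounded[OF test_fun_pd[OF f b]] by blast
  have "bounded (supp f)" using f by (simp add: test_fun_def compact_imp_bounded)
  then obtain R where "\<forall>x\<in>supp f. norm x \<le> R" unfolding bounded_iff by blast
  then have R: "supp f \<subseteq> cball 0 R" by auto
  have mvt: "\<exists>z. f (inverse (Suc n) *\<^sub>R b + x) - f x = inverse (Suc n) * pd b f z" for n x
    using MVT2[of 0 "inverse (Suc n)" "\<lambda>t. f (x + t *\<^sub>R b)" "\<lambda>t. pd b f (x + t *\<^sub>R b)"] directional_pd[OF f]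
    by (auto simp: add.commute)
  have "(\<lambda>n. \<integral>x. s n x \<partial>lebesgue) \<longlonglongrightarrow> (\<integral>x. pd b f x \<partial>lebesgue)"
  \<comment> \<open>The mean value theorem bounds the quotients by \<open>M\<close>; the steps have
    length at most 1, so the quotients vanish outside the ball of radius
    \<open>R + 1\<close>.\<close>
  proof (rule integral_dominated_convergence[where w = "\<lambda>x. M * indicator (cball 0 (R + 1)) x"])
    show "integrable lebesgue (\<lambda>x::'a. M * indicat_real (cball 0 (R + 1)) x)"
      using fmeasurableD2[OF lmeasurable_cball[of "0::'a" "R + 1"]]
      by (intro integrable_mult_right integrable_real_indicator) (auto simp: less_top)
    show "AE x in lebesgue. (\<lambda>n. s n x) \<longlonglongrightarrow> pd b f x"
    proof (intro AE_I2)
      fix x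
      have "((\<lambda>h. (f (x + h *\<^sub>R b) - f x) / h) \<longlongrightarrow> pd b f x) (at 0)"
        using directional_pd[OF f, of x b 0] by (simp add: DERIV_def)
      moreover have "filterlim (\<lambda>n. inverse (real (Suc n))) (at 0) sequentially"
        using LIMSEQ_inverse_real_of_nat by (intro filterlim_atI) auto
      ultimately have "(\<lambda>n. (f (x + inverse (real (Suc n)) *\<^sub>R b) - f x) / inverse (real (Suc n))) \<longlonglongrightarrow> pd b f x"
        by (rule filterlim_compose)
      then show "(\<lambda>n. s n x) \<longlonglongrightarrow> pd b f x"
        by (simp add: s_def add.commute divide_inverse)
    qed
    show "AE x in lebesgue. norm (s n x) \<le> M * indicator (cball 0 (R + 1)) x" for n
    proof (intro AE_I2)
      fix x
      obtain z where "f (inverse (Suc n) *\<^sub>R b + x) - f x = inverse (Suc n) * pd b f z" using mvt by blast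
      then have s: "s n x = pd b f z" by (simp add: s_def)
      show "norm (s n x) \<le> M * indicator (cball 0 (R + 1)) x"
      proof (cases "norm x \<le> R + 1")
        case False
        have i: "inverse (1 + real n) \<le> 1" by (simp add: inverse_le_1_iff)
        have "norm (inverse (1 + real n) *\<^sub>R b + x) \<ge> norm x - 1"
          using norm_diff_ineq[of x "inverse (1 + real n) *\<^sub>R b"] i b by (simp add: add.commute)
        moreover have "f z = 0" if "R < norm z" for z using R that by (intro not_in_supp) auto
        ultimately have "f (inverse (1 + real n) *\<^sub>R b + x) = 0" "f x = 0"
          using False by auto
        then show ?thesis using False by (simp add: s_def)
      qed (use s M in \<open>auto simp: indicator_def\<close>)
    qed
    show "pd b f \<in> borel_measurable lebesgue" by (intro borel_imp_lebesgue) simp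
    show "s n \<in> borel_measurable lebesgue" for n
      unfolding s_def[abs_def] by (intro borel_imp_lebesgue) measurable
  qed
  moreover have "(\<integral>x. s n x \<partial>lebesgue) = 0" for n
  proof -
    have t: "(\<integral>x. f (inverse (Suc n) *\<^sub>R b + x) \<partial>lebesgue) = (\<integral>x. f x \<partial>lebesgue)"
      by (rule integral_translate) simp
    have "integrable lborel (\<lambda>x. f (inverse (Suc n) *\<^sub>R b + x))"
    proof -
      have "integrable (distr lborel borel ((+) (inverse (Suc n) *\<^sub>R b))) f"
        using int unfolding lborel_distr_plus by (simp add: integrable_completion)
      then show ?thesis by (subst (asm) integrable_distr_eq) auto
    qed
    then have "integrable lebesgue (\<lambda>x. f (inverse (Suc n) *\<^sub>R b + x))"
      by (simp add: integrable_completion)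
    then show ?thesis using int t by (simp add: s_def)
  qed
  ultimately show ?thesis by (simp add: LIMSEQ_const_iff)
qed

text \<open>The product \<open>f * g\<close> is a test function, so the integral of its derivative
  is 0; the product rule splits that integral in two.\<close>

lemma test_fun_parts:
  assumes "f \<in> test_fun B" "g \<in> test_fun C" "b \<in> Basis"
  shows "(\<integral>x. f x * pd b g x \<partial>lebesgue) = - (\<integral>x. pd b f x * g x \<partial>lebesgue)"
proof -
  have fU: "f \<in> test_fun UNIV" and gU: "g \<in> test_fun UNIV" using assms by (auto simp: test_fun_def)
  have "pd b (\<lambda>x. f x * g x) x = f x * pd b g x + pd b f x * g x" for x
    using has_derivative_pd[OF has_derivative_mult[OF test_fun_deriv[OF fU, of x] test_fun_deriv[OF gU, of x]]]
    by (simp add: pd_def)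
  then have "0 = (\<integral>x. f x * pd b g x + pd b f x * g x \<partial>lebesgue)"
    using integral_pd_zero[OF test_fun_mult[OF fU gU] assms(3)] by simp
  also have "\<dots> = (\<integral>x. f x * pd b g x \<partial>lebesgue) + (\<integral>x. pd b f x * g x \<partial>lebesgue)"
    using assms(3) fU gU
    by (intro Bochner_Integration.integral_add test_fun_integrable[where B=UNIV] test_fun_mult test_fun_pd)
  finally show ?thesis by linarith
qed

definition grad :: "('a::euclidean_space \<Rightarrow> real) \<Rightarrow> 'a \<Rightarrow> 'a" where
  "grad f x = (\<Sum>b\<in>Basis. pd b f x *\<^sub>R b)"

lemma grad_inner: "b \<in> Basis \<Longrightarrow> grad f x \<bullet> b = pd b f x"
  by (simp add: grad_def inner_sum_left inner_Basis if_distrib cong: if_cong)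

lemma grad_zero_off_supp: "x \<notin> supp f \<Longrightarrow> grad f x = 0"
  by (simp add: grad_def pd_zero_off_supp)

lemma continuous_grad: "f \<in> test_fun B \<Longrightarrow> continuous_on A (grad f)"
  unfolding grad_def by (intro continuous_intros) (auto intro: test_fun_continuous test_fun_pd)

lemma continuous_compact_integrable:
  fixes g :: "'a::euclidean_space \<Rightarrow> 'b::euclidean_space"
  assumes "continuous_on UNIV g" "compact K" "\<And>x. x \<notin> K \<Longrightarrow> g x = 0"
  shows "integrable lebesgue g"
proof -
  have "integrable lborel (\<lambda>x. indicator K x *\<^sub>R g x)"
    using assms by (intro borel_integrable_compact) (auto intro: continuous_on_subset)
  moreover have "(\<lambda>x. indicator K x *\<^sub>R g x) = g" using assms(3) by (auto simp: indicator_def)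
  ultimately have "integrable lborel g" by simp
  then show ?thesis by (subst integrable_completion) (auto dest: borel_measurable_integrable)
qed

lemma integrable_imp_L1_loc:
  fixes g :: "'a::euclidean_space \<Rightarrow> 'b::euclidean_space"
  assumes "integrable lebesgue g" "B \<in> sets lebesgue" shows "g \<in> L1_loc B"
  unfolding L1_loc_def
proof (intro CollectI conjI allI impI)
  show "g \<in> borel_measurable (lebesgue_on B)"
    using borel_measurable_integrable[OF assms(1)] by (rule measurable_restrict_space1)
  show "integrable (lebesgue_on K) g" if "compact K \<and> K \<subseteq> B" for K
    using that assms(1) compact_sets_lebesgue[of K]
    by (auto simp: integrable_on_eq intro!: integrable_mult_indicator)
qed

lemma test_fun_weak_gradient:
  assumes "open B" "f \<in> test_fun B"
  shows "is_weak_gradient B f (grad f)"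
  unfolding is_weak_gradient_iff[OF assms(1)]
proof (intro conjI ballI)
  have B: "B \<in> sets lebesgue" using assms(1) by auto
  show "f \<in> L1_loc B" using test_fun_integrable[OF assms(2)] B by (rule integrable_imp_L1_loc)
  have "integrable lebesgue (grad f)"
    using assms(2) by (intro continuous_compact_integrable[where K = "supp f"] continuous_grad[OF assms(2)])
      (auto simp: test_fun_def grad_zero_off_supp)
  then show "grad f \<in> L1_loc B" using B by (rule integrable_imp_L1_loc)
  show "(\<integral>x. f x * pd b \<eta> x \<partial>lebesgue) = - (\<integral>x. (grad f x \<bullet> b) * \<eta> x \<partial>lebesgue)"
    if "\<eta> \<in> test_fun B" "b \<in> Basis" for \<eta> b
    using test_fun_parts[OF assms(2) that] that(2) by (simp add: grad_inner)
qed

section \<open>Smooth approximations of box indicators from below\<close>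

definition bump1 :: "real \<Rightarrow> real \<Rightarrow> nat \<Rightarrow> real \<Rightarrow> real" where
  "bump1 u v k t = flat 0 (real (Suc k) * (t - u)) * flat 0 (real (Suc k) * (v - t))"

lemma flat0_bounds: "0 \<le> flat 0 t" "flat 0 t \<le> 1"
  by (auto simp: flat_def)

lemma bump1_bounds: "0 \<le> bump1 u v k t" "bump1 u v k t \<le> 1"
  using flat0_bounds by (auto simp: bump1_def intro!: mult_le_one)

lemma bump1_zero: "t \<le> u \<or> v \<le> t \<Longrightarrow> bump1 u v k t = 0"
  by (auto simp: bump1_def flat_def zero_less_mult_iff)

lemma Cn_bump1: "Cn n (bump1 u v k)"
proof -
  have "Cn n (\<lambda>t. flat 0 (real (Suc k) * t + (- (real (Suc k) * u))) * flat 0 ((- real (Suc k)) * t + real (Suc k) * v))"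
    by (intro Cn_mult Cn_affine Cn_flat)
  moreover have "bump1 u v k = (\<lambda>t. flat 0 (real (Suc k) * t + (- (real (Suc k) * u))) * flat 0 ((- real (Suc k)) * t + real (Suc k) * v))"
    by (rule ext) (simp add: bump1_def algebra_simps)
  ultimately show ?thesis by simp
qed

text \<open>The exponent is -1 / ((k + 1) t): stretching the argument drives the value to 1 at every
  fixed positive t, which explains the scaling inside \<open>bump1\<close>.\<close>

lemma flat0_limit: "t > 0 \<Longrightarrow> (\<lambda>k. flat 0 (real (Suc k) * t)) \<longlonglongrightarrow> 1"
proof -
  assume t: "t > 0"
  have "(\<lambda>k. exp (- (inverse (real (Suc k)) * inverse t))) \<longlonglongrightarrow> exp (- (0 * inverse t))"
    by (intro tendsto_intros LIMSEQ_inverse_real_of_nat)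
  moreover have "flat 0 (real (Suc k) * t) = exp (- (inverse (real (Suc k)) * inverse t))" for k
    using t add_pos_nonneg[of t "t * real k"] by (simp add: flat_def field_simps)
  ultimately show ?thesis by simp
qed

lemma bump1_limit: "(\<lambda>k. bump1 u v k t) \<longlonglongrightarrow> indicator {u<..<v} t"
proof (cases "u < t \<and> t < v")
  case True
  then have "(\<lambda>k. bump1 u v k t) \<longlonglongrightarrow> 1 * 1"
    unfolding bump1_def by (intro tendsto_mult flat0_limit) auto
  then show ?thesis using True by simp
qed (auto simp: bump1_zero indicator_def not_less)

definition bump :: "'a::euclidean_space \<Rightarrow> 'a \<Rightarrow> nat \<Rightarrow> 'a \<Rightarrow> real" where
  "bump a c k x = (\<Prod>b\<in>Basis. bump1 (a \<bullet> b) (c \<bullet> b) k (x \<bullet> b))"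

lemma bump_bounds: "0 \<le> bump a c k x" "bump a c k x \<le> 1"
  using bump1_bounds by (auto simp: bump_def intro!: prod_nonneg prod_le_1)

lemma bump_test_fun:
  assumes "cbox a c \<subseteq> B" shows "bump a c k \<in> test_fun B"
proof (rule test_funI[where C = "cbox a c"])
  show "Ck m (bump a c k)" for m
    unfolding bump_def[abs_def] by (intro Ck_prod Ck_comp_inner Cn_bump1) auto
  show "bump a c k x = 0" if x: "x \<notin> cbox a c" for x
  proof -
    obtain b where "b \<in> Basis" "x \<bullet> b \<le> a \<bullet> b \<or> c \<bullet> b \<le> x \<bullet> b"
      using x by (force simp: mem_box)
    then show ?thesis unfolding bump_def by (intro prod_zero) (auto intro!: bexI[of _ b] bump1_zero)
  qed
qed (use assms in auto)

lemma bump_limit: "(\<lambda>k. bump a c k x) \<longlonglongrightarrow> indicator (box a c) x"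
proof -
  have "(\<lambda>k. bump a c k x) \<longlonglongrightarrow> (\<Prod>b\<in>Basis. indicator {a \<bullet> b<..<c \<bullet> b} (x \<bullet> b))"
    unfolding bump_def by (intro tendsto_prod bump1_limit)
  also have "(\<Prod>b\<in>Basis. indicator {a \<bullet> b<..<c \<bullet> b} (x \<bullet> b)) = (indicator (box a c) x :: real)"
    by (auto simp: indicator_def mem_box prod_zero_iff prod.neutral)
  finally show ?thesis .
qed

text \<open>Boxes form an intersection-stable generator of the Borel sets, so vanishing of the
  integral spreads to all Borel sets by induction over disjoint unions and complements; a function
  whose integrals over all Borel sets are 0 is 0 almost everywhere.\<close>

lemma AE_zero_if_boxes_zero:
  fixes g :: "'a::euclidean_space \<Rightarrow> real"
  assumes g: "integrable lebesgue g"
    and box: "\<And>a c. (\<integral>x. indicator (box a c) x * g x \<partial>lebesgue) = 0"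
  shows "AE x in lebesgue. g x = 0"
proof -
  \<comment> \<open>Boxes generate only the Borel sets, so the induction runs on a Borel version of
    \<open>g\<close>.\<close>
  obtain g' where g'[measurable]: "g' \<in> borel_measurable lborel" and eq: "AE x in lborel. g x = g' x"
    using completion_ex_borel_measurable_real[OF borel_measurable_integrable[OF g]] by blast
  have eqL: "AE x in lebesgue. g x = g' x" using eq by (rule AE_completion)
  have g'L: "g' \<in> borel_measurable lebesgue" using g' by (simp add: measurable_completion)
  have int': "integrable lebesgue g'"
    using g eqL g'L by (subst integrable_cong_AE[symmetric, where f = g]) auto
  then have int: "integrable lborel g'" by (simp add: integrable_completion)
  have box': "(\<integral>x. indicator (box a c) x * g' x \<partial>lborel) = 0" for a c
  proof -
    have "(\<integral>x. indicator (box a c) x * g' x \<partial>lborel) = (\<integral>x. indicator (box a c) x * g' x \<partial>lebesgue)"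
      by (subst integral_completion) auto
    also have "\<dots> = (\<integral>x. indicator (box a c) x * g x \<partial>lebesgue)"
      using eqL by (intro integral_cong_AE borel_measurable_times borel_measurable_indicator g'L
          borel_measurable_integrable[OF g]) auto
    finally show ?thesis using box by simp
  qed
  \<comment> \<open>The complement step needs the integral over the whole space, which is not a box;
    it is reached by exhaustion with centred cubes.\<close>
  have tot: "(\<integral>x. g' x \<partial>lborel) = 0"
  proof -
    have "(\<lambda>n. \<integral>x. indicator (box (- (real n *\<^sub>R One)) (real n *\<^sub>R One)) x * g' x \<partial>lborel) \<longlonglongrightarrow> (\<integral>x. g' x \<partial>lborel)"
    proof (rule integral_dominated_convergence[where w = "\<lambda>x. \<bar>g' x\<bar>"])
      show "AE x in lborel. (\<lambda>n. indicator (box (- (real n *\<^sub>R One)) (real n *\<^sub>R One)) x * g' x) \<longlonglongrightarrow> g' x"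
      proof (intro AE_I2 tendsto_eventually)
        fix x :: 'a
        obtain N :: nat where N: "norm x < real N" using reals_Archimedean2 by blast
        show "\<forall>\<^sub>F n in sequentially. indicator (box (- (real n *\<^sub>R One)) (real n *\<^sub>R One)) x * g' x = g' x"
        proof (rule eventually_sequentiallyI)
          fix n assume "N \<le> n"
          then have "x \<bullet> b < real n \<and> - real n < x \<bullet> b" if "b \<in> Basis" for b
            using N Basis_le_norm[OF that, of x] by linarith
          then have "x \<in> box (- (real n *\<^sub>R One)) (real n *\<^sub>R One)"
            by (auto simp: mem_box)
          then show "indicator (box (- (real n *\<^sub>R One)) (real n *\<^sub>R One)) x * g' x = g' x" by simp
        qed
      qed
    qed (use int in \<open>auto simp: indicator_def\<close>)
    then show ?thesis using box' by (simp add: LIMSEQ_const_iff)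
  qed
  have set: "(\<integral>x. indicator A x * g' x \<partial>lborel) = 0" if "A \<in> sets lborel" for A
  proof -
    have A: "A \<in> sigma_sets UNIV (range (\<lambda>(a, b). box a b :: 'a set))"
      using that by (simp add: borel_eq_box)
    have isb: "Int_stable (range (\<lambda>(a, b). box a b :: 'a set))"
      by (auto simp: Int_stable_def box_Int_box)
    have sub: "range (\<lambda>(a, b). box a b :: 'a set) \<subseteq> Pow UNIV" by simp
    show ?thesis using isb sub A
    proof (induction rule: sigma_sets_induct_disjoint)
      case (compl A)
      then have [measurable]: "A \<in> sets borel" by (simp add: borel_eq_box)
      have "(\<integral>x. indicator (UNIV - A) x * g' x \<partial>lborel) = (\<integral>x. g' x - indicator A x * g' x \<partial>lborel)"
        by (intro Bochner_Integration.integral_cong) (auto simp: indicator_def)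
      also have "\<dots> = 0" using tot compl int by (subst Bochner_Integration.integral_diff)
         (auto intro!: integrable_mult_indicator[where 'b=real, simplified])
      finally show ?case .
    next
      case (union A)
      then have A: "\<And>i. A i \<in> sets lborel" by (auto simp: borel_eq_box)
      have "(\<integral>x\<in>(\<Union>i. A i). g' x \<partial>lborel) = (\<Sum>i. (\<integral>x\<in>(A i). g' x \<partial>lborel))"
      proof (rule lebesgue_integral_countable_add)
        show "set_integrable lborel (\<Union>i. A i) g'"
          unfolding set_integrable_def using A int by (intro integrable_mult_indicator) auto
      qed (use union A in \<open>auto simp: disjoint_family_on_def\<close>)
      then show ?case using union by (simp add: set_lebesgue_integral_def)
    qed (auto simp: box')
  qed
  have "AE x in lborel. g' x = 0"
    using int set by (intro sigma_finite_measure.density_zero[OF lborel.sigma_finite_measure_axioms]) (auto simp: set_lebesgue_integral_def)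
  then have "AE x in lborel. g x = 0" using eq by eventually_elim simp
  then show ?thesis by (rule AE_completion)
qed

text \<open>Bumps turn the hypothesis into vanishing integrals over all small boxes inside a closed
  box contained in \<open>B\<close>. There \<open>AE_zero_if_boxes_zero\<close> applies, and
  countably many such closed boxes fill \<open>B\<close>.\<close>

lemma fundamental_lemma:
  fixes g :: "'a::euclidean_space \<Rightarrow> real"
  assumes B: "open B" and g: "g \<in> L1_loc B"
    and z: "\<And>\<eta>. \<eta> \<in> test_fun B \<Longrightarrow> (\<integral>x. g x * \<eta> x \<partial>lebesgue) = 0"
  shows "AE x in lebesgue. x \<in> B \<longrightarrow> g x = 0"
proof -
  have loc: "AE x in lebesgue. x \<in> box u v \<longrightarrow> g x = 0" if uv: "cbox u v \<subseteq> B" for u v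
  proof -
    have gi: "integrable lebesgue (\<lambda>x. indicator (cbox u v) x * g x)"
      using L1_loc_integrable[OF g _ uv] by simp
    have gi2: "integrable lebesgue (\<lambda>x. indicator (box u v) x * (indicator (cbox u v) x * g x))"
      by (rule integrable_mult_indicator[where 'b=real, simplified, OF _ gi]) auto
    have "AE x in lebesgue. indicator (box u v) x * (indicator (cbox u v) x * g x) = 0"
    proof (rule AE_zero_if_boxes_zero[OF gi2])
      fix a c
      \<comment> \<open>Two open boxes meet in an open box. If it is nonempty, its closure is the
        closed box with the same corners and lies in \<open>cbox u v\<close>, so its bumps are
        legitimate test functions.\<close>
      obtain a' c' where ac: "box a c \<inter> box u v = box a' c'" "cbox a' c' \<subseteq> cbox u v \<or> box a' c' = {}"
      proof -
        obtain a' c' where *: "box a c \<inter> box u v = box a' c'" using box_Int_box by blast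
        have "cbox a' c' \<subseteq> cbox u v" if "box a' c' \<noteq> {}"
        proof -
          have "closure (box a' c') \<subseteq> closure (box u v)" using * by (intro closure_mono) auto
          then show ?thesis using that * by (metis Int_empty_right closure_box)
        qed
        then show thesis using that * by blast
      qed
      have eq: "indicator (box a c) x * (indicator (box u v) x * (indicator (cbox u v) x * g x)) =
         indicator (box a' c') x * (indicator (cbox u v) x * g x)" for x
        unfolding ac(1)[symmetric] by (auto split: split_indicator)
      show "(\<integral>x. indicator (box a c) x * (indicator (box u v) x * (indicator (cbox u v) x * g x)) \<partial>lebesgue) = 0"
      proof (cases "box a' c' = {}")
        case True then show ?thesis unfolding eq by simp
      next
        case False
        then have sub: "cbox a' c' \<subseteq> cbox u v" using ac by auto
        then have tf: "bump a' c' k \<in> test_fun (cbox u v)" for k by (rule bump_test_fun)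
        have "(\<lambda>k. \<integral>x. bump a' c' k x * (indicator (cbox u v) x * g x) \<partial>lebesgue) \<longlonglongrightarrow>
           (\<integral>x. indicator (box a' c') x * (indicator (cbox u v) x * g x) \<partial>lebesgue)"
        proof (rule integral_dominated_convergence[where w = "\<lambda>x. \<bar>indicator (cbox u v) x * g x\<bar>"])
          show "(\<lambda>x. bump a' c' k x * (indicator (cbox u v) x * g x)) \<in> borel_measurable lebesgue" for k
            by (intro borel_measurable_times borel_imp_lebesgue[OF test_fun_measurable[OF tf]]
              borel_measurable_integrable[OF gi])
          show "(\<lambda>x. indicator (box a' c') x * (indicator (cbox u v) x * g x)) \<in> borel_measurable lebesgue"
            by (intro borel_measurable_times borel_measurable_indicator borel_measurable_integrable[OF gi]) auto
          show "AE x in lebesgue. (\<lambda>k. bump a' c' k x * (indicator (cbox u v) x * g x)) \<longlonglongrightarrow>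
              indicator (box a' c') x * (indicator (cbox u v) x * g x)"
            by (intro AE_I2 tendsto_mult_right bump_limit)
          show "AE x in lebesgue. norm (bump a' c' k x * (indicator (cbox u v) x * g x)) \<le> \<bar>indicator (cbox u v) x * g x\<bar>" for k
            using bump_bounds[of a' c' k] by (intro AE_I2) (auto simp: abs_mult intro!: mult_left_le_one_le)
        qed (use gi in auto)
        moreover have "(\<integral>x. bump a' c' k x * (indicator (cbox u v) x * g x) \<partial>lebesgue) = 0" for k
        proof -
          have "(\<lambda>x. bump a' c' k x * (indicator (cbox u v) x * g x)) = (\<lambda>x. g x * bump a' c' k x)"
            by (rule ext) (use test_fun_zero[OF tf] in \<open>auto split: split_indicator\<close>)
          then show ?thesis using z[of "bump a' c' k"] tf test_fun_mono[OF uv] by auto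
        qed
        ultimately show ?thesis unfolding eq by (simp add: LIMSEQ_const_iff)
      qed
    qed
    then show ?thesis
      by eventually_elim (auto simp: box_subset_cbox[THEN subsetD] split: split_indicator_asm)
  qed
  obtain D where D: "countable D" "D \<subseteq> Pow B" "\<And>X. X \<in> D \<Longrightarrow> \<exists>a b. X = cbox a b" "\<Union>D = B"
    using open_countable_Union_open_cbox[OF B] by blast
  have "\<forall>X\<in>D. AE x in lebesgue. x \<in> X \<longrightarrow> g x = 0"
  proof
    fix X assume X: "X \<in> D"
    then obtain a b where ab: "X = cbox a b" using D by blast
    \<comment> \<open>\<open>loc\<close> speaks of open boxes while the cover consists of closed
      ones; the faces are null.\<close>
    have "negligible (cbox a b - box a b)" by (rule negligible_frontier_interval)
    then have "AE x in lebesgue. x \<notin> cbox a b - box a b"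
      unfolding negligible_iff_null_sets by (rule AE_not_in)
    moreover have "AE x in lebesgue. x \<in> box a b \<longrightarrow> g x = 0"
      using X D ab by (intro loc) auto
    ultimately show "AE x in lebesgue. x \<in> X \<longrightarrow> g x = 0"
      unfolding ab by eventually_elim auto
  qed
  then have "AE x in lebesgue. \<forall>X\<in>D. x \<in> X \<longrightarrow> g x = 0"
    by (subst AE_ball_countable[OF D(1)])
  then show ?thesis
  proof eventually_elim
    case (elim x)
    then show ?case using D(4) by auto
  qed
qed

section \<open>Fast convergence and translation of boxes\<close>

lemma L1_loc_lincomb:
  fixes f g :: "'a::euclidean_space \<Rightarrow> 'b::euclidean_space"
  assumes "f \<in> L1_loc B" "g \<in> L1_loc B"
  shows "(\<lambda>x. f x + c *\<^sub>R g x) \<in> L1_loc B"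
  using assms unfolding L1_loc_def by auto

lemma L1_loc_inner:
  fixes f :: "'a::euclidean_space \<Rightarrow> 'b::euclidean_space"
  assumes "f \<in> L1_loc B"
  shows "(\<lambda>x. f x \<bullet> b) \<in> L1_loc B"
  using assms unfolding L1_loc_def by auto

lemma is_weak_gradient_lincomb:
  assumes B: "open B" and f: "is_weak_gradient B f F" and g: "is_weak_gradient B g G"
  shows "is_weak_gradient B (\<lambda>x. f x + c * g x) (\<lambda>x. F x + c *\<^sub>R G x)"
  unfolding is_weak_gradient_iff[OF B]
proof (intro conjI ballI)
  note fg = f[unfolded is_weak_gradient_iff[OF B]] g[unfolded is_weak_gradient_iff[OF B]]
  show "(\<lambda>x. f x + c * g x) \<in> L1_loc B" using L1_loc_lincomb[of f B g c] fg by simp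
  show "(\<lambda>x. F x + c *\<^sub>R G x) \<in> L1_loc B" using fg by (intro L1_loc_lincomb) auto
  fix \<eta> b assume \<eta>: "\<eta> \<in> test_fun B" and b: "b \<in> (Basis :: 'a set)"
  note p = test_fun_pd[OF \<eta> b]
  have i: "integrable lebesgue (\<lambda>x. f x * pd b \<eta> x)" "integrable lebesgue (\<lambda>x. g x * pd b \<eta> x)"
    "integrable lebesgue (\<lambda>x. (F x \<bullet> b) * \<eta> x)" "integrable lebesgue (\<lambda>x. (G x \<bullet> b) * \<eta> x)"
    using L1_loc_test_integrable[OF _ p, of f] L1_loc_test_integrable[OF _ p, of g]
      L1_loc_test_integrable[OF L1_loc_inner \<eta>, of F b] L1_loc_test_integrable[OF L1_loc_inner \<eta>, of G b] fg
    by (auto simp: mult.commute)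
  have "(\<integral>x. (f x + c * g x) * pd b \<eta> x \<partial>lebesgue) = (\<integral>x. f x * pd b \<eta> x + c * (g x * pd b \<eta> x) \<partial>lebesgue)"
    by (simp add: algebra_simps)
  also have "\<dots> = - (\<integral>x. (F x \<bullet> b) * \<eta> x + c * ((G x \<bullet> b) * \<eta> x) \<partial>lebesgue)"
    using i fg \<eta> b by simp
  also have "(\<lambda>x. (F x \<bullet> b) * \<eta> x + c * ((G x \<bullet> b) * \<eta> x)) = (\<lambda>x. ((F x + c *\<^sub>R G x) \<bullet> b) * \<eta> x)"
    by (simp add: algebra_simps inner_add_left)
  finally show "(\<integral>x. (f x + c * g x) * pd b \<eta> x \<partial>lebesgue) = - (\<integral>x. ((F x + c *\<^sub>R G x) \<bullet> b) * \<eta> x \<partial>lebesgue)" .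
qed

text \<open>The difference of the two fields is a weak gradient of \<open>f - f\<close>, the zero
  function, so each of its components is annihilated by all test functions.\<close>

lemma weak_gradient_unique:
  assumes B: "open B" and F: "is_weak_gradient B f F" and G: "is_weak_gradient B f G"
  shows "AE x in lebesgue. x \<in> B \<longrightarrow> F x = G x"
proof -
  have d: "is_weak_gradient B (\<lambda>x. f x + (-1) * f x) (\<lambda>x. F x + (-1) *\<^sub>R G x)"
    by (rule is_weak_gradient_lincomb[OF B F G])
  have "AE x in lebesgue. x \<in> B \<longrightarrow> (F x - G x) \<bullet> b = 0" if b: "b \<in> Basis" for b
  proof (rule fundamental_lemma[OF B])
    show "(\<lambda>x. (F x - G x) \<bullet> b) \<in> L1_loc B"
      using d L1_loc_inner[of "\<lambda>x. F x - G x" B b] unfolding is_weak_gradient_def by simp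
    show "(\<integral>x. (F x - G x) \<bullet> b * \<eta> x \<partial>lebesgue) = 0" if "\<eta> \<in> test_fun B" for \<eta>
      using d that b unfolding is_weak_gradient_iff[OF B] by simp
  qed
  then have "AE x in lebesgue. \<forall>b\<in>Basis. x \<in> B \<longrightarrow> (F x - G x) \<bullet> b = 0"
    by (subst AE_ball_countable) (auto intro: countable_finite)
  then show ?thesis
  proof eventually_elim
    case (elim x)
    then show ?case using euclidean_eqI[of "F x" "G x"] by (auto simp: inner_diff_left)
  qed
qed

text \<open>Jensen's inequality for the q-th power with weights of total mass at most 1: the missing
  mass is placed at the value 0, where the power is 0 since \<open>q \<ge> 1\<close>.\<close>

lemma power_sum_convex:
  fixes w b :: "nat \<Rightarrow> real"
  assumes "q \<ge> 1" "\<And>j. 0 \<le> w j" "\<And>j. 0 \<le> b j" "(\<Sum>j<n. w j) \<le> 1"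
  shows "(\<Sum>j<n. w j * b j) ^ q \<le> (\<Sum>j<n. w j * b j ^ q)"
proof -
  define w' where "w' j = (if j < n then w j else 1 - (\<Sum>j<n. w j))" for j
  define b' where "b' j = (if j < n then b j else 0)" for j
  have conv: "convex_on {0..} (\<lambda>x::real. x ^ q)"
    using convex_power_odd[of q] convex_on_subset[OF convex_power_even[of q], of "{0..}"] by (cases "even q") auto
  have "(\<Sum>j\<in>{..n}. w' j *\<^sub>R b' j) ^ q \<le> (\<Sum>j\<in>{..n}. w' j * b' j ^ q)"
    using assms by (intro convex_on_sum[OF _ _ conv]) (auto simp: w'_def b'_def lessThan_Suc_atMost[symmetric])
  then show ?thesis using assms(1)
    by (auto simp: w'_def b'_def lessThan_Suc_atMost[symmetric] zero_power)
qed

text \<open>Let s be the q-th root of r and \<open>w j = (1 - s) * s ^ j\<close>. For the increments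
  \<open>a j\<close>, Jensen bounds the q-th power of their sum by the sum of
  \<open>w j * (a j / w j) ^ q\<close>. Each of these terms has integral at most
  \<open>C / (1 - s) ^ q * w j\<close>, and the weights sum to 1. Thus one function \<open>W\<close>
  dominates all deviations from \<open>u 0\<close>, with an explicit bound on its q-th
  power.\<close>

lemma fast_convergence:
  fixes u :: "nat \<Rightarrow> 'a \<Rightarrow> 'b::euclidean_space"
  assumes q: "q \<ge> 1" and u[measurable]: "\<And>j. u j \<in> borel_measurable M"
    and C: "C \<ge> 0" and r: "0 < r" "r < 1"
    and d: "\<And>j. (\<integral>\<^sup>+x. ennreal (norm (u (Suc j) x - u j x) ^ q) \<partial>M) \<le> ennreal (C * r ^ j)"
  obtains W v where "W \<in> borel_measurable M" "v \<in> borel_measurable M" "\<And>x. 0 \<le> W x"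
    "AE x in M. (\<lambda>j. u j x) \<longlonglongrightarrow> v x"
    "AE x in M. \<forall>j. norm (u j x - u 0 x) \<le> W x"
    "(\<integral>\<^sup>+x. ennreal (W x ^ q) \<partial>M) \<le> ennreal (C / (1 - root q r) ^ q)"
proof -
  define s where "s = root q r"
  have s: "0 < s" "s < 1" "s ^ q = r" using q r by (auto simp: s_def)
  define a where "a j x = norm (u (Suc j) x - u j x)" for j x
  define w where "w j = (1 - s) * s ^ j" for j
  have w: "w j > 0" for j using s by (simp add: w_def)
  have wsum: "(\<Sum>j<n. w j) = 1 - s ^ n" for n
    unfolding w_def by (simp add: sum_distrib_left[symmetric] sum_gp_basic one_diff_power_eq lessThan_nat_numeral)
  have am[measurable]: "a j \<in> borel_measurable M" for j unfolding a_def[abs_def] by measurable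
  have a0: "0 \<le> a j x" for j x by (simp add: a_def)
  define t where "t j x = w j * (a j x / w j) ^ q" for j x
  have t0: "0 \<le> t j x" for j x using w[of j] a0 by (simp add: t_def)
  have tm[measurable]: "t j \<in> borel_measurable M" for j unfolding t_def[abs_def] by measurable
  define T where "T x = (\<Sum>j. ennreal (t j x))" for x
  have Tm[measurable]: "T \<in> borel_measurable M" unfolding T_def[abs_def] by measurable
  have tj: "(\<integral>\<^sup>+x. ennreal (t j x) \<partial>M) \<le> ennreal (C / (1 - s) ^ q * ((1 - s) * s ^ j))" for j
  proof -
    have "(\<integral>\<^sup>+x. ennreal (t j x) \<partial>M) = (\<integral>\<^sup>+x. ennreal (w j / w j ^ q) * ennreal (a j x ^ q) \<partial>M)"
      using w[of j] a0 by (intro nn_integral_cong) (simp add: t_def ennreal_mult[symmetric] power_divide)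
    also have "\<dots> = ennreal (w j / w j ^ q) * (\<integral>\<^sup>+x. ennreal (a j x ^ q) \<partial>M)"
      by (rule nn_integral_cmult) simp
    also have "\<dots> \<le> ennreal (w j / w j ^ q) * ennreal (C * r ^ j)"
      using d[of j] by (intro mult_left_mono) (auto simp: a_def)
    also have "\<dots> = ennreal (w j / w j ^ q * (C * r ^ j))"
      using w[of j] C r by (intro ennreal_mult[symmetric]) (auto intro!: divide_nonneg_pos mult_nonneg_nonneg)
    also have "w j / w j ^ q * (C * r ^ j) = C / (1 - s) ^ q * ((1 - s) * s ^ j)"
    proof -
      have "w j ^ q = (1 - s) ^ q * r ^ j"
        using s(3) by (simp add: w_def power_mult_distrib power_commutes flip: power_mult) (metis mult.commute power_mult)
      then show ?thesis using s r by (simp add: w_def)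
    qed
    finally show ?thesis .
  qed
  have "(\<integral>\<^sup>+x. T x \<partial>M) = (\<Sum>j. \<integral>\<^sup>+x. ennreal (t j x) \<partial>M)"
    unfolding T_def by (rule nn_integral_suminf) simp
  also have "\<dots> \<le> (\<Sum>j. ennreal (C / (1 - s) ^ q * ((1 - s) * s ^ j)))"
    by (intro suminf_le tj) auto
  also have "\<dots> = ennreal (C / (1 - s) ^ q)"
  proof (rule suminf_ennreal_eq)
    have "(\<lambda>j. C / (1 - s) ^ q * ((1 - s) * s ^ j)) sums (C / (1 - s) ^ q * ((1 - s) * (1 / (1 - s))))"
      using s by (intro sums_mult geometric_sums) auto
    then show "(\<lambda>j. C / (1 - s) ^ q * ((1 - s) * s ^ j)) sums (C / (1 - s) ^ q)" using s by simp
  qed (use s C in auto)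
  finally have T: "(\<integral>\<^sup>+x. T x \<partial>M) \<le> ennreal (C / (1 - s) ^ q)" .
  \<comment> \<open>Where the series is infinite, a null set, \<open>enn2real\<close> gives 0; this
    is why the bounds by \<open>W\<close> are stated almost everywhere.\<close>
  define W where "W x = root q (enn2real (T x))" for x
  have W0: "0 \<le> W x" for x using q by (simp add: W_def)
  have Wm: "W \<in> borel_measurable M" unfolding W_def[abs_def] by measurable
  have fin: "AE x in M. T x \<noteq> \<infinity>"
    using T by (intro nn_integral_PInf_AE) (auto simp: top_unique)
  have part: "(\<Sum>j<n. a j x) \<le> W x" if "T x \<noteq> \<infinity>" for n x
  proof -
    have "(\<Sum>j<n. a j x) ^ q = (\<Sum>j<n. w j * (a j x / w j)) ^ q"
      using w by (intro arg_cong[where f = "\<lambda>x. x ^ q"] sum.cong) (auto simp: less_imp_neq[symmetric])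
    also have "\<dots> \<le> (\<Sum>j<n. w j * (a j x / w j) ^ q)"
      using w a0 s by (intro power_sum_convex q) (auto simp: wsum less_imp_le)
    finally have "(\<Sum>j<n. a j x) ^ q \<le> (\<Sum>j<n. t j x)" by (simp add: t_def)
    moreover have "ennreal (\<Sum>j<n. t j x) \<le> T x"
    proof -
      have "ennreal (\<Sum>j<n. t j x) = (\<Sum>j<n. ennreal (t j x))" using t0 by (simp add: sum_ennreal)
      also have "\<dots> \<le> T x" unfolding T_def by (intro sum_le_suminf) auto
      finally show ?thesis .
    qed
    then have "(\<Sum>j<n. t j x) \<le> enn2real (T x)"
      using that t0 by (metis enn2real_mono enn2real_ennreal sum_nonneg infinity_ennreal_def less_top)
    ultimately have "(\<Sum>j<n. a j x) ^ q \<le> enn2real (T x)" by linarith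
    then have "root q ((\<Sum>j<n. a j x) ^ q) \<le> W x" using q by (simp add: W_def)
    then show ?thesis using q a0 by (simp add: real_root_power_cancel sum_nonneg)
  qed
  define v where "v x = lim (\<lambda>j. u j x)" for x
  have tele: "u n x = u 0 x + (\<Sum>j<n. u (Suc j) x - u j x)" for n x
    by (simp add: sum_lessThan_telescope[of "\<lambda>j. u j x"])
  have conv: "(\<lambda>j. u j x) \<longlonglongrightarrow> v x" if "T x \<noteq> \<infinity>" for x
  proof -
    have "summable (\<lambda>j. norm (u (Suc j) x - u j x))"
    proof (rule bounded_imp_summable[where B = "W x"])
      show "(\<Sum>j\<le>n. norm (u (Suc j) x - u j x)) \<le> W x" for n
        using part[OF that, of "Suc n"] unfolding a_def lessThan_Suc_atMost .
    qed simp
    then have "summable (\<lambda>j. u (Suc j) x - u j x)" by (rule summable_norm_cancel)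
    then have "(\<lambda>n. u 0 x + (\<Sum>j<n. u (Suc j) x - u j x)) \<longlonglongrightarrow> u 0 x + suminf (\<lambda>j. u (Suc j) x - u j x)"
      by (intro tendsto_add tendsto_const summable_LIMSEQ)
    moreover have "(\<lambda>n. u 0 x + (\<Sum>j<n. u (Suc j) x - u j x)) = (\<lambda>n. u n x)"
      by (rule ext) (rule tele[symmetric])
    ultimately have "convergent (\<lambda>n. u n x)" unfolding convergent_def by auto
    then show ?thesis by (simp add: v_def convergent_LIMSEQ_iff)
  qed
  have bd: "norm (u j x - u 0 x) \<le> W x" if "T x \<noteq> \<infinity>" for j x
  proof -
    have "norm (u j x - u 0 x) \<le> (\<Sum>i<j. a i x)"
      unfolding a_def by (subst tele) (simp add: norm_sum)
    then show ?thesis using part[OF that, of j] by linarith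
  qed
  show thesis
  proof (rule that[of W v])
    show "v \<in> borel_measurable M" unfolding v_def[abs_def] by (rule borel_measurable_lim_metric) simp
    show "AE x in M. (\<lambda>j. u j x) \<longlonglongrightarrow> v x" using fin by eventually_elim (rule conv)
    show "AE x in M. \<forall>j. norm (u j x - u 0 x) \<le> W x" using fin by eventually_elim (auto intro: bd)
    have "(\<integral>\<^sup>+x. ennreal (W x ^ q) \<partial>M) \<le> (\<integral>\<^sup>+x. T x \<partial>M)"
      using q by (intro nn_integral_mono) (simp add: W_def ennreal_enn2real_if)
    with T show "(\<integral>\<^sup>+x. ennreal (W x ^ q) \<partial>M) \<le> ennreal (C / (1 - root q r) ^ q)" by (simp add: s_def)
  qed (use W0 Wm in auto)
qed

section \<open>Moving a box along a coordinate axis\<close>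

lemma exists_antiderivative:
  fixes f :: "real \<Rightarrow> real"
  assumes "continuous_on UNIV f"
  obtains F where "\<And>t. (F has_real_derivative f t) (at t)"
proof -
  have "\<exists>F. \<forall>x. (-\<infinity>::ereal) < ereal x \<longrightarrow> ereal x < \<infinity> \<longrightarrow> (F has_vector_derivative f x) (at x)"
    using assms by (intro einterval_antiderivative) (auto simp: continuous_on_eq_continuous_at)
  then show thesis using that by (auto simp: has_real_derivative_iff_has_vector_derivative)
qed

text \<open>The test function is a product of bumps whose factor along \<open>e\<close> is replaced
  by \<open>F t - F (t - s)\<close>, where \<open>F\<close> is an antiderivative of the bump. Its
  derivative along \<open>e\<close> tends to the indicator of the box minus that of the shifted box,
  while the function itself lies between 0 and \<open>s\<close> and lives on the box swept out by
  the shift.\<close>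

lemma weak_gradient_shift:
  fixes f :: "'a::euclidean_space \<Rightarrow> real"
  assumes wg: "is_weak_gradient UNIV f G" and e: "e \<in> Basis" and s: "s > 0" and ac: "\<And>b. b \<in> Basis \<Longrightarrow> a \<bullet> b < c \<bullet> b"
  shows "\<bar>(\<integral>x. indicator (box a c) x * f x \<partial>lebesgue) - (\<integral>x. indicator (box (a + s *\<^sub>R e) (c + s *\<^sub>R e)) x * f x \<partial>lebesgue)\<bar>
    \<le> s * (\<integral>x. indicator (cbox a (c + s *\<^sub>R e)) x * norm (G x) \<partial>lebesgue)"
proof -
  note wg' = wg[unfolded is_weak_gradient_iff[OF open_UNIV]]
  define K where "K = cbox a (c + s *\<^sub>R e)"
  define \<sigma> where "\<sigma> k = bump1 (a \<bullet> e) (c \<bullet> e) k" for k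
  have "\<exists>F. \<forall>t. (F has_real_derivative \<sigma> k t) (at t)" for k
    using exists_antiderivative[OF Cn_continuous[OF Cn_bump1]] unfolding \<sigma>_def by metis
  then obtain F where F: "\<And>k t. (F k has_real_derivative \<sigma> k t) (at t)" by metis
  define w where "w k t = F k t - F k (t - s)" for k t
  have Fs: "((\<lambda>t. F k (t - s)) has_real_derivative \<sigma> k (t - s)) (at t)" for k t
  proof -
    have "((\<lambda>t. t - s) has_real_derivative 1) (at t)" by (auto intro!: derivative_eq_intros)
    from DERIV_chain2[of "F k" "\<sigma> k (t - s)" "\<lambda>t. t - s" t 1 UNIV, OF F this] show ?thesis by simp
  qed
  have wd: "(w k has_real_derivative \<sigma> k t - \<sigma> k (t - s)) (at t)" for k t
    unfolding w_def[abs_def] by (intro DERIV_diff F Fs)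
  \<comment> \<open>Both the bound by \<open>s\<close> and the vanishing off the swept interval come
    from writing \<open>w k t\<close> as \<open>s\<close> times a value of the bump between t - s
    and t.\<close>
  have mvt: "\<exists>z>t - s. z < t \<and> w k t = s * \<sigma> k z" for k t
    using MVT2[of "t - s" t "F k" "\<sigma> k"] F s by (auto simp: w_def)
  have w_bounds: "0 \<le> w k t" "w k t \<le> s" for k t
    using mvt[of t k] s bump1_bounds[of "a \<bullet> e" "c \<bullet> e" k] by (auto simp: \<sigma>_def)
  have w_zero: "w k t = 0" if "t \<le> a \<bullet> e \<or> c \<bullet> e + s \<le> t" for k t
    using mvt[of t k] that by (auto simp: \<sigma>_def intro!: bump1_zero)
  have Cw: "Cn n (w k)" for n k
  proof -
    have "Cn n (\<lambda>t. \<sigma> k t + (-1) * \<sigma> k (1 * t + (- s)))"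
      unfolding \<sigma>_def by (intro Cn_add Cn_mult Cn_const Cn_affine Cn_bump1)
    then have "Cn (Suc n) (w k)" using wd by (intro Cn_SucI[of "w k" "\<lambda>t. \<sigma> k t - \<sigma> k (t - s)"]) auto
    then show ?thesis by (rule Cn_le)
  qed
  define g where "g k b = (if b = e then w k else bump1 (a \<bullet> b) (c \<bullet> b) k)" for k b
  have "\<exists>g'. \<forall>t. (g k b has_real_derivative g' t) (at t)" for k b
  proof -
    have "Cn (Suc 0) (g k b)" using Cw Cn_bump1 by (auto simp: g_def simp del: Cn.simps)
    then show ?thesis by auto
  qed
  then obtain g' where g': "\<And>k b t. (g k b has_real_derivative g' k b t) (at t)" by metis
  have g'e: "g' k e t = \<sigma> k t - \<sigma> k (t - s)" for k t
    using DERIV_unique[OF g'[of k e t]] wd[of k t] by (simp add: g_def)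
  define \<eta> where "\<eta> k x = (\<Prod>b\<in>Basis. g k b (x \<bullet> b))" for k x
  have \<eta>K: "\<eta> k x = 0" if x: "x \<notin> K" for k x
  proof -
    obtain b where b: "b \<in> Basis" "x \<bullet> b < a \<bullet> b \<or> (c + s *\<^sub>R e) \<bullet> b < x \<bullet> b"
      using x by (force simp: mem_box K_def)
    then have "g k b (x \<bullet> b) = 0"
      using w_zero[of "x \<bullet> e" k] bump1_zero[of "x \<bullet> b" "a \<bullet> b" "c \<bullet> b" k] e
      by (auto simp: g_def inner_add_left inner_Basis)
    then show ?thesis unfolding \<eta>_def using b(1) by (intro prod_zero) auto
  qed
  have tf: "\<eta> k \<in> test_fun UNIV" for k
  proof (rule test_funI[where C = K])
    show "Ck m (\<eta> k)" for m
      unfolding \<eta>_def[abs_def] by (intro Ck_prod Ck_comp_inner) (auto simp: g_def Cw Cn_bump1)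
  qed (use \<eta>K in \<open>auto simp: K_def\<close>)
  have prod01: "0 \<le> (\<Prod>b\<in>Basis - {e}. g k b (x \<bullet> b))" "(\<Prod>b\<in>Basis - {e}. g k b (x \<bullet> b)) \<le> 1" for k x
    using bump1_bounds by (auto simp: g_def intro!: prod_nonneg prod_le_1)
  have \<eta>_eq: "\<eta> k x = w k (x \<bullet> e) * (\<Prod>b\<in>Basis - {e}. g k b (x \<bullet> b))" for k x
    unfolding \<eta>_def using e by (subst prod.remove[of _ e]) (auto simp: g_def)
  have \<eta>_bd: "\<bar>\<eta> k x\<bar> \<le> s * indicator K x" for k x
  proof (cases "x \<in> K")
    case True
    have "\<eta> k x \<le> s * 1" unfolding \<eta>_eq using w_bounds prod01 s by (intro mult_mono) auto
    moreover have "0 \<le> \<eta> k x" unfolding \<eta>_eq using w_bounds prod01 by auto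
    ultimately show ?thesis using True by simp
  qed (simp add: \<eta>K)
  have pd_eq: "pd e (\<eta> k) x = (\<sigma> k (x \<bullet> e) - \<sigma> k (x \<bullet> e - s)) * (\<Prod>b\<in>Basis - {e}. g k b (x \<bullet> b))" for k x
    unfolding \<eta>_def[abs_def] using pd_prod_inner[OF e, of "g k" "g' k" x] g' g'e by simp
  have pdK: "pd e (\<eta> k) x = 0" if "x \<notin> K" for k x
  proof (rule pd_zero_off_supp)
    have "supp (\<eta> k) \<subseteq> K" using \<eta>K by (intro supp_subset) (auto simp: K_def)
    then show "x \<notin> supp (\<eta> k)" using that by auto
  qed
  have pd_bd: "\<bar>pd e (\<eta> k) x\<bar> \<le> 1" for k x
  proof -
    have "\<bar>\<sigma> k (x \<bullet> e) - \<sigma> k (x \<bullet> e - s)\<bar> \<le> 1"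
      using bump1_bounds[of "a \<bullet> e" "c \<bullet> e" k "x \<bullet> e"] bump1_bounds[of "a \<bullet> e" "c \<bullet> e" k "x \<bullet> e - s"]
      unfolding \<sigma>_def by linarith
    then show ?thesis unfolding pd_eq abs_mult using prod01[of k x] by (simp add: mult_le_one)
  qed
  \<comment> \<open>The limit holds at every point, because the bumps vanish on the faces and the
    boxes are open.\<close>
  have lim: "(\<lambda>k. pd e (\<eta> k) x) \<longlonglongrightarrow> indicator (box a c) x - indicator (box (a + s *\<^sub>R e) (c + s *\<^sub>R e)) x" for x
  proof -
    have "(\<lambda>k. pd e (\<eta> k) x) \<longlonglongrightarrow> (indicator {a \<bullet> e<..<c \<bullet> e} (x \<bullet> e) - indicator {a \<bullet> e<..<c \<bullet> e} (x \<bullet> e - s)) *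
       (\<Prod>b\<in>Basis - {e}. indicator {a \<bullet> b<..<c \<bullet> b} (x \<bullet> b))"
      unfolding pd_eq g_def \<sigma>_def
      by (intro tendsto_mult tendsto_diff tendsto_prod) (auto intro: bump1_limit)
    also have "(\<Prod>b\<in>Basis - {e}. indicator {a \<bullet> b<..<c \<bullet> b} (x \<bullet> b)) =
        (if \<forall>b\<in>Basis - {e}. a \<bullet> b < x \<bullet> b \<and> x \<bullet> b < c \<bullet> b then 1 else 0 :: real)"
      by (auto simp: indicator_def prod_zero_iff intro!: prod.neutral)
    also have "(indicator {a \<bullet> e<..<c \<bullet> e} (x \<bullet> e) - indicator {a \<bullet> e<..<c \<bullet> e} (x \<bullet> e - s)) *
       (if \<forall>b\<in>Basis - {e}. a \<bullet> b < x \<bullet> b \<and> x \<bullet> b < c \<bullet> b then 1 else 0 :: real)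
       = indicator (box a c) x - indicator (box (a + s *\<^sub>R e) (c + s *\<^sub>R e)) x"
    proof -
      have "x \<in> box a c \<longleftrightarrow> (a \<bullet> e < x \<bullet> e \<and> x \<bullet> e < c \<bullet> e) \<and> (\<forall>b\<in>Basis - {e}. a \<bullet> b < x \<bullet> b \<and> x \<bullet> b < c \<bullet> b)"
        using e by (auto simp: mem_box)
      moreover have "x \<in> box (a + s *\<^sub>R e) (c + s *\<^sub>R e) \<longleftrightarrow>
          (a \<bullet> e < x \<bullet> e - s \<and> x \<bullet> e - s < c \<bullet> e) \<and> (\<forall>b\<in>Basis - {e}. a \<bullet> b < x \<bullet> b \<and> x \<bullet> b < c \<bullet> b)"
      proof -
        have "(\<forall>b\<in>Basis. (a + s *\<^sub>R e) \<bullet> b < x \<bullet> b \<and> x \<bullet> b < (c + s *\<^sub>R e) \<bullet> b) \<longleftrightarrow>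
          (\<forall>b\<in>insert e (Basis - {e}). (a + s *\<^sub>R e) \<bullet> b < x \<bullet> b \<and> x \<bullet> b < (c + s *\<^sub>R e) \<bullet> b)"
          using e by (simp add: insert_absorb)
        also have "\<dots> \<longleftrightarrow> (a \<bullet> e < x \<bullet> e - s \<and> x \<bullet> e - s < c \<bullet> e) \<and> (\<forall>b\<in>Basis - {e}. a \<bullet> b < x \<bullet> b \<and> x \<bullet> b < c \<bullet> b)"
          using e by (auto simp: inner_add_left inner_Basis)
        finally show ?thesis by (simp add: mem_box)
      qed
      ultimately show ?thesis by (auto simp: indicator_def)
    qed
    finally show ?thesis .
  qed
  have fK: "integrable lebesgue (\<lambda>x. indicator K x * f x)"
    using L1_loc_integrable[of f UNIV K] wg' by (simp add: K_def)
  have GK: "integrable lebesgue (\<lambda>x. indicator K x * norm (G x))"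
  proof -
    have "integrable lebesgue (\<lambda>x. norm (indicator K x *\<^sub>R G x))"
      using L1_loc_integrable[of G UNIV K] wg' by (intro integrable_norm) (simp add: K_def)
    then show ?thesis by simp
  qed
  have sub: "box a c \<subseteq> K" "box (a + s *\<^sub>R e) (c + s *\<^sub>R e) \<subseteq> K"
  proof -
    have "0 \<le> s * (e \<bullet> b)" if "b \<in> Basis" for b using e s that by (auto simp: inner_Basis)
    then show "box a c \<subseteq> K" "box (a + s *\<^sub>R e) (c + s *\<^sub>R e) \<subseteq> K"
      by (fastforce simp: K_def mem_box inner_add_left intro: add_increasing2 dest: less_imp_le)+
  qed
  have f_measurable: "f \<in> borel_measurable lebesgue"
    using wg' by (simp add: L1_loc_def lebesgue_on_UNIV_eq)
  have "(\<lambda>k. \<integral>x. f x * pd e (\<eta> k) x \<partial>lebesgue) \<longlonglongrightarrow>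
     (\<integral>x. f x * (indicator (box a c) x - indicator (box (a + s *\<^sub>R e) (c + s *\<^sub>R e)) x) \<partial>lebesgue)"
  proof (rule integral_dominated_convergence[where w = "\<lambda>x. \<bar>indicator K x * f x\<bar>"])
    show "(\<lambda>x. f x * pd e (\<eta> k) x) \<in> borel_measurable lebesgue" for k
      using f_measurable borel_imp_lebesgue[OF test_fun_measurable[OF test_fun_pd[OF tf e]]] by (rule borel_measurable_times)
    show "(\<lambda>x. f x * (indicator (box a c) x - indicator (box (a + s *\<^sub>R e) (c + s *\<^sub>R e)) x)) \<in> borel_measurable lebesgue"
      using f_measurable by (intro borel_measurable_times borel_measurable_diff borel_measurable_indicator) auto
    show "AE x in lebesgue. norm (f x * pd e (\<eta> k) x) \<le> \<bar>indicator K x * f x\<bar>" for k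
    proof (intro AE_I2)
      fix x
      show "norm (f x * pd e (\<eta> k) x) \<le> \<bar>indicator K x * f x\<bar>"
        using pd_bd[of k x] pdK[of x k] mult_left_le[of "\<bar>pd e (\<eta> k) x\<bar>" "\<bar>f x\<bar>"]
        by (cases "x \<in> K") (auto simp: abs_mult)
    qed
    show "AE x in lebesgue. (\<lambda>k. f x * pd e (\<eta> k) x) \<longlonglongrightarrow>
       f x * (indicator (box a c) x - indicator (box (a + s *\<^sub>R e) (c + s *\<^sub>R e)) x)"
      by (intro AE_I2 tendsto_mult_left lim)
  qed (use fK in auto)
  moreover have "\<bar>\<integral>x. f x * pd e (\<eta> k) x \<partial>lebesgue\<bar> \<le> s * (\<integral>x. indicator K x * norm (G x) \<partial>lebesgue)" for k
  proof -
    have "(\<integral>x. f x * pd e (\<eta> k) x \<partial>lebesgue) = - (\<integral>x. (G x \<bullet> e) * \<eta> k x \<partial>lebesgue)"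
      using wg' tf e by blast
    then have "\<bar>\<integral>x. f x * pd e (\<eta> k) x \<partial>lebesgue\<bar> = \<bar>\<integral>x. (G x \<bullet> e) * \<eta> k x \<partial>lebesgue\<bar>" by simp
    also have "\<dots> \<le> (\<integral>x. s * (indicator K x * norm (G x)) \<partial>lebesgue)"
    proof (rule integral_abs_bound[THEN order_trans], rule integral_mono)
      have "integrable lebesgue (\<lambda>x. \<eta> k x *\<^sub>R (G x \<bullet> e))"
        using wg' by (intro L1_loc_test_integrable[OF _ tf] L1_loc_inner) auto
      then show "integrable lebesgue (\<lambda>x. \<bar>(G x \<bullet> e) * \<eta> k x\<bar>)" by (simp add: mult.commute)
      show "integrable lebesgue (\<lambda>x. s * (indicator K x * norm (G x)))" using GK by simp
      fix x
      have "\<bar>(G x \<bullet> e) * \<eta> k x\<bar> \<le> norm (G x) * (s * indicator K x)"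
        unfolding abs_mult using \<eta>_bd[of k x] e s by (intro mult_mono) (auto intro: Basis_le_norm)
      then show "\<bar>(G x \<bullet> e) * \<eta> k x\<bar> \<le> s * (indicator K x * norm (G x))" by (simp add: mult_ac)
    qed
    finally show ?thesis by simp
  qed
  ultimately have "\<bar>\<integral>x. f x * (indicator (box a c) x - indicator (box (a + s *\<^sub>R e) (c + s *\<^sub>R e)) x) \<partial>lebesgue\<bar>
     \<le> s * (\<integral>x. indicator K x * norm (G x) \<partial>lebesgue)"
    by (intro tendsto_upperbound[OF tendsto_rabs]) auto
  moreover have "(\<integral>x. f x * (indicator (box a c) x - indicator (box (a + s *\<^sub>R e) (c + s *\<^sub>R e)) x) \<partial>lebesgue) =
     (\<integral>x. indicator (box a c) x * f x \<partial>lebesgue) - (\<integral>x. indicator (box (a + s *\<^sub>R e) (c + s *\<^sub>R e)) x * f x \<partial>lebesgue)"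
  proof -
    have i: "integrable lebesgue (\<lambda>x. indicator S x * f x)" if "S \<subseteq> K" "S \<in> sets lebesgue" for S
    proof -
      have "integrable lebesgue (\<lambda>x. indicator S x *\<^sub>R (indicator K x * f x))"
        using fK that(2) by (intro integrable_mult_indicator)
      moreover have "(\<lambda>x. indicator S x *\<^sub>R (indicator K x * f x)) = (\<lambda>x. indicator S x * f x)"
        using that(1) by (auto simp: fun_eq_iff split: split_indicator)
      ultimately show ?thesis by simp
    qed
    show ?thesis
      using i[OF sub(1)] i[OF sub(2)]
      by (subst Bochner_Integration.integral_diff[symmetric]) (auto simp: algebra_simps)
  qed
  ultimately show ?thesis by (simp add: K_def)
qed

section \<open>Averages over grid cells\<close>

definition corner :: "'a::euclidean_space \<Rightarrow> 'a \<Rightarrow> 'a" where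
  "corner H x = (\<Sum>b\<in>Basis. ((H \<bullet> b) * of_int \<lfloor>(x \<bullet> b) / (H \<bullet> b)\<rfloor>) *\<^sub>R b)"

text \<open>Equality of floors makes sharing a cell an equivalence relation, so averages are
  constant on cells and the averaging kernel is symmetric. The side is a vector \<open>H\<close>, so
  that edges can be halved one at a time.\<close>

definition cell :: "'a::euclidean_space \<Rightarrow> 'a \<Rightarrow> 'a set" where
  "cell H x = {y. \<forall>b\<in>Basis. \<lfloor>(y \<bullet> b) / (H \<bullet> b)\<rfloor> = \<lfloor>(x \<bullet> b) / (H \<bullet> b)\<rfloor>}"

definition hbox :: "'a::euclidean_space \<Rightarrow> 'a \<Rightarrow> 'a set" where
  "hbox c H = {y. \<forall>b\<in>Basis. c \<bullet> b \<le> y \<bullet> b \<and> y \<bullet> b < c \<bullet> b + H \<bullet> b}"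

definition vol :: "'a::euclidean_space \<Rightarrow> real" where
  "vol H = (\<Prod>b\<in>Basis. H \<bullet> b)"

definition avg :: "'a::euclidean_space \<Rightarrow> ('a \<Rightarrow> real) \<Rightarrow> 'a \<Rightarrow> real" where
  "avg H f x = (\<integral>y. indicator (cell H x) y * f y \<partial>lebesgue) / vol H"

lemma corner_inner: "b \<in> Basis \<Longrightarrow> corner H x \<bullet> b = (H \<bullet> b) * of_int \<lfloor>(x \<bullet> b) / (H \<bullet> b)\<rfloor>"
  by (simp add: corner_def inner_sum_left inner_Basis if_distrib cong: if_cong)

lemma cell_sym: "y \<in> cell H x \<longleftrightarrow> x \<in> cell H y"
  by (auto simp: cell_def)

lemma cell_eq: "y \<in> cell H x \<Longrightarrow> cell H y = cell H x"
  by (auto simp: cell_def)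

lemma avg_eq: "y \<in> cell H x \<Longrightarrow> avg H f y = avg H f x"
  by (simp add: avg_def cell_eq)

lemma cell_hbox:
  assumes H: "\<And>b. b \<in> Basis \<Longrightarrow> H \<bullet> b > 0"
  shows "cell H x = hbox (corner H x) H"
proof -
  have "\<lfloor>(y \<bullet> b) / (H \<bullet> b)\<rfloor> = \<lfloor>(x \<bullet> b) / (H \<bullet> b)\<rfloor> \<longleftrightarrow>
     corner H x \<bullet> b \<le> y \<bullet> b \<and> y \<bullet> b < corner H x \<bullet> b + H \<bullet> b" if b: "b \<in> Basis" for y b
    using H[OF b] by (simp add: corner_inner[OF b] floor_eq_iff pos_le_divide_eq pos_divide_less_eq algebra_simps)
  then show ?thesis by (auto simp: cell_def hbox_def)
qed

lemma hbox_sets [measurable]: "hbox c H \<in> sets borel"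
proof -
  have "hbox c H = (\<Inter>b\<in>Basis. {y. c \<bullet> b \<le> y \<bullet> b} \<inter> {y. y \<bullet> b < c \<bullet> b + H \<bullet> b})" by (auto simp: hbox_def)
  also have "\<dots> \<in> sets borel"
    by (intro sets.finite_INT) auto
  finally show ?thesis .
qed

lemma hbox_bounds: "box c (c + H) \<subseteq> hbox c H" "hbox c H \<subseteq> cbox c (c + H)"
  by (auto simp: hbox_def mem_box inner_add_left less_imp_le)

text \<open>Half-open cells tile the space, whereas bumps and the shift estimate work with open and
  closed boxes; the faces in between are null.\<close>

lemma hbox_AE: "AE x in lebesgue. (x \<in> hbox c H \<longleftrightarrow> x \<in> box c (c + H)) \<and> (x \<in> hbox c H \<longleftrightarrow> x \<in> cbox c (c + H))"
proof -
  have "AE x in lebesgue. x \<notin> cbox c (c + H) - box c (c + H)"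
    using negligible_frontier_interval[of c "c + H"] unfolding negligible_iff_null_sets by (rule AE_not_in)
  then show ?thesis
  proof eventually_elim
    case (elim x)
    then show ?case using hbox_bounds[of c H] by blast
  qed
qed

lemma hbox_integral:
  fixes f :: "'a::euclidean_space \<Rightarrow> real"
  assumes f: "f \<in> borel_measurable lebesgue"
  shows "(\<integral>x. indicator (hbox c H) x * f x \<partial>lebesgue) = (\<integral>x. indicator (box c (c + H)) x * f x \<partial>lebesgue)"
    "(\<integral>x. indicator (hbox c H) x * f x \<partial>lebesgue) = (\<integral>x. indicator (cbox c (c + H)) x * f x \<partial>lebesgue)"
proof -
  have m: "(\<lambda>x. indicator S x * f x) \<in> borel_measurable lebesgue" if "S \<in> sets lebesgue" for S
    using f that by (intro borel_measurable_times borel_measurable_indicator)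
  have s: "hbox c H \<in> sets lebesgue" by (simp add: sets_completionI_sets)
  have AE1: "AE x in lebesgue. indicator (hbox c H) x * f x = indicator (box c (c + H)) x * f x"
    using hbox_AE[of c H] by eventually_elim (auto simp: indicator_def)
  have AE2: "AE x in lebesgue. indicator (hbox c H) x * f x = indicator (cbox c (c + H)) x * f x"
    using hbox_AE[of c H] by eventually_elim (auto simp: indicator_def)
  note AE = AE1 AE2
  show "(\<integral>x. indicator (hbox c H) x * f x \<partial>lebesgue) = (\<integral>x. indicator (box c (c + H)) x * f x \<partial>lebesgue)"
    by (intro integral_cong_AE m s AE) auto
  show "(\<integral>x. indicator (hbox c H) x * f x \<partial>lebesgue) = (\<integral>x. indicator (cbox c (c + H)) x * f x \<partial>lebesgue)"
    by (intro integral_cong_AE m s AE) auto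
qed

lemma hbox_measure:
  assumes H: "\<And>b. b \<in> Basis \<Longrightarrow> H \<bullet> b > 0"
  shows "emeasure lebesgue (hbox c H) = ennreal (vol H)"
proof -
  have "emeasure lebesgue (hbox c H) = emeasure lebesgue (cbox c (c + H))"
    using hbox_AE[of c H] by (intro emeasure_eq_AE) (auto simp: sets_completionI_sets)
  also have "\<dots> = emeasure lborel (cbox c (c + H))" by simp
  also have "\<dots> = ennreal (vol H)"
    using H by (subst emeasure_lborel_cbox) (auto simp: inner_add_left less_imp_le vol_def)
  finally show ?thesis .
qed

lemma cell_sets [measurable]: "cell H x \<in> sets borel"
proof -
  have "cell H x = (\<Inter>b\<in>Basis. {y. \<lfloor>(y \<bullet> b) / (H \<bullet> b)\<rfloor> = \<lfloor>(x \<bullet> b) / (H \<bullet> b)\<rfloor>})"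
    by (auto simp: cell_def)
  also have "\<dots> \<in> sets borel"
    by (intro sets.finite_INT) auto
  finally show ?thesis .
qed

lemma cell_sets_lebesgue [simp]: "cell H x \<in> sets lebesgue"
  by (simp add: sets_completionI_sets)

lemma L1_loc_UNIV_measurable: "f \<in> L1_loc UNIV \<Longrightarrow> f \<in> borel_measurable lebesgue"
  by (simp add: L1_loc_def lebesgue_on_UNIV_eq)

lemma L1_loc_indicator_integrable:
  fixes f :: "'a::euclidean_space \<Rightarrow> 'b::euclidean_space"
  assumes f: "f \<in> L1_loc UNIV" and S: "bounded S" "S \<in> sets lebesgue"
  shows "integrable lebesgue (\<lambda>x. indicator S x *\<^sub>R f x)"
proof -
  have K: "compact (closure S)" using S by (simp add: compact_closure)
  have "integrable lebesgue (\<lambda>x. indicator S x *\<^sub>R (indicator (closure S) x *\<^sub>R f x))"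
    by (rule integrable_mult_indicator[OF S(2) L1_loc_integrable[OF f K]]) simp
  moreover have "(\<lambda>x. indicator S x *\<^sub>R (indicator (closure S) x *\<^sub>R f x)) = (\<lambda>x. indicator S x *\<^sub>R f x)"
    using closure_subset[of S] by (auto simp: fun_eq_iff split: split_indicator)
  ultimately show ?thesis by simp
qed

lemma hbox_bounded: "bounded (hbox c H)"
  by (rule bounded_subset[OF bounded_cbox hbox_bounds(2)])

text \<open>Halving one edge cuts the cell into two halves that are translates by
  \<open>s = H \<bullet> e / 2\<close>. The average over one half minus the average over the cell
  is, up to sign, the difference of the two half integrals divided by \<open>vol H\<close>, which
  \<open>weak_gradient_shift\<close> bounds.\<close>

lemma avg_half:
  fixes f :: "'a::euclidean_space \<Rightarrow> real"
  assumes wg: "is_weak_gradient UNIV f G" and H: "\<And>b. b \<in> Basis \<Longrightarrow> H \<bullet> b > 0" and e: "e \<in> Basis"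
    and H': "H' = H - (H \<bullet> e / 2) *\<^sub>R e"
  shows "\<bar>avg H' f x - avg H f x\<bar> \<le> (H \<bullet> e / 2) / vol H * (\<integral>y. indicator (cell H x) y * norm (G y) \<partial>lebesgue)"
    and "cell H' x \<subseteq> cell H x"
proof -
  define s where "s = H \<bullet> e / 2"
  have s: "s > 0" using H[OF e] by (simp add: s_def)
  have H'b: "H' \<bullet> b = (if b = e then s else H \<bullet> b)" if "b \<in> Basis" for b
    using that e by (auto simp: H' s_def inner_diff_left inner_Basis)
  have H'pos: "H' \<bullet> b > 0" if "b \<in> Basis" for b using H'b[OF that] H[OF that] s by auto
  have fL: "f \<in> L1_loc UNIV" and GL: "G \<in> L1_loc UNIV" using wg by (auto simp: is_weak_gradient_def)
  note f_measurable = L1_loc_UNIV_measurable[OF fL]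
  note G_measurable = L1_loc_UNIV_measurable[OF GL]
  define c where "c = corner H x"
  define c2 where "c2 = c + s *\<^sub>R e"
  have c2b: "c2 \<bullet> b = (if b = e then c \<bullet> e + s else c \<bullet> b)" if "b \<in> Basis" for b
    using that e by (auto simp: c2_def inner_add_left inner_Basis)
  have He: "H \<bullet> e = 2 * s" by (simp add: s_def)
  have vol: "vol H = 2 * vol H'"
  proof -
    have "vol H = H \<bullet> e * (\<Prod>b\<in>Basis - {e}. H \<bullet> b)" "vol H' = H' \<bullet> e * (\<Prod>b\<in>Basis - {e}. H' \<bullet> b)"
      unfolding vol_def using e by (auto intro: prod.remove)
    moreover have "(\<Prod>b\<in>Basis - {e}. H' \<bullet> b) = (\<Prod>b\<in>Basis - {e}. H \<bullet> b)"
      by (intro prod.cong) (auto simp: H'b)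
    ultimately show ?thesis using H'b[OF e] He by simp
  qed
  have vpos: "vol H' > 0" unfolding vol_def using H'pos by (intro prod_pos) auto
  have split: "hbox c H = hbox c H' \<union> hbox c2 H'" "hbox c H' \<inter> hbox c2 H' = {}"
  proof -
    have "y \<in> hbox c H \<longleftrightarrow> y \<in> hbox c H' \<or> y \<in> hbox c2 H'" for y
    proof -
      have *: "(\<forall>b\<in>Basis. P b) \<longleftrightarrow> P e \<and> (\<forall>b\<in>Basis - {e}. P b)" for P using e by auto
      show ?thesis unfolding hbox_def mem_Collect_eq
        apply (subst (1 2 3) *)
        using s by (auto simp: H'b[OF e] c2b[OF e] He H'b c2b)
    qed
    then show "hbox c H = hbox c H' \<union> hbox c2 H'" by blast
    show "hbox c H' \<inter> hbox c2 H' = {}"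
      using e H'b[OF e] c2b[OF e] by (force simp: hbox_def)
  qed
  define I where "I S = (\<integral>y. indicator S y * f y \<partial>lebesgue)" for S
  have int: "integrable lebesgue (\<lambda>y. indicator (hbox c' H') y * f y)" for c'
    using L1_loc_indicator_integrable[OF fL hbox_bounded, of c' H'] by (simp add: sets_completionI_sets)
  have IH: "I (hbox c H) = I (hbox c H') + I (hbox c2 H')"
  proof -
    have "I (hbox c H) = (\<integral>y. indicator (hbox c H') y * f y + indicator (hbox c2 H') y * f y \<partial>lebesgue)"
      unfolding I_def split(1) using split(2)
      by (intro Bochner_Integration.integral_cong) (auto split: split_indicator)
    then show ?thesis using int by (simp add: I_def)
  qed
  have corner': "corner H' x = c \<or> corner H' x = c2"
  proof -
    define t where "t = (x \<bullet> e) / (H \<bullet> e)"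
    have "(x \<bullet> e) / s = 2 * t" using s by (simp add: t_def He)
    \<comment> \<open>The parity of the floor of 2t tells which half contains
      \<open>x\<close>.\<close>
    moreover have "\<lfloor>2 * t\<rfloor> = 2 * \<lfloor>t\<rfloor> \<or> \<lfloor>2 * t\<rfloor> = 2 * \<lfloor>t\<rfloor> + 1" by linarith
    ultimately have "(corner H' x) \<bullet> e = c \<bullet> e \<or> (corner H' x) \<bullet> e = c2 \<bullet> e"
      using e s H'b[OF e] c2b[OF e] He by (auto simp: c_def corner_inner t_def algebra_simps)
    moreover have "(corner H' x) \<bullet> b = c \<bullet> b" "(corner H' x) \<bullet> b = c2 \<bullet> b" if "b \<in> Basis" "b \<noteq> e" for b
      using that H'b[of b] c2b[of b] by (auto simp: c_def corner_inner)
    ultimately show ?thesis by (metis euclidean_eqI)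
  qed
  have cH: "cell H x = hbox c H" using cell_hbox[OF H] by (simp add: c_def)
  have cH': "cell H' x = hbox c H' \<or> cell H' x = hbox c2 H'" using cell_hbox[OF H'pos] corner' by metis
  then show "cell H' x \<subseteq> cell H x" unfolding cH using split by auto
  have "\<bar>avg H' f x - avg H f x\<bar> = \<bar>I (hbox c H') - I (hbox c2 H')\<bar> / vol H"
  proof -
    have "avg H' f x = I (hbox c H') / vol H' \<or> avg H' f x = I (hbox c2 H') / vol H'"
      using cH' by (auto simp: avg_def I_def)
    moreover have "avg H f x = (I (hbox c H') + I (hbox c2 H')) / (2 * vol H')"
      using IH by (simp add: avg_def cH I_def vol)
    ultimately have "avg H' f x - avg H f x = (I (hbox c H') - I (hbox c2 H')) / vol H \<or>
      avg H' f x - avg H f x = - ((I (hbox c H') - I (hbox c2 H')) / vol H)"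
      unfolding vol using vpos by (auto simp: field_simps)
    then show ?thesis using vpos vol by auto
  qed
  also have "\<bar>I (hbox c H') - I (hbox c2 H')\<bar> \<le> s * (\<integral>y. indicator (cell H x) y * norm (G y) \<partial>lebesgue)"
  proof -
    \<comment> \<open>The box swept out in moving one half onto the other is the closed cell, so the
      gradient integral is over the cell up to a null set.\<close>
    have cc: "c2 + H' = c + H' + s *\<^sub>R e" "c + H' + s *\<^sub>R e = c + H" by (simp_all add: c2_def H' s_def algebra_simps)
    have "\<bar>I (hbox c H') - I (hbox c2 H')\<bar> \<le> s * (\<integral>x. indicator (cbox c (c + H' + s *\<^sub>R e)) x * norm (G x) \<partial>lebesgue)"
      unfolding I_def hbox_integral(1)[OF f_measurable] cc(1) unfolding c2_def
      by (rule weak_gradient_shift[OF wg e s]) (use H'pos in \<open>auto simp: inner_add_left\<close>)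
    also have "(\<integral>x. indicator (cbox c (c + H' + s *\<^sub>R e)) x * norm (G x) \<partial>lebesgue) =
      (\<integral>y. indicator (cell H x) y * norm (G y) \<partial>lebesgue)"
      unfolding cc cH using G_measurable by (subst hbox_integral(2)) auto
    finally show ?thesis .
  qed
  finally show "\<bar>avg H' f x - avg H f x\<bar> \<le> (H \<bullet> e / 2) / vol H * (\<integral>y. indicator (cell H x) y * norm (G y) \<partial>lebesgue)"
    using vol vpos by (simp add: s_def divide_right_mono)
qed

section \<open>Cubic cells: halving all edges\<close>

abbreviation cube_avg :: "real \<Rightarrow> ('a::euclidean_space \<Rightarrow> real) \<Rightarrow> 'a \<Rightarrow> real" where
  "cube_avg h \<equiv> avg (h *\<^sub>R One)"

abbreviation cube :: "real \<Rightarrow> 'a::euclidean_space \<Rightarrow> 'a set" where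
  "cube h \<equiv> cell (h *\<^sub>R One)"

lemma vol_cube: "vol (h *\<^sub>R (One::'a::euclidean_space)) = h ^ DIM('a)"
  by (simp add: vol_def)

text \<open>The edges are halved one after another. Each step costs at most
  \<open>(h / 2) / (h / 2) ^ DIM('a)\<close> times the gradient integral over the original cube,
  since all intermediate cells lie in that cube and have volume at least
  \<open>(h / 2) ^ DIM('a)\<close>.\<close>

lemma cube_avg_halve:
  fixes f :: "'a::euclidean_space \<Rightarrow> real"
  assumes wg: "is_weak_gradient UNIV f G" and h: "h > 0"
  shows "\<bar>cube_avg (h / 2) f x - cube_avg h f x\<bar>
    \<le> DIM('a) * ((h / 2) / (h / 2) ^ DIM('a) * (\<integral>y. indicator (cube h x) y * norm (G y) \<partial>lebesgue))"
proof -
  have GL: "G \<in> L1_loc UNIV" using wg by (auto simp: is_weak_gradient_def)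
  \<comment> \<open>The side vector with the edges in \<open>S\<close> already halved; the induction
    leads from side \<open>h\<close> at the empty set to side \<open>h / 2\<close> at the full
    basis.\<close>
  define HS where "HS S = (\<Sum>b\<in>Basis. (if b \<in> S then h / 2 else h) *\<^sub>R (b::'a))" for S
  have HSb: "HS S \<bullet> b = (if b \<in> S then h / 2 else h)" if "b \<in> Basis" for S b
    unfolding HS_def using that by (rule inner_sum_left_Basis)
  have HSpos: "HS S \<bullet> b > 0" if "b \<in> Basis" for S b using HSb[OF that] h by simp
  have vol: "vol (HS S) \<ge> (h / 2) ^ DIM('a)" for S
  proof -
    have "(\<Prod>b\<in>(Basis::'a set). h / 2) \<le> vol (HS S)"
      unfolding vol_def using h HSb by (intro prod_mono) auto
    then show ?thesis by simp
  qed
  define J where "J S = (\<integral>y. indicator (cell (HS S) x) y * norm (G y) \<partial>lebesgue)" for S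
  have H0: "HS {} = h *\<^sub>R One" by (simp add: HS_def scaleR_sum_right)
  have H1: "HS Basis = (h / 2) *\<^sub>R One" by (simp add: HS_def scaleR_sum_right)
  have int: "integrable lebesgue (\<lambda>y. indicator (cell (HS S) x) y * norm (G y))" for S
  proof -
    have "integrable lebesgue (\<lambda>y. norm (indicator (cell (HS S) x) y *\<^sub>R G y))"
      using L1_loc_indicator_integrable[OF GL, of "cell (HS S) x"] cell_hbox[OF HSpos, of S x] hbox_bounded
      by (intro integrable_norm) auto
    then show ?thesis by simp
  qed
  have "cell (HS S) x \<subseteq> cell (HS {}) x \<and>
    \<bar>avg (HS S) f x - avg (HS {}) f x\<bar> \<le> card S * ((h / 2) / (h / 2) ^ DIM('a) * J {})"
    if "finite S" "S \<subseteq> Basis" for S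
    using that
  proof (induction S rule: finite_induct)
    case (insert e S)
    then have e: "e \<in> Basis" "e \<notin> S" by auto
    have ins: "HS (insert e S) = HS S - (HS S \<bullet> e / 2) *\<^sub>R e"
    proof (rule euclidean_eqI)
      fix b :: 'a assume "b \<in> Basis"
      then show "HS (insert e S) \<bullet> b = (HS S - (HS S \<bullet> e / 2) *\<^sub>R e) \<bullet> b"
        using e by (auto simp: HSb inner_diff_left inner_Basis)
    qed
    note half = avg_half[OF wg HSpos e(1) ins, of x]
    have sub: "cell (HS S) x \<subseteq> cell (HS {}) x" using insert by auto
    have "J S \<le> J {}" unfolding J_def
      using sub by (intro integral_mono int) (auto split: split_indicator)
    moreover have "0 \<le> J S" unfolding J_def by (intro Bochner_Integration.integral_nonneg) auto
    ultimately have "(HS S \<bullet> e / 2) / vol (HS S) * J S \<le> (h / 2) / (h / 2) ^ DIM('a) * J {}"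
      using vol[of S] h e by (intro mult_mono frac_le) (auto simp: HSb)
    then have "\<bar>avg (HS (insert e S)) f x - avg (HS S) f x\<bar> \<le> (h / 2) / (h / 2) ^ DIM('a) * J {}"
      using half(1) unfolding J_def by linarith
    moreover have "\<bar>avg (HS S) f x - avg (HS {}) f x\<bar> \<le> card S * ((h / 2) / (h / 2) ^ DIM('a) * J {})"
      using insert by auto
    moreover have ins_card: "real (card (insert e S)) = real (card S) + 1"
      using insert(1,2) by simp
    ultimately have "\<bar>avg (HS (insert e S)) f x - avg (HS {}) f x\<bar>
        \<le> card (insert e S) * ((h / 2) / (h / 2) ^ DIM('a) * J {})"
      unfolding ins_card distrib_right by linarith
    then show ?case using half(2) sub by auto
  qed auto
  from this[of Basis] show ?thesis unfolding H0 H1 J_def by auto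
qed

lemma cube_sets_bounded: "h > 0 \<Longrightarrow> bounded (cube h x)"
  by (subst cell_hbox) (auto simp: hbox_bounded)

lemma cube_measure: "h > 0 \<Longrightarrow> emeasure lebesgue (cube h (x::'a::euclidean_space)) = ennreal (h ^ DIM('a))"
  using hbox_measure[of "h *\<^sub>R One" "corner (h *\<^sub>R One) x"]
  by (subst cell_hbox) (auto simp: vol_cube simp del: emeasure_completion)

text \<open>Cauchy-Schwarz against the constant 1, read off from the nonnegative variance of
  \<open>\<bar>g\<bar>\<close> about its mean \<open>m\<close> on the cube.\<close>

lemma cube_L1_L2:
  fixes g :: "'a::euclidean_space \<Rightarrow> real"
  assumes h: "h > 0" and g: "g \<in> borel_measurable lebesgue"
    and 2: "integrable lebesgue (\<lambda>y. indicator (cube h x) y * (g y)\<^sup>2)"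
  shows "(\<integral>y. indicator (cube h x) y * \<bar>g y\<bar> \<partial>lebesgue)\<^sup>2 \<le> h ^ DIM('a) * (\<integral>y. indicator (cube h x) y * (g y)\<^sup>2 \<partial>lebesgue)"
proof -
  define V where "V = h ^ DIM('a)"
  have V: "V > 0" using h by (simp add: V_def)
  have ci: "integrable lebesgue (\<lambda>y. indicator (cube h x) y :: real)"
    using cube_measure[OF h, of x] by (intro integrable_real_indicator) auto
  have cV: "(\<integral>y. indicator (cube h x) y \<partial>lebesgue) = V"
    using cube_measure[OF h, of x] h by (simp add: measure_def V_def)
  have 1: "integrable lebesgue (\<lambda>y. indicator (cube h x) y * \<bar>g y\<bar>)"
  proof (rule Bochner_Integration.integrable_bound)
    show "integrable lebesgue (\<lambda>y. indicator (cube h x) y + indicator (cube h x) y * (g y)\<^sup>2)" using ci 2 by simp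
    show "(\<lambda>y. indicator (cube h x) y * \<bar>g y\<bar>) \<in> borel_measurable lebesgue"
      using g by (intro borel_measurable_times borel_measurable_indicator borel_measurable_abs) auto
    show "AE y in lebesgue. norm (indicator (cube h x) y * \<bar>g y\<bar>) \<le> norm (indicator (cube h x) y + indicator (cube h x) y * (g y)\<^sup>2)"
    proof (intro AE_I2)
      fix y
      have "\<bar>g y\<bar> \<le> 1 + (g y)\<^sup>2"
        using zero_le_power2[of "\<bar>g y\<bar> - 1"] by (simp add: power2_diff)
      then show "norm (indicator (cube h x) y * \<bar>g y\<bar>) \<le> norm (indicator (cube h x) y + indicator (cube h x) y * (g y)\<^sup>2)"
        by (simp split: split_indicator)
    qed
  qed
  define m where "m = (\<integral>y. indicator (cube h x) y * \<bar>g y\<bar> \<partial>lebesgue) / V"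
  have "0 \<le> (\<integral>y. indicator (cube h x) y * (\<bar>g y\<bar> - m)\<^sup>2 \<partial>lebesgue)"
    by (intro Bochner_Integration.integral_nonneg) auto
  also have "\<dots> = (\<integral>y. indicator (cube h x) y * (g y)\<^sup>2 - 2 * m * (indicator (cube h x) y * \<bar>g y\<bar>) + m\<^sup>2 * indicator (cube h x) y \<partial>lebesgue)"
    by (intro Bochner_Integration.integral_cong) (auto simp: power2_diff algebra_simps)
  also have "\<dots> = (\<integral>y. indicator (cube h x) y * (g y)\<^sup>2 \<partial>lebesgue) - 2 * m * (m * V) + m\<^sup>2 * V"
    using 1 2 ci cV V by (simp add: m_def)
  finally have "m\<^sup>2 * V \<le> (\<integral>y. indicator (cube h x) y * (g y)\<^sup>2 \<partial>lebesgue)"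
    by (simp add: power2_eq_square algebra_simps)
  then have "m\<^sup>2 * V * V \<le> (\<integral>y. indicator (cube h x) y * (g y)\<^sup>2 \<partial>lebesgue) * V"
    using V by (intro mult_right_mono) auto
  moreover have "m\<^sup>2 * V * V = (\<integral>y. indicator (cube h x) y * \<bar>g y\<bar> \<partial>lebesgue)\<^sup>2"
    using V by (simp add: m_def power2_eq_square)
  ultimately show ?thesis by (simp add: V_def mult.commute)
qed

text \<open>The halving contributes \<open>(h / h ^ d)\<^sup>2\<close>, Cauchy-Schwarz contributes
  \<open>h ^ d\<close>, and together they leave \<open>h\<^sup>2 / h ^ d\<close> in front of the
  local energy. The numerical constant is rounded up by a factor 4.\<close>

lemma cube_avg_halve_sq:
  fixes f :: "'a::euclidean_space \<Rightarrow> real"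
  assumes wg: "is_weak_gradient UNIV f G" and h: "h > 0" and G2: "integrable lebesgue (\<lambda>y. (norm (G y))\<^sup>2)"
  shows "(cube_avg (h / 2) f x - cube_avg h f x)\<^sup>2
    \<le> (real DIM('a))\<^sup>2 * 4 ^ DIM('a) * (h\<^sup>2 / h ^ DIM('a)) * (\<integral>y. indicator (cube h x) y * (norm (G y))\<^sup>2 \<partial>lebesgue)"
proof -
  let ?d = "DIM('a)"
  let ?J = "\<integral>y. indicator (cube h x) y * norm (G y) \<partial>lebesgue"
  let ?Q = "\<integral>y. indicator (cube h x) y * (norm (G y))\<^sup>2 \<partial>lebesgue"
  have G_measurable: "(\<lambda>y. norm (G y)) \<in> borel_measurable lebesgue"
    using measurable_compose[OF L1_loc_UNIV_measurable borel_measurable_norm] wg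
    unfolding is_weak_gradient_def by blast
  have "integrable lebesgue (\<lambda>y. indicator (cube h x) y *\<^sub>R (norm (G y))\<^sup>2)"
    by (intro integrable_mult_indicator G2) simp
  then have Q: "?J\<^sup>2 \<le> h ^ ?d * ?Q"
    using cube_L1_L2[OF h G_measurable, of x] by simp
  have Q0: "0 \<le> ?Q" by (intro Bochner_Integration.integral_nonneg) auto
  have J0: "0 \<le> ?J" by (intro Bochner_Integration.integral_nonneg) auto
  have "(cube_avg (h / 2) f x - cube_avg h f x)\<^sup>2 \<le> (?d * ((h / 2) / (h / 2) ^ ?d * ?J))\<^sup>2"
    using cube_avg_halve[OF wg h, of x] by (intro abs_le_square_iff[THEN iffD1]) linarith
  also have "\<dots> = (?d * ((h / 2) / (h / 2) ^ ?d))\<^sup>2 * ?J\<^sup>2"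
    by (simp only: power_mult_distrib mult.assoc)
  also have "\<dots> \<le> (?d * ((h / 2) / (h / 2) ^ ?d))\<^sup>2 * (h ^ ?d * ?Q)" using Q by (intro mult_left_mono) auto
  also have "(?d * ((h / 2) / (h / 2) ^ ?d))\<^sup>2 * (h ^ ?d * ?Q) = (real ?d)\<^sup>2 * (4 ^ ?d / 4) * (h\<^sup>2 / h ^ ?d) * ?Q"
  proof -
    have "(2::real) ^ ?d * 2 ^ ?d = 4 ^ ?d" by (simp add: power_mult_distrib[symmetric])
    then have "((h / 2) / (h / 2) ^ ?d)\<^sup>2 * h ^ ?d = 4 ^ ?d / 4 * (h\<^sup>2 / h ^ ?d)"
      using h by (simp add: power_divide power2_eq_square field_simps)
    moreover have "(k * a)\<^sup>2 * (v * q) = k\<^sup>2 * b * c * q" if "a\<^sup>2 * v = b * c" for a b c k v q :: real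
    proof -
      have "(k * a)\<^sup>2 * (v * q) = k\<^sup>2 * (a\<^sup>2 * v) * q" by (simp add: power_mult_distrib mult_ac)
      then show ?thesis by (simp add: that)
    qed
    ultimately show ?thesis by blast
  qed
  also have "\<dots> \<le> (real ?d)\<^sup>2 * 4 ^ ?d * (h\<^sup>2 / h ^ ?d) * ?Q"
    using Q0 h by (intro mult_right_mono mult_left_mono) auto
  finally show ?thesis .
qed

section \<open>The averaging error\<close>

text \<open>Fubini and Tonelli are applied to the product of two completed measures, whose
  construction as a locale instance asks for sigma-finiteness.\<close>

lemma sigma_finite_lebesgue: "sigma_finite_measure (lebesgue :: 'a::euclidean_space measure)"
proof
  obtain A :: "'a set set" where A: "countable A" "A \<subseteq> sets lborel" "\<Union>A = space lborel" "\<forall>a\<in>A. emeasure lborel a \<noteq> \<infinity>"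
    using lborel.sigma_finite_countable by blast
  then show "\<exists>A :: 'a set set. countable A \<and> A \<subseteq> sets lebesgue \<and> \<Union>A = space lebesgue \<and> (\<forall>a\<in>A. emeasure lebesgue a \<noteq> \<infinity>)"
    by (intro exI[of _ A]) (auto simp: sets_completionI_sets)
qed

interpretation lebesgue: sigma_finite_measure "lebesgue :: 'a::euclidean_space measure"
  by (rule sigma_finite_lebesgue)

interpretation lebesgue_pair: pair_sigma_finite "lebesgue :: 'a::euclidean_space measure" "lebesgue :: 'a measure" ..

text \<open>Sharing a cell is equality of finitely many integer-valued measurable functions of the
  two variables, whence joint measurability.\<close>

lemma same_cell_measurable:
  "(\<lambda>p::'a::euclidean_space \<times> 'a. indicator (cell H (fst p)) (snd p) :: real)
    \<in> borel_measurable (lebesgue \<Otimes>\<^sub>M lebesgue)"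
proof -
  have fl [measurable]: "(\<lambda>x::'a. \<lfloor>(x \<bullet> b) / (H \<bullet> b)\<rfloor>) \<in> measurable lebesgue (count_space UNIV)" for b
  proof -
    have "(\<lambda>x::'a. (x \<bullet> b) / (H \<bullet> b)) \<in> borel_measurable lebesgue"
      by (intro borel_imp_lebesgue) measurable
    then show ?thesis by measurable
  qed
  have "(\<lambda>p::'a \<times> 'a. if \<forall>b\<in>Basis. \<lfloor>(snd p \<bullet> b) / (H \<bullet> b)\<rfloor> = \<lfloor>(fst p \<bullet> b) / (H \<bullet> b)\<rfloor> then 1 else 0 :: real)
    \<in> borel_measurable (lebesgue \<Otimes>\<^sub>M lebesgue)"
  proof (rule measurable_If[OF measurable_const measurable_const])
    have "Measurable.pred (lebesgue \<Otimes>\<^sub>M lebesgue) (\<lambda>p::'a \<times> 'a. \<lfloor>(snd p \<bullet> b) / (H \<bullet> b)\<rfloor> = \<lfloor>(fst p \<bullet> b) / (H \<bullet> b)\<rfloor>)" for b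
      using measurable_compose[OF measurable_fst fl] measurable_compose[OF measurable_snd fl] by measurable
    then have "Measurable.pred (lebesgue \<Otimes>\<^sub>M lebesgue)
        (\<lambda>p::'a \<times> 'a. \<forall>b\<in>Basis. \<lfloor>(snd p \<bullet> b) / (H \<bullet> b)\<rfloor> = \<lfloor>(fst p \<bullet> b) / (H \<bullet> b)\<rfloor>)"
      by (intro pred_intros_finite) auto
    then show "{p \<in> space (lebesgue \<Otimes>\<^sub>M lebesgue). \<forall>b\<in>Basis. \<lfloor>(snd p \<bullet> b) / (H \<bullet> b)\<rfloor> = \<lfloor>(fst (p :: 'a \<times> 'a) \<bullet> b) / (H \<bullet> b)\<rfloor>}
        \<in> sets (lebesgue \<Otimes>\<^sub>M lebesgue)"
      by (simp add: pred_def)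
  qed auto
  then show ?thesis by (simp add: indicator_def cell_def of_bool_def)
qed

lemma measurable_snd_lebesgue:
  "g \<in> measurable lebesgue N \<Longrightarrow> (\<lambda>p. g (snd p)) \<in> measurable (lebesgue \<Otimes>\<^sub>M lebesgue) N"
  by (rule measurable_compose[OF measurable_snd])

lemma measurable_fst_lebesgue:
  "g \<in> measurable lebesgue N \<Longrightarrow> (\<lambda>p. g (fst p)) \<in> measurable (lebesgue \<Otimes>\<^sub>M lebesgue) N"
  by (rule measurable_compose[OF measurable_fst])

text \<open>By symmetry of the cell relation a point \<open>y\<close> is counted for exactly those
  \<open>x\<close> in its own cell, a set of measure \<open>h ^ DIM('a)\<close>.\<close>

lemma cube_tonelli:
  fixes g :: "'a::euclidean_space \<Rightarrow> real"
  assumes h: "h > 0" and g: "g \<in> borel_measurable lebesgue"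
  shows "(\<integral>\<^sup>+x. (\<integral>\<^sup>+y. ennreal (indicator (cube h x) y * g y) \<partial>lebesgue) \<partial>lebesgue)
     = ennreal (h ^ DIM('a)) * (\<integral>\<^sup>+y. ennreal (g y) \<partial>lebesgue)"
proof -
  have m: "(\<lambda>(x, y). ennreal (indicator (cube h x) y * g y)) \<in> borel_measurable (lebesgue \<Otimes>\<^sub>M lebesgue)"
    using measurable_ennreal[THEN measurable_compose[rotated], OF
        borel_measurable_times[OF same_cell_measurable[of "h *\<^sub>R One"] measurable_snd_lebesgue[OF g]]]
    by (simp add: case_prod_unfold)
  have "(\<integral>\<^sup>+x. (\<integral>\<^sup>+y. ennreal (indicator (cube h x) y * g y) \<partial>lebesgue) \<partial>lebesgue)
    = (\<integral>\<^sup>+y. (\<integral>\<^sup>+x. ennreal (indicator (cube h x) y * g y) \<partial>lebesgue) \<partial>lebesgue)"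
    using lebesgue_pair.Fubini'[OF m] by simp
  also have "\<dots> = (\<integral>\<^sup>+y. ennreal (h ^ DIM('a)) * ennreal (g y) \<partial>lebesgue)"
  proof (rule nn_integral_cong)
    fix y
    have "(\<integral>\<^sup>+x. ennreal (indicator (cube h x) y * g y) \<partial>lebesgue) = (\<integral>\<^sup>+x. ennreal (g y) * indicator (cube h y) x \<partial>lebesgue)"
      by (intro nn_integral_cong) (auto simp: cell_sym[of y] split: split_indicator)
    also have "\<dots> = ennreal (g y) * emeasure lebesgue (cube h y)" by (rule nn_integral_cmult_indicator) simp
    finally show "(\<integral>\<^sup>+x. ennreal (indicator (cube h x) y * g y) \<partial>lebesgue) = ennreal (h ^ DIM('a)) * ennreal (g y)"
      unfolding cube_measure[OF h] by (simp add: mult.commute)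
  qed
  also have "\<dots> = ennreal (h ^ DIM('a)) * (\<integral>\<^sup>+y. ennreal (g y) \<partial>lebesgue)"
    by (intro nn_integral_cmult measurable_compose[OF g measurable_ennreal])
  finally show ?thesis .
qed

lemma avg_measurable:
  fixes f :: "'a::euclidean_space \<Rightarrow> real"
  assumes "f \<in> borel_measurable lebesgue"
  shows "avg H f \<in> borel_measurable lebesgue"
proof -
  have "case_prod (\<lambda>x y. indicator (cell H x) y * f y) \<in> borel_measurable (lebesgue \<Otimes>\<^sub>M lebesgue)"
    using borel_measurable_times[OF same_cell_measurable measurable_snd_lebesgue[OF assms], of H]
    by (simp add: case_prod_unfold)
  then have "(\<lambda>x. \<integral>y. indicator (cell H x) y * f y \<partial>lebesgue) \<in> borel_measurable lebesgue"
    by (rule lebesgue.borel_measurable_lebesgue_integral)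
  then show ?thesis unfolding avg_def[abs_def] by (rule borel_measurable_divide) simp
qed

section \<open>Dyadic averages converge to the function\<close>

lemma cube_near:
  fixes h :: real
  assumes h: "h > 0" and y: "y \<in> cube h (x::'a::euclidean_space)"
  shows "norm (y - x) \<le> DIM('a) * h"
proof -
  have "\<bar>(y - x) \<bullet> b\<bar> \<le> h" if b: "b \<in> Basis" for b
  proof -
    have "\<lfloor>(y \<bullet> b) / h\<rfloor> = \<lfloor>(x \<bullet> b) / h\<rfloor>" using y b by (simp add: cell_def)
    then have "\<bar>(y \<bullet> b) / h - (x \<bullet> b) / h\<bar> \<le> 1" by linarith
    then have "\<bar>y \<bullet> b - x \<bullet> b\<bar> / h \<le> 1" using h by (simp add: diff_divide_distrib[symmetric])
    then show ?thesis using h by (simp add: inner_diff_left)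
  qed
  then have "(\<Sum>b\<in>Basis. \<bar>(y - x) \<bullet> b\<bar>) \<le> (\<Sum>b\<in>(Basis::'a set). h)" by (intro sum_mono)
  then show ?thesis using norm_le_l1[of "y - x"] by simp
qed

lemma cube_integrable:
  fixes f :: "'a::euclidean_space \<Rightarrow> 'b::euclidean_space"
  assumes "f \<in> L1_loc UNIV" "h > 0"
  shows "integrable lebesgue (\<lambda>y. indicator (cube h x) y *\<^sub>R f y)"
  using assms by (intro L1_loc_indicator_integrable cube_sets_bounded) auto

lemma cube_indicator:
  assumes h: "h > 0"
  shows "integrable lebesgue (\<lambda>y::'a::euclidean_space. indicator (cube h x) y :: real)"
    and "(\<integral>y. indicator (cube h (x::'a)) y \<partial>lebesgue) = h ^ DIM('a)"
  using cube_measure[OF h, of x] h by (auto simp: measure_def intro!: integrable_real_indicator)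

lemma cube_avg_close:
  fixes f :: "'a::euclidean_space \<Rightarrow> real"
  assumes f: "f \<in> L1_loc UNIV" and h: "h > 0" and c: "\<And>y. y \<in> cube h x \<Longrightarrow> \<bar>f y - c\<bar> \<le> \<epsilon>"
  shows "\<bar>cube_avg h f x - c\<bar> \<le> \<epsilon>"
proof -
  let ?V = "h ^ DIM('a)"
  have V: "?V > 0" using h by simp
  have i: "integrable lebesgue (\<lambda>y. indicator (cube h x) y * f y)" using cube_integrable[OF f h, of x] by simp
  note ci = cube_indicator[OF h, of x]
  have "cube_avg h f x - c = ((\<integral>y. indicator (cube h x) y * f y \<partial>lebesgue) - c * (\<integral>y. indicator (cube h x) y \<partial>lebesgue)) / ?V"
    using V h unfolding ci(2) by (simp add: avg_def vol_cube diff_divide_distrib)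
  also have "\<dots> = (\<integral>y. indicator (cube h x) y * f y - c * indicator (cube h x) y \<partial>lebesgue) / ?V"
    using i ci(1) by simp
  finally have "\<bar>cube_avg h f x - c\<bar> = \<bar>\<integral>y. indicator (cube h x) y * f y - c * indicator (cube h x) y \<partial>lebesgue\<bar> / ?V"
    using V by simp
  also have "\<dots> \<le> (\<integral>y. \<epsilon> * indicator (cube h x) y \<partial>lebesgue) / ?V"
    using i ci(1) c V by (intro divide_right_mono integral_abs_bound[THEN order_trans] integral_mono)
      (auto split: split_indicator)
  also have "\<dots> = \<epsilon>" using ci(2) V h by simp
  finally show ?thesis .
qed

lemma test_fun_L1_loc: "\<zeta> \<in> test_fun UNIV \<Longrightarrow> \<zeta> \<in> L1_loc UNIV"
  by (intro integrable_imp_L1_loc test_fun_integrable) auto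

text \<open>All cells of points in the ball lie in one larger ball, so a single integral of
  \<open>\<bar>f\<bar>\<close> bounds all these averages.\<close>

lemma cube_avg_local_bound:
  fixes f :: "'a::euclidean_space \<Rightarrow> real"
  assumes f: "f \<in> L1_loc UNIV" and h: "h > 0"
  obtains M where "M \<ge> 0" "\<And>x. norm x \<le> R \<Longrightarrow> \<bar>cube_avg h f x\<bar> \<le> M"
proof -
  define K where "K = cball (0::'a) (R + DIM('a) * h)"
  define M where "M = (\<integral>y. indicator K y * \<bar>f y\<bar> \<partial>lebesgue) / h ^ DIM('a)"
  have K: "integrable lebesgue (\<lambda>y. indicator K y * \<bar>f y\<bar>)"
  proof -
    have "integrable lebesgue (\<lambda>y. norm (indicator K y *\<^sub>R f y))"
      using f by (intro integrable_norm L1_loc_indicator_integrable) (auto simp: K_def)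
    then show ?thesis by (simp add: abs_mult)
  qed
  show thesis
  proof (rule that[of M])
    show "M \<ge> 0" using h by (auto simp: M_def intro!: divide_nonneg_pos Bochner_Integration.integral_nonneg)
    fix x :: 'a assume x: "norm x \<le> R"
    have sub: "y \<in> K" if "y \<in> cube h x" for y
    proof -
      have "norm (y - x) \<le> DIM('a) * h" by (rule cube_near[OF h that])
      then show ?thesis using x norm_triangle_sub[of y x] by (simp add: K_def)
    qed
    have i: "integrable lebesgue (\<lambda>y. indicator (cube h x) y * f y)" using cube_integrable[OF f h, of x] by simp
    have "\<bar>\<integral>y. indicator (cube h x) y * f y \<partial>lebesgue\<bar> \<le> (\<integral>y. indicator K y * \<bar>f y\<bar> \<partial>lebesgue)"
      using i K sub by (intro integral_abs_bound[THEN order_trans] integral_mono) (auto split: split_indicator)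
    then show "\<bar>cube_avg h f x\<bar> \<le> M" using h by (simp add: avg_def vol_cube M_def divide_right_mono)
  qed
qed

lemma test_fun_support_bound:
  assumes "\<zeta> \<in> test_fun B"
  obtains R where "R > 0" "\<And>x. norm x > R \<Longrightarrow> \<zeta> x = 0"
proof -
  have "bounded (supp \<zeta>)" using assms by (simp add: test_fun_def compact_imp_bounded)
  then obtain R where R: "R > 0" "\<forall>x\<in>supp \<zeta>. norm x \<le> R" unfolding bounded_pos by blast
  then show thesis using that[of R] not_in_supp[of _ \<zeta>] by force
qed

text \<open>The averaging kernel is symmetric, so Fubini moves it from \<open>f\<close> to the test
  function. Integrability on the product comes from the compact support of \<zeta> and the local
  bound on averages of \<open>\<bar>f\<bar>\<close>.\<close>

lemma cube_avg_self_adjoint: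
  fixes f :: "'a::euclidean_space \<Rightarrow> real"
  assumes f: "f \<in> L1_loc UNIV" and \<zeta>: "\<zeta> \<in> test_fun UNIV" and h: "h > 0"
  shows "(\<integral>x. cube_avg h f x * \<zeta> x \<partial>lebesgue) = (\<integral>x. f x * cube_avg h \<zeta> x \<partial>lebesgue)"
proof -
  let ?V = "h ^ DIM('a)"
  let ?F = "\<lambda>x y. indicator (cube h x) y * f y * \<zeta> x"
  have V: "?V > 0" using h by simp
  note f_measurable = L1_loc_UNIV_measurable[OF f] and \<zeta>m = borel_imp_lebesgue[OF test_fun_measurable[OF \<zeta>]]
  have af: "(\<lambda>x. \<bar>f x\<bar>) \<in> L1_loc UNIV" using f by (auto simp: L1_loc_def)
  have m: "case_prod ?F \<in> borel_measurable (lebesgue \<Otimes>\<^sub>M lebesgue)"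
    using borel_measurable_times[OF borel_measurable_times[OF same_cell_measurable[of "h *\<^sub>R One"] measurable_snd_lebesgue[OF f_measurable]]
        measurable_fst_lebesgue[OF \<zeta>m]]
    by (simp add: case_prod_unfold)
  obtain R where R: "\<And>x. norm x > R \<Longrightarrow> \<zeta> x = 0" using test_fun_support_bound[OF \<zeta>] by blast
  obtain M where M: "M \<ge> 0" "\<And>x. norm x \<le> R \<Longrightarrow> \<bar>cube_avg h (\<lambda>x. \<bar>f x\<bar>) x\<bar> \<le> M"
    using cube_avg_local_bound[OF af h] by blast
  have int1: "(\<integral>y. norm (?F x y) \<partial>lebesgue) = \<bar>\<zeta> x\<bar> * (?V * cube_avg h (\<lambda>x. \<bar>f x\<bar>) x)" for x
  proof -
    have "(\<lambda>y. norm (?F x y)) = (\<lambda>y. \<bar>\<zeta> x\<bar> * (indicator (cube h x) y * \<bar>f y\<bar>))"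
      by (auto simp: abs_mult)
    then show ?thesis using h by (simp add: avg_def vol_cube)
  qed
  have int: "integrable (lebesgue \<Otimes>\<^sub>M lebesgue) (case_prod ?F)"
  proof (rule lebesgue_pair.Fubini_integrable[OF m])
    show "integrable lebesgue (\<lambda>x. \<integral>y. norm (case (x, y) of (x, y) \<Rightarrow> ?F x y) \<partial>lebesgue)"
      unfolding prod.case int1
    proof (rule Bochner_Integration.integrable_bound)
      show "integrable lebesgue (\<lambda>x. \<bar>\<zeta> x\<bar> * (?V * M))" using test_fun_integrable[OF \<zeta>] by simp
      show "(\<lambda>x. \<bar>\<zeta> x\<bar> * (?V * cube_avg h (\<lambda>x. \<bar>f x\<bar>) x)) \<in> borel_measurable lebesgue"
        using \<zeta>m f_measurable by (intro borel_measurable_times borel_measurable_abs avg_measurable) auto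
      show "AE x in lebesgue. norm (\<bar>\<zeta> x\<bar> * (?V * cube_avg h (\<lambda>x. \<bar>f x\<bar>) x)) \<le> norm (\<bar>\<zeta> x\<bar> * (?V * M))"
      proof (intro AE_I2)
        fix x
        show "norm (\<bar>\<zeta> x\<bar> * (?V * cube_avg h (\<lambda>x. \<bar>f x\<bar>) x)) \<le> norm (\<bar>\<zeta> x\<bar> * (?V * M))"
          using M R[of x] V by (cases "norm x \<le> R") (auto simp: abs_mult intro!: mult_left_mono)
      qed
    qed
    show "AE x in lebesgue. integrable lebesgue (\<lambda>y. case (x, y) of (x, y) \<Rightarrow> ?F x y)"
      using cube_integrable[OF f h] by (intro AE_I2) (auto simp: mult.commute)
  qed
  have "(\<integral>x. cube_avg h f x * \<zeta> x \<partial>lebesgue) = (\<integral>x. (\<integral>y. ?F x y \<partial>lebesgue) \<partial>lebesgue) / ?V"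
    by (simp add: avg_def vol_cube)
  also have "\<dots> = (\<integral>y. (\<integral>x. ?F x y \<partial>lebesgue) \<partial>lebesgue) / ?V"
    using lebesgue_pair.Fubini_integral[OF int] by simp
  also have "\<dots> = (\<integral>y. f y * (\<integral>x. indicator (cube h y) x * \<zeta> x \<partial>lebesgue) \<partial>lebesgue) / ?V"
  proof -
    have "(\<integral>x. ?F x y \<partial>lebesgue) = f y * (\<integral>x. indicator (cube h y) x * \<zeta> x \<partial>lebesgue)" for y
    proof -
      have "(\<lambda>x. ?F x y) = (\<lambda>x. f y * (indicator (cube h y) x * \<zeta> x))"
        by (auto simp: cell_sym[of y] fun_eq_iff split: split_indicator)
      then show ?thesis by simp
    qed
    then show ?thesis by simp
  qed
  also have "\<dots> = (\<integral>x. f x * cube_avg h \<zeta> x \<partial>lebesgue)" by (simp add: avg_def vol_cube)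
  finally show ?thesis .
qed

lemma halving_pos: "h > 0 \<Longrightarrow> h / 2 ^ j > (0::real)"
  by simp

lemma cube_avg_test_limit:
  assumes \<zeta>: "\<zeta> \<in> test_fun UNIV" and h: "h > 0"
  shows "(\<lambda>j. cube_avg (h / 2 ^ j) \<zeta> x) \<longlonglongrightarrow> \<zeta> (x::'a::euclidean_space)"
proof (rule LIMSEQ_I)
  fix r :: real assume r: "r > 0"
  have "continuous (at x) \<zeta>" using test_fun_continuous[OF \<zeta>, of UNIV] by (simp add: continuous_on_eq_continuous_at)
  then obtain \<delta> where \<delta>: "\<delta> > 0" "\<And>y. dist y x < \<delta> \<Longrightarrow> dist (\<zeta> y) (\<zeta> x) < r / 2"
    unfolding continuous_at_eps_delta using r by (metis half_gt_zero)
  have "(\<lambda>j. DIM('a) * h * (1 / 2) ^ j) \<longlonglongrightarrow> DIM('a) * h * 0"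
    by (intro tendsto_mult_left LIMSEQ_realpow_zero) auto
  then have "\<forall>\<^sub>F j in sequentially. DIM('a) * h * (1 / 2) ^ j < \<delta>"
    using \<delta>(1) by (intro order_tendstoD(2)) auto
  then obtain N where N: "\<And>j. j \<ge> N \<Longrightarrow> DIM('a) * h * (1 / 2) ^ j < \<delta>"
    by (auto simp: eventually_sequentially)
  have "norm (cube_avg (h / 2 ^ j) \<zeta> x - \<zeta> x) < r" if j: "j \<ge> N" for j
  proof -
    have "\<bar>cube_avg (h / 2 ^ j) \<zeta> x - \<zeta> x\<bar> \<le> r / 2"
    proof (rule cube_avg_close[OF test_fun_L1_loc[OF \<zeta>] halving_pos[OF h]])
      fix y assume "y \<in> cube (h / 2 ^ j) x"
      then have "dist y x < \<delta>" using cube_near[OF halving_pos[OF h]] N[OF j]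
        by (force simp: dist_norm power_divide)
      then show "\<bar>\<zeta> y - \<zeta> x\<bar> \<le> r / 2" using \<delta>(2)[of y] by (simp add: dist_real_def)
    qed
    then show ?thesis using r by simp
  qed
  then show "\<exists>N. \<forall>j\<ge>N. norm (cube_avg (h / 2 ^ j) \<zeta> x - \<zeta> x) < r" by blast
qed

lemma le_one_plus_power: "0 \<le> t \<Longrightarrow> q \<ge> 1 \<Longrightarrow> t \<le> 1 + t ^ q" for t :: real
proof -
  assume "0 \<le> t" "q \<ge> 1"
  then have "t \<le> 1 \<or> t \<le> t ^ q" using power_increasing[of 1 q t] by force
  then show ?thesis using zero_le_power[OF \<open>0 \<le> t\<close>, of q] by linarith
qed

text \<open>Convergence to some \<open>v\<close> is given. To see that \<open>v\<close> is
  \<open>f\<close>, the averaging is moved onto a test function, where continuity yields the limit,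
  and the fundamental lemma compares both sides. The majorant \<open>W\<close> is known only through
  its q-th power, hence the local estimate \<open>W \<le> 1 + W ^ q\<close>.\<close>

lemma cube_avg_limit_identification:
  fixes f :: "'a::euclidean_space \<Rightarrow> real"
  assumes f: "f \<in> L1_loc UNIV" and h: "h > 0" and v: "v \<in> borel_measurable lebesgue"
    and W: "W \<in> borel_measurable lebesgue" "\<And>x. 0 \<le> W x" "integrable lebesgue (\<lambda>x. W x ^ q)" "q \<ge> 1"
    and lim: "AE x in lebesgue. (\<lambda>j. cube_avg (h / 2 ^ j) f x) \<longlonglongrightarrow> v x"
    and bd: "AE x in lebesgue. \<forall>j. \<bar>cube_avg (h / 2 ^ j) f x - cube_avg h f x\<bar> \<le> W x"
  shows "AE x in lebesgue. v x = f x"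
proof -
  define u where "u j = cube_avg (h / 2 ^ j) f" for j
  note f_measurable = L1_loc_UNIV_measurable[OF f]
  have um: "u j \<in> borel_measurable lebesgue" for j unfolding u_def by (rule avg_measurable[OF f_measurable])
  have WK: "integrable lebesgue (\<lambda>x. indicator (cball 0 R) x * (M + W x))" for R M
  proof (rule Bochner_Integration.integrable_bound)
    have "integrable lebesgue (\<lambda>x::'a. indicator (cball 0 R) x :: real)"
      using fmeasurableD2[OF lmeasurable_cball[of "0::'a" R]] by (intro integrable_real_indicator) (auto simp: less_top)
    then show "integrable lebesgue (\<lambda>x::'a. \<bar>M\<bar> * indicator (cball 0 R) x + indicator (cball 0 R) x + W x ^ q)" using W(3) by simp
    show "(\<lambda>x. indicator (cball 0 R) x * (M + W x)) \<in> borel_measurable lebesgue"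
      using W(1) by (intro borel_measurable_times borel_measurable_add borel_measurable_indicator) auto
    show "AE x in lebesgue. norm (indicator (cball 0 R) x * (M + W x)) \<le> norm (\<bar>M\<bar> * indicator (cball 0 R) x + indicator (cball 0 R) x + W x ^ q)"
    proof (intro AE_I2)
      fix x
      show "norm (indicator (cball 0 R) x * (M + W x)) \<le> norm (\<bar>M\<bar> * indicator (cball 0 R) x + indicator (cball 0 R) x + W x ^ q)"
        using le_one_plus_power[OF W(2,4), of x] zero_le_power[OF W(2), of x q] W(2)[of x]
        by (cases "x \<in> cball 0 R") (auto simp del: mem_cball)
    qed
  qed
  have dom: "\<exists>M. \<forall>x. norm x \<le> R \<longrightarrow> \<bar>u 0 x\<bar> \<le> M" for R
    using cube_avg_local_bound[OF f h, of R] unfolding u_def by auto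
  have vL: "v \<in> L1_loc UNIV"
    unfolding L1_loc_def
  proof (intro CollectI conjI allI impI)
    show "v \<in> borel_measurable (lebesgue_on UNIV)" using v by (simp add: lebesgue_on_UNIV_eq)
    fix K :: "'a set" assume K: "compact K \<and> K \<subseteq> UNIV"
    then obtain R where R: "\<forall>x\<in>K. norm x \<le> R" using compact_imp_bounded[of K] by (auto simp: bounded_iff)
    obtain M where M: "\<And>x. norm x \<le> R \<Longrightarrow> \<bar>u 0 x\<bar> \<le> M" using dom by blast
    have "integrable lebesgue (\<lambda>x. indicator K x * v x)"
    proof (rule Bochner_Integration.integrable_bound[OF WK[of R M]])
      show "(\<lambda>x. indicator K x * v x) \<in> borel_measurable lebesgue"
        using v K by (intro borel_measurable_times borel_measurable_indicator) (auto intro: compact_sets_lebesgue)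
      show "AE x in lebesgue. norm (indicator K x * v x) \<le> norm (indicator (cball 0 R) x * (M + W x))"
        using lim bd
      proof eventually_elim
        case (elim x)
        show ?case
        proof (cases "x \<in> K")
          case True
          have "\<bar>v x - u 0 x\<bar> \<le> W x"
          proof (rule tendsto_upperbound)
            show "(\<lambda>j. \<bar>u j x - u 0 x\<bar>) \<longlonglongrightarrow> \<bar>v x - u 0 x\<bar>"
              using elim(1) unfolding u_def by (intro tendsto_intros)
          qed (use elim(2) in \<open>auto simp: u_def\<close>)
          then show ?thesis using True M[of x] R W(2)[of x] by (auto split: split_indicator)
        qed simp
      qed
    qed
    then show "integrable (lebesgue_on K) v" using K by (auto simp: integrable_on_eq compact_sets_lebesgue)
  qed
  have "AE x in lebesgue. x \<in> UNIV \<longrightarrow> v x + (-1) *\<^sub>R f x = 0"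
  proof (rule fundamental_lemma[OF open_UNIV])
    show "(\<lambda>x. v x + (-1) *\<^sub>R f x) \<in> L1_loc UNIV" by (rule L1_loc_lincomb[OF vL f])
    fix \<zeta> :: "'a \<Rightarrow> real" assume \<zeta>: "\<zeta> \<in> test_fun UNIV"
    note \<zeta>m = borel_imp_lebesgue[OF test_fun_measurable[OF \<zeta>]]
    obtain R where R: "R > 0" "\<And>x. norm x > R \<Longrightarrow> \<zeta> x = 0" using test_fun_support_bound[OF \<zeta>] by blast
    obtain M where M: "\<And>x. norm x \<le> R \<Longrightarrow> \<bar>u 0 x\<bar> \<le> M" using dom by blast
    obtain Z where Z: "Z > 0" "\<And>x. \<bar>\<zeta> x\<bar> \<le> Z" using test_fun_bounded[OF \<zeta>] by blast
    have l1: "(\<lambda>j. \<integral>x. u j x * \<zeta> x \<partial>lebesgue) \<longlonglongrightarrow> (\<integral>x. v x * \<zeta> x \<partial>lebesgue)"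
    proof (rule integral_dominated_convergence[where w = "\<lambda>x. Z * (indicator (cball 0 R) x * (M + W x))"])
      show "AE x in lebesgue. (\<lambda>j. u j x * \<zeta> x) \<longlonglongrightarrow> v x * \<zeta> x"
        using lim by eventually_elim (auto simp: u_def intro!: tendsto_intros)
      show "AE x in lebesgue. norm (u j x * \<zeta> x) \<le> Z * (indicator (cball 0 R) x * (M + W x))" for j
        using bd
      proof eventually_elim
        case (elim x)
        show ?case
        proof (cases "norm x \<le> R")
          case True
          have "\<bar>u j x - u 0 x\<bar> \<le> W x" using elim by (simp add: u_def)
          then have "\<bar>u j x\<bar> \<le> M + W x" using M[OF True] by linarith
          then have "\<bar>\<zeta> x\<bar> * \<bar>u j x\<bar> \<le> Z * (M + W x)" using Z by (intro mult_mono) auto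
          then show ?thesis using True by (simp add: abs_mult mult.commute)
        qed (use R in auto)
      qed
    qed (use um v \<zeta>m WK in auto)
    have l2: "(\<lambda>j. \<integral>x. f x * cube_avg (h / 2 ^ j) \<zeta> x \<partial>lebesgue) \<longlonglongrightarrow> (\<integral>x. f x * \<zeta> x \<partial>lebesgue)"
    \<comment> \<open>All cells have side at most \<open>h\<close>, so the averages of \<zeta>
      vanish farther than \<open>DIM('a) * h\<close> outside the ball that carries \<zeta>.\<close>
    proof (rule integral_dominated_convergence[where w = "\<lambda>x. Z * \<bar>indicator (cball 0 (R + DIM('a) * h)) x * f x\<bar>"])
      show "AE x in lebesgue. (\<lambda>j. f x * cube_avg (h / 2 ^ j) \<zeta> x) \<longlonglongrightarrow> f x * \<zeta> x"
        by (intro AE_I2 tendsto_mult_left cube_avg_test_limit[OF \<zeta> h])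
      show "integrable lebesgue (\<lambda>x. Z * \<bar>indicator (cball 0 (R + DIM('a) * h)) x * f x\<bar>)"
        using L1_loc_indicator_integrable[OF f, of "cball 0 (R + DIM('a) * h)"] by simp
      show "AE x in lebesgue. norm (f x * cube_avg (h / 2 ^ j) \<zeta> x) \<le> Z * \<bar>indicator (cball 0 (R + DIM('a) * h)) x * f x\<bar>" for j
      proof (intro AE_I2)
        fix x :: 'a
        have hj: "h / 2 ^ j \<le> h" using h by (simp add: divide_le_eq)
        have 1: "\<bar>cube_avg (h / 2 ^ j) \<zeta> x - 0\<bar> \<le> Z"
          using Z(2) by (intro cube_avg_close[OF test_fun_L1_loc[OF \<zeta>] halving_pos[OF h]]) auto
        have 2: "\<bar>cube_avg (h / 2 ^ j) \<zeta> x - 0\<bar> \<le> 0" if "norm x > R + DIM('a) * h"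
        proof (rule cube_avg_close[OF test_fun_L1_loc[OF \<zeta>] halving_pos[OF h]])
          fix y assume "y \<in> cube (h / 2 ^ j) x"
          then have "norm (y - x) \<le> DIM('a) * (h / 2 ^ j)" by (rule cube_near[OF halving_pos[OF h]])
          also have "\<dots> \<le> DIM('a) * h" using hj by (intro mult_left_mono) auto
          finally have "norm y > R" using that norm_triangle_ineq2[of x y] by (simp add: norm_minus_commute)
          then show "\<bar>\<zeta> y - 0\<bar> \<le> 0" using R(2) by simp
        qed
        show "norm (f x * cube_avg (h / 2 ^ j) \<zeta> x) \<le> Z * \<bar>indicator (cball 0 (R + DIM('a) * h)) x * f x\<bar>"
          using 1 2 mult_right_mono[of "\<bar>cube_avg (h / 2 ^ j) \<zeta> x\<bar>" Z "\<bar>f x\<bar>"]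
          by (cases "norm x \<le> R + DIM('a) * h") (auto simp: abs_mult mult.commute)
      qed
      show "(\<lambda>x. f x * cube_avg (h / 2 ^ j) \<zeta> x) \<in> borel_measurable lebesgue" for j
        using f_measurable avg_measurable[OF \<zeta>m] by (rule borel_measurable_times)
    qed (use f_measurable \<zeta>m in auto)
    have "(\<integral>x. u j x * \<zeta> x \<partial>lebesgue) = (\<integral>x. f x * cube_avg (h / 2 ^ j) \<zeta> x \<partial>lebesgue)" for j
      unfolding u_def by (rule cube_avg_self_adjoint[OF f \<zeta> halving_pos[OF h]])
    then have eq: "(\<integral>x. v x * \<zeta> x \<partial>lebesgue) = (\<integral>x. f x * \<zeta> x \<partial>lebesgue)"
      using l1 l2 by (auto intro: LIMSEQ_unique)
    have i: "integrable lebesgue (\<lambda>x. v x * \<zeta> x)" "integrable lebesgue (\<lambda>x. f x * \<zeta> x)"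
      using L1_loc_test_integrable[OF vL \<zeta>] L1_loc_test_integrable[OF f \<zeta>] by (auto simp: mult.commute)
    show "(\<integral>x. (v x + (-1) *\<^sub>R f x) * \<zeta> x \<partial>lebesgue) = 0"
      using i eq by (simp add: left_diff_distrib)
  qed
  then show ?thesis by eventually_elim simp
qed

text \<open>The pointwise bound is the p-th power of the local energy \<open>Q x\<close>. One factor
  is kept and integrated by Tonelli, giving \<open>h ^ d\<close> times the total energy; the other p
  - 1 factors are bounded by the total energy.\<close>

lemma cube_avg_halve_power:
  fixes f :: "'a::euclidean_space \<Rightarrow> real"
  assumes wg: "is_weak_gradient UNIV f G" and h: "h > 0" and G2: "integrable lebesgue (\<lambda>y. (norm (G y))\<^sup>2)"
    and p: "p \<ge> 1"
  shows "(\<integral>\<^sup>+x. ennreal (\<bar>cube_avg (h / 2) f x - cube_avg h f x\<bar> ^ (2 * p)) \<partial>lebesgue)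
     \<le> ennreal (((real DIM('a))\<^sup>2 * 4 ^ DIM('a)) ^ p * ((h\<^sup>2 / h ^ DIM('a)) ^ p * h ^ DIM('a)) * (\<integral>y. (norm (G y))\<^sup>2 \<partial>lebesgue) ^ p)"
proof -
  let ?d = "DIM('a)"
  define D where "D = (\<integral>y. (norm (G y))\<^sup>2 \<partial>lebesgue)"
  define K where "K = (real DIM('a))\<^sup>2 * 4 ^ DIM('a) * (h\<^sup>2 / h ^ ?d)"
  have D0: "D \<ge> 0" unfolding D_def by (intro Bochner_Integration.integral_nonneg) auto
  have K0: "K \<ge> 0" using h by (simp add: K_def)
  define Q where "Q x = (\<integral>y. indicator (cube h x) y * (norm (G y))\<^sup>2 \<partial>lebesgue)" for x
  have Gi: "integrable lebesgue (\<lambda>y. indicator (cube h x) y * (norm (G y))\<^sup>2)" for x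
  proof -
    have "integrable lebesgue (\<lambda>y. indicator (cube h x) y *\<^sub>R (norm (G y))\<^sup>2)"
      by (intro integrable_mult_indicator G2) simp
    then show ?thesis by simp
  qed
  have Q0: "0 \<le> Q x" for x unfolding Q_def by (intro Bochner_Integration.integral_nonneg) auto
  have QD: "Q x \<le> D" for x unfolding Q_def D_def
    using Gi G2 by (intro integral_mono) (auto split: split_indicator)
  have gm: "(\<lambda>y. (norm (G y))\<^sup>2) \<in> borel_measurable lebesgue" using G2 by (rule borel_measurable_integrable)
  have "(\<integral>\<^sup>+x. ennreal (\<bar>cube_avg (h / 2) f x - cube_avg h f x\<bar> ^ (2 * p)) \<partial>lebesgue)
    \<le> (\<integral>\<^sup>+x. ennreal (K ^ p * D ^ (p - 1)) * (\<integral>\<^sup>+y. ennreal (indicator (cube h x) y * (norm (G y))\<^sup>2) \<partial>lebesgue) \<partial>lebesgue)"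
  proof (rule nn_integral_mono)
    fix x
    have "\<bar>cube_avg (h / 2) f x - cube_avg h f x\<bar> ^ (2 * p) = ((cube_avg (h / 2) f x - cube_avg h f x)\<^sup>2) ^ p"
      by (simp add: power_mult)
    also have "\<dots> \<le> (K * Q x) ^ p"
      using cube_avg_halve_sq[OF wg h G2, of x] unfolding K_def Q_def by (intro power_mono) auto
    also have "\<dots> = K ^ p * (Q x ^ (p - 1) * Q x)" using p
      by (simp add: power_mult_distrib power_eq_if[of "Q x" p])
    also have "\<dots> \<le> K ^ p * (D ^ (p - 1) * Q x)"
      using K0 Q0 QD by (intro mult_left_mono mult_right_mono power_mono) auto
    finally have "ennreal (\<bar>cube_avg (h / 2) f x - cube_avg h f x\<bar> ^ (2 * p)) \<le> ennreal (K ^ p * D ^ (p - 1) * Q x)"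
      by (intro ennreal_leI) (simp add: mult_ac)
    also have "\<dots> = ennreal (K ^ p * D ^ (p - 1)) * ennreal (Q x)" using K0 D0 Q0 by (simp add: ennreal_mult)
    also have "ennreal (Q x) = (\<integral>\<^sup>+y. ennreal (indicator (cube h x) y * (norm (G y))\<^sup>2) \<partial>lebesgue)"
      unfolding Q_def using Gi by (intro nn_integral_eq_integral[symmetric]) auto
    finally show "ennreal (\<bar>cube_avg (h / 2) f x - cube_avg h f x\<bar> ^ (2 * p)) \<le>
       ennreal (K ^ p * D ^ (p - 1)) * (\<integral>\<^sup>+y. ennreal (indicator (cube h x) y * (norm (G y))\<^sup>2) \<partial>lebesgue)" .
  qed
  also have "\<dots> = ennreal (K ^ p * D ^ (p - 1)) * (\<integral>\<^sup>+x. (\<integral>\<^sup>+y. ennreal (indicator (cube h x) y * (norm (G y))\<^sup>2) \<partial>lebesgue) \<partial>lebesgue)"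
  proof (rule nn_integral_cmult)
    have "(\<lambda>x. ennreal (Q x)) \<in> borel_measurable lebesgue"
    proof -
      have "(\<lambda>x. avg (h *\<^sub>R One) (\<lambda>y. (norm (G y))\<^sup>2) x * h ^ ?d) \<in> borel_measurable lebesgue"
        using avg_measurable[OF gm] by (intro borel_measurable_times) auto
      moreover have "(\<lambda>x. avg (h *\<^sub>R One) (\<lambda>y. (norm (G y))\<^sup>2) x * h ^ ?d) = Q"
        using h by (auto simp: avg_def vol_cube Q_def)
      ultimately show ?thesis by simp
    qed
    moreover have "(\<lambda>x. ennreal (Q x)) = (\<lambda>x. \<integral>\<^sup>+y. ennreal (indicator (cube h x) y * (norm (G y))\<^sup>2) \<partial>lebesgue)"
      unfolding Q_def using Gi by (intro ext nn_integral_eq_integral[symmetric]) auto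
    ultimately show "(\<lambda>x. \<integral>\<^sup>+y. ennreal (indicator (cube h x) y * (norm (G y))\<^sup>2) \<partial>lebesgue) \<in> borel_measurable lebesgue"
      by simp
  qed
  also have "\<dots> = ennreal (K ^ p * D ^ (p - 1)) * (ennreal (h ^ ?d) * ennreal D)"
    unfolding cube_tonelli[OF h gm] D_def using G2 by (subst nn_integral_eq_integral) auto
  also have "\<dots> = ennreal (K ^ p * D ^ (p - 1) * (h ^ ?d * D))"
    using K0 D0 h by (simp add: ennreal_mult)
  also have "K ^ p * D ^ (p - 1) * (h ^ ?d * D) = K ^ p * h ^ ?d * D ^ p"
    using p by (simp add: power_eq_if[of D p])
  also have "K ^ p = ((real DIM('a))\<^sup>2 * 4 ^ DIM('a)) ^ p * (h\<^sup>2 / h ^ ?d) ^ p"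
    unfolding K_def by (rule power_mult_distrib)
  finally show ?thesis by (simp only: D_def mult.assoc)
qed

text \<open>The bound at side \<open>h / 2 ^ j\<close> is the bound at side \<open>h\<close> times
  the j-th power of a fixed ratio, so the sum over scales is geometric.\<close>

lemma scale_halving:
  fixes h :: real
  assumes h: "h > 0"
  shows "((h / 2 ^ j)\<^sup>2 / (h / 2 ^ j) ^ d) ^ p * (h / 2 ^ j) ^ d = ((h\<^sup>2 / h ^ d) ^ p * h ^ d) * ((2 ^ d / 4) ^ p / 2 ^ d) ^ j"
proof -
  define g where "g = h / 2 ^ j"
  have e: "(2 ^ j :: real)\<^sup>2 = 4 ^ j" "((2::real) ^ j) ^ d = (2 ^ d) ^ j"
    by (simp_all add: power_mult[symmetric] mult.commute power2_eq_square power_mult_distrib[symmetric])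
  have "g\<^sup>2 / g ^ d = (h\<^sup>2 / h ^ d) * (2 ^ d / 4) ^ j"
    unfolding g_def using h by (simp add: power_divide e field_simps)
  moreover have "g ^ d = h ^ d / (2 ^ d) ^ j" by (simp add: g_def power_divide e)
  moreover have "(a * X ^ j) ^ p * (b / Y ^ j) = (a ^ p * b) * (X ^ p / Y) ^ j" for a b X Y :: real
    by (simp add: power_mult_distrib power_divide power_mult[symmetric] mult.commute)
  ultimately show ?thesis by (simp only: g_def[symmetric])
qed

text \<open>The ratio is 2^(p (d - 2) - d), and with natural exponents the hypothesis becomes
  \<open>p * d < 2 * p + d\<close>. Writing it as a quotient keeps it meaningful for d = 1, where d
  - 2 is negative.\<close>

lemma scale_ratio_less_1:
  assumes sub: "int p * (int d - 2) < int d"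
  shows "(2 ^ d / 4) ^ p / 2 ^ d < (1::real)"
proof -
  have "int (p * d) < int (2 * p + d)" using sub by (simp add: algebra_simps)
  then have "p * d < 2 * p + d" by linarith
  then have "(2::real) ^ (p * d) < 2 ^ (2 * p + d)" by (intro power_strict_increasing) auto
  moreover have "(2::real) ^ (p * d) = (2 ^ d) ^ p" by (simp add: power_mult[symmetric] mult.commute)
  moreover have "(2::real) ^ (2 * p + d) = 4 ^ p * 2 ^ d" by (simp add: power_add power_mult)
  ultimately have "(2 ^ d) ^ p < 4 ^ p * (2::real) ^ d" by linarith
  then show ?thesis by (simp add: power_divide divide_less_eq mult.commute)
qed

text \<open>The averages at sides \<open>h / 2 ^ j\<close> satisfy \<open>fast_convergence\<close>
  with exponent \<open>2 * p\<close>; its majorant bounds the distance of their limit, which is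
  \<open>f\<close>, from the first average. \<open>C\<close> depends only on \<open>p\<close> and
  the dimension, and the factor in \<open>h\<close> is the power with the positive exponent d - p (d
  - 2).\<close>

theorem cube_avg_error:
  fixes p :: nat
  assumes p: "p \<ge> 1" and sub: "int p * (int DIM('a::euclidean_space) - 2) < int DIM('a)"
  obtains C where "C \<ge> 0" "\<And>f (G :: 'a \<Rightarrow> 'a) h. is_weak_gradient UNIV f G \<Longrightarrow>
     integrable lebesgue (\<lambda>y. (norm (G y))\<^sup>2) \<Longrightarrow> h > 0 \<Longrightarrow>
     (\<integral>\<^sup>+x. ennreal (\<bar>f x - cube_avg h f x\<bar> ^ (2 * p)) \<partial>lebesgue)
     \<le> ennreal (C * ((h\<^sup>2 / h ^ DIM('a)) ^ p * h ^ DIM('a)) * (\<integral>y. (norm (G y))\<^sup>2 \<partial>lebesgue) ^ p)"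
proof -
  let ?d = "DIM('a)"
  define r :: real where "r = (2 ^ ?d / 4) ^ p / 2 ^ ?d"
  have r0: "r > 0" by (simp add: r_def)
  have r1: "r < 1" unfolding r_def by (rule scale_ratio_less_1[OF sub])
  define k where "k = ((real ?d)\<^sup>2 * 4 ^ ?d) ^ p"
  \<comment> \<open>\<open>k\<close> is the constant of a single halving; the denominator is the
    price of summing over the scales.\<close>
  define C where "C = k / (1 - root (2 * p) r) ^ (2 * p)"
  have root1: "root (2 * p) r < 1" using r1 p by simp
  have C0: "C \<ge> 0" using root1 by (auto simp: C_def k_def)
  show thesis
  proof (rule that[OF C0])
    fix f and G :: "'a \<Rightarrow> 'a" and h :: real
    assume wg: "is_weak_gradient UNIV f G" and G2: "integrable lebesgue (\<lambda>y. (norm (G y))\<^sup>2)" and h: "h > 0"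
    have f: "f \<in> L1_loc UNIV" using wg by (simp add: is_weak_gradient_def)
    note f_measurable = L1_loc_UNIV_measurable[OF f]
    define D where "D = (\<integral>y. (norm (G y))\<^sup>2 \<partial>lebesgue)"
    have D0: "D \<ge> 0" unfolding D_def by (intro Bochner_Integration.integral_nonneg) auto
    define u where "u j = cube_avg (h / 2 ^ j) f" for j
    define A where "A = k * ((h\<^sup>2 / h ^ ?d) ^ p * h ^ ?d) * D ^ p"
    have A0: "A \<ge> 0" using h D0 by (simp add: A_def k_def)
    have step: "(\<integral>\<^sup>+x. ennreal (norm (u (Suc j) x - u j x) ^ (2 * p)) \<partial>lebesgue) \<le> ennreal (A * r ^ j)" for j
    proof -
      define g where "g = h / 2 ^ j"
      have "(g\<^sup>2 / g ^ ?d) ^ p * g ^ ?d = ((h\<^sup>2 / h ^ ?d) ^ p * h ^ ?d) * r ^ j"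
        unfolding g_def r_def by (rule scale_halving[OF h])
      then show ?thesis
        using cube_avg_halve_power[OF wg halving_pos[OF h, of j] G2 p]
        unfolding u_def g_def[symmetric] by (simp add: A_def k_def D_def mult_ac g_def)
    qed
    have um: "u j \<in> borel_measurable lebesgue" for j unfolding u_def by (rule avg_measurable[OF f_measurable])
    have q: "1 \<le> 2 * p" using p by simp
    obtain W v where W: "W \<in> borel_measurable lebesgue" "v \<in> borel_measurable lebesgue" "\<And>x. 0 \<le> W x"
      and lim: "AE x in lebesgue. (\<lambda>j. u j x) \<longlonglongrightarrow> v x"
      and bd: "AE x in lebesgue. \<forall>j. norm (u j x - u 0 x) \<le> W x"
      and Wi: "(\<integral>\<^sup>+x. ennreal (W x ^ (2 * p)) \<partial>lebesgue) \<le> ennreal (A / (1 - root (2 * p) r) ^ (2 * p))"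
      using fast_convergence[OF q um A0 r0 r1 step] by blast
    have Wint: "integrable lebesgue (\<lambda>x. W x ^ (2 * p))"
      using Wi W by (intro integrableI_bounded) (auto simp: less_top[symmetric] top_unique intro: le_less_trans)
    have vf: "AE x in lebesgue. v x = f x"
      using lim bd by (intro cube_avg_limit_identification[OF f h W(2,1,3) Wint q]) (auto simp: u_def)
    have "(\<integral>\<^sup>+x. ennreal (\<bar>f x - cube_avg h f x\<bar> ^ (2 * p)) \<partial>lebesgue) \<le> (\<integral>\<^sup>+x. ennreal (W x ^ (2 * p)) \<partial>lebesgue)"
    proof (rule nn_integral_mono_AE)
      show "AE x in lebesgue. ennreal (\<bar>f x - cube_avg h f x\<bar> ^ (2 * p)) \<le> ennreal (W x ^ (2 * p))"
        using lim bd vf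
      proof eventually_elim
        case (elim x)
        have "\<bar>v x - u 0 x\<bar> \<le> W x"
        proof (rule tendsto_upperbound)
          show "(\<lambda>j. \<bar>u j x - u 0 x\<bar>) \<longlonglongrightarrow> \<bar>v x - u 0 x\<bar>"
            using elim(1) by (intro tendsto_intros)
        qed (use elim(2) in auto)
        then show ?case using elim(3) by (intro ennreal_leI power_mono) (auto simp: u_def)
      qed
    qed
    also note Wi
    also have "A / (1 - root (2 * p) r) ^ (2 * p) = C * ((h\<^sup>2 / h ^ ?d) ^ p * h ^ ?d) * D ^ p"
      by (simp add: A_def C_def)
    finally show "(\<integral>\<^sup>+x. ennreal (\<bar>f x - cube_avg h f x\<bar> ^ (2 * p)) \<partial>lebesgue)
     \<le> ennreal (C * ((h\<^sup>2 / h ^ ?d) ^ p * h ^ ?d) * (\<integral>y. (norm (G y))\<^sup>2 \<partial>lebesgue) ^ p)"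
      by (simp add: D_def)
  qed
qed

section \<open>Classes of functions with square integrable gradient\<close>

lemma nn_bound_integrable:
  fixes g :: "'a \<Rightarrow> real"
  assumes "g \<in> borel_measurable M" "\<And>x. 0 \<le> g x" "(\<integral>\<^sup>+x. ennreal (g x) \<partial>M) \<le> ennreal c" "0 \<le> c"
  shows "integrable M g" "(\<integral>x. g x \<partial>M) \<le> c"
proof -
  show "integrable M g"
    using assms by (intro integrableI_nonneg) (auto intro: le_less_trans)
  show "(\<integral>x. g x \<partial>M) \<le> c"
    using assms by (subst integral_eq_nn_integral) (auto intro: enn2real_leI)
qed

lemma power_add_bound:
  fixes a b :: real
  assumes "a \<ge> 0" "b \<ge> 0"
  shows "(a + b) ^ n \<le> 2 ^ n * (a ^ n + b ^ n)"
proof -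
  have "(a + b) ^ n \<le> (2 * max a b) ^ n" using assms by (intro power_mono) auto
  also have "\<dots> = 2 ^ n * max a b ^ n" by (simp add: power_mult_distrib)
  also have "max a b ^ n \<le> a ^ n + b ^ n" using assms by (simp add: max_def)
  finally show ?thesis by simp
qed

lemma abs_diff_power_bound:
  fixes a b :: real
  shows "\<bar>a - b\<bar> ^ n \<le> 2 ^ n * (\<bar>a\<bar> ^ n + \<bar>b\<bar> ^ n)"
proof -
  have "\<bar>a - b\<bar> ^ n \<le> (\<bar>a\<bar> + \<bar>b\<bar>) ^ n" by (intro power_mono) auto
  also have "\<dots> \<le> 2 ^ n * (\<bar>a\<bar> ^ n + \<bar>b\<bar> ^ n)" by (rule power_add_bound) auto
  finally show ?thesis .
qed

lemma integrable_power_add: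
  fixes u v :: "'a \<Rightarrow> 'b::euclidean_space"
  assumes [measurable]: "u \<in> borel_measurable M" "v \<in> borel_measurable M"
    and i: "integrable M (\<lambda>x. norm (u x) ^ q)" "integrable M (\<lambda>x. norm (v x) ^ q)"
  shows "integrable M (\<lambda>x. norm (u x + c *\<^sub>R v x) ^ q)"
proof (rule Bochner_Integration.integrable_bound)
  show "integrable M (\<lambda>x. 2 ^ q * (norm (u x) ^ q + \<bar>c\<bar> ^ q * norm (v x) ^ q))" using i by simp
  show "AE x in M. norm (norm (u x + c *\<^sub>R v x) ^ q) \<le> norm (2 ^ q * (norm (u x) ^ q + \<bar>c\<bar> ^ q * norm (v x) ^ q))"
  proof (intro AE_I2)
    fix x
    have "norm (u x + c *\<^sub>R v x) ^ q \<le> (norm (u x) + norm (c *\<^sub>R v x)) ^ q"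
      by (intro power_mono norm_triangle_ineq) auto
    also have "\<dots> \<le> 2 ^ q * (norm (u x) ^ q + norm (c *\<^sub>R v x) ^ q)" by (intro power_add_bound) auto
    finally show "norm (norm (u x + c *\<^sub>R v x) ^ q) \<le> norm (2 ^ q * (norm (u x) ^ q + \<bar>c\<bar> ^ q * norm (v x) ^ q))"
      by (simp add: power_mult_distrib)
  qed
qed measurable

text \<open>Minkowski from convexity: with a and b above the two norms, (norm u + norm v) / (a + b)
  is the convex combination of norm u / a and norm v / b with weights a / (a + b) and b / (a + b).
  Enlarging the norms by e > 0 keeps the denominators positive when a norm is 0; then e tends to
  0.\<close>

lemma Lq_triangle:
  fixes u v :: "'a \<Rightarrow> 'b::euclidean_space"
  assumes q: "q \<ge> 1" and m: "u \<in> borel_measurable M" "v \<in> borel_measurable M"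
    and i: "integrable M (\<lambda>x. norm (u x) ^ q)" "integrable M (\<lambda>x. norm (v x) ^ q)"
  shows "root q (\<integral>x. norm (u x + v x) ^ q \<partial>M) \<le> root q (\<integral>x. norm (u x) ^ q \<partial>M) + root q (\<integral>x. norm (v x) ^ q \<partial>M)"
proof -
  define A where "A = root q (\<integral>x. norm (u x) ^ q \<partial>M)"
  define B where "B = root q (\<integral>x. norm (v x) ^ q \<partial>M)"
  have n0: "0 \<le> (\<integral>x. norm (w x) ^ q \<partial>M)" for w :: "'a \<Rightarrow> 'b"
    by (intro Bochner_Integration.integral_nonneg) auto
  have AB: "A \<ge> 0" "B \<ge> 0" "A ^ q = (\<integral>x. norm (u x) ^ q \<partial>M)" "B ^ q = (\<integral>x. norm (v x) ^ q \<partial>M)"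
    using q n0 by (auto simp: A_def B_def)
  have eps: "root q (\<integral>x. norm (u x + v x) ^ q \<partial>M) \<le> A + B + 2 * e" if e: "e > 0" for e
  proof -
    define a where "a = A + e"
    define b where "b = B + e"
    have ab: "a > 0" "b > 0" using AB e by (auto simp: a_def b_def)
    have conv: "convex_on {0..} (\<lambda>x::real. x ^ q)"
      using convex_power_odd[of q] convex_on_subset[OF convex_power_even[of q], of "{0..}"] by (cases "even q") auto
    define l where "l = b / (a + b)"
    have l: "0 \<le> l" "l \<le> 1" "1 - l = a / (a + b)" using ab by (auto simp: l_def field_simps)
    have pt: "norm (u x + v x) ^ q \<le> (a + b) ^ q * ((1 - l) / a ^ q * norm (u x) ^ q + l / b ^ q * norm (v x) ^ q)" for x
    proof -
      have "((1 - l) * (norm (u x) / a) + l * (norm (v x) / b)) ^ q \<le> (1 - l) * (norm (u x) / a) ^ q + l * (norm (v x) / b) ^ q"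
        using convex_onD[OF conv l(1,2), of "norm (u x) / a" "norm (v x) / b"] ab by simp
      moreover have "(1 - l) * (norm (u x) / a) + l * (norm (v x) / b) = (norm (u x) + norm (v x)) / (a + b)"
        unfolding l(3) using ab by (simp add: l_def add_divide_distrib)
      ultimately have "((norm (u x) + norm (v x)) / (a + b)) ^ q \<le> (1 - l) / a ^ q * norm (u x) ^ q + l / b ^ q * norm (v x) ^ q"
        by (simp add: power_divide)
      then have "(norm (u x) + norm (v x)) ^ q \<le> (a + b) ^ q * ((1 - l) / a ^ q * norm (u x) ^ q + l / b ^ q * norm (v x) ^ q)"
        using ab by (simp add: power_divide pos_divide_le_eq mult.commute)
      moreover have "norm (u x + v x) ^ q \<le> (norm (u x) + norm (v x)) ^ q" by (intro power_mono norm_triangle_ineq) auto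
      ultimately show ?thesis by linarith
    qed
    have "(\<integral>x. norm (u x + v x) ^ q \<partial>M) \<le> (\<integral>x. (a + b) ^ q * ((1 - l) / a ^ q * norm (u x) ^ q + l / b ^ q * norm (v x) ^ q) \<partial>M)"
      using integrable_power_add[OF m i, of 1] i pt by (intro integral_mono) auto
    also have "\<dots> = (a + b) ^ q * ((1 - l) * (A ^ q / a ^ q) + l * (B ^ q / b ^ q))" using i AB by simp
    also have "\<dots> \<le> (a + b) ^ q * ((1 - l) * 1 + l * 1)"
    proof -
      have "A ^ q \<le> a ^ q" "B ^ q \<le> b ^ q" using AB(1,2) e by (auto simp: a_def b_def intro!: power_mono)
      then have "A ^ q / a ^ q \<le> 1" "B ^ q / b ^ q \<le> 1" using ab by auto
      then show ?thesis using l ab by (intro mult_left_mono add_mono) auto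
    qed
    finally have "(\<integral>x. norm (u x + v x) ^ q \<partial>M) \<le> (a + b) ^ q" by simp
    then have "root q (\<integral>x. norm (u x + v x) ^ q \<partial>M) \<le> root q ((a + b) ^ q)" using q by simp
    also have "root q ((a + b) ^ q) = a + b" using q ab by (intro real_root_power_cancel) auto
    finally show ?thesis by (simp add: a_def b_def)
  qed
  have "root q (\<integral>x. norm (u x + v x) ^ q \<partial>M) \<le> A + B + d" if "d > 0" for d
    using eps[of "d / 2"] that by simp
  then have "root q (\<integral>x. norm (u x + v x) ^ q \<partial>M) \<le> A + B" by (rule field_le_epsilon)
  then show ?thesis by (simp add: A_def B_def)
qed

section \<open>Linear spaces of functions paired with their gradients\<close>

definition dirichlet :: "('a::euclidean_space \<Rightarrow> 'a) \<Rightarrow> real" where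
  "dirichlet G = (\<integral>x. (norm (G x))\<^sup>2 \<partial>lebesgue)"

lemma dirichlet_nonneg: "0 \<le> dirichlet G"
  unfolding dirichlet_def by (intro Bochner_Integration.integral_nonneg) auto

lemma avg_lincomb:
  assumes "f \<in> L1_loc UNIV" "g \<in> L1_loc UNIV" "h > 0"
  shows "cube_avg h (\<lambda>x. f x + c * g x) x = cube_avg h f x + c * cube_avg h g x"
proof -
  have i: "integrable lebesgue (\<lambda>y. indicator (cube h x) y * f y)" "integrable lebesgue (\<lambda>y. indicator (cube h x) y * g y)"
    using cube_integrable[OF assms(1,3), of x] cube_integrable[OF assms(2,3), of x] by auto
  have "(\<integral>y. indicator (cube h x) y * (f y + c * g y) \<partial>lebesgue) =
    (\<integral>y. indicator (cube h x) y * f y + c * (indicator (cube h x) y * g y) \<partial>lebesgue)"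
    by (simp add: algebra_simps)
  also have "\<dots> = (\<integral>y. indicator (cube h x) y * f y \<partial>lebesgue) + c * (\<integral>y. indicator (cube h x) y * g y \<partial>lebesgue)"
    using i by simp
  finally show ?thesis by (simp add: avg_def add_divide_distrib)
qed

lemma box_subset_cube:
  assumes h: "h > 0"
  shows "box (corner (h *\<^sub>R One) x) (corner (h *\<^sub>R One) x + h *\<^sub>R One) \<subseteq> cube h x"
  using hbox_bounds(1)[of "corner (h *\<^sub>R One) x" "h *\<^sub>R One"] h by (subst cell_hbox) auto

lemma cube_meets_dense:
  fixes D :: "'a::euclidean_space set"
  assumes h: "h > 0" and D: "\<And>X. open X \<Longrightarrow> X \<noteq> {} \<Longrightarrow> \<exists>d\<in>D. d \<in> X"
  obtains z where "z \<in> D" "z \<in> cube h x"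
proof -
  have "box (corner (h *\<^sub>R One) x) (corner (h *\<^sub>R One) x + h *\<^sub>R One) \<noteq> {}"
    using h by (simp add: box_ne_empty inner_add_left)
  then obtain z where "z \<in> D" "z \<in> box (corner (h *\<^sub>R One) x) (corner (h *\<^sub>R One) x + h *\<^sub>R One)"
    using D[OF open_box] by blast
  then show thesis using that box_subset_cube[OF h, of x] by blast
qed

text \<open>Each function carries a gradient along, so none has to be chosen. The single closure
  rule \<open>lin\<close> yields sums, differences and multiples. \<open>avg_bound\<close> is an
  inequality of Poincare type for the averages at the one side \<open>h\<close>; through it the
  boundary condition, or vanishing at infinity, enters.\<close>

locale gradient_class =
  fixes V :: "(('a::euclidean_space \<Rightarrow> real) \<times> ('a \<Rightarrow> 'a)) set" and h :: real and C :: real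
  assumes wg: "(f, G) \<in> V \<Longrightarrow> is_weak_gradient UNIV f G"
    and G2: "(f, G) \<in> V \<Longrightarrow> integrable lebesgue (\<lambda>x. (norm (G x))\<^sup>2)"
    and lin: "(f, F) \<in> V \<Longrightarrow> (g, G) \<in> V \<Longrightarrow> ((\<lambda>x. f x + c * g x), (\<lambda>x. F x + c *\<^sub>R G x)) \<in> V"
    and h_pos: "h > 0" and C_nonneg: "C \<ge> 0"
    and avg_bound: "(f, G) \<in> V \<Longrightarrow> (cube_avg h f x)\<^sup>2 \<le> C * dirichlet G"
begin

lemma fL: "(f, G) \<in> V \<Longrightarrow> f \<in> L1_loc UNIV"
  using wg by (auto simp: is_weak_gradient_def)

lemma f_measurable: "(f, G) \<in> V \<Longrightarrow> f \<in> borel_measurable lebesgue"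
  using fL L1_loc_UNIV_measurable by blast

lemma G_measurable: "(f, G) \<in> V \<Longrightarrow> G \<in> borel_measurable lebesgue"
  using wg unfolding is_weak_gradient_def by (blast intro: L1_loc_UNIV_measurable)

text \<open>Each halving changes the squared average by at most a multiple of the energy. The
  constant may grow with \<open>j\<close>, as it serves to bound averages at one fixed scale at a
  time.\<close>

lemma avg_bound_levels:
  "\<exists>C'\<ge>0. \<forall>f G x. (f, G) \<in> V \<longrightarrow> (cube_avg (h / 2 ^ j) f x)\<^sup>2 \<le> C' * dirichlet G"
proof (induction j)
  case 0
  show ?case using avg_bound C_nonneg by auto
next
  case (Suc j)
  then obtain C' where C': "C' \<ge> 0" "\<And>f G x. (f, G) \<in> V \<Longrightarrow> (cube_avg (h / 2 ^ j) f x)\<^sup>2 \<le> C' * dirichlet G" by blast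
  define g where "g = h / 2 ^ j"
  have g: "g > 0" using h_pos by (simp add: g_def)
  define k where "k = (real DIM('a))\<^sup>2 * 4 ^ DIM('a) * (g\<^sup>2 / g ^ DIM('a))"
  have k: "k \<ge> 0" using g by (simp add: k_def)
  have "(cube_avg (h / 2 ^ Suc j) f x)\<^sup>2 \<le> (2 * C' + 2 * k) * dirichlet G" if fG: "(f, G) \<in> V" for f G x
  proof -
    have "(cube_avg (g / 2) f x - cube_avg g f x)\<^sup>2 \<le> k * (\<integral>y. indicator (cube g x) y * (norm (G y))\<^sup>2 \<partial>lebesgue)"
      unfolding k_def by (rule cube_avg_halve_sq[OF wg[OF fG] g G2[OF fG]])
    also have "\<dots> \<le> k * dirichlet G"
      unfolding dirichlet_def using k G2[OF fG] integrable_mult_indicator[OF _ G2[OF fG], of "cube g x"]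
      by (intro mult_left_mono integral_mono) (auto split: split_indicator)
    finally have 1: "(cube_avg (g / 2) f x - cube_avg g f x)\<^sup>2 \<le> k * dirichlet G" .
    have 2: "(cube_avg g f x)\<^sup>2 \<le> C' * dirichlet G" using C'(2)[OF fG] by (simp add: g_def)
    have "(a + b)\<^sup>2 \<le> 2 * a\<^sup>2 + 2 * b\<^sup>2" for a b :: real using sum_squares_bound[of a b] by (simp add: power2_sum)
    from this[of "cube_avg (g / 2) f x - cube_avg g f x" "cube_avg g f x"] 1 2
    have "(cube_avg (g / 2) f x)\<^sup>2 \<le> 2 * (k * dirichlet G) + 2 * (C' * dirichlet G)" by simp
    also have "\<dots> = (2 * C' + 2 * k) * dirichlet G" by (simp add: algebra_simps)
    also have "g / 2 = h / 2 ^ Suc j" by (simp add: g_def)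
    finally show ?thesis .
  qed
  then show ?case using C'(1) k by (intro exI[of _ "2 * C' + 2 * k"]) auto
qed

lemma avg_error:
  assumes p: "p \<ge> 1" and sub: "int p * (int DIM('a) - 2) < int DIM('a)"
  obtains A where "A \<ge> 0" "\<And>f G g. (f, G) \<in> V \<Longrightarrow> g > 0 \<Longrightarrow>
     integrable lebesgue (\<lambda>x. \<bar>f x - cube_avg g f x\<bar> ^ (2 * p)) \<and>
     (\<integral>x. \<bar>f x - cube_avg g f x\<bar> ^ (2 * p) \<partial>lebesgue) \<le> A * ((g\<^sup>2 / g ^ DIM('a)) ^ p * g ^ DIM('a)) * dirichlet G ^ p"
proof -
  obtain A where A: "A \<ge> 0" "\<And>f (G :: 'a \<Rightarrow> 'a) h. is_weak_gradient UNIV f G \<Longrightarrow>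
     integrable lebesgue (\<lambda>y. (norm (G y))\<^sup>2) \<Longrightarrow> h > 0 \<Longrightarrow>
     (\<integral>\<^sup>+x. ennreal (\<bar>f x - cube_avg h f x\<bar> ^ (2 * p)) \<partial>lebesgue)
     \<le> ennreal (A * ((h\<^sup>2 / h ^ DIM('a)) ^ p * h ^ DIM('a)) * (\<integral>y. (norm (G y))\<^sup>2 \<partial>lebesgue) ^ p)"
    using cube_avg_error[OF p sub] by blast
  show thesis
  proof (rule that[OF A(1)])
    fix f G and g :: real assume fG: "(f, G) \<in> V" and g: "g > 0"
    have m: "(\<lambda>x. \<bar>f x - cube_avg g f x\<bar> ^ (2 * p)) \<in> borel_measurable lebesgue"
      using f_measurable[OF fG] avg_measurable[OF f_measurable[OF fG]] by (intro borel_measurable_power borel_measurable_abs borel_measurable_diff)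
    have b0: "0 \<le> A * ((g\<^sup>2 / g ^ DIM('a)) ^ p * g ^ DIM('a)) * dirichlet G ^ p"
      using A(1) g dirichlet_nonneg[of G] by simp
    note b = A(2)[OF wg[OF fG] G2[OF fG] g, folded dirichlet_def]
    show "integrable lebesgue (\<lambda>x. \<bar>f x - cube_avg g f x\<bar> ^ (2 * p)) \<and>
     (\<integral>x. \<bar>f x - cube_avg g f x\<bar> ^ (2 * p) \<partial>lebesgue) \<le> A * ((g\<^sup>2 / g ^ DIM('a)) ^ p * g ^ DIM('a)) * dirichlet G ^ p"
      using nn_bound_integrable[OF m _ b b0] by auto
  qed
qed

lemma ball_indicator_integrable: "integrable lebesgue (\<lambda>x::'a. indicator (cball 0 R) x :: real)"
  using fmeasurableD2[OF lmeasurable_cball[of "0::'a" R]] by (intro integrable_real_indicator) (auto simp: less_top)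

text \<open>On the ball \<open>f\<close> is split into its averaging error, bounded by
  \<open>avg_error\<close>, and its average at side \<open>h\<close>, bounded by
  \<open>avg_bound\<close>.\<close>

lemma local_bound:
  assumes p: "p \<ge> 1" and sub: "int p * (int DIM('a) - 2) < int DIM('a)"
  obtains A where "A \<ge> 0" "\<And>f G. (f, G) \<in> V \<Longrightarrow>
     integrable lebesgue (\<lambda>x. indicator (cball 0 R) x * \<bar>f x\<bar> ^ (2 * p)) \<and>
     (\<integral>x. indicator (cball 0 R) x * \<bar>f x\<bar> ^ (2 * p) \<partial>lebesgue) \<le> A * dirichlet G ^ p"
proof -
  obtain A where A: "A \<ge> 0" "\<And>f G g. (f, G) \<in> V \<Longrightarrow> g > 0 \<Longrightarrow>
     integrable lebesgue (\<lambda>x. \<bar>f x - cube_avg g f x\<bar> ^ (2 * p)) \<and>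
     (\<integral>x. \<bar>f x - cube_avg g f x\<bar> ^ (2 * p) \<partial>lebesgue) \<le> A * ((g\<^sup>2 / g ^ DIM('a)) ^ p * g ^ DIM('a)) * dirichlet G ^ p"
    using avg_error[OF p sub] by blast
  define k where "k = (h\<^sup>2 / h ^ DIM('a)) ^ p * h ^ DIM('a)"
  define m where "m = (\<integral>x. indicator (cball (0::'a) R) x \<partial>lebesgue :: real)"
  have m: "m \<ge> 0" unfolding m_def by (intro Bochner_Integration.integral_nonneg) auto
  have k: "k \<ge> 0" using h_pos by (simp add: k_def)
  define A' where "A' = 2 ^ (2 * p) * (A * k + C ^ p * m)"
  have A': "A' \<ge> 0" using A k m C_nonneg by (simp add: A'_def)
  show thesis
  proof (rule that[OF A'], intro conjI)
    fix f G assume fG: "(f, G) \<in> V"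
    let ?u = "\<lambda>x. 2 ^ (2 * p) * (\<bar>f x - cube_avg h f x\<bar> ^ (2 * p) + (C * dirichlet G) ^ p * indicator (cball 0 R) x)"
    note a = A(2)[OF fG h_pos, folded k_def]
    have pt: "indicator (cball 0 R) x * \<bar>f x\<bar> ^ (2 * p) \<le> ?u x" for x
    proof (cases "x \<in> cball 0 R")
      case True
      have "\<bar>f x\<bar> ^ (2 * p) \<le> (\<bar>f x - cube_avg h f x\<bar> + \<bar>cube_avg h f x\<bar>) ^ (2 * p)" by (intro power_mono) auto
      also have "\<dots> \<le> 2 ^ (2 * p) * (\<bar>f x - cube_avg h f x\<bar> ^ (2 * p) + \<bar>cube_avg h f x\<bar> ^ (2 * p))" by (intro power_add_bound) auto
      also have "\<bar>cube_avg h f x\<bar> ^ (2 * p) = ((cube_avg h f x)\<^sup>2) ^ p" by (simp add: power_mult)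
      also have "((cube_avg h f x)\<^sup>2) ^ p \<le> (C * dirichlet G) ^ p" using avg_bound[OF fG] by (intro power_mono) auto
      finally show ?thesis using True by simp
    qed (use C_nonneg dirichlet_nonneg in simp)
    have ui: "integrable lebesgue ?u" using a ball_indicator_integrable by simp
    show fi: "integrable lebesgue (\<lambda>x. indicator (cball 0 R) x * \<bar>f x\<bar> ^ (2 * p))"
    proof (rule Bochner_Integration.integrable_bound[OF ui])
      show "(\<lambda>x. indicator (cball 0 R) x * \<bar>f x\<bar> ^ (2 * p)) \<in> borel_measurable lebesgue"
        using f_measurable[OF fG] by (intro borel_measurable_times borel_measurable_power borel_measurable_abs borel_measurable_indicator) auto
      show "AE x in lebesgue. norm (indicator (cball 0 R) x * \<bar>f x\<bar> ^ (2 * p)) \<le> norm (?u x)"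
      proof (intro AE_I2)
        fix x
        have "0 \<le> indicator (cball 0 R) x * \<bar>f x\<bar> ^ (2 * p)" by simp
        then show "norm (indicator (cball 0 R) x * \<bar>f x\<bar> ^ (2 * p)) \<le> norm (?u x)"
          using pt[of x] unfolding real_norm_def by linarith
      qed
    qed
    have "(\<integral>x. indicator (cball 0 R) x * \<bar>f x\<bar> ^ (2 * p) \<partial>lebesgue) \<le> (\<integral>x. ?u x \<partial>lebesgue)"
      using fi ui pt by (intro integral_mono) auto
    also have "\<dots> = 2 ^ (2 * p) * ((\<integral>x. \<bar>f x - cube_avg h f x\<bar> ^ (2 * p) \<partial>lebesgue) + (C * dirichlet G) ^ p * m)"
      using a ball_indicator_integrable[of R] by (simp add: m_def del: integral_indicator)
    also have "\<dots> \<le> 2 ^ (2 * p) * (A * k * dirichlet G ^ p + (C * dirichlet G) ^ p * m)"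
      using a by simp
    also have "\<dots> = A' * dirichlet G ^ p" by (simp add: A'_def power_mult_distrib algebra_simps)
    finally show "(\<integral>x. indicator (cball 0 R) x * \<bar>f x\<bar> ^ (2 * p) \<partial>lebesgue) \<le> A' * dirichlet G ^ p" .
  qed
qed

lemma diff_in_V:
  assumes "(f, F) \<in> V" "(g, G) \<in> V"
  shows "((\<lambda>x. f x - g x), (\<lambda>x. F x - G x)) \<in> V"
  using lin[OF assms, of "-1"] by simp

lemma scale_in_V:
  assumes "(f, F) \<in> V"
  shows "((\<lambda>x. c * f x), (\<lambda>x. c *\<^sub>R F x)) \<in> V"
  \<comment> \<open>The multiple is written as \<open>f + (c - 1) * f\<close>.\<close>
  using lin[OF assms assms, of "c - 1"] by (simp add: algebra_simps)

lemma dirichlet_parallelogram: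
  assumes "(f, F) \<in> V" "(g, G) \<in> V"
  shows "dirichlet (\<lambda>x. F x - G x) + dirichlet (\<lambda>x. F x + G x) = 2 * dirichlet F + 2 * dirichlet G"
proof -
  have i: "integrable lebesgue (\<lambda>x. (norm (F x + G x))\<^sup>2)" "integrable lebesgue (\<lambda>x. (norm (F x - G x))\<^sup>2)"
    using G2[OF diff_in_V[OF assms]] G2[OF lin[OF assms, of 1]] by auto
  have "dirichlet (\<lambda>x. F x - G x) + dirichlet (\<lambda>x. F x + G x) = (\<integral>x. (norm (F x - G x))\<^sup>2 + (norm (F x + G x))\<^sup>2 \<partial>lebesgue)"
    using i by (simp add: dirichlet_def)
  also have "\<dots> = (\<integral>x. 2 * (norm (F x))\<^sup>2 + 2 * (norm (G x))\<^sup>2 \<partial>lebesgue)"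
    by (intro Bochner_Integration.integral_cong refl)
       (simp add: power2_norm_eq_inner inner_add_left inner_add_right inner_diff_left inner_diff_right inner_commute)
  also have "\<dots> = 2 * dirichlet F + 2 * dirichlet G" using G2 assms by (simp add: dirichlet_def)
  finally show ?thesis .
qed

lemma dirichlet_scale: "dirichlet (\<lambda>x. c *\<^sub>R F x) = c\<^sup>2 * dirichlet F"
  by (simp add: dirichlet_def power_mult_distrib)

text \<open>Rellich--Kondrachov in the only form needed: the averages at dyadic scales take countably many
  values, so a diagonal subsequence makes all of them converge, and the averaging error is uniformly
  small at small scales.\<close>

lemma compactness:
  assumes p: "p \<ge> 1" and sub: "int p * (int DIM('a) - 2) < int DIM('a)"
    and V: "\<And>k. (f k, G k) \<in> V" and M: "\<And>k. dirichlet (G k) \<le> M"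
  shows "\<exists>s :: nat \<Rightarrow> nat. strict_mono s \<and>
    (\<forall>e>0. \<exists>N. \<forall>k\<ge>N. \<forall>l\<ge>N. (\<integral>x. indicator (cball 0 R) x * \<bar>f (s k) x - f (s l) x\<bar> ^ (2 * p) \<partial>lebesgue) < e)"
proof -
  have M0: "M \<ge> 0" using M[of 0] dirichlet_nonneg[of "G 0"] by linarith
  obtain D :: "'a set" where D: "countable D" "\<And>X. open X \<Longrightarrow> X \<noteq> {} \<Longrightarrow> \<exists>d\<in>D. d \<in> X"
    by (rule countable_dense_setE) blast
  have "\<exists>b>0. \<forall>k x. \<bar>cube_avg (h / 2 ^ j) (f k) x\<bar> \<le> b" for j
  proof -
    obtain C' where C': "C' \<ge> 0" "\<And>f G x. (f, G) \<in> V \<Longrightarrow> (cube_avg (h / 2 ^ j) f x)\<^sup>2 \<le> C' * dirichlet G"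
      using avg_bound_levels by blast
    have "\<bar>cube_avg (h / 2 ^ j) (f k) x\<bar> \<le> sqrt (C' * M) + 1" for k x
    proof -
      have "(cube_avg (h / 2 ^ j) (f k) x)\<^sup>2 \<le> C' * M"
        using C'(2)[OF V[of k], of x] mult_left_mono[OF M[of k] C'(1)] by linarith
      then have "\<bar>cube_avg (h / 2 ^ j) (f k) x\<bar> \<le> sqrt (C' * M)" by (metis real_sqrt_abs real_sqrt_le_mono)
      then show ?thesis by simp
    qed
    then show ?thesis using C'(1) M0 by (intro exI[of _ "sqrt (C' * M) + 1"]) (auto intro!: add_nonneg_pos)
  qed
  then obtain b where b: "\<And>j. b j > 0" "\<And>j k x. \<bar>cube_avg (h / 2 ^ j) (f k) x\<bar> \<le> b j" by metis
  obtain s where s: "strict_mono (s :: nat \<Rightarrow> nat)"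
    and conv: "\<And>z. z \<in> D \<times> (UNIV :: nat set) \<Longrightarrow>
      \<exists>l. (\<lambda>k. cube_avg (h / 2 ^ snd z) (f (s k)) (fst z) / b (snd z)) \<longlonglongrightarrow> l"
  \<comment> \<open>Dividing by \<open>b j\<close> brings all scales under the common bound 1 that
    the diagonal selection asks for.\<close>
  proof (rule function_convergent_subsequence[of "D \<times> (UNIV :: nat set)"
        "\<lambda>k z. cube_avg (h / 2 ^ snd z) (f k) (fst z) / b (snd z)" 1])
    show "countable (D \<times> (UNIV :: nat set))" using D(1) by auto
    show "norm (cube_avg (h / 2 ^ snd z) (f k) (fst z) / b (snd z)) \<le> 1" if "z \<in> D \<times> (UNIV :: nat set)" for k z
      using b(1)[of "snd z"] b(2)[of "snd z" k "fst z"] by (simp add: abs_of_pos)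
  qed blast
  have "\<exists>l. (\<lambda>k. cube_avg (h / 2 ^ j) (f (s k)) x) \<longlonglongrightarrow> l" for j x
  proof -
    \<comment> \<open>The average is constant on the cell of \<open>x\<close>, and this cell
      contains a point of the countable dense set \<open>D\<close>.\<close>
    obtain z where z: "z \<in> D" "z \<in> cube (h / 2 ^ j) x" using cube_meets_dense[OF halving_pos[OF h_pos] D(2)] by blast
    obtain l where "(\<lambda>k. cube_avg (h / 2 ^ j) (f (s k)) z / b j) \<longlonglongrightarrow> l" using conv[of "(z, j)"] z by auto
    then have "(\<lambda>k. b j * (cube_avg (h / 2 ^ j) (f (s k)) z / b j)) \<longlonglongrightarrow> b j * l" by (intro tendsto_mult_left)
    moreover have "b j * (cube_avg (h / 2 ^ j) (f (s k)) z / b j) = cube_avg (h / 2 ^ j) (f (s k)) x" for k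
      using b(1)[of j] avg_eq[OF z(2)] by simp
    ultimately show ?thesis by auto
  qed
  then obtain a where a: "\<And>j x. (\<lambda>k. cube_avg (h / 2 ^ j) (f (s k)) x) \<longlonglongrightarrow> a j x" by metis
  have am: "a j \<in> borel_measurable lebesgue" for j
    by (rule borel_measurable_LIMSEQ_metric[OF _ a]) (rule avg_measurable[OF f_measurable[OF V]])
  have ab: "\<bar>a j x\<bar> \<le> b j" for j x
    by (rule tendsto_upperbound[OF tendsto_rabs[OF a]]) (use b(2) in auto)
  define E where "E j k = (\<integral>x. indicator (cball 0 R) x * \<bar>cube_avg (h / 2 ^ j) (f (s k)) x - a j x\<bar> ^ (2 * p) \<partial>lebesgue)" for j k
  have dm: "(\<lambda>x. indicator (cball 0 R) x * \<bar>cube_avg (h / 2 ^ j) (f (s k)) x - a j x\<bar> ^ (2 * p)) \<in> borel_measurable lebesgue" for j k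
    using avg_measurable[OF f_measurable[OF V]] am
    by (intro borel_measurable_times borel_measurable_power borel_measurable_abs borel_measurable_diff borel_measurable_indicator) auto
  have dbd: "norm (indicator (cball 0 R) x * \<bar>cube_avg (h / 2 ^ j) (f (s k)) x - a j x\<bar> ^ (2 * p)) \<le> (2 * b j) ^ (2 * p) * indicator (cball 0 R) x" for j k x
  proof -
    have "\<bar>cube_avg (h / 2 ^ j) (f (s k)) x - a j x\<bar> \<le> 2 * b j" using b(2)[of j "s k" x] ab[of j x] by linarith
    then have "\<bar>cube_avg (h / 2 ^ j) (f (s k)) x - a j x\<bar> ^ (2 * p) \<le> (2 * b j) ^ (2 * p)" by (intro power_mono) auto
    then show ?thesis by (auto split: split_indicator)
  qed
  have di: "integrable lebesgue (\<lambda>x. indicator (cball 0 R) x * \<bar>cube_avg (h / 2 ^ j) (f (s k)) x - a j x\<bar> ^ (2 * p))" for j k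
    by (rule Bochner_Integration.integrable_bound[OF integrable_mult_right[OF ball_indicator_integrable[of R], of "(2 * b j) ^ (2 * p)"] dm])
       (use dbd in \<open>auto intro: order_trans\<close>)
  have E: "(\<lambda>k. E j k) \<longlonglongrightarrow> 0" for j
  proof -
    have "(\<lambda>k. E j k) \<longlonglongrightarrow> (\<integral>x. (0::real) \<partial>(lebesgue::'a measure))"
      unfolding E_def
    proof (rule integral_dominated_convergence[where w = "\<lambda>x. (2 * b j) ^ (2 * p) * indicator (cball 0 R) x"])
      show "AE x in lebesgue. (\<lambda>k. indicator (cball 0 R) x * \<bar>cube_avg (h / 2 ^ j) (f (s k)) x - a j x\<bar> ^ (2 * p)) \<longlonglongrightarrow> 0"
      proof (intro AE_I2)
        fix x
        have "(\<lambda>k. indicator (cball 0 R) x * \<bar>cube_avg (h / 2 ^ j) (f (s k)) x - a j x\<bar> ^ (2 * p)) \<longlonglongrightarrow> indicator (cball 0 R) x * \<bar>a j x - a j x\<bar> ^ (2 * p)"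
          by (intro tendsto_intros a)
        then show "(\<lambda>k. indicator (cball 0 R) x * \<bar>cube_avg (h / 2 ^ j) (f (s k)) x - a j x\<bar> ^ (2 * p)) \<longlonglongrightarrow> 0"
          using p by (simp add: zero_power)
      qed
    qed (use dm dbd ball_indicator_integrable in auto)
    then show ?thesis by simp
  qed
  obtain A where A: "A \<ge> 0" "\<And>f G g. (f, G) \<in> V \<Longrightarrow> g > 0 \<Longrightarrow>
     integrable lebesgue (\<lambda>x. \<bar>f x - cube_avg g f x\<bar> ^ (2 * p)) \<and>
     (\<integral>x. \<bar>f x - cube_avg g f x\<bar> ^ (2 * p) \<partial>lebesgue) \<le> A * ((g\<^sup>2 / g ^ DIM('a)) ^ p * g ^ DIM('a)) * dirichlet G ^ p"
    using avg_error[OF p sub] by blast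
  define \<kappa> where "\<kappa> j = ((h / 2 ^ j)\<^sup>2 / (h / 2 ^ j) ^ DIM('a)) ^ p * (h / 2 ^ j) ^ DIM('a)" for j :: nat
  have \<kappa>0: "\<kappa> j \<ge> 0" for j using h_pos by (simp add: \<kappa>_def)
  have \<kappa>: "\<kappa> \<longlonglongrightarrow> 0"
  proof -
    have "(\<lambda>j. (h\<^sup>2 / h ^ DIM('a)) ^ p * h ^ DIM('a) * ((2 ^ DIM('a) / 4) ^ p / 2 ^ DIM('a)) ^ j) \<longlonglongrightarrow>
       (h\<^sup>2 / h ^ DIM('a)) ^ p * h ^ DIM('a) * 0"
      using scale_ratio_less_1[OF sub] by (intro tendsto_mult_left LIMSEQ_realpow_zero) auto
    then show ?thesis unfolding \<kappa>_def[abs_def] scale_halving[OF h_pos] by simp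
  qed
  let ?P = "2 ^ (2 * p) :: real"
  \<comment> \<open>The difference of two members consists of its averaging error at scale
    \<open>j\<close>, small uniformly in \<open>k\<close> and \<open>l\<close>, and a difference of
    averages, each compared with the limit \<open>a j\<close>.\<close>
  have main: "(\<integral>x. indicator (cball 0 R) x * \<bar>f (s k) x - f (s l) x\<bar> ^ (2 * p) \<partial>lebesgue)
     \<le> ?P * (A * \<kappa> j * (4 * M) ^ p + ?P * (E j k + E j l))" for j k l
  proof -
    define u where "u x = f (s k) x - f (s l) x" for x
    define U where "U x = G (s k) x - G (s l) x" for x
    have uV: "(u, U) \<in> V" using diff_in_V[OF V[of "s k"] V[of "s l"]] by (simp add: u_def[abs_def] U_def[abs_def])
    \<comment> \<open>The parallelogram law, with the energy of the sum dropped.\<close>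
    have dU: "dirichlet U \<le> 4 * M"
      using dirichlet_parallelogram[OF V[of "s k"] V[of "s l"]] M[of "s k"] M[of "s l"]
        dirichlet_nonneg[of "\<lambda>x. G (s k) x + G (s l) x"] by (simp add: U_def[abs_def])
    have avu: "cube_avg (h / 2 ^ j) u x = cube_avg (h / 2 ^ j) (f (s k)) x - cube_avg (h / 2 ^ j) (f (s l)) x" for x
      using avg_lincomb[OF fL[OF V[of "s k"]] fL[OF V[of "s l"]] halving_pos[OF h_pos, of j], of "-1" x] by (simp add: u_def[abs_def])
    note Au = A(2)[OF uV halving_pos[OF h_pos, of j], folded \<kappa>_def]
    let ?a = "\<lambda>k x. indicator (cball 0 R) x * \<bar>cube_avg (h / 2 ^ j) (f (s k)) x - a j x\<bar> ^ (2 * p)"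
    let ?w = "\<lambda>x. ?P * (\<bar>u x - cube_avg (h / 2 ^ j) u x\<bar> ^ (2 * p) + ?P * (?a k x + ?a l x))"
    have wi: "integrable lebesgue ?w" using Au di by auto
    have pt: "indicator (cball 0 R) x * \<bar>u x\<bar> ^ (2 * p) \<le> ?w x" for x
    proof (cases "x \<in> cball 0 R")
      case True
      have "\<bar>u x\<bar> ^ (2 * p) \<le> (\<bar>u x - cube_avg (h / 2 ^ j) u x\<bar> + \<bar>cube_avg (h / 2 ^ j) u x\<bar>) ^ (2 * p)" by (intro power_mono) auto
      also have "\<dots> \<le> ?P * (\<bar>u x - cube_avg (h / 2 ^ j) u x\<bar> ^ (2 * p) + \<bar>cube_avg (h / 2 ^ j) u x\<bar> ^ (2 * p))"
        by (intro power_add_bound) auto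
      also have "\<bar>cube_avg (h / 2 ^ j) u x\<bar> ^ (2 * p) \<le> ?P * (?a k x + ?a l x)"
        using abs_diff_power_bound[of "cube_avg (h / 2 ^ j) (f (s k)) x - a j x" "cube_avg (h / 2 ^ j) (f (s l)) x - a j x" "2 * p"] True
        by (simp add: avu)
      finally show ?thesis using True by simp
    qed (auto intro!: add_nonneg_nonneg mult_nonneg_nonneg)
    have "integrable lebesgue (\<lambda>x. indicator (cball 0 R) x * \<bar>u x\<bar> ^ (2 * p))"
      using local_bound[OF p sub, of R] uV by metis
    then have "(\<integral>x. indicator (cball 0 R) x * \<bar>u x\<bar> ^ (2 * p) \<partial>lebesgue) \<le> (\<integral>x. ?w x \<partial>lebesgue)"
      using wi pt by (intro integral_mono) auto
    also have "\<dots> = ?P * ((\<integral>x. \<bar>u x - cube_avg (h / 2 ^ j) u x\<bar> ^ (2 * p) \<partial>lebesgue) + ?P * (E j k + E j l))"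
      using Au di[of j k] di[of j l] by (simp add: E_def)
    also have "\<dots> \<le> ?P * (A * \<kappa> j * (4 * M) ^ p + ?P * (E j k + E j l))"
    proof -
      have "A * \<kappa> j * dirichlet U ^ p \<le> A * \<kappa> j * (4 * M) ^ p"
        using A(1) \<kappa>0[of j] dU dirichlet_nonneg[of U] by (intro mult_left_mono power_mono) auto
      then show ?thesis using Au by simp
    qed
    finally show ?thesis by (simp add: u_def)
  qed
  show ?thesis
  proof (intro exI[of _ s] conjI s allI impI)
    fix e :: real assume e: "e > 0"
    \<comment> \<open>The scale \<open>j\<close> is fixed through the averaging error first; only
      then is \<open>N\<close> chosen for the averages at that scale.\<close>
    have "(\<lambda>j. ?P * (A * \<kappa> j * (4 * M) ^ p)) \<longlonglongrightarrow> ?P * (A * 0 * (4 * M) ^ p)"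
      by (intro tendsto_intros \<kappa>)
    then have "\<forall>\<^sub>F j in sequentially. ?P * (A * \<kappa> j * (4 * M) ^ p) < e / 2"
      by (rule order_tendstoD(2)) (use e in simp)
    then obtain j where j: "?P * (A * \<kappa> j * (4 * M) ^ p) < e / 2" by (auto simp: eventually_sequentially)
    have "(\<lambda>k. ?P * ?P * E j k) \<longlonglongrightarrow> ?P * ?P * 0" by (intro tendsto_intros E)
    then have "\<forall>\<^sub>F k in sequentially. ?P * ?P * E j k < e / 4"
      by (rule order_tendstoD(2)) (use e in simp)
    then obtain N where N: "\<And>k. k \<ge> N \<Longrightarrow> ?P * ?P * E j k < e / 4" by (auto simp: eventually_sequentially)
    have "(\<integral>x. indicator (cball 0 R) x * \<bar>f (s k) x - f (s l) x\<bar> ^ (2 * p) \<partial>lebesgue) < e" if "k \<ge> N" "l \<ge> N" for k l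
      using main[of k l j] j N[OF that(1)] N[OF that(2)] by (simp add: algebra_simps)
    then show "\<exists>N. \<forall>k\<ge>N. \<forall>l\<ge>N. (\<integral>x. indicator (cball 0 R) x * \<bar>f (s k) x - f (s l) x\<bar> ^ (2 * p) \<partial>lebesgue) < e" by blast
  qed
qed

end

section \<open>Limits of weak gradients\<close>

text \<open>The polynomial a + 2 t b + t^2 c is the integral of a square and hence nonnegative for
  all t; its value at t = -b / c is the inequality, and c = 0 is treated apart.\<close>

lemma integral_cauchy_schwarz:
  fixes u v :: "'a \<Rightarrow> real"
  assumes [measurable]: "u \<in> borel_measurable M" "v \<in> borel_measurable M"
    and i: "integrable M (\<lambda>x. (u x)\<^sup>2)" "integrable M (\<lambda>x. (v x)\<^sup>2)"
  shows "integrable M (\<lambda>x. u x * v x)"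
    and "(\<integral>x. u x * v x \<partial>M)\<^sup>2 \<le> (\<integral>x. (u x)\<^sup>2 \<partial>M) * (\<integral>x. (v x)\<^sup>2 \<partial>M)"
proof -
  show uv: "integrable M (\<lambda>x. u x * v x)"
  proof (rule Bochner_Integration.integrable_bound)
    show "integrable M (\<lambda>x. (u x)\<^sup>2 + (v x)\<^sup>2)" using i by simp
    show "AE x in M. norm (u x * v x) \<le> norm ((u x)\<^sup>2 + (v x)\<^sup>2)"
    proof (intro AE_I2)
      fix x
      have "2 * \<bar>u x\<bar> * \<bar>v x\<bar> \<le> \<bar>u x\<bar>\<^sup>2 + \<bar>v x\<bar>\<^sup>2" by (rule sum_squares_bound)
      moreover have "0 \<le> \<bar>u x\<bar> * \<bar>v x\<bar>" by simp
      ultimately have "\<bar>u x\<bar> * \<bar>v x\<bar> \<le> (u x)\<^sup>2 + (v x)\<^sup>2" by (simp only: power2_abs)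
      then show "norm (u x * v x) \<le> norm ((u x)\<^sup>2 + (v x)\<^sup>2)" by (simp add: abs_mult)
    qed
  qed measurable
  define a where "a = (\<integral>x. (u x)\<^sup>2 \<partial>M)"
  define b where "b = (\<integral>x. u x * v x \<partial>M)"
  define c where "c = (\<integral>x. (v x)\<^sup>2 \<partial>M)"
  have q: "0 \<le> a + 2 * t * b + t\<^sup>2 * c" for t
  proof -
    have "0 \<le> (\<integral>x. (u x + t * v x)\<^sup>2 \<partial>M)" by (intro Bochner_Integration.integral_nonneg) auto
    also have "\<dots> = (\<integral>x. (u x)\<^sup>2 + 2 * t * (u x * v x) + t\<^sup>2 * (v x)\<^sup>2 \<partial>M)"
      by (intro Bochner_Integration.integral_cong) (auto simp: power2_sum power_mult_distrib algebra_simps)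
    also have "\<dots> = a + 2 * t * b + t\<^sup>2 * c" using i uv by (simp add: a_def b_def c_def)
    finally show ?thesis .
  qed
  have c0: "c \<ge> 0" unfolding c_def by (intro Bochner_Integration.integral_nonneg) auto
  have "b\<^sup>2 \<le> a * c"
  proof (cases "c = 0")
    case True
    have "b = 0"
    proof (rule ccontr)
      assume b: "b \<noteq> 0"
      \<comment> \<open>With c = 0 the polynomial equals -1 at this t.\<close>
      show False using q[of "- (a + 1) / (2 * b)"] b True by (simp add: field_simps)
    qed
    then show ?thesis using True by simp
  next
    case False
    then have c: "c > 0" using c0 by simp
    have "0 \<le> (a + 2 * (- b / c) * b + (- b / c)\<^sup>2 * c) * c" using q[of "- b / c"] c by (intro mult_nonneg_nonneg) auto
    also have "\<dots> = a * c - b\<^sup>2" using c by (simp add: field_simps power2_eq_square)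
    finally show ?thesis by simp
  qed
  then show "(\<integral>x. u x * v x \<partial>M)\<^sup>2 \<le> (\<integral>x. (u x)\<^sup>2 \<partial>M) * (\<integral>x. (v x)\<^sup>2 \<partial>M)"
    by (simp add: a_def b_def c_def)
qed

text \<open>Completeness along fast sequences: every \<open>u j - v\<close> is dominated by twice
  the majorant from \<open>fast_convergence\<close>, so almost everywhere convergence becomes
  convergence in mean of order q.\<close>

lemma fast_convergence_Lq:
  fixes u :: "nat \<Rightarrow> 'a \<Rightarrow> 'b::euclidean_space"
  assumes q: "q \<ge> 1" and u[measurable]: "\<And>j. u j \<in> borel_measurable M"
    and C: "C \<ge> 0" and r: "0 < r" "r < 1"
    and i0: "integrable M (\<lambda>x. norm (u 0 x) ^ q)"
    and d: "\<And>j. (\<integral>\<^sup>+x. ennreal (norm (u (Suc j) x - u j x) ^ q) \<partial>M) \<le> ennreal (C * r ^ j)"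
  shows "\<exists>v. v \<in> borel_measurable M \<and> (AE x in M. (\<lambda>j. u j x) \<longlonglongrightarrow> v x) \<and>
    integrable M (\<lambda>x. norm (v x) ^ q) \<and> (\<forall>j. integrable M (\<lambda>x. norm (u j x - v x) ^ q)) \<and>
    (\<lambda>j. \<integral>x. norm (u j x - v x) ^ q \<partial>M) \<longlonglongrightarrow> 0"
proof -
  obtain W v where W[measurable]: "W \<in> borel_measurable M" and v[measurable]: "v \<in> borel_measurable M" and W0: "\<And>x. 0 \<le> W x"
    and lim: "AE x in M. (\<lambda>j. u j x) \<longlonglongrightarrow> v x"
    and bd: "AE x in M. \<forall>j. norm (u j x - u 0 x) \<le> W x"
    and Wi: "(\<integral>\<^sup>+x. ennreal (W x ^ q) \<partial>M) \<le> ennreal (C / (1 - root q r) ^ q)"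
    using fast_convergence[OF q u C r d] by blast
  have Wint: "integrable M (\<lambda>x. W x ^ q)"
    using Wi W0 by (intro integrableI_nonneg) (auto intro: le_less_trans)
  have bd2: "AE x in M. \<forall>j. norm (u j x - v x) \<le> 2 * W x"
    using lim bd
  proof eventually_elim
    case (elim x)
    have "norm (v x - u 0 x) \<le> W x"
    proof (rule tendsto_upperbound)
      show "(\<lambda>j. norm (u j x - u 0 x)) \<longlonglongrightarrow> norm (v x - u 0 x)"
        using elim(1) by (intro tendsto_intros)
    qed (use elim(2) in auto)
    then show ?case using elim(2) norm_triangle_ineq4[of "u j x - u 0 x" "v x - u 0 x" for j]
      by (smt (verit, best) diff_diff_eq2 diff_add_cancel)
  qed
  have W2: "integrable M (\<lambda>x. (2 * W x) ^ q)" using Wint by (simp add: power_mult_distrib)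
  have bd3: "AE x in M. norm (norm (u j x - v x) ^ q) \<le> (2 * W x) ^ q" for j
    using bd2
  proof eventually_elim
    case (elim x)
    show ?case using power_mono[OF elim[rule_format, of j], of q] by simp
  qed
  have di: "integrable M (\<lambda>x. norm (u j x - v x) ^ q)" for j
  proof (rule Bochner_Integration.integrable_bound[OF W2])
    show "AE x in M. norm (norm (u j x - v x) ^ q) \<le> norm ((2 * W x) ^ q)"
      using bd3[of j] by eventually_elim (use W0 in auto)
  qed measurable
  have "(\<lambda>j. \<integral>x. norm (u j x - v x) ^ q \<partial>M) \<longlonglongrightarrow> (\<integral>x. 0 \<partial>M)"
  proof (rule integral_dominated_convergence[where w = "\<lambda>x. (2 * W x) ^ q"])
    show "AE x in M. (\<lambda>j. norm (u j x - v x) ^ q) \<longlonglongrightarrow> 0"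
      using lim
    proof eventually_elim
      case (elim x)
      have "(\<lambda>j. norm (u j x - v x) ^ q) \<longlonglongrightarrow> norm (v x - v x) ^ q" by (intro tendsto_intros elim)
      then show ?case using q by (simp add: zero_power)
    qed
  qed (use W2 bd3 in auto)
  moreover have "integrable M (\<lambda>x. norm (v x) ^ q)"
    using integrable_power_add[of "u 0" M "\<lambda>x. u 0 x - v x" q "-1"] i0 di[of 0] by simp
  ultimately show ?thesis using lim di v by (intro exI[of _ v]) simp
qed

lemma square_locally_integrable_L1_loc:
  fixes g :: "'a::euclidean_space \<Rightarrow> 'b::euclidean_space"
  assumes m: "g \<in> borel_measurable lebesgue"
    and i: "\<And>R. integrable lebesgue (\<lambda>x. indicator (cball 0 R) x * (norm (g x))\<^sup>2)"
  shows "g \<in> L1_loc UNIV"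
  unfolding L1_loc_def
proof (intro CollectI conjI allI impI)
  show "g \<in> borel_measurable (lebesgue_on UNIV)" using m by (simp add: lebesgue_on_UNIV_eq)
  fix K :: "'a set" assume K: "compact K \<and> K \<subseteq> UNIV"
  then obtain R where R: "\<forall>x\<in>K. norm x \<le> R" using compact_imp_bounded[of K] by (auto simp: bounded_iff)
  have "integrable lebesgue (\<lambda>x. indicator K x *\<^sub>R g x)"
  proof (rule Bochner_Integration.integrable_bound)
    have "integrable lebesgue (\<lambda>x::'a. indicator (cball 0 R) x :: real)"
      using fmeasurableD2[OF lmeasurable_cball[of "0::'a" R]] by (intro integrable_real_indicator) (auto simp: less_top)
    then show "integrable lebesgue (\<lambda>x. indicator (cball 0 R) x + indicator (cball 0 R) x * (norm (g x))\<^sup>2)"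
      using i[of R] by (rule Bochner_Integration.integrable_add)
    show "(\<lambda>x. indicator K x *\<^sub>R g x) \<in> borel_measurable lebesgue"
      using m K by (intro borel_measurable_scaleR borel_measurable_indicator) (auto intro: compact_sets_lebesgue)
    show "AE x in lebesgue. norm (indicator K x *\<^sub>R g x) \<le> norm (indicator (cball 0 R) x + indicator (cball 0 R) x * (norm (g x))\<^sup>2 :: real)"
    proof (intro AE_I2)
      fix x
      show "norm (indicator K x *\<^sub>R g x) \<le> norm (indicator (cball 0 R) x + indicator (cball 0 R) x * (norm (g x))\<^sup>2 :: real)"
        using le_one_plus_power[of "norm (g x)" 2] R by (cases "x \<in> K") (auto split: split_indicator)
    qed
  qed
  then show "integrable (lebesgue_on K) g" using K by (auto simp: integrable_on_eq compact_sets_lebesgue)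
qed

text \<open>Cauchy-Schwarz on the ball that carries \<zeta>. No smoothness of \<zeta> is assumed, so
  the lemma covers derivatives of test functions as well as indicators of cells.\<close>

lemma test_integral_limit:
  fixes u :: "nat \<Rightarrow> 'a::euclidean_space \<Rightarrow> real"
  assumes m: "\<And>k. u k \<in> borel_measurable lebesgue" and \<zeta>m: "\<zeta> \<in> borel_measurable lebesgue"
    and \<zeta>: "integrable lebesgue (\<lambda>x. (\<zeta> x)\<^sup>2)" "\<And>x. norm x > R \<Longrightarrow> \<zeta> x = 0"
    and i: "\<And>k. integrable lebesgue (\<lambda>x. indicator (cball 0 R) x * (u k x)\<^sup>2)"
    and lim: "(\<lambda>k. \<integral>x. indicator (cball 0 R) x * (u k x)\<^sup>2 \<partial>lebesgue) \<longlonglongrightarrow> 0"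
  shows "(\<lambda>k. \<integral>x. u k x * \<zeta> x \<partial>lebesgue) \<longlonglongrightarrow> 0"
proof -
  have eq: "(\<lambda>x. (indicator (cball 0 R) x * u k x)\<^sup>2) = (\<lambda>x. indicator (cball 0 R) x * (u k x)\<^sup>2)" for k
    by (auto simp: fun_eq_iff power2_eq_square split: split_indicator)
  have eq2: "(\<lambda>x. indicator (cball 0 R) x * u k x * \<zeta> x) = (\<lambda>x. u k x * \<zeta> x)" for k
    using \<zeta>(2) by (auto simp: fun_eq_iff split: split_indicator)
  have cs: "(\<integral>x. u k x * \<zeta> x \<partial>lebesgue)\<^sup>2 \<le> (\<integral>x. indicator (cball 0 R) x * (u k x)\<^sup>2 \<partial>lebesgue) * (\<integral>x. (\<zeta> x)\<^sup>2 \<partial>lebesgue)" for k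
  proof -
    have "(\<lambda>x. indicator (cball 0 R) x * u k x) \<in> borel_measurable lebesgue"
      by (intro borel_measurable_times borel_measurable_indicator m) simp
    from integral_cauchy_schwarz(2)[OF this \<zeta>m] i[of k] \<zeta>(1) show ?thesis unfolding eq eq2 by blast
  qed
  have "(\<lambda>k. (\<integral>x. u k x * \<zeta> x \<partial>lebesgue)\<^sup>2) \<longlonglongrightarrow> 0"
  proof (rule tendsto_sandwich[OF _ _ tendsto_const])
    show "(\<lambda>k. (\<integral>x. indicator (cball 0 R) x * (u k x)\<^sup>2 \<partial>lebesgue) * (\<integral>x. (\<zeta> x)\<^sup>2 \<partial>lebesgue)) \<longlonglongrightarrow> 0"
      using tendsto_mult_right[OF lim] by simp
  qed (use cs in auto)
  then have "(\<lambda>k. sqrt ((\<integral>x. u k x * \<zeta> x \<partial>lebesgue)\<^sup>2)) \<longlonglongrightarrow> sqrt 0" by (intro tendsto_intros)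
  then show ?thesis by (simp add: tendsto_rabs_zero_iff)
qed

lemma test_fun_square_integrable:
  assumes "\<zeta> \<in> test_fun B" shows "integrable lebesgue (\<lambda>x. (\<zeta> x)\<^sup>2)"
  using test_fun_integrable[OF test_fun_mult[OF assms assms]] by (simp add: power2_eq_square)

text \<open>For a fixed test function both sides of the defining identity are continuous under local
  convergence in mean square of the functions and convergence in mean square of the
  gradients.\<close>

lemma weak_gradient_limit:
  fixes f :: "nat \<Rightarrow> 'a::euclidean_space \<Rightarrow> real"
  assumes wg: "\<And>k. is_weak_gradient UNIV (f k) (G k)" and f': "f' \<in> L1_loc UNIV" and G': "G' \<in> L1_loc UNIV"
    and fi: "\<And>k R. integrable lebesgue (\<lambda>x. indicator (cball 0 R) x * (f k x - f' x)\<^sup>2)"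
    and fl: "\<And>R. (\<lambda>k. \<integral>x. indicator (cball 0 R) x * (f k x - f' x)\<^sup>2 \<partial>lebesgue) \<longlonglongrightarrow> 0"
    and Gi: "\<And>k. integrable lebesgue (\<lambda>x. (norm (G k x - G' x))\<^sup>2)"
    and Gl: "(\<lambda>k. \<integral>x. (norm (G k x - G' x))\<^sup>2 \<partial>lebesgue) \<longlonglongrightarrow> 0"
  shows "is_weak_gradient UNIV f' G'"
  unfolding is_weak_gradient_iff[OF open_UNIV]
proof (intro conjI ballI f' G')
  fix \<eta> :: "'a \<Rightarrow> real" and b :: 'a assume \<eta>: "\<eta> \<in> test_fun UNIV" and b: "b \<in> Basis"
  note wg' = wg[unfolded is_weak_gradient_iff[OF open_UNIV]]
  have fk: "f k \<in> L1_loc UNIV" and Gk: "G k \<in> L1_loc UNIV" for k using wg' by auto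
  note p = test_fun_pd[OF \<eta> b]
  obtain R where R: "\<And>x. norm x > R \<Longrightarrow> \<eta> x = 0" using test_fun_support_bound[OF \<eta>] by blast
  obtain R' where R': "\<And>x. norm x > R' \<Longrightarrow> pd b \<eta> x = 0" using test_fun_support_bound[OF p] by blast
  have 1: "(\<lambda>k. \<integral>x. (f k x - f' x) * pd b \<eta> x \<partial>lebesgue) \<longlonglongrightarrow> 0"
    using L1_loc_UNIV_measurable[OF fk] L1_loc_UNIV_measurable[OF f']
    by (intro test_integral_limit[where R = R'] R' fi fl borel_measurable_diff test_fun_square_integrable[OF p]
        borel_imp_lebesgue[OF test_fun_measurable[OF p]])
  have Gb: "((G k x - G' x) \<bullet> b)\<^sup>2 \<le> (norm (G k x - G' x))\<^sup>2" for k x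
    using Basis_le_norm[OF b, of "G k x - G' x"] by (metis abs_le_square_iff abs_norm_cancel)
  have gm: "(\<lambda>x. (G k x - G' x) \<bullet> b) \<in> borel_measurable lebesgue" for k
    using L1_loc_UNIV_measurable[OF Gk] L1_loc_UNIV_measurable[OF G']
    by (intro borel_measurable_inner borel_measurable_diff) auto
  have gi: "integrable lebesgue (\<lambda>x. indicator (cball 0 R) x * ((G k x - G' x) \<bullet> b)\<^sup>2)" for k
    using gm Gb by (intro Bochner_Integration.integrable_bound[OF Gi[of k]] borel_measurable_times
        borel_measurable_power borel_measurable_indicator) (auto split: split_indicator)
  have 2: "(\<lambda>k. \<integral>x. ((G k x - G' x) \<bullet> b) * \<eta> x \<partial>lebesgue) \<longlonglongrightarrow> 0"
  proof (rule test_integral_limit[where R = R])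
    show "(\<lambda>k. \<integral>x. indicator (cball 0 R) x * ((G k x - G' x) \<bullet> b)\<^sup>2 \<partial>lebesgue) \<longlonglongrightarrow> 0"
    proof (rule tendsto_sandwich[OF _ _ tendsto_const Gl])
      show "\<forall>\<^sub>F k in sequentially. (\<integral>x. indicator (cball 0 R) x * ((G k x - G' x) \<bullet> b)\<^sup>2 \<partial>lebesgue) \<le> (\<integral>x. (norm (G k x - G' x))\<^sup>2 \<partial>lebesgue)"
        using Gb gi Gi by (intro always_eventually allI integral_mono) (auto split: split_indicator)
    qed (auto intro!: always_eventually Bochner_Integration.integral_nonneg)
  qed (use gm gi R test_fun_square_integrable[OF \<eta>] borel_imp_lebesgue[OF test_fun_measurable[OF \<eta>]] in auto)
  have eq: "(\<integral>x. (f k x - f' x) * pd b \<eta> x \<partial>lebesgue) + (\<integral>x. ((G k x - G' x) \<bullet> b) * \<eta> x \<partial>lebesgue)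
     = - ((\<integral>x. f' x * pd b \<eta> x \<partial>lebesgue) + (\<integral>x. (G' x \<bullet> b) * \<eta> x \<partial>lebesgue))" for k
  proof -
    have i: "integrable lebesgue (\<lambda>x. f k x * pd b \<eta> x)" "integrable lebesgue (\<lambda>x. f' x * pd b \<eta> x)"
      "integrable lebesgue (\<lambda>x. (G k x \<bullet> b) * \<eta> x)" "integrable lebesgue (\<lambda>x. (G' x \<bullet> b) * \<eta> x)"
      using L1_loc_test_integrable[OF fk[of k] p] L1_loc_test_integrable[OF f' p]
        L1_loc_test_integrable[OF L1_loc_inner[OF Gk[of k]] \<eta>, of b] L1_loc_test_integrable[OF L1_loc_inner[OF G'] \<eta>, of b]
      by (auto simp: mult.commute)
    have "(\<integral>x. f k x * pd b \<eta> x \<partial>lebesgue) = - (\<integral>x. (G k x \<bullet> b) * \<eta> x \<partial>lebesgue)" using wg' \<eta> b by blast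
    then show ?thesis using i by (simp add: left_diff_distrib inner_diff_left)
  qed
  have "(\<lambda>k. (\<integral>x. (f k x - f' x) * pd b \<eta> x \<partial>lebesgue) + (\<integral>x. ((G k x - G' x) \<bullet> b) * \<eta> x \<partial>lebesgue)) \<longlonglongrightarrow> 0 + 0"
    by (rule tendsto_add[OF 1 2])
  then show "(\<integral>x. f' x * pd b \<eta> x \<partial>lebesgue) = - (\<integral>x. (G' x \<bullet> b) * \<eta> x \<partial>lebesgue)"
    unfolding eq by (simp add: LIMSEQ_const_iff)
qed

lemma square_integrable_ball:
  fixes g :: "'a::euclidean_space \<Rightarrow> 'b::euclidean_space"
  assumes "integrable lebesgue (\<lambda>x. (norm (g x))\<^sup>2)"
  shows "integrable lebesgue (\<lambda>x. indicator (cball 0 R) x * (norm (g x))\<^sup>2)"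
  using integrable_mult_indicator[OF _ assms, of "cball 0 R"] by simp

text \<open>The gradients converge by completeness. Through \<open>local_bound\<close> with exponent
  2, fast convergence of gradients gives fast convergence of the functions on every ball; the limit
  is built ball by ball, as it need not be square integrable on the whole space.\<close>

lemma (in gradient_class) local_limit:
  assumes V: "\<And>k. (f k, G k) \<in> V" and fast: "\<And>k. dirichlet (\<lambda>x. G (Suc k) x - G k x) \<le> (1 / 2) ^ k"
  obtains f' G' where "is_weak_gradient UNIV f' G'" "integrable lebesgue (\<lambda>x. (norm (G' x))\<^sup>2)"
    "(\<lambda>k. dirichlet (\<lambda>x. G k x - G' x)) \<longlonglongrightarrow> 0"
    "AE x in lebesgue. (\<lambda>k. f k x) \<longlonglongrightarrow> f' x"
    "\<And>R. integrable lebesgue (\<lambda>x. indicator (cball 0 R) x * (f' x)\<^sup>2)"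
    "\<And>k R. integrable lebesgue (\<lambda>x. indicator (cball 0 R) x * (f k x - f' x)\<^sup>2)"
    "\<And>R. (\<lambda>k. \<integral>x. indicator (cball 0 R) x * (f k x - f' x)\<^sup>2 \<partial>lebesgue) \<longlonglongrightarrow> 0"
    "\<And>g x. g > 0 \<Longrightarrow> (\<lambda>k. cube_avg g (f k) x) \<longlonglongrightarrow> cube_avg g f' x"
proof -
  have dG: "(\<integral>\<^sup>+x. ennreal (norm (G (Suc k) x - G k x) ^ 2) \<partial>lebesgue) \<le> ennreal (1 * (1 / 2) ^ k)" for k
  proof -
    have "integrable lebesgue (\<lambda>x. norm (G (Suc k) x - G k x) ^ 2)" using G2[OF diff_in_V[OF V V]] by simp
    then have "(\<integral>\<^sup>+x. ennreal (norm (G (Suc k) x - G k x) ^ 2) \<partial>lebesgue) = ennreal (dirichlet (\<lambda>x. G (Suc k) x - G k x))"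
      unfolding dirichlet_def by (intro nn_integral_eq_integral) auto
    then show ?thesis using fast[of k] by (simp add: ennreal_leI)
  qed
  have num: "(2::nat) \<ge> 1" "(1::real) \<ge> 0" "0 < (1 / 2 :: real)" "1 / 2 < (1 :: real)" by auto
  have "\<exists>v. v \<in> borel_measurable lebesgue \<and> (AE x in lebesgue. (\<lambda>j. G j x) \<longlonglongrightarrow> v x) \<and>
    integrable lebesgue (\<lambda>x. norm (v x) ^ 2) \<and> (\<forall>j. integrable lebesgue (\<lambda>x. norm (G j x - v x) ^ 2)) \<and>
    (\<lambda>j. \<integral>x. norm (G j x - v x) ^ 2 \<partial>lebesgue) \<longlonglongrightarrow> 0"
    by (rule fast_convergence_Lq[where C = 1 and r = "1 / 2"]) (use num G_measurable[OF V] G2[OF V] dG in auto)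
  then obtain G' where G': "G' \<in> borel_measurable lebesgue" "integrable lebesgue (\<lambda>x. (norm (G' x))\<^sup>2)"
    "\<And>k. integrable lebesgue (\<lambda>x. (norm (G k x - G' x))\<^sup>2)"
    "(\<lambda>k. \<integral>x. (norm (G k x - G' x))\<^sup>2 \<partial>lebesgue) \<longlonglongrightarrow> 0"
    by blast
  \<comment> \<open>One limit function for all radii; the limits \<open>v R\<close> obtained on the
    balls agree with it almost everywhere there.\<close>
  define f' where "f' x = lim (\<lambda>k. f k x)" for x
  have f'm: "f' \<in> borel_measurable lebesgue"
    unfolding f'_def[abs_def] by (rule borel_measurable_lim_metric) (rule f_measurable[OF V])
  \<comment> \<open>For p = 1 the exponent condition reads d - 2 < d, which holds in every
    dimension.\<close>
  have one: "(1::nat) \<ge> 1" "int 1 * (int DIM('a) - 2) < int DIM('a)" by auto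
  define P where "P R v \<longleftrightarrow> v \<in> borel_measurable lebesgue \<and> (AE x in lebesgue. (\<lambda>k. indicator (cball 0 R) x * f k x) \<longlonglongrightarrow> v x) \<and>
     integrable lebesgue (\<lambda>x. (v x)\<^sup>2) \<and> (\<forall>k. integrable lebesgue (\<lambda>x. (indicator (cball 0 R) x * f k x - v x)\<^sup>2)) \<and>
     (\<lambda>k. \<integral>x. (indicator (cball 0 R) x * f k x - v x)\<^sup>2 \<partial>lebesgue) \<longlonglongrightarrow> 0" for R and v :: "'a \<Rightarrow> real"
  have "\<exists>v. P R v" for R
  proof -
    obtain A where A: "A \<ge> 0" "\<And>f G. (f, G) \<in> V \<Longrightarrow>
     integrable lebesgue (\<lambda>x. indicator (cball 0 R) x * \<bar>f x\<bar> ^ (2 * 1)) \<and>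
     (\<integral>x. indicator (cball 0 R) x * \<bar>f x\<bar> ^ (2 * 1) \<partial>lebesgue) \<le> A * dirichlet G ^ 1"
      using local_bound[OF one, of R] by blast
    have eq: "(indicator (cball 0 R) x * t)\<^sup>2 = indicator (cball 0 R) x * t\<^sup>2" for x :: 'a and t :: real
      by (auto simp: power2_eq_square split: split_indicator)
    have m: "(\<lambda>x. indicator (cball 0 R) x * f k x) \<in> borel_measurable lebesgue" for k
      using f_measurable[OF V] by (intro borel_measurable_times borel_measurable_indicator) auto
    have i0: "integrable lebesgue (\<lambda>x. norm (indicator (cball 0 R) x * f 0 x) ^ 2)"
      using A(2)[OF V[of 0]] by (simp add: eq)
    have d: "(\<integral>\<^sup>+x. ennreal (norm (indicator (cball 0 R) x * f (Suc k) x - indicator (cball 0 R) x * f k x) ^ 2) \<partial>lebesgue) \<le> ennreal (A * (1 / 2) ^ k)" for k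
    proof -
      note a = A(2)[OF diff_in_V[OF V V], of "Suc k" k]
      have "(\<integral>\<^sup>+x. ennreal (norm (indicator (cball 0 R) x * f (Suc k) x - indicator (cball 0 R) x * f k x) ^ 2) \<partial>lebesgue)
        = (\<integral>\<^sup>+x. ennreal (indicator (cball 0 R) x * (f (Suc k) x - f k x)\<^sup>2) \<partial>lebesgue)"
        by (simp add: eq right_diff_distrib[symmetric])
      also have "\<dots> = ennreal (\<integral>x. indicator (cball 0 R) x * (f (Suc k) x - f k x)\<^sup>2 \<partial>lebesgue)"
        using a by (intro nn_integral_eq_integral) auto
      also have "\<dots> \<le> ennreal (A * (1 / 2) ^ k)"
        using a mult_left_mono[OF fast[of k] A(1)] by (intro ennreal_leI) simp
      finally show ?thesis .
    qed
    show ?thesis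
      using fast_convergence_Lq[OF num(1) m A(1) num(3,4) i0 d] unfolding real_norm_def power2_abs P_def .
  qed
  then obtain v where "\<And>R. P R (v R)" by metis
  note vP = this[unfolded P_def]
  have v: "\<And>R. v R \<in> borel_measurable lebesgue"
    and vlim: "\<And>R. AE x in lebesgue. (\<lambda>k. indicator (cball 0 R) x * f k x) \<longlonglongrightarrow> v R x"
    and vi: "\<And>R. integrable lebesgue (\<lambda>x. (v R x)\<^sup>2)"
    and vd: "\<And>R k. integrable lebesgue (\<lambda>x. (indicator (cball 0 R) x * f k x - v R x)\<^sup>2)"
      "\<And>R. (\<lambda>k. \<integral>x. (indicator (cball 0 R) x * f k x - v R x)\<^sup>2 \<partial>lebesgue) \<longlonglongrightarrow> 0"
    using vP by blast+
  \<comment> \<open>Restricting to integer radii leaves countably many exceptional null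
    sets.\<close>
  have "AE x in lebesgue. \<forall>n::nat. (\<lambda>k. indicator (cball 0 (real n)) x * f k x) \<longlonglongrightarrow> v (real n) x"
    using vlim by (simp add: AE_all_countable)
  then have conv: "AE x in lebesgue. (\<lambda>k. f k x) \<longlonglongrightarrow> f' x"
  proof eventually_elim
    case (elim x)
    obtain n :: nat where n: "norm x \<le> real n" using real_arch_simple by blast
    from elim[rule_format, of n] have "(\<lambda>k. f k x) \<longlonglongrightarrow> v (real n) x" using n by simp
    moreover from this have "f' x = v (real n) x" unfolding f'_def by (rule limI)
    ultimately show ?case by simp
  qed
  have vf: "AE x in lebesgue. v R x = indicator (cball 0 R) x * f' x" for R
    using vlim[of R] conv
  proof eventually_elim
    case (elim x)
    show ?case by (rule LIMSEQ_unique[OF elim(1)]) (intro tendsto_mult_left elim(2))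
  qed
  have indm: "(\<lambda>x. indicator (cball 0 R) x * f' x) \<in> borel_measurable lebesgue" for R
    using f'm by (intro borel_measurable_times borel_measurable_indicator) auto
  have f'i: "integrable lebesgue (\<lambda>x. indicator (cball 0 R) x * (f' x)\<^sup>2)" for R
  proof -
    have "integrable lebesgue (\<lambda>x. indicator (cball 0 R) x * (f' x)\<^sup>2) \<longleftrightarrow> integrable lebesgue (\<lambda>x. (v R x)\<^sup>2)"
      using vf[of R] v f'm
      by (intro integrable_cong_AE borel_measurable_times borel_measurable_indicator borel_measurable_power)
        (auto elim!: eventually_mono split: split_indicator)
    then show ?thesis using vi by simp
  qed
  have dm: "(\<lambda>x. indicator (cball 0 R) x * (f k x - f' x)\<^sup>2) \<in> borel_measurable lebesgue"
      "(\<lambda>x. (indicator (cball 0 R) x * f k x - v R x)\<^sup>2) \<in> borel_measurable lebesgue" for k R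
    using v f'm f_measurable[OF V]
    by (auto intro!: borel_measurable_times borel_measurable_indicator borel_measurable_power borel_measurable_diff)
  have dAE: "AE x in lebesgue. indicator (cball 0 R) x * (f k x - f' x)\<^sup>2 = (indicator (cball 0 R) x * f k x - v R x)\<^sup>2" for k R
    using vf[of R] by eventually_elim (auto split: split_indicator)
  have fi: "integrable lebesgue (\<lambda>x. indicator (cball 0 R) x * (f k x - f' x)\<^sup>2)" for k R
    using integrable_cong_AE[OF dm dAE] vd(1) by simp
  have fl: "(\<lambda>k. \<integral>x. indicator (cball 0 R) x * (f k x - f' x)\<^sup>2 \<partial>lebesgue) \<longlonglongrightarrow> 0" for R
    using vd(2) unfolding integral_cong_AE[OF dm dAE] .
  have f'L: "f' \<in> L1_loc UNIV" using f'i by (intro square_locally_integrable_L1_loc f'm) simp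
  have G'L: "G' \<in> L1_loc UNIV" using G' by (intro square_locally_integrable_L1_loc square_integrable_ball)
  have wg': "is_weak_gradient UNIV f' G'"
    by (rule weak_gradient_limit[OF wg[OF V] f'L G'L fi fl G'(3,4)])
  have "(\<lambda>k. cube_avg g (f k) x) \<longlonglongrightarrow> cube_avg g f' x" if g: "g > 0" for g x
  proof -
    have "bounded (cube g x)" using g by (rule cube_sets_bounded)
    then obtain R where R: "\<forall>y\<in>cube g x. norm y \<le> R" unfolding bounded_iff by blast
    have "(\<lambda>k. \<integral>y. (f k y - f' y) * indicator (cube g x) y \<partial>lebesgue) \<longlonglongrightarrow> 0"
    proof (rule test_integral_limit[where R = R])
      have "(\<lambda>y. (indicator (cube g x) y)\<^sup>2) = (\<lambda>y. indicator (cube g x) y :: real)"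
        by (auto simp: fun_eq_iff split: split_indicator)
      then show "integrable lebesgue (\<lambda>y. (indicator (cube g x) y)\<^sup>2 :: real)" using cube_indicator(1)[OF g, of x] by simp
      show "indicator (cube g x) y = (0::real)" if "norm y > R" for y
        using R that by (auto split: split_indicator)
      show "indicator (cube g x) \<in> borel_measurable lebesgue" by (rule borel_measurable_indicator) simp
    qed (use f_measurable[OF V] f'm fi fl in auto)
    moreover have "(\<integral>y. (f k y - f' y) * indicator (cube g x) y \<partial>lebesgue) = (cube_avg g (f k) x - cube_avg g f' x) * g ^ DIM('a)" for k
    proof -
      have "integrable lebesgue (\<lambda>y. indicator (cube g x) y * f k y)" "integrable lebesgue (\<lambda>y. indicator (cube g x) y * f' y)"
        using cube_integrable[OF fL[OF V[of k]] g, of x] cube_integrable[OF f'L g, of x] by auto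
      then have "(\<integral>y. (f k y - f' y) * indicator (cube g x) y \<partial>lebesgue) =
          (\<integral>y. indicator (cube g x) y * f k y \<partial>lebesgue) - (\<integral>y. indicator (cube g x) y * f' y \<partial>lebesgue)"
        by (simp add: algebra_simps)
      then show ?thesis using g by (simp add: avg_def vol_cube diff_divide_distrib[symmetric])
    qed
    ultimately have "(\<lambda>k. (cube_avg g (f k) x - cube_avg g f' x) * g ^ DIM('a)) \<longlonglongrightarrow> 0" by simp
    then have "(\<lambda>k. (cube_avg g (f k) x - cube_avg g f' x) * g ^ DIM('a) / g ^ DIM('a)) \<longlonglongrightarrow> 0 / g ^ DIM('a)"
      using g by (intro tendsto_divide tendsto_const) auto
    then show ?thesis using g by (simp add: LIM_zero_iff)
  qed
  then show thesis
    using that[OF wg' G'(2) _ conv f'i fi fl] G'(4) unfolding dirichlet_def by blast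
qed

section \<open>Existence of minimisers\<close>

definition wnorm :: "nat \<Rightarrow> ('a::euclidean_space \<Rightarrow> real) \<Rightarrow> ('a \<Rightarrow> real) \<Rightarrow> real" where
  "wnorm q \<phi> f = root q (\<integral>x. norm (\<phi> x * f x) ^ q \<partial>lebesgue)"

lemma wnorm_nonneg: "0 \<le> wnorm q \<phi> f"
  unfolding wnorm_def by (intro real_root_ge_zero Bochner_Integration.integral_nonneg) simp

lemma wnorm_scale: "q \<ge> 1 \<Longrightarrow> wnorm q \<phi> (\<lambda>x. c * f x) = \<bar>c\<bar> * wnorm q \<phi> f"
proof -
  assume q: "q \<ge> 1"
  have "(\<lambda>x. norm (\<phi> x * (c * f x)) ^ q) = (\<lambda>x. \<bar>c\<bar> ^ q * norm (\<phi> x * f x) ^ q)"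
    by (simp add: abs_mult power_mult_distrib mult_ac)
  then show ?thesis using q by (simp add: wnorm_def real_root_mult real_root_power_cancel)
qed

text \<open>\<open>complete\<close> is asked along fast sequences, which can be extracted from any
  Cauchy sequence, and mentions only gradients: convergence in the constraint seminorm then follows
  from \<open>local_bound\<close>. The numbers \<open>b\<close> and \<open>R\<close> bound all
  weights and their supports at once.\<close>

locale weighted_problem = gradient_class V h C
  for V :: "(('a::euclidean_space \<Rightarrow> real) \<times> ('a \<Rightarrow> 'a)) set" and h C :: real +
  fixes p n :: nat and \<phi> :: "nat \<Rightarrow> 'a \<Rightarrow> real" and b R :: real
  assumes complete: "(\<And>k. (f k, G k) \<in> V) \<Longrightarrow> (\<And>k. dirichlet (\<lambda>x. G (Suc k) x - G k x) \<le> (1 / 2) ^ k) \<Longrightarrow>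
      \<exists>f' G'. (f', G') \<in> V \<and> (\<lambda>k. dirichlet (\<lambda>x. G k x - G' x)) \<longlonglongrightarrow> 0"
    and p: "p \<ge> 1" and sub: "int p * (int DIM('a) - 2) < int DIM('a)"
    and \<phi>m: "i \<in> {1..n} \<Longrightarrow> \<phi> i \<in> borel_measurable lebesgue"
    and \<phi>b: "i \<in> {1..n} \<Longrightarrow> \<bar>\<phi> i x\<bar> \<le> b" and \<phi>0: "i \<in> {1..n} \<Longrightarrow> norm x > R \<Longrightarrow> \<phi> i x = 0"
    and b0: "b \<ge> 0"
begin

text \<open>The Euclidean norm of the vector of weighted norms is a seminorm, so the constraint
  becomes the unit sphere of a seminorm and the triangle inequality is available.\<close>

definition constraint_norm :: "('a \<Rightarrow> real) \<Rightarrow> real" where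
  "constraint_norm f = L2_set (\<lambda>i. wnorm (2 * p) (\<phi> i) f) {1..n}"

text \<open>It dominates all weighted norms at once and is the quantity for which
  \<open>compactness\<close> yields a Cauchy sequence.\<close>

definition ball_power :: "('a \<Rightarrow> real) \<Rightarrow> real" where
  "ball_power f = (\<integral>x. indicator (cball 0 R) x * \<bar>f x\<bar> ^ (2 * p) \<partial>lebesgue)"

lemma constraint_norm_nonneg: "0 \<le> constraint_norm f"
  by (simp add: constraint_norm_def)

lemma ball_power_nonneg: "0 \<le> ball_power f"
  unfolding ball_power_def by (intro Bochner_Integration.integral_nonneg) auto

lemma ball_power_integrable: "(f, G) \<in> V \<Longrightarrow> integrable lebesgue (\<lambda>x. indicator (cball 0 R) x * \<bar>f x\<bar> ^ (2 * p))"
  using local_bound[OF p sub, of R] by metis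

lemma weight_pointwise:
  assumes "i \<in> {1..n}"
  shows "norm (\<phi> i x * f x) ^ (2 * p) \<le> b ^ (2 * p) * (indicator (cball 0 R) x * \<bar>f x\<bar> ^ (2 * p))"
proof (cases "x \<in> cball 0 R")
  case True
  have "norm (\<phi> i x * f x) ^ (2 * p) \<le> (b * \<bar>f x\<bar>) ^ (2 * p)"
    using \<phi>b[OF assms, of x] by (intro power_mono) (auto simp: abs_mult intro: mult_right_mono)
  then show ?thesis using True by (simp add: power_mult_distrib)
next
  case False
  then show ?thesis using \<phi>0[OF assms, of x] p by (simp add: zero_power)
qed

lemma weighted_measurable:
  assumes "(f, G) \<in> V" "i \<in> {1..n}"
  shows "(\<lambda>x. \<phi> i x * f x) \<in> borel_measurable lebesgue"
  using f_measurable[OF assms(1)] \<phi>m[OF assms(2)] by (rule borel_measurable_times[rotated])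

lemma weighted_integrable:
  assumes "(f, G) \<in> V" "i \<in> {1..n}"
  shows "integrable lebesgue (\<lambda>x. norm (\<phi> i x * f x) ^ (2 * p))"
proof (rule Bochner_Integration.integrable_bound)
  show "integrable lebesgue (\<lambda>x. b ^ (2 * p) * (indicator (cball 0 R) x * \<bar>f x\<bar> ^ (2 * p)))"
    using ball_power_integrable[OF assms(1)] by simp
  show "(\<lambda>x. norm (\<phi> i x * f x) ^ (2 * p)) \<in> borel_measurable lebesgue"
    using weighted_measurable[OF assms] by measurable
  show "AE x in lebesgue. norm (norm (\<phi> i x * f x) ^ (2 * p)) \<le> norm (b ^ (2 * p) * (indicator (cball 0 R) x * \<bar>f x\<bar> ^ (2 * p)))"
  proof (intro AE_I2)
    fix x
    have "0 \<le> norm (\<phi> i x * f x) ^ (2 * p)" by simp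
    then show "norm (norm (\<phi> i x * f x) ^ (2 * p)) \<le> norm (b ^ (2 * p) * (indicator (cball 0 R) x * \<bar>f x\<bar> ^ (2 * p)))"
      using weight_pointwise[OF assms(2), of x f] unfolding real_norm_def by linarith
  qed
qed

lemma wnorm_le_ball_power:
  assumes "(f, G) \<in> V" "i \<in> {1..n}"
  shows "wnorm (2 * p) (\<phi> i) f \<le> b * root (2 * p) (ball_power f)"
proof -
  have "(\<integral>x. norm (\<phi> i x * f x) ^ (2 * p) \<partial>lebesgue) \<le> (\<integral>x. b ^ (2 * p) * (indicator (cball 0 R) x * \<bar>f x\<bar> ^ (2 * p)) \<partial>lebesgue)"
    using weighted_integrable[OF assms] ball_power_integrable[OF assms(1)] weight_pointwise[OF assms(2)]
    by (intro integral_mono) auto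
  also have "\<dots> = b ^ (2 * p) * ball_power f" by (simp add: ball_power_def)
  finally have "wnorm (2 * p) (\<phi> i) f \<le> root (2 * p) (b ^ (2 * p) * ball_power f)"
    unfolding wnorm_def using p by simp
  also have "\<dots> = b * root (2 * p) (ball_power f)" using p b0 by (simp add: real_root_mult real_root_power_cancel)
  finally show ?thesis .
qed

lemma constraint_norm_le_ball_power:
  assumes "(f, G) \<in> V" shows "constraint_norm f \<le> real n * b * root (2 * p) (ball_power f)"
proof -
  have "constraint_norm f \<le> (\<Sum>i\<in>{1..n}. wnorm (2 * p) (\<phi> i) f)" unfolding constraint_norm_def
    by (intro L2_set_le_sum wnorm_nonneg)
  also have "\<dots> \<le> (\<Sum>i\<in>{1..n}. b * root (2 * p) (ball_power f))" using assms by (intro sum_mono wnorm_le_ball_power)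
  finally show ?thesis by simp
qed

lemma constraint_norm_scale: "constraint_norm (\<lambda>x. c * f x) = \<bar>c\<bar> * constraint_norm f"
  unfolding constraint_norm_def using p by (subst wnorm_scale) (auto simp: L2_set_right_distrib)

lemma constraint_norm_triangle:
  assumes "(f, F) \<in> V" "(g, G) \<in> V"
  shows "constraint_norm (\<lambda>x. f x + g x) \<le> constraint_norm f + constraint_norm g"
proof -
  have "constraint_norm (\<lambda>x. f x + g x) \<le> L2_set (\<lambda>i. wnorm (2 * p) (\<phi> i) f + wnorm (2 * p) (\<phi> i) g) {1..n}"
    unfolding constraint_norm_def
  proof (rule L2_set_mono)
    fix i assume i: "i \<in> {1..n}"
    show "wnorm (2 * p) (\<phi> i) (\<lambda>x. f x + g x) \<le> wnorm (2 * p) (\<phi> i) f + wnorm (2 * p) (\<phi> i) g"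
      unfolding wnorm_def distrib_left using p assms i
      by (intro Lq_triangle weighted_measurable weighted_integrable) auto
  qed (rule wnorm_nonneg)
  also have "\<dots> \<le> constraint_norm f + constraint_norm g" unfolding constraint_norm_def by (rule L2_set_triangle_ineq)
  finally show ?thesis .
qed

text \<open>The seminorm is bounded by a root of the ball integral, and that by a power of the
  energy. This is how the constraint survives the passage to the limit.\<close>

lemma constraint_norm_tendsto_zero:
  assumes V: "\<And>k. (f k, G k) \<in> V" and d: "(\<lambda>k. dirichlet (G k)) \<longlonglongrightarrow> 0"
  shows "(\<lambda>k. constraint_norm (f k)) \<longlonglongrightarrow> 0"
proof -
  obtain A where A: "A \<ge> 0" "\<And>f G. (f, G) \<in> V \<Longrightarrow>
     integrable lebesgue (\<lambda>x. indicator (cball 0 R) x * \<bar>f x\<bar> ^ (2 * p)) \<and>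
     (\<integral>x. indicator (cball 0 R) x * \<bar>f x\<bar> ^ (2 * p) \<partial>lebesgue) \<le> A * dirichlet G ^ p"
    using local_bound[OF p sub, of R] by blast
  have "constraint_norm (f k) \<le> real n * b * root (2 * p) (A * dirichlet (G k) ^ p)" for k
  proof -
    have "ball_power (f k) \<le> A * dirichlet (G k) ^ p" using A(2)[OF V[of k]] by (simp add: ball_power_def)
    then have "real n * b * root (2 * p) (ball_power (f k)) \<le> real n * b * root (2 * p) (A * dirichlet (G k) ^ p)"
      using p b0 by (intro mult_left_mono) auto
    then show ?thesis using constraint_norm_le_ball_power[OF V[of k]] by linarith
  qed
  moreover have "(\<lambda>k. real n * b * root (2 * p) (A * dirichlet (G k) ^ p)) \<longlonglongrightarrow> real n * b * root (2 * p) (A * 0 ^ p)"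
    by (intro tendsto_intros d)
  then have "(\<lambda>k. real n * b * root (2 * p) (A * dirichlet (G k) ^ p)) \<longlonglongrightarrow> 0" using p by (simp add: zero_power)
  ultimately show ?thesis
    by (intro tendsto_sandwich[OF _ _ tendsto_const, of 0 "\<lambda>k. constraint_norm (f k)" sequentially
        "\<lambda>k. real n * b * root (2 * p) (A * dirichlet (G k) ^ p)"])
      (simp_all add: constraint_norm_nonneg)
qed

lemma constraint_norm_diff_le:
  assumes "(f, F) \<in> V" "(g, G) \<in> V"
  shows "\<bar>constraint_norm f - constraint_norm g\<bar> \<le> constraint_norm (\<lambda>x. f x - g x)"
proof -
  have "constraint_norm f \<le> constraint_norm (\<lambda>x. f x - g x) + constraint_norm g"
    using constraint_norm_triangle[OF diff_in_V[OF assms] assms(2)] by simp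
  moreover have "constraint_norm g \<le> constraint_norm (\<lambda>x. g x - f x) + constraint_norm f"
    using constraint_norm_triangle[OF diff_in_V[OF assms(2,1)] assms(1)] by simp
  moreover have "constraint_norm (\<lambda>x. g x - f x) = constraint_norm (\<lambda>x. f x - g x)"
    using constraint_norm_scale[of "-1" "\<lambda>x. f x - g x"] by simp
  ultimately show ?thesis by linarith
qed

text \<open>By the parallelogram law, a minimising sequence that is Cauchy for the constraint seminorm is Cauchy
  for the Dirichlet seminorm: the midpoints are almost admissible, so their energy cannot drop below
  the infimum. No weak compactness is needed.\<close>

theorem minimiser_exists:
  assumes f0: "(f0, G0) \<in> V" "constraint_norm f0 \<noteq> 0"
  obtains f G where "(f, G) \<in> V" "constraint_norm f = 1" "\<And>g H. (g, H) \<in> V \<Longrightarrow> constraint_norm g = 1 \<Longrightarrow> dirichlet G \<le> dirichlet H"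
proof -
  define S where "S = {dirichlet H | g H. (g, H) \<in> V \<and> constraint_norm g = 1}"
  have normalise: "dirichlet H / (constraint_norm g)\<^sup>2 \<in> S" if gH: "(g, H) \<in> V" "constraint_norm g \<noteq> 0" for g H
  proof -
    have "((\<lambda>x. (1 / constraint_norm g) * g x), (\<lambda>x. (1 / constraint_norm g) *\<^sub>R H x)) \<in> V" by (rule scale_in_V[OF gH(1)])
    moreover have "constraint_norm (\<lambda>x. (1 / constraint_norm g) * g x) = 1" using gH(2) constraint_norm_nonneg[of g] by (simp only: constraint_norm_scale) simp
    moreover have "dirichlet (\<lambda>x. (1 / constraint_norm g) *\<^sub>R H x) = dirichlet H / (constraint_norm g)\<^sup>2"
      by (simp only: dirichlet_scale) (simp add: power_divide)
    ultimately show ?thesis unfolding S_def by (metis (mono_tags, lifting) mem_Collect_eq)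
  qed
  have Sne: "S \<noteq> {}" using normalise[OF f0] by auto
  have Sb: "bdd_below S" unfolding S_def by (intro bdd_belowI[of _ 0]) (auto simp: dirichlet_nonneg)
  define T where "T = Inf S"
  \<comment> \<open>The infimum in homogeneous form, valid on the whole class and also for seminorm
    0; it is applied to midpoints, whose seminorm is only known to be close to 1.\<close>
  have T_le: "T * (constraint_norm g)\<^sup>2 \<le> dirichlet H" if gH: "(g, H) \<in> V" for g H
  proof (cases "constraint_norm g = 0")
    case False
    then have "T \<le> dirichlet H / (constraint_norm g)\<^sup>2" unfolding T_def using normalise[OF gH] Sb by (intro cInf_lower) auto
    then show ?thesis using False by (simp add: field_simps)
  qed (simp add: dirichlet_nonneg)
  have T0: "T \<ge> 0" unfolding T_def using Sne by (intro cInf_greatest) (auto simp: S_def dirichlet_nonneg)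
  have "\<exists>g H. (g, H) \<in> V \<and> constraint_norm g = 1 \<and> dirichlet H < T + inverse (real (Suc k))" for k
  proof -
    have "\<exists>x\<in>S. x < T + inverse (real (Suc k))" unfolding T_def using Sne by (intro cInf_lessD) auto
    then show ?thesis unfolding S_def by auto
  qed
  then obtain f G where fG: "\<And>k. (f k, G k) \<in> V" "\<And>k. constraint_norm (f k) = 1" "\<And>k. dirichlet (G k) < T + inverse (real (Suc k))"
    by metis
  have M: "dirichlet (G k) \<le> T + 1" for k
  proof -
    have "inverse (real (Suc k)) \<le> 1" by (simp add: inverse_le_1_iff)
    then show ?thesis using fG(3)[of k] by linarith
  qed
  \<comment> \<open>In this formula \<open>constraint_norm\<close> is a bound index, the threshold
    of the Cauchy condition, and not the seminorm.\<close>
  obtain s :: "nat \<Rightarrow> nat" where s: "strict_mono s" and cauchy': "\<forall>e>0. \<exists>constraint_norm. \<forall>k\<ge>constraint_norm. \<forall>l\<ge>constraint_norm.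
      (\<integral>x. indicator (cball 0 R) x * \<bar>f (s k) x - f (s l) x\<bar> ^ (2 * p) \<partial>lebesgue) < e"
    using compactness[where f = f and G = G and M = "T + 1" and R = R, OF p sub fG(1) M] by (elim exE conjE)
  note cauchy = cauchy'[rule_format]
  have Nc: "\<exists>K. \<forall>k\<ge>K. \<forall>l\<ge>K. constraint_norm (\<lambda>x. f (s k) x - f (s l) x) < e" if e: "e > 0" for e
  proof -
    \<comment> \<open>The summand 1 keeps \<open>c\<close> positive when \<open>n\<close> or
      \<open>b\<close> is 0.\<close>
    define c where "c = real n * b + 1"
    have c: "c > 0" using b0 by (simp add: c_def add_nonneg_pos)
    have "(e / c) ^ (2 * p) > 0" using e c by simp
    then obtain K where K: "\<And>k l. k \<ge> K \<Longrightarrow> l \<ge> K \<Longrightarrow> ball_power (\<lambda>x. f (s k) x - f (s l) x) < (e / c) ^ (2 * p)"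
      using cauchy[of "(e / c) ^ (2 * p)"] unfolding ball_power_def by blast
    have "constraint_norm (\<lambda>x. f (s k) x - f (s l) x) < e" if "k \<ge> K" "l \<ge> K" for k l
    proof -
      define r where "r = root (2 * p) (ball_power (\<lambda>x. f (s k) x - f (s l) x))"
      have r0: "r \<ge> 0" using p ball_power_nonneg by (simp add: r_def)
      have "r < root (2 * p) ((e / c) ^ (2 * p))" unfolding r_def using K[OF that] p by simp
      then have "r < e / c" using e c p by (simp add: real_root_power_cancel)
      then have "r * c < e" using c by (simp add: pos_less_divide_eq)
      moreover have "constraint_norm (\<lambda>x. f (s k) x - f (s l) x) \<le> real n * b * r"
        using constraint_norm_le_ball_power[OF diff_in_V[OF fG(1) fG(1)]] by (simp add: r_def)
      moreover have "real n * b * r \<le> r * c" using r0 by (simp add: c_def algebra_simps)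
      ultimately show ?thesis by linarith
    qed
    then show ?thesis by blast
  qed
  have Gc: "\<exists>K. \<forall>k\<ge>K. \<forall>l\<ge>K. dirichlet (\<lambda>x. G (s k) x - G (s l) x) < e" if e: "e > 0" for e
  proof -
    \<comment> \<open>Chosen so that \<open>4 * T * \<delta>\<close> is at most e/2; the denominator
      uses \<open>T + 1\<close> because \<open>T\<close> is only known to be nonnegative.\<close>
    define \<delta> where "\<delta> = min 1 (e / (8 * (T + 1)))"
    have \<delta>: "\<delta> > 0" "\<delta> \<le> 1" "4 * T * \<delta> \<le> e / 2"
    proof -
      show "\<delta> > 0" "\<delta> \<le> 1" using e T0 by (auto simp: \<delta>_def)
      have "4 * T * \<delta> \<le> 4 * (T + 1) * (e / (8 * (T + 1)))" using T0 e by (intro mult_mono) (auto simp: \<delta>_def)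
      also have "\<dots> = e / 2" using T0 by (simp add: field_simps)
      finally show "4 * T * \<delta> \<le> e / 2" .
    qed
    obtain K where K: "\<And>k l. k \<ge> K \<Longrightarrow> l \<ge> K \<Longrightarrow> constraint_norm (\<lambda>x. f (s k) x - f (s l) x) < \<delta>" using Nc[OF \<delta>(1)] by blast
    \<comment> \<open>Both energies then exceed \<open>T\<close> by less than e/8; the parallelogram
      law doubles each, for a total of e/2. The other half of e pays for the deficit of the
      midpoint.\<close>
    obtain L :: nat where L: "inverse (real (Suc L)) < e / 8" using reals_Archimedean[of "e / 8"] e by auto
    have "dirichlet (\<lambda>x. G (s k) x - G (s l) x) < e" if kl: "k \<ge> max K L" "l \<ge> max K L" for k l
    proof -
      have small: "dirichlet (G (s j)) < T + e / 8" if "j \<ge> max K L" for j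
      proof -
        have "L \<le> s j" using seq_suble[OF s, of j] that by simp
        then have "inverse (real (Suc (s j))) \<le> inverse (real (Suc L))" by (intro le_imp_inverse_le) auto
        then show ?thesis using fG(3)[of "s j"] L by linarith
      qed
      let ?m = "\<lambda>x. (1 / 2) * (f (s k) x + f (s l) x)"
      have sumV: "((\<lambda>x. f (s k) x + f (s l) x), (\<lambda>x. G (s k) x + G (s l) x)) \<in> V"
        using lin[OF fG(1) fG(1), of "s k" 1 "s l"] by simp
      have half: "((\<lambda>x. (1 / 2) * (f (s k) x - f (s l) x)), (\<lambda>x. (1 / 2) *\<^sub>R (G (s k) x - G (s l) x))) \<in> V"
        by (rule scale_in_V[OF diff_in_V[OF fG(1) fG(1)]])
      have "constraint_norm (f (s k)) \<le> constraint_norm ?m + constraint_norm (\<lambda>x. (1 / 2) * (f (s k) x - f (s l) x))"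
        using constraint_norm_triangle[OF scale_in_V[OF sumV, of "1 / 2"] half] by (simp add: field_simps)
      also have "constraint_norm (\<lambda>x. (1 / 2) * (f (s k) x - f (s l) x)) = (1 / 2) * constraint_norm (\<lambda>x. f (s k) x - f (s l) x)"
        by (subst constraint_norm_scale) simp
      finally have "constraint_norm ?m \<ge> 1 - \<delta> / 2" using K[of k l] kl fG(2)[of "s k"] by simp
      then have "(1 - \<delta> / 2)\<^sup>2 \<le> (constraint_norm ?m)\<^sup>2" using \<delta> by (intro power_mono) auto
      then have "T * (1 - \<delta> / 2)\<^sup>2 \<le> T * (constraint_norm ?m)\<^sup>2" using T0 by (rule mult_left_mono)
      also have "\<dots> \<le> dirichlet (\<lambda>x. (1 / 2) *\<^sub>R (G (s k) x + G (s l) x))" by (rule T_le[OF scale_in_V[OF sumV]])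
      also have "\<dots> = dirichlet (\<lambda>x. G (s k) x + G (s l) x) / 4" by (simp only: dirichlet_scale) (simp add: power2_eq_square)
      finally have "4 * T * (1 - \<delta> / 2)\<^sup>2 \<le> dirichlet (\<lambda>x. G (s k) x + G (s l) x)" by simp
      \<comment> \<open>Bernoulli's inequality: expanding the square and dropping its quadratic
        term.\<close>
      moreover have "4 * T * (1 - \<delta>) \<le> 4 * T * (1 - \<delta> / 2)\<^sup>2"
        using T0 by (intro mult_left_mono) (auto simp: power2_eq_square algebra_simps)
      moreover have "4 * T * (1 - \<delta>) = 4 * T - 4 * T * \<delta>" by (simp add: algebra_simps)
      ultimately show ?thesis
        using dirichlet_parallelogram[OF fG(1)[of "s k"] fG(1)[of "s l"]] small[OF kl(1)] small[OF kl(2)] \<delta>(3) by linarith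
    qed
    then show ?thesis by blast
  qed
  have "\<exists>K. \<forall>k\<ge>K. \<forall>l\<ge>K. dirichlet (\<lambda>x. G (s k) x - G (s l) x) < (1 / 2) ^ j" for j :: nat
    by (rule Gc) simp
  then obtain K where K: "\<And>j k l. k \<ge> K j \<Longrightarrow> l \<ge> K j \<Longrightarrow> dirichlet (\<lambda>x. G (s k) x - G (s l) x) < (1 / 2) ^ (j::nat)" by metis
  \<comment> \<open>The partial sum of \<open>K\<close> is at least \<open>K j\<close>, and adding
    \<open>j\<close> makes the index strictly increasing.\<close>
  define t where "t j = s ((\<Sum>i\<le>j. K i) + j)" for j
  have Kle: "K j \<le> (\<Sum>i\<le>j. K i) + j" for j
  proof -
    have "K j \<le> (\<Sum>i\<le>j. K i)" by (rule member_le_sum) auto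
    then show ?thesis by simp
  qed
  have fast: "dirichlet (\<lambda>x. G (t (Suc j)) x - G (t j) x) \<le> (1 / 2) ^ j" for j
  proof -
    have "K j \<le> (\<Sum>i\<le>Suc j. K i) + Suc j" using Kle[of j] by simp
    then show ?thesis using K[OF _ Kle, of j "(\<Sum>i\<le>Suc j. K i) + Suc j"] unfolding t_def by (simp only: less_imp_le)
  qed
  obtain f' G' where f': "(f', G') \<in> V" and conv: "(\<lambda>k. dirichlet (\<lambda>x. G (t k) x - G' x)) \<longlonglongrightarrow> 0"
    using complete[of "\<lambda>k. f (t k)" "\<lambda>k. G (t k)"] fG(1) fast by blast
  have "(\<lambda>k. constraint_norm (\<lambda>x. f (t k) x - f' x)) \<longlonglongrightarrow> 0"
    by (rule constraint_norm_tendsto_zero[OF diff_in_V[OF fG(1) f'] conv])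
  moreover have "\<bar>1 - constraint_norm f'\<bar> \<le> constraint_norm (\<lambda>x. f (t k) x - f' x)" for k
    using constraint_norm_diff_le[OF fG(1)[of "t k"] f'] fG(2)[of "t k"] by simp
  ultimately have "\<bar>1 - constraint_norm f'\<bar> \<le> 0" by (intro tendsto_lowerbound[where f = "\<lambda>k. constraint_norm (\<lambda>x. f (t k) x - f' x)"]) auto
  then have Nf': "constraint_norm f' = 1" by simp
  \<comment> \<open>The root of the energy is a norm of the gradient, so strong convergence and the
    triangle inequality carry the bound to the limit.\<close>
  have "sqrt (dirichlet G') \<le> sqrt T"
  proof (rule tendsto_lowerbound)
    have "strict_mono t"
      unfolding t_def using s by (intro strict_monoI_Suc strict_monoD[OF s]) simp
    then have "(\<lambda>k. inverse (real (Suc (t k)))) \<longlonglongrightarrow> 0"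
      using LIMSEQ_subseq_LIMSEQ[OF LIMSEQ_inverse_real_of_nat] by (simp add: o_def)
    then have "(\<lambda>k. sqrt (T + inverse (real (Suc (t k)))) + sqrt (dirichlet (\<lambda>x. G (t k) x - G' x))) \<longlonglongrightarrow> sqrt (T + 0) + sqrt 0"
      by (intro tendsto_intros conv)
    then show "(\<lambda>k. sqrt (T + inverse (real (Suc (t k)))) + sqrt (dirichlet (\<lambda>x. G (t k) x - G' x))) \<longlonglongrightarrow> sqrt T" by simp
    show "\<forall>\<^sub>F k in sequentially. sqrt (dirichlet G') \<le> sqrt (T + inverse (real (Suc (t k)))) + sqrt (dirichlet (\<lambda>x. G (t k) x - G' x))"
    proof (intro always_eventually allI)
      fix k
      have m: "G (t k) \<in> borel_measurable lebesgue" "(\<lambda>x. (-1) *\<^sub>R (G (t k) x - G' x)) \<in> borel_measurable lebesgue"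
        by (rule G_measurable[OF fG(1)], rule G_measurable[OF scale_in_V[OF diff_in_V[OF fG(1) f']]])
      have i: "integrable lebesgue (\<lambda>x. norm (G (t k) x) ^ 2)" "integrable lebesgue (\<lambda>x. norm ((-1) *\<^sub>R (G (t k) x - G' x)) ^ 2)"
        by (rule G2[OF fG(1)], rule G2[OF scale_in_V[OF diff_in_V[OF fG(1) f']]])
      have "sqrt (dirichlet G') \<le> sqrt (dirichlet (G (t k))) + sqrt (dirichlet (\<lambda>x. G (t k) x - G' x))"
        using Lq_triangle[OF _ m i] by (simp add: sqrt_def dirichlet_def norm_minus_commute)
      then show "sqrt (dirichlet G') \<le> sqrt (T + inverse (real (Suc (t k)))) + sqrt (dirichlet (\<lambda>x. G (t k) x - G' x))"
        using fG(3)[of "t k"] real_sqrt_le_mono[of "dirichlet (G (t k))" "T + inverse (real (Suc (t k)))"] by linarith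
    qed
  qed auto
  then have "dirichlet G' \<le> T" by simp
  then have "dirichlet G' \<le> dirichlet H" if "(g, H) \<in> V" "constraint_norm g = 1" for g H
    using T_le[OF that(1)] that(2) by simp
  then show thesis using that[OF f' Nf'] by blast
qed

end

section \<open>The space \<open>D1\<close>\<close>

lemma weak_grad_weak_gradient: "is_weak_gradient B f G \<Longrightarrow> is_weak_gradient B f (weak_grad B f)"
  unfolding weak_grad_def by (rule someI[where P = "is_weak_gradient B f"])

lemma indicator_measurable_lebesgue:
  fixes G :: "'a::euclidean_space \<Rightarrow> 'b::euclidean_space"
  assumes "open B" "G \<in> L1_loc B"
  shows "(\<lambda>x. indicator B x *\<^sub>R G x) \<in> borel_measurable lebesgue"
  using assms by (subst measurable_on_eq[symmetric]) (auto simp: L1_loc_def)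

lemma Lq_norm_indicator:
  fixes g :: "'a::euclidean_space \<Rightarrow> 'b::euclidean_space"
  assumes "open B" "q \<ge> 1"
  shows "Lq_norm B q g = root q (\<integral>x. norm (indicator B x *\<^sub>R g x) ^ q \<partial>lebesgue)"
proof -
  have "(\<integral>x. norm (g x) ^ q \<partial>lebesgue_on B) = (\<integral>x. norm (indicator B x *\<^sub>R g x) ^ q \<partial>lebesgue)"
    using assms by (subst integral_on_eq) (auto intro!: Bochner_Integration.integral_cong simp: zero_power split: split_indicator)
  then show ?thesis by (simp add: Lq_norm_def)
qed

lemma Lq_norm_2_sq:
  fixes g :: "'a::euclidean_space \<Rightarrow> 'b::euclidean_space"
  assumes "open B"
  shows "(Lq_norm B 2 g)\<^sup>2 = (\<integral>x. (norm (indicator B x *\<^sub>R g x))\<^sup>2 \<partial>lebesgue)"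
  using Lq_norm_indicator[OF assms, of 2 g]
  by (simp add: Bochner_Integration.integral_nonneg)

lemma Lq_iff:
  fixes g :: "'a::euclidean_space \<Rightarrow> 'b::euclidean_space"
  assumes "open B" "q \<ge> 1"
  shows "g \<in> Lq B q \<longleftrightarrow> (\<lambda>x. indicator B x *\<^sub>R g x) \<in> borel_measurable lebesgue \<and>
     integrable lebesgue (\<lambda>x. norm (indicator B x *\<^sub>R g x) ^ q)"
proof -
  have "(\<lambda>x. indicator B x *\<^sub>R (norm (g x) ^ q)) = (\<lambda>x. norm (indicator B x *\<^sub>R g x) ^ q)"
    using assms(2) by (auto simp: fun_eq_iff zero_power split: split_indicator)
  then show ?thesis using assms
    unfolding Lq_def by (simp add: measurable_on_eq integrable_on_eq)
qed

text \<open>By uniqueness up to null sets the value does not depend on the field picked by the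
  choice operator, so any weak gradient at hand computes the norm.\<close>

lemma Lq_norm_weak_grad:
  assumes B: "open B" and wg: "is_weak_gradient B f G"
  shows "(Lq_norm B 2 (weak_grad B f))\<^sup>2 = dirichlet (\<lambda>x. indicator B x *\<^sub>R G x)"
proof -
  note wg' = weak_grad_weak_gradient[OF wg]
  have "AE x in lebesgue. x \<in> B \<longrightarrow> weak_grad B f x = G x" by (rule weak_gradient_unique[OF B wg' wg])
  then have "AE x in lebesgue. (norm (indicator B x *\<^sub>R weak_grad B f x))\<^sup>2 = (norm (indicator B x *\<^sub>R G x))\<^sup>2"
    by eventually_elim (auto split: split_indicator)
  moreover have "(\<lambda>x. indicator B x *\<^sub>R weak_grad B f x) \<in> borel_measurable lebesgue"
      "(\<lambda>x. indicator B x *\<^sub>R G x) \<in> borel_measurable lebesgue"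
    using wg wg' by (auto simp: is_weak_gradient_def intro!: indicator_measurable_lebesgue[OF B])
  ultimately show ?thesis unfolding Lq_norm_2_sq[OF B] dirichlet_def
    by (intro integral_cong_AE borel_measurable_power borel_measurable_norm[THEN measurable_compose[rotated]])
qed

definition extension_class :: "'a::euclidean_space set \<Rightarrow> (('a \<Rightarrow> real) \<times> ('a \<Rightarrow> 'a)) set" where
  "extension_class B = {((\<lambda>x. indicator B x * f x), (\<lambda>x. indicator B x *\<^sub>R G x)) | f G.
     f \<in> D_space B \<and> is_weak_gradient B f G \<and> G \<in> Lq B 2}"

text \<open>Suppose the limit c of the averages over growing cubes is not 0. On a large cube of side
  H the function then stays at distance at least \<epsilon> from its average, except on a set of
  finite measure m. The squared averaging error is at least \<epsilon>^2 (H^d - m) but at most A H^2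
  D, a contradiction for large H as d \<ge> 3.\<close>

lemma vanishing_avg_bound_aux:
  fixes f :: "'a::euclidean_space \<Rightarrow> real"
  assumes wg: "is_weak_gradient UNIV f G" and G2: "integrable lebesgue (\<lambda>x. (norm (G x))\<^sup>2)"
    and van: "vanishes_at_infinity f" and d: "DIM('a) \<ge> 3" and h: "h > 0"
    and c: "(\<lambda>j. cube_avg (2 ^ j * h) f x) \<longlonglongrightarrow> c"
  shows "c = 0"
proof (rule ccontr)
  assume c0: "c \<noteq> 0"
  have fL: "f \<in> L1_loc UNIV" using wg by (simp add: is_weak_gradient_def)
  note f_measurable = L1_loc_UNIV_measurable[OF fL]
  \<comment> \<open>A quarter of \<open>\<bar>c\<bar>\<close>: eventually the averages exceed twice
    \<epsilon> in absolute value, while \<open>\<bar>f\<bar> \<le> \<epsilon>\<close> off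
    \<open>S\<close>, which leaves a gap of at least \<epsilon>.\<close>
  define \<epsilon> where "\<epsilon> = \<bar>c\<bar> / 4"
  have \<epsilon>: "\<epsilon> > 0" using c0 by (simp add: \<epsilon>_def)
  obtain A where A: "A \<ge> 0" "\<And>f (G :: 'a \<Rightarrow> 'a) h. is_weak_gradient UNIV f G \<Longrightarrow>
     integrable lebesgue (\<lambda>y. (norm (G y))\<^sup>2) \<Longrightarrow> h > 0 \<Longrightarrow>
     (\<integral>\<^sup>+x. ennreal (\<bar>f x - cube_avg h f x\<bar> ^ (2 * 1)) \<partial>lebesgue)
     \<le> ennreal (A * ((h\<^sup>2 / h ^ DIM('a)) ^ 1 * h ^ DIM('a)) * (\<integral>y. (norm (G y))\<^sup>2 \<partial>lebesgue) ^ 1)"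
    using cube_avg_error[where 'a = 'a and p = 1] by auto
  define D where "D = (\<integral>y. (norm (G y))\<^sup>2 \<partial>lebesgue)"
  have D0: "D \<ge> 0" unfolding D_def by (intro Bochner_Integration.integral_nonneg) auto
  define S where "S = {y. \<bar>f y\<bar> > \<epsilon>}"
  have S: "S \<in> sets lebesgue"
  proof -
    have "{y \<in> space lebesgue. \<epsilon> < \<bar>f y\<bar>} \<in> sets lebesgue" using f_measurable by measurable
    then show ?thesis by (simp add: S_def)
  qed
  have Sfin: "emeasure lebesgue S < \<infinity>" using van \<epsilon> by (simp add: vanishes_at_infinity_def S_def)
  define m where "m = measure lebesgue S"
  have m0: "m \<ge> 0" by (simp add: m_def)
  have key: "\<epsilon>\<^sup>2 * (H ^ DIM('a) - m) \<le> A * H\<^sup>2 * D" if H: "H > 0" and a: "\<bar>cube_avg H f x\<bar> \<ge> 2 * \<epsilon>" for H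
  proof -
    have Qf: "cube H x \<in> fmeasurable lebesgue" using cube_measure[OF H, of x] by (intro fmeasurableI) auto
    have Sf: "S \<in> fmeasurable lebesgue" using S Sfin by (intro fmeasurableI) auto
    have Q: "measure lebesgue (cube H x) = H ^ DIM('a)" using cube_measure[OF H, of x] H by (simp add: measure_def)
    have "measure lebesgue (cube H x) \<le> measure lebesgue (cube H x - S) + measure lebesgue S"
    proof -
      have "measure lebesgue (cube H x) \<le> measure lebesgue ((cube H x - S) \<union> S)"
        using Qf Sf by (intro measure_mono_fmeasurable fmeasurable.Un fmeasurable_Diff) (auto simp: fmeasurableD)
      also have "\<dots> \<le> measure lebesgue (cube H x - S) + measure lebesgue S"
        using Qf S by (intro measure_Un_le) (auto simp: fmeasurableD)
      finally show ?thesis .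
    qed
    then have m1: "H ^ DIM('a) - m \<le> measure lebesgue (cube H x - S)" unfolding Q m_def by simp
    have QSf: "cube H x - S \<in> fmeasurable lebesgue" using Qf S by (intro fmeasurable_Diff) auto
    have "ennreal (\<epsilon>\<^sup>2 * measure lebesgue (cube H x - S)) = (\<integral>\<^sup>+y. ennreal (\<epsilon>\<^sup>2) * indicator (cube H x - S) y \<partial>lebesgue)"
      using QSf by (subst nn_integral_cmult_indicator) (auto simp: fmeasurableD emeasure_eq_measure2 ennreal_mult)
    also have "\<dots> \<le> (\<integral>\<^sup>+y. ennreal (\<bar>f y - cube_avg H f y\<bar> ^ (2 * 1)) \<partial>lebesgue)"
    proof (rule nn_integral_mono)
      fix y
      have "\<epsilon>\<^sup>2 \<le> \<bar>f y - cube_avg H f y\<bar> ^ (2 * 1)" if y: "y \<in> cube H x - S"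
      proof -
        have "cube_avg H f y = cube_avg H f x" using y by (intro avg_eq) auto
        moreover have "\<bar>f y\<bar> \<le> \<epsilon>" using y by (simp add: S_def not_less)
        ultimately have "\<epsilon> \<le> \<bar>f y - cube_avg H f y\<bar>" using a by linarith
        from power_mono[OF this, of 2] show ?thesis using \<epsilon> by simp
      qed
      then show "ennreal (\<epsilon>\<^sup>2) * indicator (cube H x - S) y \<le> ennreal (\<bar>f y - cube_avg H f y\<bar> ^ (2 * 1))"
        by (auto intro!: ennreal_leI split: split_indicator)
    qed
    also have "\<dots> \<le> ennreal (A * H\<^sup>2 * D)"
      using A(2)[OF wg G2 H] H by (simp add: D_def)
    finally have "\<epsilon>\<^sup>2 * measure lebesgue (cube H x - S) \<le> A * H\<^sup>2 * D"
      using A(1) D0 by (simp add: ennreal_le_iff)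
    moreover have "\<epsilon>\<^sup>2 * (H ^ DIM('a) - m) \<le> \<epsilon>\<^sup>2 * measure lebesgue (cube H x - S)"
      using m1 by (intro mult_left_mono) auto
    ultimately show ?thesis by linarith
  qed
  have "(\<lambda>j. \<bar>cube_avg (2 ^ j * h) f x\<bar>) \<longlonglongrightarrow> \<bar>c\<bar>" by (intro tendsto_intros c)
  then have "\<forall>\<^sub>F j in sequentially. \<bar>cube_avg (2 ^ j * h) f x\<bar> > 2 * \<epsilon>"
    by (rule order_tendstoD(1)) (use c0 in \<open>simp add: \<epsilon>_def\<close>)
  \<comment> \<open>Beyond 1, to compare powers of the side; beyond the quotient, so that the cubic
    lower bound exceeds the quadratic upper bound.\<close>
  moreover have "\<forall>\<^sub>F j in sequentially. 2 ^ j * h > max 1 ((A * D + \<epsilon>\<^sup>2 * m) / \<epsilon>\<^sup>2)"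
  proof -
    have "filterlim (\<lambda>j. 2 ^ j * h) at_top sequentially"
    proof (rule filterlim_at_top_mult_tendsto_pos[OF tendsto_const h])
      show "filterlim (\<lambda>j. (2::real) ^ j) at_top sequentially"
        by (rule filterlim_at_top_mono[OF filterlim_real_sequentially])
          (auto intro!: always_eventually less_imp_le of_nat_less_two_power)
    qed
    then show ?thesis unfolding filterlim_at_top_dense by blast
  qed
  ultimately have "\<forall>\<^sub>F j in sequentially. False"
  proof eventually_elim
    case (elim j)
    define H where "H = 2 ^ j * h"
    have H: "H > 1" "H > (A * D + \<epsilon>\<^sup>2 * m) / \<epsilon>\<^sup>2" using elim(2) by (auto simp: H_def)
    have "\<epsilon>\<^sup>2 * (H ^ DIM('a) - m) \<le> A * H\<^sup>2 * D"
      using elim(1) H(1) by (intro key) (auto simp: H_def)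
    moreover have "H ^ 3 \<le> H ^ DIM('a)" using H(1) d by (intro power_increasing) auto
    then have "\<epsilon>\<^sup>2 * H ^ 3 \<le> \<epsilon>\<^sup>2 * H ^ DIM('a)" by (intro mult_left_mono) auto
    ultimately have "\<epsilon>\<^sup>2 * H ^ 3 \<le> A * H\<^sup>2 * D + \<epsilon>\<^sup>2 * m" by (simp add: right_diff_distrib)
    also have "\<dots> \<le> A * H\<^sup>2 * D + \<epsilon>\<^sup>2 * m * H\<^sup>2"
      using H(1) m0 \<epsilon> mult_left_mono[of 1 "H\<^sup>2" "\<epsilon>\<^sup>2 * m"] by (simp add: one_le_power)
    also have "\<dots> = (A * D + \<epsilon>\<^sup>2 * m) * H\<^sup>2"
    proof -
      have "a * q * d + e * k * q = (a * d + e * k) * q" for a q d e k :: real by algebra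
      then show ?thesis .
    qed
    finally have "(\<epsilon>\<^sup>2 * H) * H\<^sup>2 \<le> (A * D + \<epsilon>\<^sup>2 * m) * H\<^sup>2"
      by (simp add: eval_nat_numeral mult.assoc)
    then have "\<epsilon>\<^sup>2 * H \<le> A * D + \<epsilon>\<^sup>2 * m" by (rule mult_right_le_imp_le) (use H(1) in simp)
    moreover have "A * D + \<epsilon>\<^sup>2 * m < H * \<epsilon>\<^sup>2" using H(2) \<epsilon> by (simp add: pos_divide_less_eq)
    ultimately show ?case by (simp add: mult.commute)
  qed
  then show False by simp
qed

text \<open>Passing from side \<open>2 ^ j * h\<close> to twice that side moves the average by at
  most \<open>s * \<rho> ^ j\<close>, where \<rho> is 2^(1 - d/2), below 1 for d \<ge> 3. So the
  averages converge, the limit is 0 by \<open>vanishing_avg_bound_aux\<close>, and the geometric sum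
  bounds the initial average.\<close>

lemma vanishing_avg_bound:
  assumes d: "DIM('a::euclidean_space) \<ge> 3"
  obtains C where "C \<ge> 0" "\<And>f (G :: 'a \<Rightarrow> 'a) h x. is_weak_gradient UNIV f G \<Longrightarrow>
    integrable lebesgue (\<lambda>x. (norm (G x))\<^sup>2) \<Longrightarrow> vanishes_at_infinity f \<Longrightarrow> h > 0 \<Longrightarrow>
    (cube_avg h f x)\<^sup>2 \<le> C * (h\<^sup>2 / h ^ DIM('a)) * dirichlet G"
proof -
  define \<rho> where "\<rho> = sqrt (4 / 2 ^ DIM('a))"
  have "(2::real) ^ 3 \<le> 2 ^ DIM('a)" using d by (intro power_increasing) auto
  then have "4 / 2 ^ DIM('a) < (1::real)" by simp
  then have \<rho>: "0 < \<rho>" "\<rho> < 1" by (auto simp: \<rho>_def real_sqrt_lt_1_iff)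
  define K where "K = (real DIM('a))\<^sup>2 * 4 ^ DIM('a)"
  have K0: "K \<ge> 0" by (simp add: K_def)
  define C where "C = K / (1 - \<rho>)\<^sup>2"
  have C0: "C \<ge> 0" using K0 by (simp add: C_def)
  show thesis
  proof (rule that[OF C0])
    fix f and G :: "'a \<Rightarrow> 'a" and h :: real and x
    assume wg: "is_weak_gradient UNIV f G" and G2: "integrable lebesgue (\<lambda>x. (norm (G x))\<^sup>2)"
      and van: "vanishes_at_infinity f" and h: "h > 0"
    define s where "s = sqrt (K * (h\<^sup>2 / h ^ DIM('a)) * dirichlet G)"
    have s0: "s \<ge> 0" using K0 h dirichlet_nonneg[of G] by (simp add: s_def)
    define a where "a j = cube_avg (2 ^ j * h) f x" for j :: nat
    have step: "\<bar>a (Suc j) - a j\<bar> \<le> s * \<rho> ^ j" for j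
    proof -
      define H where "H = 2 ^ Suc j * h"
      have H: "H > 0" using h by (simp add: H_def)
      have "(cube_avg (H / 2) f x - cube_avg H f x)\<^sup>2 \<le> K * (H\<^sup>2 / H ^ DIM('a)) * (\<integral>y. indicator (cube H x) y * (norm (G y))\<^sup>2 \<partial>lebesgue)"
        unfolding K_def by (rule cube_avg_halve_sq[OF wg H G2])
      also have "\<dots> \<le> K * (H\<^sup>2 / H ^ DIM('a)) * dirichlet G"
        unfolding dirichlet_def using K0 H G2 integrable_mult_indicator[OF _ G2, of "cube H x"]
        by (intro mult_left_mono integral_mono) (auto split: split_indicator)
      also have "H\<^sup>2 / H ^ DIM('a) = (h\<^sup>2 / h ^ DIM('a)) * (4 / 2 ^ DIM('a)) ^ Suc j"
      proof -
        have e: "((2::real) ^ n)\<^sup>2 = 4 ^ n" "((2::real) ^ n) ^ DIM('a) = (2 ^ DIM('a)) ^ n" for n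
          by (simp_all add: power_mult[symmetric] mult.commute power2_eq_square power_mult_distrib[symmetric])
        show ?thesis unfolding H_def power_mult_distrib e power_divide by (simp only: times_divide_times_eq mult.commute)
      qed
      also have "(4 / 2 ^ DIM('a)) ^ Suc j = (\<rho>\<^sup>2) ^ Suc j" by (simp add: \<rho>_def)
      also have "K * (h\<^sup>2 / h ^ DIM('a) * (\<rho>\<^sup>2) ^ Suc j) * dirichlet G = (s * \<rho> ^ Suc j)\<^sup>2"
      proof -
        have "s\<^sup>2 = K * (h\<^sup>2 / h ^ DIM('a)) * dirichlet G" using K0 h dirichlet_nonneg[of G] by (simp add: s_def)
        moreover have "(\<rho> ^ Suc j)\<^sup>2 = (\<rho>\<^sup>2) ^ Suc j" by (metis mult.commute power_mult)
        ultimately show ?thesis by (simp only: power_mult_distrib) (simp only: mult_ac)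
      qed
      finally have "\<bar>cube_avg (H / 2) f x - cube_avg H f x\<bar> \<le> s * \<rho> ^ Suc j"
        using s0 \<rho> by (intro power2_le_imp_le[of "\<bar>cube_avg (H / 2) f x - cube_avg H f x\<bar>"]) auto
      moreover have "s * \<rho> ^ Suc j \<le> s * \<rho> ^ j" using s0 \<rho> by (intro mult_left_mono) (auto simp: mult_left_le_one_le)
      moreover have "H / 2 = 2 ^ j * h" by (simp add: H_def)
      ultimately show ?thesis by (simp add: a_def H_def abs_minus_commute)
    qed
    have sumb: "\<bar>a n - a 0\<bar> \<le> s / (1 - \<rho>)" for n
    proof -
      have "\<bar>a n - a 0\<bar> = \<bar>\<Sum>j<n. a (Suc j) - a j\<bar>" by (simp add: sum_lessThan_telescope[of a])
      also have "\<dots> \<le> (\<Sum>j<n. \<bar>a (Suc j) - a j\<bar>)" by (rule sum_abs)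
      also have "\<dots> \<le> (\<Sum>j<n. s * \<rho> ^ j)" by (intro sum_mono step)
      also have "\<dots> = s * (\<Sum>j<n. \<rho> ^ j)" by (simp add: sum_distrib_left)
      also have "\<dots> \<le> s * (1 / (1 - \<rho>))"
      proof -
        have "(\<Sum>j<n. \<rho> ^ j) \<le> (\<Sum>j. \<rho> ^ j)" using \<rho> by (intro sum_le_suminf summable_geometric) auto
        then show ?thesis using \<rho> s0 by (intro mult_left_mono) (auto simp: suminf_geometric)
      qed
      finally show ?thesis by simp
    qed
    have "summable (\<lambda>j. norm (a (Suc j) - a j))"
      by (rule summable_comparison_test'[where g = "\<lambda>j. s * \<rho> ^ j" and N = 0])
         (use step \<rho> in \<open>auto intro!: summable_mult summable_geometric\<close>)
    then have "summable (\<lambda>j. a (Suc j) - a j)" by (rule summable_norm_cancel)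
    then have "(\<lambda>n. a 0 + (\<Sum>j<n. a (Suc j) - a j)) \<longlonglongrightarrow> a 0 + (\<Sum>j. a (Suc j) - a j)"
      by (intro tendsto_add tendsto_const summable_LIMSEQ)
    then have lim: "a \<longlonglongrightarrow> a 0 + (\<Sum>j. a (Suc j) - a j)" by (simp add: sum_lessThan_telescope[of a])
    then have "a 0 + (\<Sum>j. a (Suc j) - a j) = 0"
      unfolding a_def[abs_def] by (intro vanishing_avg_bound_aux[OF wg G2 van d h])
    then have "a \<longlonglongrightarrow> 0" using lim by simp
    then have "(\<lambda>n. \<bar>a n - a 0\<bar>) \<longlonglongrightarrow> \<bar>0 - a 0\<bar>" by (intro tendsto_intros)
    then have "\<bar>0 - a 0\<bar> \<le> s / (1 - \<rho>)" by (rule tendsto_upperbound) (use sumb in auto)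
    then have "\<bar>cube_avg h f x\<bar> \<le> s / (1 - \<rho>)" by (simp add: a_def)
    then have "(cube_avg h f x)\<^sup>2 \<le> (s / (1 - \<rho>))\<^sup>2" using power_mono[of "\<bar>cube_avg h f x\<bar>" _ 2] by simp
    also have "\<dots> = C * (h\<^sup>2 / h ^ DIM('a)) * dirichlet G"
      using K0 h dirichlet_nonneg[of G] by (simp add: s_def C_def power_divide)
    finally show "(cube_avg h f x)\<^sup>2 \<le> C * (h\<^sup>2 / h ^ DIM('a)) * dirichlet G" .
  qed
qed

text \<open>The counterpart of \<open>vanishing_avg_bound\<close>, meant for limit functions: with
  averages at most a/2 on a coarse grid, \<open>\<bar>f\<bar> > a\<close> forces an averaging error
  of at least a/2, and Chebyshev's inequality bounds the measure of the set where this
  happens.\<close>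

lemma vanishes_if_avg_small:
  fixes f :: "'a::euclidean_space \<Rightarrow> real"
  assumes wg: "is_weak_gradient UNIV f G" and G2: "integrable lebesgue (\<lambda>x. (norm (G x))\<^sup>2)"
    and d: "DIM('a) \<ge> 3" and b: "\<And>h x. h > 0 \<Longrightarrow> (cube_avg h f x)\<^sup>2 \<le> C * (h\<^sup>2 / h ^ DIM('a))" and C: "C \<ge> 0"
  shows "vanishes_at_infinity f"
  unfolding vanishes_at_infinity_def
proof (intro allI impI)
  fix a :: real assume a: "a > 0"
  have fL: "f \<in> L1_loc UNIV" using wg by (simp add: is_weak_gradient_def)
  note f_measurable = L1_loc_UNIV_measurable[OF fL]
  \<comment> \<open>As h \<ge> 1 and d \<ge> 3, the squared averages are at most C / h, which is at
    most (a/2)^2 for this side.\<close>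
  define h where "h = max 1 (4 * C / a\<^sup>2)"
  have h: "h \<ge> 1" "4 * C / a\<^sup>2 \<le> h" by (auto simp: h_def)
  have small: "\<bar>cube_avg h f x\<bar> \<le> a / 2" for x
  proof -
    have "h ^ 3 \<le> h ^ DIM('a)" using h(1) d by (intro power_increasing) auto
    then have "h\<^sup>2 / h ^ DIM('a) \<le> h\<^sup>2 / h ^ 3" using h(1) by (intro divide_left_mono) auto
    also have "\<dots> = 1 / h" using h(1) by (simp add: power2_eq_square power3_eq_cube)
    finally have "C * (h\<^sup>2 / h ^ DIM('a)) \<le> C * (1 / h)" using C by (rule mult_left_mono)
    also have "\<dots> \<le> (a / 2)\<^sup>2"
    proof -
      have "4 * C \<le> h * a\<^sup>2" using h(2) a by (simp add: pos_divide_le_eq)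
      then show ?thesis using h(1) by (simp add: field_simps power2_eq_square)
    qed
    finally have "(cube_avg h f x)\<^sup>2 \<le> (a / 2)\<^sup>2" using b[of h x] h(1) by simp
    then show ?thesis using a by (intro power2_le_imp_le[of "\<bar>cube_avg h f x\<bar>"]) auto
  qed
  obtain A where A: "A \<ge> 0" "\<And>f (G :: 'a \<Rightarrow> 'a) h. is_weak_gradient UNIV f G \<Longrightarrow>
     integrable lebesgue (\<lambda>y. (norm (G y))\<^sup>2) \<Longrightarrow> h > 0 \<Longrightarrow>
     (\<integral>\<^sup>+x. ennreal (\<bar>f x - cube_avg h f x\<bar> ^ (2 * 1)) \<partial>lebesgue)
     \<le> ennreal (A * ((h\<^sup>2 / h ^ DIM('a)) ^ 1 * h ^ DIM('a)) * (\<integral>y. (norm (G y))\<^sup>2 \<partial>lebesgue) ^ 1)"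
    using cube_avg_error[where 'a = 'a and p = 1] by auto
  have S: "{x. a < \<bar>f x\<bar>} \<in> sets lebesgue"
  proof -
    have "{y \<in> space lebesgue. a < \<bar>f y\<bar>} \<in> sets lebesgue" using f_measurable by measurable
    then show ?thesis by simp
  qed
  have "ennreal ((a / 2)\<^sup>2) * emeasure lebesgue {x. a < \<bar>f x\<bar>} = (\<integral>\<^sup>+x. ennreal ((a / 2)\<^sup>2) * indicator {x. a < \<bar>f x\<bar>} x \<partial>lebesgue)"
    using S by (rule nn_integral_cmult_indicator[symmetric])
  also have "\<dots> \<le> (\<integral>\<^sup>+x. ennreal (\<bar>f x - cube_avg h f x\<bar> ^ (2 * 1)) \<partial>lebesgue)"
  proof (rule nn_integral_mono)
    fix x
    have "(a / 2)\<^sup>2 \<le> \<bar>f x - cube_avg h f x\<bar> ^ (2 * 1)" if "a < \<bar>f x\<bar>"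
    proof -
      have "a / 2 \<le> \<bar>f x - cube_avg h f x\<bar>" using small[of x] that by linarith
      then show ?thesis using a power_mono[of "a / 2" "\<bar>f x - cube_avg h f x\<bar>" 2] by simp
    qed
    then show "ennreal ((a / 2)\<^sup>2) * indicator {x. a < \<bar>f x\<bar>} x \<le> ennreal (\<bar>f x - cube_avg h f x\<bar> ^ (2 * 1))"
      by (auto intro!: ennreal_leI split: split_indicator)
  qed
  also have "\<dots> < \<infinity>" using A(2)[OF wg G2, of h] h(1) by (auto intro: le_less_trans)
  finally have "ennreal ((a / 2)\<^sup>2) * emeasure lebesgue {x. a < \<bar>f x\<bar>} < \<infinity>" .
  then show "emeasure lebesgue {x. a < \<bar>f x\<bar>} < \<infinity>"
    using a by (auto simp: ennreal_mult_less_top less_top[symmetric])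
qed

section \<open>\<open>D1\<close> as a complete class of pairs\<close>

lemma Lq_UNIV_2: "(G :: 'a::euclidean_space \<Rightarrow> 'a) \<in> Lq UNIV 2 \<longleftrightarrow> G \<in> borel_measurable lebesgue \<and> integrable lebesgue (\<lambda>x. (norm (G x))\<^sup>2)"
  by (simp add: Lq_iff)

lemma extension_class_UNIV:
  "extension_class UNIV = {(f, G) | (f :: 'a::euclidean_space \<Rightarrow> real) G. f \<in> D1 \<and> is_weak_gradient UNIV f G \<and> integrable lebesgue (\<lambda>x. (norm (G x))\<^sup>2)}"
proof -
  have "\<not> bounded (UNIV :: 'a set)" by (rule not_bounded_UNIV)
  moreover have "is_weak_gradient UNIV f G \<Longrightarrow> G \<in> borel_measurable lebesgue" for f :: "'a \<Rightarrow> real" and G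
    unfolding is_weak_gradient_def by (blast intro: L1_loc_UNIV_measurable)
  ultimately show ?thesis unfolding extension_class_def D_space_def Lq_UNIV_2 by auto
qed

lemma D1_intro:
  assumes "is_weak_gradient UNIV f G" "integrable lebesgue (\<lambda>x. (norm (G x))\<^sup>2)" "vanishes_at_infinity f"
  shows "f \<in> D1"
  using assms unfolding D1_def is_weak_gradient_def Lq_UNIV_2 by (blast intro: L1_loc_UNIV_measurable)

lemma vanishes_lincomb:
  assumes f: "vanishes_at_infinity f" "f \<in> borel_measurable lebesgue" and g: "vanishes_at_infinity g" "g \<in> borel_measurable lebesgue"
  shows "vanishes_at_infinity (\<lambda>x. f x + c * g x)"
  unfolding vanishes_at_infinity_def
proof (intro allI impI)
  fix a :: real assume a: "a > 0"
  \<comment> \<open>\<open>\<bar>g x\<bar> \<le> e\<close> then implies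
    \<open>\<bar>c * g x\<bar> \<le> a / 2\<close>; the summand 1 covers c = 0.\<close>
  define e where "e = a / (2 * (\<bar>c\<bar> + 1))"
  have e: "e > 0" using a by (simp add: e_def)
  have m: "{x. t < \<bar>u x\<bar>} \<in> sets lebesgue" if "u \<in> borel_measurable lebesgue" for u :: "'a \<Rightarrow> real" and t
  proof -
    have "{y \<in> space lebesgue. t < \<bar>u y\<bar>} \<in> sets lebesgue" using that by measurable
    then show ?thesis by simp
  qed
  have sub: "{x. a < \<bar>f x + c * g x\<bar>} \<subseteq> {x. a / 2 < \<bar>f x\<bar>} \<union> {x. e < \<bar>g x\<bar>}"
  proof
    fix x assume x: "x \<in> {x. a < \<bar>f x + c * g x\<bar>}"
    show "x \<in> {x. a / 2 < \<bar>f x\<bar>} \<union> {x. e < \<bar>g x\<bar>}"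
    proof (rule ccontr)
      assume "x \<notin> {x. a / 2 < \<bar>f x\<bar>} \<union> {x. e < \<bar>g x\<bar>}"
      then have 1: "\<bar>f x\<bar> \<le> a / 2" "\<bar>g x\<bar> \<le> e" by auto
      have "\<bar>c * g x\<bar> \<le> (\<bar>c\<bar> + 1) * e" unfolding abs_mult using 1 by (intro mult_mono) auto
      also have "\<dots> = a / 2" by (simp add: e_def field_simps)
      finally show False using 1 x by auto
    qed
  qed
  have "emeasure lebesgue {x. a < \<bar>f x + c * g x\<bar>} \<le> emeasure lebesgue ({x. a / 2 < \<bar>f x\<bar>} \<union> {x. e < \<bar>g x\<bar>})"
    by (rule emeasure_mono[OF sub sets.Un[OF m[OF f(2)] m[OF g(2)]]])
  also have "\<dots> \<le> emeasure lebesgue {x. a / 2 < \<bar>f x\<bar>} + emeasure lebesgue {x. e < \<bar>g x\<bar>}"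
    by (rule emeasure_subadditive[OF m[OF f(2)] m[OF g(2)]])
  also have "\<dots> < \<infinity>"
  proof -
    have "emeasure lebesgue {x. a / 2 < \<bar>f x\<bar>} < \<infinity>"
      by (rule f(1)[unfolded vanishes_at_infinity_def, rule_format]) (use a in simp)
    moreover have "emeasure lebesgue {x. e < \<bar>g x\<bar>} < \<infinity>"
      by (rule g(1)[unfolded vanishes_at_infinity_def, rule_format, OF e])
    ultimately show ?thesis by (simp only: infinity_ennreal_def ennreal_add_less_top)
  qed
  finally show "emeasure lebesgue {x. a < \<bar>f x + c * g x\<bar>} < \<infinity>" .
qed

text \<open>The locale asks for the bound at side 1 only. The bound at all sides is kept as well,
  because its decay in \<open>h\<close> is what shows that limits vanish at infinity.\<close>

lemma gradient_class_UNIV: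
  assumes d: "DIM('a::euclidean_space) \<ge> 3"
  obtains C where "gradient_class (extension_class (UNIV :: 'a set)) 1 C"
    "\<And>f G h x. (f, G) \<in> extension_class (UNIV :: 'a set) \<Longrightarrow> h > 0 \<Longrightarrow> (cube_avg h f x)\<^sup>2 \<le> C * (h\<^sup>2 / h ^ DIM('a)) * dirichlet G"
proof -
  obtain C where C: "C \<ge> 0" "\<And>f (G :: 'a \<Rightarrow> 'a) h x. is_weak_gradient UNIV f G \<Longrightarrow>
    integrable lebesgue (\<lambda>x. (norm (G x))\<^sup>2) \<Longrightarrow> vanishes_at_infinity f \<Longrightarrow> h > 0 \<Longrightarrow>
    (cube_avg h f x)\<^sup>2 \<le> C * (h\<^sup>2 / h ^ DIM('a)) * dirichlet G"
    using vanishing_avg_bound[OF d] by blast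
  have b: "(cube_avg h f x)\<^sup>2 \<le> C * (h\<^sup>2 / h ^ DIM('a)) * dirichlet G"
    if "(f, G) \<in> extension_class (UNIV :: 'a set)" "h > 0" for f G h x
    using C(2) that unfolding extension_class_UNIV D1_def by auto
  have "gradient_class (extension_class (UNIV :: 'a set)) 1 C"
  proof
    fix f F g G and c :: real
    assume fF: "(f, F) \<in> extension_class (UNIV :: 'a set)" and gG: "(g, G) \<in> extension_class (UNIV :: 'a set)"
    then have w: "is_weak_gradient UNIV (\<lambda>x. f x + c * g x) (\<lambda>x. F x + c *\<^sub>R G x)"
      unfolding extension_class_UNIV by (auto intro: is_weak_gradient_lincomb)
    have m: "f \<in> borel_measurable lebesgue" "g \<in> borel_measurable lebesgue" "F \<in> borel_measurable lebesgue" "G \<in> borel_measurable lebesgue"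
      using fF gG unfolding extension_class_UNIV is_weak_gradient_def by (auto intro: L1_loc_UNIV_measurable)
    have i: "integrable lebesgue (\<lambda>x. (norm (F x + c *\<^sub>R G x))\<^sup>2)"
      using fF gG m unfolding extension_class_UNIV by (auto intro: integrable_power_add)
    have "vanishes_at_infinity (\<lambda>x. f x + c * g x)"
      using fF gG m unfolding extension_class_UNIV D1_def by (auto intro: vanishes_lincomb)
    then show "((\<lambda>x. f x + c * g x), (\<lambda>x. F x + c *\<^sub>R G x)) \<in> extension_class UNIV"
      using w i D1_intro[OF w i] unfolding extension_class_UNIV by blast
  next
    show "(cube_avg 1 f x)\<^sup>2 \<le> C * dirichlet G" if "(f, G) \<in> extension_class UNIV" for f G and x :: 'a
      using b[OF that, of 1 x] by simp
  qed (use C(1) in \<open>auto simp: extension_class_UNIV\<close>)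
  then show thesis using that b by blast
qed

text \<open>Local convergence alone does not preserve vanishing at infinity. The energies stay
  bounded, so the bound on averages at all sides passes to the limit, and
  \<open>vanishes_if_avg_small\<close> recovers the property.\<close>

lemma complete_UNIV:
  assumes d: "DIM('a::euclidean_space) \<ge> 3"
    and V: "\<And>k. (f k, G k) \<in> extension_class (UNIV :: 'a set)"
    and fast: "\<And>k. dirichlet (\<lambda>x. G (Suc k) x - G k x) \<le> (1 / 2) ^ k"
  shows "\<exists>f' G'. (f', G') \<in> extension_class (UNIV :: 'a set) \<and> (\<lambda>k. dirichlet (\<lambda>x. G k x - G' x)) \<longlonglongrightarrow> 0"
proof -
  obtain C where gc: "gradient_class (extension_class (UNIV :: 'a set)) 1 C"
    and b: "\<And>f G h x. (f, G) \<in> extension_class (UNIV :: 'a set) \<Longrightarrow> h > 0 \<Longrightarrow> (cube_avg h f x)\<^sup>2 \<le> C * (h\<^sup>2 / h ^ DIM('a)) * dirichlet G"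
    using gradient_class_UNIV[OF d] by blast
  interpret gradient_class "extension_class (UNIV :: 'a set)" 1 C by (rule gc)
  obtain f' G' where f': "is_weak_gradient UNIV f' G'" "integrable lebesgue (\<lambda>x. (norm (G' x))\<^sup>2)"
    and conv: "(\<lambda>k. dirichlet (\<lambda>x. G k x - G' x)) \<longlonglongrightarrow> 0"
    and av: "\<And>g x. g > 0 \<Longrightarrow> (\<lambda>k. cube_avg g (f k) x) \<longlonglongrightarrow> cube_avg g f' x"
    by (rule local_limit[where f = f and G = G, OF V fast]) blast
  have "Bseq (\<lambda>k. dirichlet (\<lambda>x. G k x - G' x))" using conv by (intro convergent_imp_Bseq) (auto simp: convergent_def)
  then obtain B where B: "\<And>k. \<bar>dirichlet (\<lambda>x. G k x - G' x)\<bar> \<le> B" unfolding Bseq_def by auto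
  define B' where "B' = 2 * B + 2 * dirichlet G'"
  have dk: "dirichlet (G k) \<le> B'" for k
  proof -
    have G'm: "G' \<in> borel_measurable lebesgue"
      using f' unfolding is_weak_gradient_def by (blast intro: L1_loc_UNIV_measurable)
    have i: "integrable lebesgue (\<lambda>x. (norm (G k x - G' x))\<^sup>2)"
      using integrable_power_add[OF G_measurable[OF V[of k]] G'm G2[OF V[of k]] f'(2), of "-1"] by simp
    have "(norm (G k x))\<^sup>2 \<le> 2 * (norm (G k x - G' x))\<^sup>2 + 2 * (norm (G' x))\<^sup>2" for x
    proof -
      have "norm (G k x) \<le> norm (G k x - G' x) + norm (G' x)" using norm_triangle_ineq[of "G k x - G' x" "G' x"] by simp
      then have "(norm (G k x))\<^sup>2 \<le> (norm (G k x - G' x) + norm (G' x))\<^sup>2" by (intro power_mono) auto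
      also have "\<dots> \<le> 2 * (norm (G k x - G' x))\<^sup>2 + 2 * (norm (G' x))\<^sup>2"
        using sum_squares_bound[of "norm (G k x - G' x)" "norm (G' x)"] by (simp add: power2_sum)
      finally show ?thesis .
    qed
    then have "dirichlet (G k) \<le> (\<integral>x. 2 * (norm (G k x - G' x))\<^sup>2 + 2 * (norm (G' x))\<^sup>2 \<partial>lebesgue)"
      unfolding dirichlet_def using i f'(2) G2[OF V] by (intro integral_mono) auto
    also have "\<dots> = 2 * dirichlet (\<lambda>x. G k x - G' x) + 2 * dirichlet G'" using i f'(2) by (simp add: dirichlet_def)
    finally show ?thesis using B[of k] by (simp add: B'_def)
  qed
  have B'0: "0 \<le> B'" using dk[of 0] dirichlet_nonneg[of "G 0"] by linarith
  have "(cube_avg h f' x)\<^sup>2 \<le> (C * B') * (h\<^sup>2 / h ^ DIM('a))" if h: "h > 0" for h x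
  proof (rule tendsto_upperbound)
    show "(\<lambda>k. (cube_avg h (f k) x)\<^sup>2) \<longlonglongrightarrow> (cube_avg h f' x)\<^sup>2" by (intro tendsto_intros av h)
    show "\<forall>\<^sub>F k in sequentially. (cube_avg h (f k) x)\<^sup>2 \<le> (C * B') * (h\<^sup>2 / h ^ DIM('a))"
    proof (intro always_eventually allI)
      fix k
      have "C * (h\<^sup>2 / h ^ DIM('a)) * dirichlet (G k) \<le> C * (h\<^sup>2 / h ^ DIM('a)) * B'"
        using C_nonneg h by (intro mult_left_mono dk) auto
      then show "(cube_avg h (f k) x)\<^sup>2 \<le> (C * B') * (h\<^sup>2 / h ^ DIM('a))"
        using b[OF V[of k] h, of x] by (simp add: mult_ac)
    qed
  qed auto
  then have "vanishes_at_infinity f'"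
    using C_nonneg B'0 by (intro vanishes_if_avg_small[OF f' d, of "C * B'"]) auto
  then have "(f', G') \<in> extension_class UNIV" unfolding extension_class_UNIV using f' D1_intro[OF f'] by blast
  then show ?thesis using conv by blast
qed

section \<open>The space \<open>H10\<close>\<close>

lemma square_integral_add_bound:
  fixes u v :: "'a::euclidean_space \<Rightarrow> 'b::euclidean_space"
  assumes m: "u \<in> borel_measurable lebesgue" "v \<in> borel_measurable lebesgue"
    and i: "integrable lebesgue (\<lambda>x. (norm (u x))\<^sup>2)" "integrable lebesgue (\<lambda>x. (norm (v x))\<^sup>2)"
  shows "(\<integral>x. (norm (u x + c *\<^sub>R v x))\<^sup>2 \<partial>lebesgue) \<le> 2 * (\<integral>x. (norm (u x))\<^sup>2 \<partial>lebesgue) + 2 * c\<^sup>2 * (\<integral>x. (norm (v x))\<^sup>2 \<partial>lebesgue)"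
proof -
  have pt: "(norm (u x + c *\<^sub>R v x))\<^sup>2 \<le> 2 * (norm (u x))\<^sup>2 + 2 * c\<^sup>2 * (norm (v x))\<^sup>2" for x
  proof -
    have "(norm (u x + c *\<^sub>R v x))\<^sup>2 \<le> (norm (u x) + norm (c *\<^sub>R v x))\<^sup>2"
      by (intro power_mono norm_triangle_ineq) auto
    also have "\<dots> \<le> 2 * (norm (u x))\<^sup>2 + 2 * (norm (c *\<^sub>R v x))\<^sup>2"
      using sum_squares_bound[of "norm (u x)" "norm (c *\<^sub>R v x)"] by (simp add: power2_sum)
    finally show ?thesis by (simp add: power_mult_distrib)
  qed
  have "(\<integral>x. (norm (u x + c *\<^sub>R v x))\<^sup>2 \<partial>lebesgue) \<le> (\<integral>x. 2 * (norm (u x))\<^sup>2 + 2 * c\<^sup>2 * (norm (v x))\<^sup>2 \<partial>lebesgue)"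
    using integrable_power_add[OF m i, of c] i pt by (intro integral_mono) auto
  also have "\<dots> = 2 * (\<integral>x. (norm (u x))\<^sup>2 \<partial>lebesgue) + 2 * c\<^sup>2 * (\<integral>x. (norm (v x))\<^sup>2 \<partial>lebesgue)"
    using i by simp
  finally show ?thesis .
qed

lemma Lq_2_iff:
  fixes g :: "'a::euclidean_space \<Rightarrow> 'b::euclidean_space"
  assumes "open B"
  shows "g \<in> Lq B 2 \<longleftrightarrow> (\<lambda>x. indicator B x *\<^sub>R g x) \<in> borel_measurable lebesgue \<and>
     integrable lebesgue (\<lambda>x. (norm (indicator B x *\<^sub>R g x))\<^sup>2)"
  using Lq_iff[OF assms, of 2 g] by simp

lemma Lq_2_lincomb:
  fixes u v :: "'a::euclidean_space \<Rightarrow> 'b::euclidean_space"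
  assumes B: "open B" and uv: "u \<in> Lq B 2" "v \<in> Lq B 2"
  shows "(\<lambda>x. u x + c *\<^sub>R v x) \<in> Lq B 2"
proof -
  have eq: "(\<lambda>x. indicator B x *\<^sub>R (u x + c *\<^sub>R v x)) = (\<lambda>x. indicator B x *\<^sub>R u x + c *\<^sub>R (indicator B x *\<^sub>R v x))"
    by (auto simp: fun_eq_iff split: split_indicator)
  note h = uv[unfolded Lq_2_iff[OF B]]
  show ?thesis unfolding Lq_2_iff[OF B] fun_cong[OF eq]
  proof
    show "(\<lambda>x. indicator B x *\<^sub>R u x + c *\<^sub>R (indicator B x *\<^sub>R v x)) \<in> borel_measurable lebesgue"
      by (rule borel_measurable_add[OF conjunct1[OF h(1)] borel_measurable_scaleR[OF borel_measurable_const conjunct1[OF h(2)]]])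
    show "integrable lebesgue (\<lambda>x. (norm (indicator B x *\<^sub>R u x + c *\<^sub>R (indicator B x *\<^sub>R v x)))\<^sup>2)"
      by (rule integrable_power_add[OF conjunct1[OF h(1)] conjunct1[OF h(2)] conjunct2[OF h(1)] conjunct2[OF h(2)]])
  qed
qed

section \<open>Approximation by test functions in the norm of \<open>H1\<close>\<close>

lemma H1_norm_nonneg: "0 \<le> H1_norm B f"
  by (simp add: H1_norm_def)

lemma H1_norm_sq:
  assumes B: "open B" and wg: "is_weak_gradient B f G"
  shows "(H1_norm B f)\<^sup>2 = (\<integral>x. (norm (indicator B x *\<^sub>R f x))\<^sup>2 \<partial>lebesgue) + dirichlet (\<lambda>x. indicator B x *\<^sub>R G x)"
proof -
  have "(H1_norm B f)\<^sup>2 = (Lq_norm B 2 f)\<^sup>2 + (Lq_norm B 2 (weak_grad B f))\<^sup>2"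
    unfolding H1_norm_def by (rule real_sqrt_pow2) simp
  then show ?thesis by (simp only: Lq_norm_weak_grad[OF B wg] Lq_norm_2_sq[OF B, of f])
qed

text \<open>The inequality (x + y)^2 \<le> 2 x^2 + 2 y^2 for both parts of the norm; it is a
  substitute for the triangle inequality when sequences are shown to tend to 0.\<close>

lemma H1_norm_sq_lincomb:
  assumes B: "open B" and u: "is_weak_gradient B u U" "u \<in> Lq B 2" "U \<in> Lq B 2"
    and v: "is_weak_gradient B v W" "v \<in> Lq B 2" "W \<in> Lq B 2"
  shows "(H1_norm B (\<lambda>x. u x + c * v x))\<^sup>2 \<le> 2 * (H1_norm B u)\<^sup>2 + 2 * c\<^sup>2 * (H1_norm B v)\<^sup>2"
proof -
  have eq1: "(\<lambda>x. indicator B x *\<^sub>R (u x + c * v x)) = (\<lambda>x. indicator B x *\<^sub>R u x + c *\<^sub>R (indicator B x *\<^sub>R v x))"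
    and eq2: "(\<lambda>x. indicator B x *\<^sub>R (U x + c *\<^sub>R W x)) = (\<lambda>x. indicator B x *\<^sub>R U x + c *\<^sub>R (indicator B x *\<^sub>R W x))"
    by (auto simp: fun_eq_iff split: split_indicator)
  note h = u(2,3)[unfolded Lq_2_iff[OF B]] v(2,3)[unfolded Lq_2_iff[OF B]]
  have 1: "(\<integral>x. (norm (indicator B x *\<^sub>R (u x + c * v x)))\<^sup>2 \<partial>lebesgue) \<le>
      2 * (\<integral>x. (norm (indicator B x *\<^sub>R u x))\<^sup>2 \<partial>lebesgue) + 2 * c\<^sup>2 * (\<integral>x. (norm (indicator B x *\<^sub>R v x))\<^sup>2 \<partial>lebesgue)"
    using square_integral_add_bound[of "\<lambda>x. indicator B x *\<^sub>R u x" "\<lambda>x. indicator B x *\<^sub>R v x" c] h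
    unfolding fun_cong[OF eq1] by blast
  have 2: "dirichlet (\<lambda>x. indicator B x *\<^sub>R (U x + c *\<^sub>R W x)) \<le>
      2 * dirichlet (\<lambda>x. indicator B x *\<^sub>R U x) + 2 * c\<^sup>2 * dirichlet (\<lambda>x. indicator B x *\<^sub>R W x)"
    unfolding eq2 dirichlet_def using h by (intro square_integral_add_bound) auto
  show ?thesis
    unfolding H1_norm_sq[OF B is_weak_gradient_lincomb[OF B u(1) v(1)]] H1_norm_sq[OF B u(1)] H1_norm_sq[OF B v(1)]
    using 1 2 by (simp add: algebra_simps)
qed

lemma tendsto_zero_if_sq_le:
  fixes a b :: "nat \<Rightarrow> real"
  assumes "\<And>k. 0 \<le> a k" "\<And>k. (a k)\<^sup>2 \<le> b k" "b \<longlonglongrightarrow> 0"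
  shows "a \<longlonglongrightarrow> 0"
proof -
  have "(\<lambda>k. (a k)\<^sup>2) \<longlonglongrightarrow> 0"
    using assms by (intro tendsto_sandwich[OF _ _ tendsto_const, of 0 "\<lambda>k. (a k)\<^sup>2" sequentially b]) auto
  then have "(\<lambda>k. sqrt ((a k)\<^sup>2)) \<longlonglongrightarrow> sqrt 0" by (intro tendsto_intros)
  then show ?thesis using assms(1) by simp
qed

lemma test_fun_Lq_2:
  assumes B: "open B" and \<eta>: "\<eta> \<in> test_fun B"
  shows "\<eta> \<in> Lq B 2" "grad \<eta> \<in> Lq B 2"
proof -
  have supp: "compact (supp \<eta>)" "supp \<eta> \<subseteq> B" using \<eta> by (auto simp: test_fun_def)
  have e: "(\<lambda>x. indicator B x *\<^sub>R \<eta> x) = \<eta>" "(\<lambda>x. indicator B x *\<^sub>R grad \<eta> x) = grad \<eta>"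
    using supp not_in_supp[of _ \<eta>] grad_zero_off_supp[of _ \<eta>] by (force simp: fun_eq_iff split: split_indicator)+
  have m: "\<eta> \<in> borel_measurable lebesgue" by (rule borel_imp_lebesgue[OF test_fun_measurable[OF \<eta>]])
  have gm: "grad \<eta> \<in> borel_measurable lebesgue"
    using borel_measurable_continuous_onI[OF continuous_grad[OF \<eta>]] by (simp add: measurable_completion)
  have "integrable lebesgue (\<lambda>x. (norm (grad \<eta> x))\<^sup>2)"
    by (rule continuous_compact_integrable[OF _ supp(1)])
       (auto intro!: continuous_intros continuous_grad[OF \<eta>] simp: grad_zero_off_supp)
  then show "grad \<eta> \<in> Lq B 2" unfolding Lq_2_iff[OF B] fun_cong[OF e(2)] using gm by simp
  show "\<eta> \<in> Lq B 2" unfolding Lq_2_iff[OF B] fun_cong[OF e(1)] using m test_fun_square_integrable[OF \<eta>] by simp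
qed

lemma test_fun_indicator:
  assumes "\<eta> \<in> test_fun B"
  shows "indicator B x *\<^sub>R \<eta> x = \<eta> x" "indicator B x *\<^sub>R grad \<eta> x = grad \<eta> x"
proof -
  have supp: "supp \<eta> \<subseteq> B" using assms by (auto simp: test_fun_def)
  show "indicator B x *\<^sub>R \<eta> x = \<eta> x" "indicator B x *\<^sub>R grad \<eta> x = grad \<eta> x"
    using supp not_in_supp[of x \<eta>] grad_zero_off_supp[of x \<eta>] by (auto split: split_indicator)
qed

lemma H10_approx:
  assumes B: "open B" and f: "f \<in> H10 B"
  obtains G \<eta> where "is_weak_gradient B f G" "f \<in> Lq B 2" "G \<in> Lq B 2" "\<And>k::nat. \<eta> k \<in> test_fun B"
    "(\<lambda>k. H1_norm B (\<lambda>x. \<eta> k x - f x)) \<longlonglongrightarrow> 0"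
  using f unfolding H10_def H1_def by blast

lemma H10_intro:
  assumes "is_weak_gradient B f G" "f \<in> Lq B 2" "G \<in> Lq B 2" "\<And>k::nat. \<eta> k \<in> test_fun B"
    "(\<lambda>k. H1_norm B (\<lambda>x. \<eta> k x - f x)) \<longlonglongrightarrow> 0"
  shows "f \<in> H10 B"
  using assms unfolding H10_def H1_def by blast

lemma test_fun_diff_weak_gradient:
  assumes B: "open B" and \<eta>: "\<eta> \<in> test_fun B" and wg: "is_weak_gradient B f G"
  shows "is_weak_gradient B (\<lambda>x. \<eta> x - f x) (\<lambda>x. grad \<eta> x - G x)"
  using is_weak_gradient_lincomb[OF B test_fun_weak_gradient[OF B \<eta>] wg, of "-1"] by simp

lemma test_fun_diff_Lq_2:
  assumes B: "open B" and \<eta>: "\<eta> \<in> test_fun B" and f: "f \<in> Lq B 2" "G \<in> Lq B 2"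
  shows "(\<lambda>x. \<eta> x - f x) \<in> Lq B 2" "(\<lambda>x. grad \<eta> x - G x) \<in> Lq B 2"
  using Lq_2_lincomb[OF B test_fun_Lq_2(1)[OF B \<eta>] f(1), of "-1"] Lq_2_lincomb[OF B test_fun_Lq_2(2)[OF B \<eta>] f(2), of "-1"]
  by simp_all

lemma H10_lincomb:
  assumes B: "open B" and f: "f \<in> H10 B" and g: "g \<in> H10 B"
  shows "(\<lambda>x. f x + c * g x) \<in> H10 B"
proof -
  obtain F \<eta> where F: "is_weak_gradient B f F" "f \<in> Lq B 2" "F \<in> Lq B 2" and \<eta>: "\<And>k::nat. \<eta> k \<in> test_fun B"
    and \<eta>l: "(\<lambda>k. H1_norm B (\<lambda>x. \<eta> k x - f x)) \<longlonglongrightarrow> 0" using H10_approx[OF B f] by blast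
  obtain G \<zeta> where G: "is_weak_gradient B g G" "g \<in> Lq B 2" "G \<in> Lq B 2" and \<zeta>: "\<And>k::nat. \<zeta> k \<in> test_fun B"
    and \<zeta>l: "(\<lambda>k. H1_norm B (\<lambda>x. \<zeta> k x - g x)) \<longlonglongrightarrow> 0" using H10_approx[OF B g] by blast
  have "(\<lambda>k. H1_norm B (\<lambda>x. (\<eta> k x + c * \<zeta> k x) - (f x + c * g x))) \<longlonglongrightarrow> 0"
  proof (rule tendsto_zero_if_sq_le)
    show "(H1_norm B (\<lambda>x. (\<eta> k x + c * \<zeta> k x) - (f x + c * g x)))\<^sup>2 \<le>
      2 * (H1_norm B (\<lambda>x. \<eta> k x - f x))\<^sup>2 + 2 * c\<^sup>2 * (H1_norm B (\<lambda>x. \<zeta> k x - g x))\<^sup>2" for k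
    proof -
      have "(\<lambda>x. (\<eta> k x + c * \<zeta> k x) - (f x + c * g x)) = (\<lambda>x. (\<eta> k x - f x) + c * (\<zeta> k x - g x))"
        by (auto simp: algebra_simps)
      then show ?thesis
        using H1_norm_sq_lincomb[OF B test_fun_diff_weak_gradient[OF B \<eta> F(1)] test_fun_diff_Lq_2[OF B \<eta> F(2,3)]
          test_fun_diff_weak_gradient[OF B \<zeta> G(1)] test_fun_diff_Lq_2[OF B \<zeta> G(2,3)], of k c k] by simp
    qed
    have "(\<lambda>k. 2 * (H1_norm B (\<lambda>x. \<eta> k x - f x))\<^sup>2 + 2 * c\<^sup>2 * (H1_norm B (\<lambda>x. \<zeta> k x - g x))\<^sup>2) \<longlonglongrightarrow> 2 * 0\<^sup>2 + 2 * c\<^sup>2 * 0\<^sup>2"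
      by (intro tendsto_intros \<eta>l \<zeta>l)
    then show "(\<lambda>k. 2 * (H1_norm B (\<lambda>x. \<eta> k x - f x))\<^sup>2 + 2 * c\<^sup>2 * (H1_norm B (\<lambda>x. \<zeta> k x - g x))\<^sup>2) \<longlonglongrightarrow> 0" by simp
  qed (rule H1_norm_nonneg)
  moreover have "(\<lambda>x. f x + c * g x) \<in> Lq B 2" using Lq_2_lincomb[OF B F(2) G(2), of c] by simp
  ultimately show ?thesis
    using is_weak_gradient_lincomb[OF B F(1) G(1), of c] Lq_2_lincomb[OF B F(3) G(3), of c]
      test_fun_add[OF \<eta> test_fun_cmult[OF \<zeta>]]
    by (intro H10_intro[where \<eta> = "\<lambda>k x. \<eta> k x + c * \<zeta> k x"]) auto
qed

lemma test_fun_H10: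
  assumes B: "open B" and \<eta>: "\<eta> \<in> test_fun B" shows "\<eta> \<in> H10 B"
proof (rule H10_intro[OF test_fun_weak_gradient[OF B \<eta>] test_fun_Lq_2[OF B \<eta>] \<eta>])
  have "(H1_norm B (\<lambda>x. \<eta> x - \<eta> x))\<^sup>2 = 0"
    unfolding H1_norm_sq[OF B test_fun_diff_weak_gradient[OF B \<eta> test_fun_weak_gradient[OF B \<eta>]]]
    by (simp add: dirichlet_def)
  then show "(\<lambda>k. H1_norm B (\<lambda>x. \<eta> x - \<eta> x)) \<longlonglongrightarrow> 0" by simp
qed

text \<open>The classical gradient of a test function on \<open>B\<close> is a weak gradient on the
  whole space, and this passes to the limit along an approximating sequence. Here the zero boundary
  condition acts: for a general member of \<open>H1\<close> a jump across the boundary could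
  contribute.\<close>

lemma H10_extension_weak_gradient:
  assumes B: "open B" and f: "f \<in> H10 B" and wg: "is_weak_gradient B f G" and GL: "G \<in> Lq B 2"
  shows "is_weak_gradient UNIV (\<lambda>x. indicator B x * f x) (\<lambda>x. indicator B x *\<^sub>R G x)"
proof -
  obtain \<eta> where fL: "f \<in> Lq B 2" and \<eta>: "\<And>k::nat. \<eta> k \<in> test_fun B"
    and \<eta>l: "(\<lambda>k. H1_norm B (\<lambda>x. \<eta> k x - f x)) \<longlonglongrightarrow> 0" using H10_approx[OF B f] by blast
  have \<eta>U: "\<eta> k \<in> test_fun UNIV" for k using \<eta> test_fun_mono[of B UNIV] by blast
  note fi = fL[unfolded Lq_2_iff[OF B]] and Gi = GL[unfolded Lq_2_iff[OF B]]
  note dw = test_fun_diff_weak_gradient[OF B \<eta> wg]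
  note dL = test_fun_diff_Lq_2[OF B \<eta> fL GL]
  have e1: "indicator B x *\<^sub>R (\<eta> k x - f x) = \<eta> k x - indicator B x * f x" for k x
    using test_fun_indicator(1)[OF \<eta>, of x k] by (simp add: right_diff_distrib)
  have e2: "indicator B x *\<^sub>R (grad (\<eta> k) x - G x) = grad (\<eta> k) x - indicator B x *\<^sub>R G x" for k x
    using test_fun_indicator(2)[OF \<eta>, of x k] by (simp add: scaleR_diff_right)
  have sq: "(H1_norm B (\<lambda>x. \<eta> k x - f x))\<^sup>2 = (\<integral>x. (\<eta> k x - indicator B x * f x)\<^sup>2 \<partial>lebesgue) + (\<integral>x. (norm (grad (\<eta> k) x - indicator B x *\<^sub>R G x))\<^sup>2 \<partial>lebesgue)" for k
    unfolding H1_norm_sq[OF B dw] dirichlet_def e1 e2 by simp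
  have sql: "(\<lambda>k. (H1_norm B (\<lambda>x. \<eta> k x - f x))\<^sup>2) \<longlonglongrightarrow> 0" using tendsto_power[OF \<eta>l, of 2] by simp
  have i1: "integrable lebesgue (\<lambda>x. (\<eta> k x - indicator B x * f x)\<^sup>2)" for k
    using dL(1)[of k] unfolding Lq_2_iff[OF B] e1 by simp
  have i2: "integrable lebesgue (\<lambda>x. (norm (grad (\<eta> k) x - indicator B x *\<^sub>R G x))\<^sup>2)" for k
    using dL(2)[of k] unfolding Lq_2_iff[OF B] e2 by simp
  have i1R: "integrable lebesgue (\<lambda>x. indicator (cball 0 R) x * (\<eta> k x - indicator B x * f x)\<^sup>2)" for k R
    using integrable_mult_indicator[OF _ i1, of "cball 0 R" k] by simp
  have p: "0 \<le> (\<integral>x. (\<eta> k x - indicator B x * f x)\<^sup>2 \<partial>lebesgue)" "0 \<le> (\<integral>x. (norm (grad (\<eta> k) x - indicator B x *\<^sub>R G x))\<^sup>2 \<partial>lebesgue)" for k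
    by (auto intro!: Bochner_Integration.integral_nonneg)
  show ?thesis
  proof (rule weak_gradient_limit[where f = \<eta> and G = "\<lambda>k. grad (\<eta> k)"])
    show "is_weak_gradient UNIV (\<eta> k) (grad (\<eta> k))" for k by (rule test_fun_weak_gradient[OF open_UNIV \<eta>U])
    show "(\<lambda>x. indicator B x * f x) \<in> L1_loc UNIV"
      using fi by (intro square_locally_integrable_L1_loc square_integrable_ball) auto
    show "(\<lambda>x. indicator B x *\<^sub>R G x) \<in> L1_loc UNIV"
      using Gi by (intro square_locally_integrable_L1_loc square_integrable_ball) auto
    show "(\<lambda>k. \<integral>x. indicator (cball 0 R) x * (\<eta> k x - indicator B x * f x)\<^sup>2 \<partial>lebesgue) \<longlonglongrightarrow> 0" for R
    proof (rule tendsto_sandwich[OF _ _ tendsto_const sql])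
      show "\<forall>\<^sub>F k in sequentially. (\<integral>x. indicator (cball 0 R) x * (\<eta> k x - indicator B x * f x)\<^sup>2 \<partial>lebesgue) \<le> (H1_norm B (\<lambda>x. \<eta> k x - f x))\<^sup>2"
      proof (intro always_eventually allI)
        fix k
        have "(\<integral>x. indicator (cball 0 R) x * (\<eta> k x - indicator B x * f x)\<^sup>2 \<partial>lebesgue) \<le> (\<integral>x. (\<eta> k x - indicator B x * f x)\<^sup>2 \<partial>lebesgue)"
          by (rule integral_mono[OF i1R i1]) (auto split: split_indicator)
        then show "(\<integral>x. indicator (cball 0 R) x * (\<eta> k x - indicator B x * f x)\<^sup>2 \<partial>lebesgue) \<le> (H1_norm B (\<lambda>x. \<eta> k x - f x))\<^sup>2"
          using p(2)[of k] unfolding sq by linarith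
      qed
    qed (auto intro!: always_eventually Bochner_Integration.integral_nonneg)
    show "(\<lambda>k. \<integral>x. (norm (grad (\<eta> k) x - indicator B x *\<^sub>R G x))\<^sup>2 \<partial>lebesgue) \<longlonglongrightarrow> 0"
    proof (rule tendsto_sandwich[OF _ _ tendsto_const sql])
      show "\<forall>\<^sub>F k in sequentially. (\<integral>x. (norm (grad (\<eta> k) x - indicator B x *\<^sub>R G x))\<^sup>2 \<partial>lebesgue) \<le> (H1_norm B (\<lambda>x. \<eta> k x - f x))\<^sup>2"
      proof (intro always_eventually allI)
        fix k
        show "(\<integral>x. (norm (grad (\<eta> k) x - indicator B x *\<^sub>R G x))\<^sup>2 \<partial>lebesgue) \<le> (H1_norm B (\<lambda>x. \<eta> k x - f x))\<^sup>2"
          using p(1)[of k] unfolding sq by linarith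
      qed
    qed (use p in auto)
  qed (rule i1R i2)+
qed

lemma D_space_bounded: "bounded B \<Longrightarrow> D_space B = H10 B"
  by (simp add: D_space_def)

lemma bounded_open_measure:
  fixes B :: "'a::euclidean_space set"
  assumes "open B" "bounded B" shows "B \<in> fmeasurable lebesgue"
  using assms by (simp add: bounded_set_imp_lmeasurable)

lemma extension_classI:
  "f \<in> D_space B \<Longrightarrow> is_weak_gradient B f G \<Longrightarrow> G \<in> Lq B 2 \<Longrightarrow>
    ((\<lambda>x. indicator B x * f x), (\<lambda>x. indicator B x *\<^sub>R G x)) \<in> extension_class B"
  unfolding extension_class_def by blast

text \<open>A cell whose side h is the measure of \<open>B\<close> plus 1 has volume at least h, so
  a part of measure at least 1 lies outside \<open>B\<close>. There the extended function is 0 and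
  its averaging error is the average, which the error estimate therefore bounds by the
  energy.\<close>

lemma gradient_class_bounded:
  fixes B :: "'a::euclidean_space set"
  assumes B: "open B" and bd: "bounded B"
  obtains h C where "gradient_class (extension_class B) h C"
proof -
  define m where "m = measure lebesgue B"
  define h where "h = m + 1"
  have m0: "m \<ge> 0" by (simp add: m_def)
  have h: "h \<ge> 1" "h > 0" using m0 by (auto simp: h_def)
  obtain A where A: "A \<ge> 0" "\<And>f (G :: 'a \<Rightarrow> 'a) h. is_weak_gradient UNIV f G \<Longrightarrow>
     integrable lebesgue (\<lambda>y. (norm (G y))\<^sup>2) \<Longrightarrow> h > 0 \<Longrightarrow>
     (\<integral>\<^sup>+x. ennreal (\<bar>f x - cube_avg h f x\<bar> ^ (2 * 1)) \<partial>lebesgue)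
     \<le> ennreal (A * ((h\<^sup>2 / h ^ DIM('a)) ^ 1 * h ^ DIM('a)) * (\<integral>y. (norm (G y))\<^sup>2 \<partial>lebesgue) ^ 1)"
    using cube_avg_error[where 'a = 'a and p = 1] by auto
  define C where "C = A * h\<^sup>2"
  have C0: "C \<ge> 0" using A by (simp add: C_def)
  have "gradient_class (extension_class B) h C"
  proof
    fix f0 G0 assume "(f0, G0) \<in> extension_class B"
    then obtain f G where f: "f \<in> H10 B" "is_weak_gradient B f G" "G \<in> Lq B 2"
      and f0: "f0 = (\<lambda>x. indicator B x * f x)" and G0: "G0 = (\<lambda>x. indicator B x *\<^sub>R G x)"
      using D_space_bounded[OF bd] unfolding extension_class_def by auto
    show wg: "is_weak_gradient UNIV f0 G0" unfolding f0 G0 by (rule H10_extension_weak_gradient[OF B f])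
    show G2: "integrable lebesgue (\<lambda>x. (norm (G0 x))\<^sup>2)" using f(3) unfolding G0 Lq_2_iff[OF B] by simp
    show "(cube_avg h f0 x)\<^sup>2 \<le> C * dirichlet G0" for x
    proof -
      define a where "a = cube_avg h f0 x"
      have Qf: "cube h x \<in> fmeasurable lebesgue" using cube_measure[OF h(2), of x] by (intro fmeasurableI) auto
      have Bf: "B \<in> fmeasurable lebesgue" by (rule bounded_open_measure[OF B bd])
      have Q: "measure lebesgue (cube h x) = h ^ DIM('a)" using cube_measure[OF h(2), of x] h by (simp add: measure_def)
      have QB: "cube h x - B \<in> fmeasurable lebesgue" using Qf Bf by (intro fmeasurable_Diff) (auto simp: fmeasurableD)
      have "measure lebesgue (cube h x) \<le> measure lebesgue ((cube h x - B) \<union> B)"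
        using Qf Bf QB by (intro measure_mono_fmeasurable fmeasurable.Un) (auto simp: fmeasurableD)
      also have "\<dots> \<le> measure lebesgue (cube h x - B) + measure lebesgue B"
        using QB Bf by (intro measure_Un_le) (auto simp: fmeasurableD)
      finally have "h ^ DIM('a) - m \<le> measure lebesgue (cube h x - B)" unfolding Q m_def by simp
      moreover have "h ^ 1 \<le> h ^ DIM('a)" using h by (intro power_increasing) (auto simp: Suc_le_eq)
      ultimately have 1: "1 \<le> measure lebesgue (cube h x - B)" by (simp add: h_def)
      have "ennreal (a\<^sup>2 * measure lebesgue (cube h x - B)) = (\<integral>\<^sup>+y. ennreal (a\<^sup>2) * indicator (cube h x - B) y \<partial>lebesgue)"
        using QB by (subst nn_integral_cmult_indicator) (auto simp: fmeasurableD emeasure_eq_measure2 ennreal_mult)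
      also have "\<dots> \<le> (\<integral>\<^sup>+y. ennreal (\<bar>f0 y - cube_avg h f0 y\<bar> ^ (2 * 1)) \<partial>lebesgue)"
      proof (rule nn_integral_mono)
        fix y
        have "a\<^sup>2 = \<bar>f0 y - cube_avg h f0 y\<bar> ^ (2 * 1)" if y: "y \<in> cube h x - B"
        proof -
          have "cube_avg h f0 y = a" unfolding a_def using y by (intro avg_eq) auto
          moreover have "f0 y = 0" using y by (simp add: f0)
          ultimately show ?thesis by simp
        qed
        then show "ennreal (a\<^sup>2) * indicator (cube h x - B) y \<le> ennreal (\<bar>f0 y - cube_avg h f0 y\<bar> ^ (2 * 1))"
          by (cases "y \<in> cube h x - B") auto
      qed
      also have "\<dots> \<le> ennreal (C * dirichlet G0)"
        using A(2)[OF wg G2 h(2)] h by (simp add: dirichlet_def C_def)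
      finally have "a\<^sup>2 * measure lebesgue (cube h x - B) \<le> C * dirichlet G0"
        using C0 dirichlet_nonneg[of G0] by (simp add: ennreal_le_iff)
      moreover have "a\<^sup>2 * 1 \<le> a\<^sup>2 * measure lebesgue (cube h x - B)" using 1 by (intro mult_left_mono) auto
      ultimately show ?thesis by (simp add: a_def)
    qed
  next
    fix f0 F0 g0 G0 and c :: real
    assume "(f0, F0) \<in> extension_class B" "(g0, G0) \<in> extension_class B"
    then obtain f F g G where f: "f \<in> H10 B" "is_weak_gradient B f F" "F \<in> Lq B 2"
      and f0: "f0 = (\<lambda>x. indicator B x * f x)" "F0 = (\<lambda>x. indicator B x *\<^sub>R F x)"
      and g: "g \<in> H10 B" "is_weak_gradient B g G" "G \<in> Lq B 2"
      and g0: "g0 = (\<lambda>x. indicator B x * g x)" "G0 = (\<lambda>x. indicator B x *\<^sub>R G x)"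
      using D_space_bounded[OF bd] unfolding extension_class_def by auto
    have "(\<lambda>x. f0 x + c * g0 x) = (\<lambda>x. indicator B x * (f x + c * g x))"
      "(\<lambda>x. F0 x + c *\<^sub>R G0 x) = (\<lambda>x. indicator B x *\<^sub>R (F x + c *\<^sub>R G x))"
      unfolding f0 g0 by (auto simp: fun_eq_iff split: split_indicator)
    moreover have "((\<lambda>x. indicator B x * (f x + c * g x)), (\<lambda>x. indicator B x *\<^sub>R (F x + c *\<^sub>R G x))) \<in> extension_class B"
      using H10_lincomb[OF B f(1) g(1), of c] is_weak_gradient_lincomb[OF B f(2) g(2), of c] Lq_2_lincomb[OF B f(3) g(3), of c]
      by (intro extension_classI) (simp_all add: D_space_bounded[OF bd])
    ultimately show "((\<lambda>x. f0 x + c * g0 x), (\<lambda>x. F0 x + c *\<^sub>R G0 x)) \<in> extension_class B" by simp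
  qed (use h C0 in auto)
  then show thesis by (rule that)
qed

text \<open>Every test function on \<open>B\<close> is one on the whole space.\<close>

lemma is_weak_gradient_subset:
  assumes B: "open B" and wg: "is_weak_gradient UNIV f G"
  shows "is_weak_gradient B f G"
proof -
  have L: "g \<in> L1_loc B" if "g \<in> L1_loc UNIV" for g :: "'a \<Rightarrow> 'c::euclidean_space"
    using that B unfolding L1_loc_def by (auto simp: lebesgue_on_UNIV_eq intro: measurable_restrict_space1)
  note wg' = wg[unfolded is_weak_gradient_iff[OF open_UNIV]]
  have "f \<in> L1_loc B" "G \<in> L1_loc B" using L[of f] L[of G] wg' by auto
  moreover have "\<eta> \<in> test_fun UNIV" if "\<eta> \<in> test_fun B" for \<eta> using that test_fun_mono[of B UNIV] by blast
  ultimately show ?thesis using wg' unfolding is_weak_gradient_iff[OF B] by blast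
qed

text \<open>Convergence in mean square on a ball containing \<open>B\<close> gives convergence in
  the norm of \<open>H1\<close> on \<open>B\<close>. To land in \<open>H10\<close>, each member is
  replaced by a test function within 1/(k + 1) of it; these test functions approximate the
  limit.\<close>

lemma complete_bounded:
  fixes B :: "'a::euclidean_space set"
  assumes B: "open B" and bd: "bounded B"
    and V: "\<And>k. (f k, G k) \<in> extension_class B"
    and fast: "\<And>k. dirichlet (\<lambda>x. G (Suc k) x - G k x) \<le> (1 / 2) ^ k"
  shows "\<exists>f' G'. (f', G') \<in> extension_class B \<and> (\<lambda>k. dirichlet (\<lambda>x. G k x - G' x)) \<longlonglongrightarrow> 0"
proof -
  obtain h C where "gradient_class (extension_class B) h C" using gradient_class_bounded[OF B bd] by blast
  then interpret gradient_class "extension_class B" h C .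
  obtain f' G' where f': "is_weak_gradient UNIV f' G'" "integrable lebesgue (\<lambda>x. (norm (G' x))\<^sup>2)"
    and conv: "(\<lambda>k. dirichlet (\<lambda>x. G k x - G' x)) \<longlonglongrightarrow> 0"
    and f'i: "\<And>R. integrable lebesgue (\<lambda>x. indicator (cball 0 R) x * (f' x)\<^sup>2)"
    and fi: "\<And>k R. integrable lebesgue (\<lambda>x. indicator (cball 0 R) x * (f k x - f' x)\<^sup>2)"
    and fl: "\<And>R. (\<lambda>k. \<integral>x. indicator (cball 0 R) x * (f k x - f' x)\<^sup>2 \<partial>lebesgue) \<longlonglongrightarrow> 0"
    by (rule local_limit[where f = f and G = G, OF V fast]) blast
  have f'm: "f' \<in> borel_measurable lebesgue" and G'm: "G' \<in> borel_measurable lebesgue"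
    using f' unfolding is_weak_gradient_def by (blast intro: L1_loc_UNIV_measurable)+
  have Bs: "B \<in> sets lebesgue" using B by auto
  obtain R where R: "B \<subseteq> cball 0 R" using bd unfolding bounded_iff by (auto simp: subset_iff)
  have wgB: "is_weak_gradient B f' G'" by (rule is_weak_gradient_subset[OF B f'(1)])
  have f'L: "f' \<in> Lq B 2" unfolding Lq_2_iff[OF B]
  proof
    show "(\<lambda>x. indicator B x *\<^sub>R f' x) \<in> borel_measurable lebesgue"
      using f'm Bs by (intro borel_measurable_scaleR borel_measurable_indicator)
    then have m2: "(\<lambda>x. (norm (indicator B x *\<^sub>R f' x))\<^sup>2) \<in> borel_measurable lebesgue" by measurable
    show "integrable lebesgue (\<lambda>x. (norm (indicator B x *\<^sub>R f' x))\<^sup>2)"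
      by (rule Bochner_Integration.integrable_bound[OF f'i[of R] m2]) (use R in \<open>auto intro!: AE_I2 split: split_indicator\<close>)
  qed
  have G'L: "G' \<in> Lq B 2" unfolding Lq_2_iff[OF B]
  proof
    show "(\<lambda>x. indicator B x *\<^sub>R G' x) \<in> borel_measurable lebesgue"
      using G'm Bs by (intro borel_measurable_scaleR borel_measurable_indicator)
    then have m2: "(\<lambda>x. (norm (indicator B x *\<^sub>R G' x))\<^sup>2) \<in> borel_measurable lebesgue" by measurable
    show "integrable lebesgue (\<lambda>x. (norm (indicator B x *\<^sub>R G' x))\<^sup>2)"
      by (rule Bochner_Integration.integrable_bound[OF f'(2) m2]) (auto split: split_indicator)
  qed
  define P where "P k \<psi> U \<longleftrightarrow> \<psi> \<in> H10 B \<and> is_weak_gradient B \<psi> U \<and> U \<in> Lq B 2 \<and>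
      f k = (\<lambda>x. indicator B x * \<psi> x) \<and> G k = (\<lambda>x. indicator B x *\<^sub>R U x)" for k \<psi> U
  have "\<exists>\<psi> U. P k \<psi> U" for k
    using V[of k] D_space_bounded[OF bd] unfolding extension_class_def P_def by auto
  then obtain \<psi> U where "\<And>k. P k (\<psi> k) (U k)" by metis
  note PU = this[unfolded P_def]
  have \<psi>: "\<And>k. \<psi> k \<in> H10 B" and U: "\<And>k. is_weak_gradient B (\<psi> k) (U k)" "\<And>k. U k \<in> Lq B 2"
    and fk: "\<And>k. f k = (\<lambda>x. indicator B x * \<psi> k x)" and Gk: "\<And>k. G k = (\<lambda>x. indicator B x *\<^sub>R U k x)"
    using PU by blast+
  have \<psi>L: "\<psi> k \<in> Lq B 2" for k using H10_approx[OF B \<psi>[of k]] by blast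
  have "\<exists>\<eta>\<in>test_fun B. H1_norm B (\<lambda>x. \<eta> x - \<psi> k x) < inverse (real (Suc k))" for k
  proof -
    obtain \<eta> where \<eta>: "\<And>j::nat. \<eta> j \<in> test_fun B" and l: "(\<lambda>j. H1_norm B (\<lambda>x. \<eta> j x - \<psi> k x)) \<longlonglongrightarrow> 0"
      using H10_approx[OF B \<psi>[of k]] by blast
    have "\<forall>\<^sub>F j in sequentially. H1_norm B (\<lambda>x. \<eta> j x - \<psi> k x) < inverse (real (Suc k))"
      using l by (rule order_tendstoD(2)) simp
    then obtain j where "H1_norm B (\<lambda>x. \<eta> j x - \<psi> k x) < inverse (real (Suc k))" by (auto simp: eventually_sequentially)
    then show ?thesis using \<eta> by blast
  qed
  then obtain \<eta> where \<eta>: "\<And>k. \<eta> k \<in> test_fun B" "\<And>k. H1_norm B (\<lambda>x. \<eta> k x - \<psi> k x) < inverse (real (Suc k))" by metis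
  define I where "I k = (\<integral>x. indicator (cball 0 R) x * (f k x - f' x)\<^sup>2 \<partial>lebesgue) + dirichlet (\<lambda>x. G k x - G' x)" for k
  have Gd: "integrable lebesgue (\<lambda>x. (norm (G k x - G' x))\<^sup>2)" for k
    using integrable_power_add[OF G_measurable[OF V[of k]] G'm G2[OF V[of k]] f'(2), of "-1"] by simp
  have dwg: "is_weak_gradient B (\<lambda>x. \<psi> k x - f' x) (\<lambda>x. U k x - G' x)" for k
    using is_weak_gradient_lincomb[OF B U(1)[of k] wgB, of "-1"] by simp
  have dL: "(\<lambda>x. \<psi> k x - f' x) \<in> Lq B 2" "(\<lambda>x. U k x - G' x) \<in> Lq B 2" for k
    using Lq_2_lincomb[OF B \<psi>L[of k] f'L, of "-1"] Lq_2_lincomb[OF B U(2)[of k] G'L, of "-1"] by simp_all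
  have dd: "dirichlet (\<lambda>x. indicator B x *\<^sub>R (U k x - G' x)) \<le> dirichlet (\<lambda>x. G k x - G' x)" for k
    unfolding dirichlet_def using dL(2)[of k] Gd[of k] unfolding Lq_2_iff[OF B]
    by (intro integral_mono) (auto simp: Gk split: split_indicator)
  have Hd: "(H1_norm B (\<lambda>x. \<psi> k x - f' x))\<^sup>2 \<le> I k" for k
  proof -
    have "(\<integral>x. (norm (indicator B x *\<^sub>R (\<psi> k x - f' x)))\<^sup>2 \<partial>lebesgue) \<le> (\<integral>x. indicator (cball 0 R) x * (f k x - f' x)\<^sup>2 \<partial>lebesgue)"
      using dL(1)[of k] fi[of R k] R unfolding Lq_2_iff[OF B]
      by (intro integral_mono) (auto simp: fk split: split_indicator)
    then show ?thesis unfolding H1_norm_sq[OF B dwg] I_def using dd[of k] by linarith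
  qed
  have Il: "I \<longlonglongrightarrow> 0" using tendsto_add[OF fl[of R] conv] by (simp add: I_def[abs_def])
  have "(\<lambda>k. H1_norm B (\<lambda>x. \<eta> k x - f' x)) \<longlonglongrightarrow> 0"
  proof (rule tendsto_zero_if_sq_le)
    show "(H1_norm B (\<lambda>x. \<eta> k x - f' x))\<^sup>2 \<le> 2 * (inverse (real (Suc k)))\<^sup>2 + 2 * I k" for k
    proof -
      have "(\<lambda>x. \<eta> k x - f' x) = (\<lambda>x. (\<eta> k x - \<psi> k x) + 1 * (\<psi> k x - f' x))" by auto
      then have "(H1_norm B (\<lambda>x. \<eta> k x - f' x))\<^sup>2 \<le> 2 * (H1_norm B (\<lambda>x. \<eta> k x - \<psi> k x))\<^sup>2 + 2 * 1\<^sup>2 * (H1_norm B (\<lambda>x. \<psi> k x - f' x))\<^sup>2"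
        using H1_norm_sq_lincomb[OF B test_fun_diff_weak_gradient[OF B \<eta>(1)[of k] U(1)[of k]]
          test_fun_diff_Lq_2[OF B \<eta>(1)[of k] \<psi>L[of k] U(2)[of k]] dwg[of k] dL[of k], of 1] by simp
      moreover have "(H1_norm B (\<lambda>x. \<eta> k x - \<psi> k x))\<^sup>2 \<le> (inverse (real (Suc k)))\<^sup>2"
        using \<eta>(2)[of k] by (intro power_mono) (auto simp: H1_norm_nonneg)
      ultimately show ?thesis using Hd[of k] by simp
    qed
    have "(\<lambda>k. 2 * (inverse (real (Suc k)))\<^sup>2 + 2 * I k) \<longlonglongrightarrow> 2 * 0\<^sup>2 + 2 * 0"
      by (intro tendsto_intros LIMSEQ_inverse_real_of_nat Il)
    then show "(\<lambda>k. 2 * (inverse (real (Suc k)))\<^sup>2 + 2 * I k) \<longlonglongrightarrow> 0" by simp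
  qed (rule H1_norm_nonneg)
  then have "f' \<in> H10 B" by (rule H10_intro[OF wgB f'L G'L \<eta>(1)])
  then have "((\<lambda>x. indicator B x * f' x), (\<lambda>x. indicator B x *\<^sub>R G' x)) \<in> extension_class B"
    using wgB G'L by (intro extension_classI) (simp_all add: D_space_bounded[OF bd])
  \<comment> \<open>Cutting the limit field off outside \<open>B\<close> cannot increase the
    distance, as every \<open>G k\<close> is 0 there.\<close>
  moreover have "(\<lambda>k. dirichlet (\<lambda>x. G k x - indicator B x *\<^sub>R G' x)) \<longlonglongrightarrow> 0"
  proof (rule tendsto_sandwich[OF _ _ tendsto_const conv])
    have "(\<lambda>x. G k x - indicator B x *\<^sub>R G' x) = (\<lambda>x. indicator B x *\<^sub>R (U k x - G' x))" for k
      by (auto simp: Gk fun_eq_iff split: split_indicator)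
    then show "\<forall>\<^sub>F k in sequentially. dirichlet (\<lambda>x. G k x - indicator B x *\<^sub>R G' x) \<le> dirichlet (\<lambda>x. G k x - G' x)"
      using dd by simp
  qed (auto simp: dirichlet_nonneg)
  ultimately show ?thesis by blast
qed

section \<open>The Euler--Lagrange equation\<close>

text \<open>Both factors are bounded by powers of the larger of the two absolute values, and its
  q-th power is at most the sum of the two q-th powers.\<close>

lemma mixed_power_integrable:
  fixes u v :: "'a \<Rightarrow> real"
  assumes [measurable]: "u \<in> borel_measurable M" "v \<in> borel_measurable M"
    and i: "integrable M (\<lambda>x. \<bar>u x\<bar> ^ q)" "integrable M (\<lambda>x. \<bar>v x\<bar> ^ q)" and k: "k \<le> q"
  shows "integrable M (\<lambda>x. u x ^ k * v x ^ (q - k))"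
proof (rule Bochner_Integration.integrable_bound)
  show "integrable M (\<lambda>x. \<bar>u x\<bar> ^ q + \<bar>v x\<bar> ^ q)" using i by simp
  show "AE x in M. norm (u x ^ k * v x ^ (q - k)) \<le> norm (\<bar>u x\<bar> ^ q + \<bar>v x\<bar> ^ q)"
  proof (intro AE_I2)
    fix x
    let ?m = "max \<bar>u x\<bar> \<bar>v x\<bar>"
    have "norm (u x ^ k * v x ^ (q - k)) = \<bar>u x\<bar> ^ k * \<bar>v x\<bar> ^ (q - k)" by (simp add: abs_mult power_abs)
    also have "\<dots> \<le> ?m ^ k * ?m ^ (q - k)" by (intro mult_mono power_mono) auto
    also have "\<dots> = ?m ^ q" using k by (simp add: power_add[symmetric])
    also have "\<dots> \<le> \<bar>u x\<bar> ^ q + \<bar>v x\<bar> ^ q" by (simp add: max_def)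
    finally show "norm (u x ^ k * v x ^ (q - k)) \<le> norm (\<bar>u x\<bar> ^ q + \<bar>v x\<bar> ^ q)" by simp
  qed
qed measurable

text \<open>By the binomial theorem the integral is a polynomial in t whose coefficients are mixed
  integrals, so the derivative at 0 is the coefficient of t.\<close>

lemma power_integral_derivative:
  fixes u v :: "'a \<Rightarrow> real"
  assumes m: "u \<in> borel_measurable M" "v \<in> borel_measurable M"
    and i: "integrable M (\<lambda>x. \<bar>u x\<bar> ^ q)" "integrable M (\<lambda>x. \<bar>v x\<bar> ^ q)" and q: "q \<ge> 1"
  shows "((\<lambda>t. \<integral>x. (u x + t * v x) ^ q \<partial>M) has_real_derivative (real q * (\<integral>x. u x ^ (q - 1) * v x \<partial>M))) (at 0)"
proof -
  define c where "c k = real (q choose k) * (\<integral>x. u x ^ k * v x ^ (q - k) \<partial>M)" for k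
  have eq: "(\<integral>x. (u x + t * v x) ^ q \<partial>M) = (\<Sum>k\<le>q. c k * t ^ (q - k))" for t
  proof -
    have "(\<integral>x. (u x + t * v x) ^ q \<partial>M) = (\<integral>x. (\<Sum>k\<le>q. (real (q choose k) * t ^ (q - k)) * (u x ^ k * v x ^ (q - k))) \<partial>M)"
      by (simp add: binomial_ring power_mult_distrib mult_ac)
    also have "\<dots> = (\<Sum>k\<le>q. (\<integral>x. (real (q choose k) * t ^ (q - k)) * (u x ^ k * v x ^ (q - k)) \<partial>M))"
      using mixed_power_integrable[OF m i] by (intro Bochner_Integration.integral_sum) auto
    also have "\<dots> = (\<Sum>k\<le>q. c k * t ^ (q - k))"
      by (intro sum.cong refl) (simp only: c_def integral_mult_right_zero, simp only: mult_ac)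
    finally show ?thesis .
  qed
  have "((\<lambda>t. \<Sum>k\<le>q. c k * t ^ (q - k)) has_real_derivative (\<Sum>k\<le>q. c k * (real (q - k) * 0 ^ (q - k - 1)))) (at 0)"
    by (auto intro!: derivative_eq_intros sum.cong)
  \<comment> \<open>Only k = q - 1 survives. For smaller k the power of 0 has a positive exponent;
    for k = q truncated subtraction makes it \<open>0 ^ 0 = 1\<close>, but the factor
    \<open>real (q - k)\<close> is 0.\<close>
  also have "(\<Sum>k\<le>q. c k * (real (q - k) * 0 ^ (q - k - 1))) = (\<Sum>k\<le>q. if k = q - 1 then c k else 0)"
  proof (intro sum.cong refl)
    fix k assume "k \<in> {..q}"
    then consider "k = q - 1" | "k = q" | "k < q - 1" using q by force
    then show "c k * (real (q - k) * 0 ^ (q - k - 1)) = (if k = q - 1 then c k else 0)"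
      using q by cases (auto simp: zero_power)
  qed
  also have "\<dots> = c (q - 1)" by simp
  also have "c (q - 1) = real q * (\<integral>x. u x ^ (q - 1) * v x \<partial>M)"
  proof -
    have "q choose (q - 1) = q" using q binomial_symmetric[of 1 q] by simp
    moreover have "q - (q - 1) = 1" using q by simp
    ultimately show ?thesis by (simp add: c_def)
  qed
  finally show ?thesis unfolding eq .
qed

text \<open>For a positive norm this is the chain rule. If the norm is 0, then \<open>u\<close> is 0
  almost everywhere, the squared norm is a constant times t^2 and the last integral is 0, so both
  sides vanish whatever value the power of 0 has.\<close>

lemma Lp_norm_sq_derivative:
  fixes u v :: "'a \<Rightarrow> real"
  assumes m: "u \<in> borel_measurable M" "v \<in> borel_measurable M" and p: "p \<ge> 1"
    and i: "integrable M (\<lambda>x. \<bar>u x\<bar> ^ (2 * p))" "integrable M (\<lambda>x. \<bar>v x\<bar> ^ (2 * p))"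
  shows "((\<lambda>t. (root (2 * p) (\<integral>x. \<bar>u x + t * v x\<bar> ^ (2 * p) \<partial>M))\<^sup>2) has_real_derivative
    (2 * root (2 * p) (\<integral>x. \<bar>u x\<bar> ^ (2 * p) \<partial>M) powi (2 - 2 * int p) * (\<integral>x. u x ^ (2 * p - 1) * v x \<partial>M))) (at 0)"
proof -
  have ev: "\<bar>a\<bar> ^ (2 * p) = a ^ (2 * p)" for a :: real by (simp add: power_even_abs)
  define I where "I t = (\<integral>x. (u x + t * v x) ^ (2 * p) \<partial>M)" for t
  define J where "J = (\<integral>x. u x ^ (2 * p - 1) * v x \<partial>M)"
  have I0: "I 0 = (\<integral>x. u x ^ (2 * p) \<partial>M)" by (simp add: I_def)
  have dI: "(I has_real_derivative (real (2 * p) * J)) (at 0)"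
    unfolding I_def[abs_def] J_def by (rule power_integral_derivative[OF m i]) (use p in simp)
  have "I 0 \<ge> 0" unfolding I0 by (intro Bochner_Integration.integral_nonneg) auto
  then consider "I 0 > 0" | "I 0 = 0" by linarith
  then have "((\<lambda>t. (root (2 * p) (I t))\<^sup>2) has_real_derivative (2 * root (2 * p) (I 0) powi (2 - 2 * int p) * J)) (at 0)"
  proof cases
    case 1
    define r where "r = root (2 * p) (I 0)"
    have r: "r > 0" using 1 p by (simp add: r_def)
    have dr: "((\<lambda>t. root (2 * p) (I t)) has_real_derivative (inverse (real (2 * p) * r ^ (2 * p - Suc 0)) * (real (2 * p) * J))) (at 0)"
      unfolding r_def by (rule DERIV_chain2[OF DERIV_real_root dI]) (use p 1 in auto)
    have "((\<lambda>t. (root (2 * p) (I t))\<^sup>2) has_real_derivative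
        (real 2 * (inverse (real (2 * p) * r ^ (2 * p - Suc 0)) * (real (2 * p) * J) * r ^ (2 - Suc 0)))) (at 0)"
      using DERIV_power[OF dr, of 2] unfolding r_def .
    also have "real 2 * (inverse (real (2 * p) * r ^ (2 * p - Suc 0)) * (real (2 * p) * J) * r ^ (2 - Suc 0)) =
        2 * r * (inverse (real (2 * p) * r ^ (2 * p - Suc 0)) * (real (2 * p) * J))"
      by simp
    also have "2 * r * (inverse (real (2 * p) * r ^ (2 * p - Suc 0)) * (real (2 * p) * J)) = 2 * r powi (2 - 2 * int p) * J"
    proof -
      \<comment> \<open>The exponent is 1 - (2p - 1): one factor \<open>r\<close> from the outer
        square over \<open>r ^ (2 * p - 1)\<close> from the derivative of the root.\<close>
      have "r powi (2 - 2 * int p) = r powi (1 - int (2 * p - 1))" using p by (simp add: of_nat_diff)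
      also have "\<dots> = r / r ^ (2 * p - 1)" using r by (subst power_int_diff) auto
      finally show ?thesis using p r by (simp add: field_simps)
    qed
    finally show ?thesis by (simp add: r_def)
  next
    case 2
    have AE: "AE x in M. u x = 0"
    proof -
      have "integrable M (\<lambda>x. u x ^ (2 * p))" using i(1) by (simp only: ev)
      then have "AE x in M. u x ^ (2 * p) = 0"
        using 2 unfolding I0 by (subst integral_nonneg_eq_0_iff_AE[symmetric]) auto
      then show ?thesis by eventually_elim (use p in auto)
    qed
    have J: "J = 0"
    proof -
      have "J = (\<integral>x. 0 \<partial>M)" unfolding J_def
      proof (rule integral_cong_AE)
        show "AE x in M. u x ^ (2 * p - 1) * v x = 0" using AE by eventually_elim (use p in \<open>simp add: zero_power\<close>)
      qed (use m in auto)
      then show ?thesis by simp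
    qed
    have It: "I t = t ^ (2 * p) * (\<integral>x. v x ^ (2 * p) \<partial>M)" for t
    proof -
      have "I t = (\<integral>x. t ^ (2 * p) * v x ^ (2 * p) \<partial>M)" unfolding I_def
      proof (rule integral_cong_AE)
        show "AE x in M. (u x + t * v x) ^ (2 * p) = t ^ (2 * p) * v x ^ (2 * p)"
          using AE by eventually_elim (simp add: power_mult_distrib)
      qed (use m in auto)
      then show ?thesis by simp
    qed
    have "(root (2 * p) (I t))\<^sup>2 = t\<^sup>2 * (root (2 * p) (\<integral>x. v x ^ (2 * p) \<partial>M))\<^sup>2" for t
    proof -
      have "root (2 * p) (I t) = root (2 * p) (\<bar>t\<bar> ^ (2 * p)) * root (2 * p) (\<integral>x. v x ^ (2 * p) \<partial>M)"
        unfolding It ev[symmetric, of t] using p by (simp add: real_root_mult)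
      also have "root (2 * p) (\<bar>t\<bar> ^ (2 * p)) = \<bar>t\<bar>" using p by (intro real_root_power_cancel) auto
      finally show ?thesis by (simp add: power_mult_distrib)
    qed
    moreover have "((\<lambda>t. t\<^sup>2 * (root (2 * p) (\<integral>x. v x ^ (2 * p) \<partial>M))\<^sup>2) has_real_derivative 0) (at 0)"
      by (auto intro!: derivative_eq_intros)
    ultimately show ?thesis using J by simp
  qed
  then show ?thesis unfolding I0 by (simp only: ev I_def J_def)
qed

text \<open>The added assumptions record what the two definitions of \<open>D_space B\<close> have
  in common, so that both kinds of domain are treated at once.\<close>

locale extension_problem = weighted_problem "extension_class B" h C p n \<phi> b R
  for B :: "'a::euclidean_space set" and h C :: real and p n :: nat and \<phi> :: "nat \<Rightarrow> 'a \<Rightarrow> real" and b R :: real +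
  assumes B: "open B"
    and D_grad: "\<psi> \<in> D_space B \<Longrightarrow> \<exists>G. is_weak_gradient B \<psi> G \<and> G \<in> Lq B 2"
    and D_test: "\<eta> \<in> test_fun B \<Longrightarrow> \<eta> \<in> D_space B"
    and \<phi>_off: "i \<in> {1..n} \<Longrightarrow> x \<notin> B \<Longrightarrow> \<phi> i x = 0"
begin

abbreviation ext :: "('a \<Rightarrow> real) \<Rightarrow> 'a \<Rightarrow> real" where
  "ext f \<equiv> (\<lambda>x. indicator B x * f x)"

abbreviation ext_grad :: "('a \<Rightarrow> 'a) \<Rightarrow> 'a \<Rightarrow> 'a" where
  "ext_grad G \<equiv> (\<lambda>x. indicator B x *\<^sub>R G x)"

section \<open>The problem on \<open>B\<close> in terms of zero extensions\<close>

lemma two_p: "2 * p \<ge> 1"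
  using p by simp

lemma energy_eq: "is_weak_gradient B \<psi> G \<Longrightarrow> energy B p \<psi> = real p / 2 * dirichlet (ext_grad G)"
  by (simp add: energy_def Lq_norm_weak_grad[OF B])

lemma energy_nonneg: "0 \<le> energy B p \<psi>"
  by (simp add: energy_def)

lemma Lq_norm_wnorm: "Lq_norm B (2 * p) (\<lambda>x. \<phi> i x * \<psi> x) = wnorm (2 * p) (\<phi> i) (ext \<psi>)"
proof -
  have "(\<lambda>x. norm (indicator B x *\<^sub>R (\<phi> i x * \<psi> x)) ^ (2 * p)) = (\<lambda>x. norm (\<phi> i x * ext \<psi> x) ^ (2 * p))"
    by (simp add: mult_ac)
  then show ?thesis by (simp only: Lq_norm_indicator[OF B two_p] wnorm_def)
qed

lemma constraint_norm_sq: "(\<Sum>i=1..n. (Lq_norm B (2 * p) (\<lambda>x. \<phi> i x * \<psi> x))\<^sup>2) = (constraint_norm (ext \<psi>))\<^sup>2"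
  unfolding Lq_norm_wnorm constraint_norm_def L2_set_def by (simp add: sum_nonneg)

text \<open>The integrability in \<open>admissible\<close> follows from membership in
  \<open>D_space B\<close> by \<open>local_bound\<close> on the ball that contains the supports; a
  nonnegative number whose square is 1 is 1.\<close>

lemma admissible_iff: "\<psi> \<in> admissible B p n \<phi> \<longleftrightarrow> \<psi> \<in> D_space B \<and> constraint_norm (ext \<psi>) = 1"
proof -
  have "(\<lambda>x. \<phi> i x * \<psi> x) \<in> Lq B (2 * p)" if \<psi>: "\<psi> \<in> D_space B" and i: "i \<in> {1..n}" for i
  proof -
    obtain G where "is_weak_gradient B \<psi> G" "G \<in> Lq B 2" using D_grad[OF \<psi>] by blast
    then have V: "(ext \<psi>, ext_grad G) \<in> extension_class B" using \<psi> by (intro extension_classI)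
    have eq: "(\<lambda>x. indicator B x *\<^sub>R (\<phi> i x * \<psi> x)) = (\<lambda>x. \<phi> i x * ext \<psi> x)" by (simp add: mult_ac)
    show ?thesis
      unfolding Lq_iff[OF B two_p] fun_cong[OF eq] using weighted_measurable[OF V i] weighted_integrable[OF V i]
      by blast
  qed
  then show ?thesis unfolding admissible_def mem_Collect_eq constraint_norm_sq
    using constraint_norm_nonneg[of "ext \<psi>"] power2_eq_1_iff[of "constraint_norm (ext \<psi>)"] by auto
qed

lemma extension_classE:
  assumes "(f, H) \<in> extension_class B"
  shows "\<exists>\<psi> G. \<psi> \<in> D_space B \<and> is_weak_gradient B \<psi> G \<and> f = ext \<psi> \<and> H = ext_grad G"
  using assms unfolding extension_class_def by auto

lemma Theta_le: "\<psi> \<in> admissible B p n \<phi> \<Longrightarrow> Theta B p n \<phi> \<le> energy B p \<psi>"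
  unfolding Theta_def by (intro cINF_lower bdd_belowI2[of _ 0] energy_nonneg)

text \<open>Scaling to seminorm 1 gives the homogeneous form of the infimum, which also applies to
  perturbations of a minimiser that leave the constraint set.\<close>

lemma Theta_le_scaled:
  assumes fH: "(f, H) \<in> extension_class B"
  shows "Theta B p n \<phi> * (constraint_norm f)\<^sup>2 \<le> real p / 2 * dirichlet H"
proof (cases "constraint_norm f = 0")
  case False
  obtain \<psi> G where \<psi>: "\<psi> \<in> D_space B" "is_weak_gradient B \<psi> G"
    and eq: "(\<lambda>x. (1 / constraint_norm f) * f x) = ext \<psi>" "(\<lambda>x. (1 / constraint_norm f) *\<^sub>R H x) = ext_grad G"
    using extension_classE[OF scale_in_V[OF fH, of "1 / constraint_norm f"]] by (elim exE conjE)
  have "constraint_norm (ext \<psi>) = 1" using False constraint_norm_nonneg[of f] unfolding eq(1)[symmetric] constraint_norm_scale by simp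
  then have "Theta B p n \<phi> \<le> energy B p \<psi>" using \<psi>(1) by (intro Theta_le) (simp add: admissible_iff)
  also have "\<dots> = real p / 2 * (dirichlet H / (constraint_norm f)\<^sup>2)"
    unfolding energy_eq[OF \<psi>(2)] eq(2)[symmetric] dirichlet_scale by (simp add: power_divide)
  finally have "Theta B p n \<phi> * (constraint_norm f)\<^sup>2 \<le> real p / 2 * (dirichlet H / (constraint_norm f)\<^sup>2) * (constraint_norm f)\<^sup>2"
    by (rule mult_right_mono) simp
  then show ?thesis using False by simp
qed (simp add: dirichlet_nonneg)

lemma test_fun_in_V:
  assumes "\<eta> \<in> test_fun B" shows "(\<eta>, grad \<eta>) \<in> extension_class B"
proof -
  have "(ext \<eta>, ext_grad (grad \<eta>)) \<in> extension_class B"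
    using assms by (intro extension_classI D_test test_fun_weak_gradient[OF B] test_fun_Lq_2[OF B])
  moreover have "ext \<eta> = \<eta>" "ext_grad (grad \<eta>) = grad \<eta>"
    using test_fun_indicator[OF assms] by (auto simp: fun_eq_iff)
  ultimately show ?thesis by simp
qed

lemma weight_integrable:
  assumes "i \<in> {1..n}" shows "integrable lebesgue (\<lambda>x. \<bar>\<phi> i x\<bar> ^ (2 * p))"
proof (rule Bochner_Integration.integrable_bound)
  show "integrable lebesgue (\<lambda>x::'a. b ^ (2 * p) * indicator (cball 0 R) x)"
    by (intro integrable_mult_right ball_indicator_integrable)
  show "(\<lambda>x. \<bar>\<phi> i x\<bar> ^ (2 * p)) \<in> borel_measurable lebesgue"
    using \<phi>m[OF assms] by measurable
  show "AE x in lebesgue. norm (\<bar>\<phi> i x\<bar> ^ (2 * p)) \<le> norm (b ^ (2 * p) * indicator (cball 0 R) x :: real)"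
    using weight_pointwise[OF assms, of _ "\<lambda>x. 1"] b0 by (intro AE_I2) (simp add: power_abs)
qed

text \<open>If the seminorm vanished on all test functions, each product
  \<open>\<phi> i * \<eta>\<close> would be 0 almost everywhere, and the fundamental lemma would
  make \<open>\<phi> i\<close> vanish. The test function found here shows that the constraint can be
  met.\<close>

lemma test_fun_nonzero:
  assumes i: "i \<in> {1..n}" and nd: "\<not> (AE x in lebesgue. \<phi> i x = 0)"
  obtains \<eta> where "\<eta> \<in> test_fun B" "constraint_norm \<eta> \<noteq> 0"
proof (rule ccontr)
  assume "\<not> thesis"
  then have z: "constraint_norm \<eta> = 0" if "\<eta> \<in> test_fun B" for \<eta> using that \<open>\<And>\<eta>. \<eta> \<in> test_fun B \<Longrightarrow> constraint_norm \<eta> \<noteq> 0 \<Longrightarrow> thesis\<close> by blast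
  have \<phi>i: "integrable lebesgue (\<phi> i)"
  proof (rule Bochner_Integration.integrable_bound)
    show "integrable lebesgue (\<lambda>x::'a. b * indicator (cball 0 R) x)"
      by (intro integrable_mult_right ball_indicator_integrable)
    show "AE x in lebesgue. norm (\<phi> i x) \<le> norm (b * indicator (cball 0 R) x)"
    proof (intro AE_I2)
      fix x
      show "norm (\<phi> i x) \<le> norm (b * indicator (cball 0 R) x)"
        using \<phi>b[OF i, of x] \<phi>0[OF i, of x] by (cases "norm x \<le> R") auto
    qed
  qed (rule \<phi>m[OF i])
  have "(\<integral>x. \<phi> i x * \<eta> x \<partial>lebesgue) = 0" if \<eta>: "\<eta> \<in> test_fun B" for \<eta>
  proof -
    have "wnorm (2 * p) (\<phi> i) \<eta> = 0"
      using z[OF \<eta>] i unfolding constraint_norm_def by (simp add: L2_set_eq_0_iff)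
    then have 0: "(\<integral>x. norm (\<phi> i x * \<eta> x) ^ (2 * p) \<partial>lebesgue) = 0" using p by (simp add: wnorm_def)
    have "AE x in lebesgue. norm (\<phi> i x * \<eta> x) ^ (2 * p) = 0"
      using 0 weighted_integrable[OF test_fun_in_V[OF \<eta>] i] by (subst integral_nonneg_eq_0_iff_AE[symmetric]) auto
    then have "AE x in lebesgue. \<phi> i x * \<eta> x = 0" by eventually_elim (use p in auto)
    then show ?thesis by (rule integral_eq_zero_AE)
  qed
  then have "AE x in lebesgue. x \<in> B \<longrightarrow> \<phi> i x = 0"
    using B by (intro fundamental_lemma[OF B integrable_imp_L1_loc[OF \<phi>i]]) auto
  then have "AE x in lebesgue. \<phi> i x = 0"
    by eventually_elim (use \<phi>_off[OF i] in blast)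
  then show False using nd by simp
qed

lemma minimiser_attained:
  assumes "i \<in> {1..n}" "\<not> (AE x in lebesgue. \<phi> i x = 0)"
  shows "\<exists>\<psi>. is_minimiser B p n \<phi> \<psi>"
proof -
  obtain \<eta> where \<eta>: "\<eta> \<in> test_fun B" "constraint_norm \<eta> \<noteq> 0" using test_fun_nonzero[OF assms] by blast
  obtain f H where fH: "(f, H) \<in> extension_class B" "constraint_norm f = 1"
    and min: "\<And>g K. (g, K) \<in> extension_class B \<Longrightarrow> constraint_norm g = 1 \<Longrightarrow> dirichlet H \<le> dirichlet K"
    using minimiser_exists[OF test_fun_in_V[OF \<eta>(1)] \<eta>(2)] by blast
  obtain \<psi> G where \<psi>: "\<psi> \<in> D_space B" "is_weak_gradient B \<psi> G" "f = ext \<psi>" "H = ext_grad G"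
    using extension_classE[OF fH(1)] by (elim exE conjE)
  have adm: "\<psi> \<in> admissible B p n \<phi>" using \<psi> fH(2) by (simp add: admissible_iff)
  have le: "energy B p \<psi> \<le> energy B p \<xi>" if \<xi>: "\<xi> \<in> admissible B p n \<phi>" for \<xi>
  proof -
    obtain K where K: "is_weak_gradient B \<xi> K" "K \<in> Lq B 2" using D_grad \<xi> unfolding admissible_iff by blast
    have "dirichlet H \<le> dirichlet (ext_grad K)"
      using \<xi> K by (intro min[of "ext \<xi>"] extension_classI) (auto simp: admissible_iff)
    then show ?thesis unfolding energy_eq[OF \<psi>(2)] energy_eq[OF K(1)] \<psi>(4)[symmetric] by (intro mult_left_mono) auto
  qed
  have "Theta B p n \<phi> = energy B p \<psi>"
    unfolding Theta_def by (rule cInf_eq_minimum) (use adm le in auto)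
  then show ?thesis using adm by (auto simp: is_minimiser_def)
qed

text \<open>The energy along the line is a quadratic polynomial in t whose linear coefficient is
  twice the inner product of the gradients.\<close>

lemma dirichlet_derivative:
  assumes fF: "(f, F) \<in> extension_class B" and gG: "(g, G) \<in> extension_class B"
  shows "((\<lambda>t. dirichlet (\<lambda>x. F x + t *\<^sub>R G x)) has_real_derivative (2 * (\<integral>x. F x \<bullet> G x \<partial>lebesgue))) (at 0)"
proof -
  have i: "integrable lebesgue (\<lambda>x. F x \<bullet> G x)"
  proof (rule Bochner_Integration.integrable_bound)
    show "integrable lebesgue (\<lambda>x. (norm (F x))\<^sup>2 + (norm (G x))\<^sup>2)" using G2[OF fF] G2[OF gG] by simp
    show "(\<lambda>x. F x \<bullet> G x) \<in> borel_measurable lebesgue" using G_measurable[OF fF] G_measurable[OF gG] by (rule borel_measurable_inner)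
    show "AE x in lebesgue. norm (F x \<bullet> G x) \<le> norm ((norm (F x))\<^sup>2 + (norm (G x))\<^sup>2)"
    proof (intro AE_I2)
      fix x
      have "\<bar>F x \<bullet> G x\<bar> \<le> norm (F x) * norm (G x)" by (rule Cauchy_Schwarz_ineq2)
      moreover have "2 * norm (F x) * norm (G x) \<le> (norm (F x))\<^sup>2 + (norm (G x))\<^sup>2" by (rule sum_squares_bound)
      moreover have "0 \<le> norm (F x) * norm (G x)" by simp
      ultimately show "norm (F x \<bullet> G x) \<le> norm ((norm (F x))\<^sup>2 + (norm (G x))\<^sup>2)" unfolding real_norm_def by linarith
    qed
  qed
  have "dirichlet (\<lambda>x. F x + t *\<^sub>R G x) = dirichlet F + 2 * t * (\<integral>x. F x \<bullet> G x \<partial>lebesgue) + t\<^sup>2 * dirichlet G" for t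
  proof -
    have "dirichlet (\<lambda>x. F x + t *\<^sub>R G x) = (\<integral>x. (norm (F x))\<^sup>2 + 2 * t * (F x \<bullet> G x) + t\<^sup>2 * (norm (G x))\<^sup>2 \<partial>lebesgue)"
      unfolding dirichlet_def
      by (intro Bochner_Integration.integral_cong refl)
         (simp add: power2_norm_eq_inner inner_add_left inner_add_right inner_commute, simp add: power2_eq_square algebra_simps)
    then show ?thesis using i G2[OF fF] G2[OF gG] by (simp add: dirichlet_def)
  qed
  then show ?thesis by (auto intro!: derivative_eq_intros)
qed

text \<open>Nonnegativity of \<open>g\<close> for every t is \<open>Theta_le_scaled\<close>. As
  energy and squared constraint have the same degree of homogeneity, the Lagrange multiplier is
  \<open>Theta\<close> itself.\<close>

lemma euler_lagrange_weak:
  assumes min: "is_minimiser B p n \<phi> \<psi>" and wgG: "is_weak_gradient B \<psi> G" and GL: "G \<in> Lq B 2" and \<eta>: "\<eta> \<in> test_fun B"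
  shows "real p / 2 * (\<integral>x. ext_grad G x \<bullet> grad \<eta> x \<partial>lebesgue) =
    Theta B p n \<phi> * (\<Sum>i=1..n. Lq_norm B (2 * p) (\<lambda>y. \<phi> i y * \<psi> y) powi (2 - 2 * int p) *
       (\<integral>x. (\<phi> i x * ext \<psi> x) ^ (2 * p - 1) * (\<phi> i x * \<eta> x) \<partial>lebesgue))"
proof -
  let ?T = "Theta B p n \<phi>"
  have \<psi>: "\<psi> \<in> D_space B" "constraint_norm (ext \<psi>) = 1" "energy B p \<psi> = ?T"
    using min by (auto simp: is_minimiser_def admissible_iff)
  have V: "(ext \<psi>, ext_grad G) \<in> extension_class B" using \<psi>(1) wgG GL by (rule extension_classI)
  note V\<eta> = test_fun_in_V[OF \<eta>]
  define r where "r i = Lq_norm B (2 * p) (\<lambda>y. \<phi> i y * \<psi> y)" for i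
  define J where "J i = (\<integral>x. (\<phi> i x * ext \<psi> x) ^ (2 * p - 1) * (\<phi> i x * \<eta> x) \<partial>lebesgue)" for i
  define g where "g t = real p / 2 * dirichlet (\<lambda>x. ext_grad G x + t *\<^sub>R grad \<eta> x) -
     ?T * (\<Sum>i=1..n. (wnorm (2 * p) (\<phi> i) (\<lambda>x. ext \<psi> x + t * \<eta> x))\<^sup>2)" for t
  have constraint_norm_eq: "(\<Sum>i=1..n. (wnorm (2 * p) (\<phi> i) f)\<^sup>2) = (constraint_norm f)\<^sup>2" for f
    unfolding constraint_norm_def L2_set_def by (simp add: sum_nonneg)
  have g_nonneg: "g t \<ge> 0" for t
    using Theta_le_scaled[OF lin[OF V V\<eta>, of t]] unfolding g_def constraint_norm_eq by simp
  have g0: "g 0 = 0" unfolding g_def constraint_norm_eq using \<psi>(2,3) energy_eq[OF wgG] by simp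
  have dw: "((\<lambda>t. (wnorm (2 * p) (\<phi> i) (\<lambda>x. ext \<psi> x + t * \<eta> x))\<^sup>2) has_real_derivative (2 * r i powi (2 - 2 * int p) * J i)) (at 0)"
    if i: "i \<in> {1..n}" for i
  proof -
    have "(\<lambda>x. \<phi> i x * (ext \<psi> x + t * \<eta> x)) = (\<lambda>x. \<phi> i x * ext \<psi> x + t * (\<phi> i x * \<eta> x))" for t
      by (simp add: algebra_simps)
    then have w: "wnorm (2 * p) (\<phi> i) (\<lambda>x. ext \<psi> x + t * \<eta> x) = root (2 * p) (\<integral>x. \<bar>\<phi> i x * ext \<psi> x + t * (\<phi> i x * \<eta> x)\<bar> ^ (2 * p) \<partial>lebesgue)" for t
      unfolding wnorm_def real_norm_def by metis
    have "r i = root (2 * p) (\<integral>x. \<bar>\<phi> i x * ext \<psi> x\<bar> ^ (2 * p) \<partial>lebesgue)"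
      unfolding r_def Lq_norm_wnorm wnorm_def real_norm_def ..
    then show ?thesis unfolding w J_def
      using Lp_norm_sq_derivative[OF weighted_measurable[OF V i] weighted_measurable[OF V\<eta> i] p]
        weighted_integrable[OF V i] weighted_integrable[OF V\<eta> i] unfolding real_norm_def by presburger
  qed
  have "(g has_real_derivative (real p / 2 * (2 * (\<integral>x. ext_grad G x \<bullet> grad \<eta> x \<partial>lebesgue)) -
      ?T * (\<Sum>i=1..n. 2 * r i powi (2 - 2 * int p) * J i))) (at 0)"
    unfolding g_def[abs_def]
    by (intro DERIV_diff DERIV_cmult dirichlet_derivative[OF V V\<eta>] DERIV_sum dw)
  then have "real p / 2 * (2 * (\<integral>x. ext_grad G x \<bullet> grad \<eta> x \<partial>lebesgue)) -
      ?T * (\<Sum>i=1..n. 2 * r i powi (2 - 2 * int p) * J i) = 0"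
    by (rule DERIV_local_min[where d = 1]) (use g_nonneg g0 in auto)
  moreover have "(\<Sum>i=1..n. 2 * r i powi (2 - 2 * int p) * J i) = 2 * (\<Sum>i=1..n. r i powi (2 - 2 * int p) * J i)"
    by (simp add: sum_distrib_left mult.assoc)
  ultimately show ?thesis unfolding r_def J_def by simp
qed

text \<open>Each second derivative is a first derivative of the test function
  \<open>pd b \<eta>\<close>, so the weak gradient takes over one of the two derivatives.\<close>

lemma weak_laplacian:
  assumes wgG: "is_weak_gradient B \<psi> G" and \<eta>: "\<eta> \<in> test_fun B"
  shows "distr_laplacian B \<psi> \<eta> = - (\<integral>x. ext_grad G x \<bullet> grad \<eta> x \<partial>lebesgue)"
proof -
  note wg' = wgG[unfolded is_weak_gradient_iff[OF B]]
  have pd: "pd b \<eta> \<in> test_fun B" if "b \<in> Basis" for b using test_fun_pd[OF \<eta> that] .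
  have pd2: "pd b (pd b \<eta>) \<in> test_fun B" if "b \<in> Basis" for b using test_fun_pd[OF pd[OF that] that] .
  have "distr_laplacian B \<psi> \<eta> = (\<integral>x. \<psi> x * laplace \<eta> x \<partial>lebesgue)"
    unfolding distr_laplacian_def distr_of_def
  proof (rule integral_on_zero_off)
    show "\<psi> x * laplace \<eta> x = 0" if "x \<notin> B" for x
      unfolding laplace_def using test_fun_zero[OF pd2 that] by simp
  qed (use B in auto)
  also have "\<dots> = (\<integral>x. (\<Sum>b\<in>Basis. \<psi> x * pd b (pd b \<eta>) x) \<partial>lebesgue)" by (simp add: laplace_def sum_distrib_left)
  also have "\<dots> = (\<Sum>b\<in>Basis. \<integral>x. \<psi> x * pd b (pd b \<eta>) x \<partial>lebesgue)"
  proof (rule Bochner_Integration.integral_sum)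
    show "integrable lebesgue (\<lambda>x. \<psi> x * pd b (pd b \<eta>) x)" if "b \<in> Basis" for b
      using L1_loc_test_integrable[OF _ pd2[OF that], of \<psi>] wg' by (simp add: mult.commute)
  qed
  also have "\<dots> = (\<Sum>b\<in>Basis. - (\<integral>x. (G x \<bullet> b) * pd b \<eta> x \<partial>lebesgue))"
    using wg' pd by (intro sum.cong) auto
  also have "\<dots> = - (\<integral>x. (\<Sum>b\<in>Basis. (G x \<bullet> b) * pd b \<eta> x) \<partial>lebesgue)"
  proof -
    have "integrable lebesgue (\<lambda>x. (G x \<bullet> b) * pd b \<eta> x)" if "b \<in> Basis" for b
      using L1_loc_test_integrable[OF L1_loc_inner pd[OF that], of G b] wg' by (simp add: mult.commute)
    then show ?thesis by (simp add: sum_negf)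
  qed
  also have "(\<lambda>x. \<Sum>b\<in>Basis. (G x \<bullet> b) * pd b \<eta> x) = (\<lambda>x. ext_grad G x \<bullet> grad \<eta> x)"
  proof
    fix x
    have "(\<Sum>b\<in>Basis. (G x \<bullet> b) * pd b \<eta> x) = G x \<bullet> grad \<eta> x"
      by (simp add: grad_def inner_sum_right mult.commute)
    also have "\<dots> = ext_grad G x \<bullet> grad \<eta> x"
      using test_fun_indicator(2)[OF \<eta>, of x] by (auto split: split_indicator_asm simp: indicator_def)
    finally show "(\<Sum>b\<in>Basis. (G x \<bullet> b) * pd b \<eta> x) = ext_grad G x \<bullet> grad \<eta> x" .
  qed
  finally show ?thesis .
qed

theorem minimiser_el_equation:
  assumes min: "is_minimiser B p n \<phi> \<psi>"
  shows "el_equation B p n \<phi> \<psi>"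
  unfolding el_equation_def
proof (intro conjI ballI)
  let ?T = "Theta B p n \<phi>"
  have \<psi>: "\<psi> \<in> D_space B" using min by (auto simp: is_minimiser_def admissible_iff)
  obtain G where G: "is_weak_gradient B \<psi> G" "G \<in> Lq B 2" using D_grad[OF \<psi>] by blast
  have V: "(ext \<psi>, ext_grad G) \<in> extension_class B" using \<psi> G by (rule extension_classI)
  show \<psi>L: "\<psi> \<in> L1_loc B" using G(1) by (simp add: is_weak_gradient_def)
  define r where "r i = Lq_norm B (2 * p) (\<lambda>y. \<phi> i y * \<psi> y) powi (2 - 2 * int p)" for i
  \<comment> \<open>\<open>\<psi> ^ (2 * p - 1) * \<phi> ^ (2 * p)\<close> is regrouped as
    \<open>(\<phi> * \<psi>) ^ (2 * p - 1) * \<phi>\<close>, a mixed power of two functions with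
    integrable powers of order \<open>2 * p\<close>, to which \<open>mixed_power_integrable\<close>
    applies.\<close>
  have rhs: "indicator B x * el_rhs B p n \<phi> \<psi> x = ?T * (\<Sum>i=1..n. r i * ((\<phi> i x * ext \<psi> x) ^ (2 * p - 1) * \<phi> i x))" for x
  proof -
    have "\<phi> i x ^ (2 * p) = \<phi> i x ^ (2 * p - 1) * \<phi> i x" for i
      by (rule power_minus_mult[symmetric]) (use p in simp)
    moreover have "ext \<psi> x ^ (2 * p - 1) = indicator B x * \<psi> x ^ (2 * p - 1)" using p by (auto split: split_indicator simp: zero_power)
    ultimately show ?thesis
      unfolding el_rhs_def r_def[symmetric] sum_distrib_left by (intro sum.cong) (auto simp: power_mult_distrib mult_ac)
  qed
  have int: "integrable lebesgue (\<lambda>x. (\<phi> i x * ext \<psi> x) ^ (2 * p - 1) * \<phi> i x)" if i: "i \<in> {1..n}" for i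
    using mixed_power_integrable[OF weighted_measurable[OF V i] \<phi>m[OF i] _ weight_integrable[OF i], of "2 * p - 1"]
      weighted_integrable[OF V i] p by simp
  have rint: "integrable lebesgue (\<lambda>x. indicator B x * el_rhs B p n \<phi> \<psi> x)"
    unfolding rhs using int by auto
  have Bs: "B \<in> sets lebesgue" using B by auto
  show "el_rhs B p n \<phi> \<psi> \<in> L1_loc B"
    unfolding L1_loc_def
  proof (intro CollectI conjI allI impI)
    show "el_rhs B p n \<phi> \<psi> \<in> borel_measurable (lebesgue_on B)"
      unfolding measurable_on_eq[OF Bs] using rint by simp
    fix K assume K: "compact K \<and> K \<subseteq> B"
    have "integrable lebesgue (\<lambda>x. indicator K x *\<^sub>R (indicator B x * el_rhs B p n \<phi> \<psi> x))"
      using K by (intro integrable_mult_indicator[OF _ rint]) (auto intro: compact_sets_lebesgue)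
    moreover have "(\<lambda>x. indicator K x *\<^sub>R (indicator B x * el_rhs B p n \<phi> \<psi> x)) = (\<lambda>x. indicator K x *\<^sub>R el_rhs B p n \<phi> \<psi> x)"
      using K by (auto simp: fun_eq_iff split: split_indicator)
    ultimately show "integrable (lebesgue_on K) (el_rhs B p n \<phi> \<psi>)"
      using K by (auto simp: integrable_on_eq compact_sets_lebesgue)
  qed
  fix \<eta> assume \<eta>: "\<eta> \<in> test_fun B"
  have "distr_of B (el_rhs B p n \<phi> \<psi>) \<eta> = (\<integral>x. indicator B x * el_rhs B p n \<phi> \<psi> x * \<eta> x \<partial>lebesgue)"
    unfolding distr_of_def integral_test_on[OF B \<eta>]
    using test_fun_indicator(1)[OF \<eta>] by (intro Bochner_Integration.integral_cong) (auto simp: mult_ac)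
  also have "\<dots> = (\<integral>x. (\<Sum>i=1..n. ?T * r i * ((\<phi> i x * ext \<psi> x) ^ (2 * p - 1) * (\<phi> i x * \<eta> x))) \<partial>lebesgue)"
    unfolding rhs by (simp add: sum_distrib_left sum_distrib_right mult_ac)
  also have "\<dots> = (\<Sum>i=1..n. \<integral>x. ?T * r i * ((\<phi> i x * ext \<psi> x) ^ (2 * p - 1) * (\<phi> i x * \<eta> x)) \<partial>lebesgue)"
  proof (rule Bochner_Integration.integral_sum)
    fix i assume i: "i \<in> {1..n}"
    have "integrable lebesgue (\<lambda>x. (\<phi> i x * ext \<psi> x) ^ (2 * p - 1) * (\<phi> i x * \<eta> x))"
      using mixed_power_integrable[OF weighted_measurable[OF V i] weighted_measurable[OF test_fun_in_V[OF \<eta>] i], of "2 * p" "2 * p - 1"]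
        weighted_integrable[OF V i] weighted_integrable[OF test_fun_in_V[OF \<eta>] i] p by simp
    then show "integrable lebesgue (\<lambda>x. ?T * r i * ((\<phi> i x * ext \<psi> x) ^ (2 * p - 1) * (\<phi> i x * \<eta> x)))" by simp
  qed
  also have "\<dots> = ?T * (\<Sum>i=1..n. r i * (\<integral>x. (\<phi> i x * ext \<psi> x) ^ (2 * p - 1) * (\<phi> i x * \<eta> x) \<partial>lebesgue))"
    by (simp add: sum_distrib_left mult.assoc)
  also have "\<dots> = real p / 2 * (\<integral>x. ext_grad G x \<bullet> grad \<eta> x \<partial>lebesgue)"
    unfolding r_def by (rule euler_lagrange_weak[OF min G \<eta>, symmetric])
  also have "\<dots> = - (real p / 2) * distr_laplacian B \<psi> \<eta>" by (simp add: weak_laplacian[OF G(1) \<eta>])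
  finally show "- (real p / 2) * distr_laplacian B \<psi> \<eta> = distr_of B (el_rhs B p n \<phi> \<psi>) \<eta>" ..
qed

end

section \<open>Both kinds of domain satisfy the assumptions\<close>

lemma test_fun_D1: "\<eta> \<in> test_fun UNIV \<Longrightarrow> \<eta> \<in> D1"
proof (rule D1_intro)
  assume \<eta>: "\<eta> \<in> test_fun UNIV"
  show "is_weak_gradient UNIV \<eta> (grad \<eta>)" by (rule test_fun_weak_gradient[OF open_UNIV \<eta>])
  show "integrable lebesgue (\<lambda>x. (norm (grad \<eta> x))\<^sup>2)" using test_fun_Lq_2(2)[OF open_UNIV \<eta>] by (simp add: Lq_2_iff)
  have "compact (supp \<eta>)" using \<eta> by (simp add: test_fun_def)
  then have s: "supp \<eta> \<in> fmeasurable lebesgue" by (rule lmeasurable_compact)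
  show "vanishes_at_infinity \<eta>" unfolding vanishes_at_infinity_def
  proof (intro allI impI)
    fix a :: real assume "a > 0"
    then have "{x. a < \<bar>\<eta> x\<bar>} \<subseteq> supp \<eta>" using not_in_supp[of _ \<eta>] by fastforce
    then have "emeasure lebesgue {x. a < \<bar>\<eta> x\<bar>} \<le> emeasure lebesgue (supp \<eta>)"
      using s by (intro emeasure_mono) (auto simp: fmeasurableD)
    also have "\<dots> < \<infinity>" using fmeasurableD2[OF s] by (simp add: less_top)
    finally show "emeasure lebesgue {x. a < \<bar>\<eta> x\<bar>} < \<infinity>" .
  qed
qed

lemma extension_problem_exists:
  fixes B :: "'a::euclidean_space set" and \<phi> :: "nat \<Rightarrow> 'a \<Rightarrow> real"
  assumes p: "p \<ge> 1" and sub: "int p * (int DIM('a) - 2) < int DIM('a)" and B: "open B"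
    and cases: "bounded B \<or> (B = UNIV \<and> DIM('a) \<ge> 3)"
    and \<phi>m: "\<And>i. i \<in> {1..n} \<Longrightarrow> \<phi> i \<in> borel_measurable lebesgue"
    and \<phi>b: "\<And>i. i \<in> {1..n} \<Longrightarrow> bounded (range (\<phi> i))"
    and \<phi>s: "\<And>i. i \<in> {1..n} \<Longrightarrow> compact (supp (\<phi> i)) \<and> supp (\<phi> i) \<subseteq> B"
  shows "\<exists>h C b R. extension_problem B h C p n \<phi> b R"
proof -
  have "\<exists>M\<ge>0. \<forall>x. \<bar>\<phi> i x\<bar> \<le> M" if "i \<in> {1..n}" for i
    using \<phi>b[OF that] unfolding bounded_pos by (auto intro: less_imp_le)
  then obtain M where M: "\<And>i. i \<in> {1..n} \<Longrightarrow> M i \<ge> 0" "\<And>i x. i \<in> {1..n} \<Longrightarrow> \<bar>\<phi> i x\<bar> \<le> M i" by metis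
  have "\<exists>r\<ge>0. \<forall>x. norm x > r \<longrightarrow> \<phi> i x = 0" if i: "i \<in> {1..n}" for i
  proof -
    have "bounded (supp (\<phi> i))" using \<phi>s[OF i] by (simp add: compact_imp_bounded)
    then obtain r where r: "r > 0" "\<forall>x\<in>supp (\<phi> i). norm x \<le> r" unfolding bounded_pos by blast
    then show ?thesis using not_in_supp[of _ "\<phi> i"] by (intro exI[of _ r]) force
  qed
  then obtain r where r: "\<And>i. i \<in> {1..n} \<Longrightarrow> r i \<ge> 0" "\<And>i x. i \<in> {1..n} \<Longrightarrow> norm x > r i \<Longrightarrow> \<phi> i x = 0" by metis
  have le: "f i \<le> sum f {1..n}" if "i \<in> {1..n}" "\<And>i. i \<in> {1..n} \<Longrightarrow> f i \<ge> 0" for i and f :: "nat \<Rightarrow> real"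
    using that by (intro member_le_sum) auto
  obtain h C where gc: "gradient_class (extension_class B) h C"
    using cases gradient_class_bounded[OF B] gradient_class_UNIV by metis
  have complete: "\<exists>f' G'. (f', G') \<in> extension_class B \<and> (\<lambda>k. dirichlet (\<lambda>x. G k x - G' x)) \<longlonglongrightarrow> 0"
    if "\<And>k. (f k, G k) \<in> extension_class B" "\<And>k. dirichlet (\<lambda>x. G (Suc k) x - G k x) \<le> (1 / 2) ^ k" for f G
    using cases
  proof
    assume "bounded B"
    then show ?thesis using that by (rule complete_bounded[OF B])
  next
    assume "B = UNIV \<and> DIM('a) \<ge> 3"
    then show ?thesis using that complete_UNIV[of f G] by blast
  qed
  interpret gradient_class "extension_class B" h C by (rule gc)
  \<comment> \<open>Sums of the individual bounds serve as common bounds, also when the index set is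
    empty.\<close>
  have "extension_problem B h C p n \<phi> (sum M {1..n}) (sum r {1..n})"
  proof unfold_locales
    show "\<bar>\<phi> i x\<bar> \<le> sum M {1..n}" if "i \<in> {1..n}" for i x using M(2)[OF that, of x] le[of i M, OF that M(1)] by linarith
    show "\<phi> i x = 0" if "i \<in> {1..n}" "sum r {1..n} < norm x" for i x
      using le[of i r, OF that(1) r(1)] that(2) by (intro r(2)[OF that(1)]) linarith
    show "0 \<le> sum M {1..n}" using M(1) by (rule sum_nonneg)
    show "\<phi> i x = 0" if "i \<in> {1..n}" "x \<notin> B" for i x using \<phi>s[OF that(1)] that(2) by (intro not_in_supp) auto
    show "\<exists>G. is_weak_gradient B \<psi> G \<and> G \<in> Lq B 2" if "\<psi> \<in> D_space B" for \<psi>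
      using that cases not_bounded_UNIV[where 'a = 'a] unfolding D_space_def H10_def H1_def D1_def by (auto split: if_splits)
    show "\<eta> \<in> D_space B" if "\<eta> \<in> test_fun B" for \<eta>
      using that cases test_fun_H10[OF B that] test_fun_D1[of \<eta>] unfolding D_space_def by auto
    show "\<exists>f' G'. (f', G') \<in> extension_class B \<and> (\<lambda>k. dirichlet (\<lambda>x. G k x - G' x)) \<longlonglongrightarrow> 0"
      if "\<And>k. (f k, G k) \<in> extension_class B" "\<And>k. dirichlet (\<lambda>x. G (Suc k) x - G k x) \<le> (1 / 2) ^ k" for f G
      using that by (rule complete)
  qed (use p sub \<phi>m B in auto)
  then show ?thesis by blast
qed

text \<open>\<open>nondegenerate\<close> expresses that the constraint can be met: if every
  \<open>\<phi> i\<close> vanished almost everywhere, all the norms would be 0 and their squares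
  could not sum to 1.\<close>

theorem proposition1p3:
  fixes B :: "'a::euclidean_space set"
    and p n :: nat
    and \<phi> :: "nat \<Rightarrow> 'a \<Rightarrow> real"
  assumes "p \<ge> 1"
    and "int p * (int DIM('a) - 2) < int DIM('a)"
    and "open B"
    and "bounded B \<or> (B = UNIV \<and> DIM('a) \<ge> 3)"
    and "\<And>i. i \<in> {1..n} \<Longrightarrow> \<phi> i \<in> borel_measurable lebesgue"
    and "\<And>i x. i \<in> {1..n} \<Longrightarrow> \<phi> i x \<ge> 0"
    and "\<And>i. i \<in> {1..n} \<Longrightarrow> bounded (range (\<phi> i))"
    and "\<And>i. i \<in> {1..n} \<Longrightarrow> compact (supp (\<phi> i)) \<and> supp (\<phi> i) \<subseteq> B"
    and nondegenerate: "\<exists>i\<in>{1..n}. \<not> (AE x in lebesgue. \<phi> i x = 0)"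
  shows "(\<exists>\<psi>. is_minimiser B p n \<phi> \<psi>) \<and>
         (\<forall>\<psi>. is_minimiser B p n \<phi> \<psi> \<longrightarrow> el_equation B p n \<phi> \<psi>)"
proof -
  obtain h C b R where "extension_problem B h C p n \<phi> b R"
  proof -
    have "\<exists>h C b R. extension_problem B h C p n \<phi> b R"
      by (rule extension_problem_exists[OF assms(1-4)]) (erule assms(5), erule assms(7), erule assms(8))
    then show thesis using that by blast
  qed
  then interpret extension_problem B h C p n \<phi> b R .
  show ?thesis using nondegenerate minimiser_attained minimiser_el_equation by blast
qed

end
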